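(* Let $\underline Z_n=\boldsymbol X_n\underline\theta_0+\underline e_n$ with $\underline\theta_0\in\mathbb R^r$, where the fixed design matrices $\boldsymbol X_n\in\mathbb R^{n\times r}$ satisfy Assumption D and $\{e_t\}$ is a stationary mean zero Gaussian time series with spectral density $f_0$ satisfying Assumption F (with $\underline e_n=(e_1,\dots,e_n)^T$). Let $0<\tau_0<\min_\omega f_0(\omega)\le\max_\omega f_0(\omega)<\tau_1<\infty$. Let the prior be $P(d\underline\theta)P_{\tau_0,\tau_1}(df)$ as in the context, satisfying Assumptions P, G and K, and let $P^n_{W;\tau_0,\tau_1}(\cdot|\underline Z_n)$ be the pseudo-posterior based on Whittle's likelihood. Put $\boldsymbol S_n=\tilde{\boldsymbol X}_n^T\boldsymbol D_n(f_0)^{-1}\tilde{\boldsymbol X}_n$, $$\Theta_n=\{\underline\theta\in\mathbb R^r:(\underline\theta-\underline\theta_0)^T\boldsymbol S_n(\underline\theta-\underline\theta_0)\le\sqrt{\lambda_{\min}(\boldsymbol S_n)}\},\qquad \mathcal H_n=\{f\in\mathcal C_{\tau_0,\tau_1}:\|f-f_0\|_\infty\le1/\log n\}.$$ Then $$P^n_{W;\tau_0,\tau_1}\big((\underline\theta,f)\in\Theta_n\times\mathcal H_n\,|\,\underline Z_n\big)\to1$$ in $P^n_{W;0}$-probability as $n\to\infty$, where $P^n_{W;0}=P^n_W(\cdot|\underline\theta_0,f_0)$.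
   Context: Notation. $r$ is fixed. $\lambda_{\min}(\cdot),\lambda_{\max}(\cdot)$ denote the minimal and maximal eigenvalue of a matrix and $\|\cdot\|$ the Euclidean norm. $\lambda_j=2\pi j/n$ are the Fourier frequencies, $N=\lfloor (n-1)/2\rfloor$. The orthogonal matrix $\boldsymbol F_n\in\mathbb R^{n\times n}$ has rows $\mathbf e_0,\mathbf c_1,\mathbf s_1,\dots,\mathbf c_N,\mathbf s_N$ (and additionally $\mathbf e_{n/2}$ as last row if $n$ is even), where $\mathbf e_j=n^{-1/2}(e_j,e_j^2,\dots,e_j^n)^T$ with $e_j=\exp(-2\pi i j/n)$, $\mathbf c_j=\sqrt2\,\mathrm{Re}\,\mathbf e_j$, $\mathbf s_j=\sqrt2\,\mathrm{Im}\,\mathbf e_j$. Put $\tilde{\underline z}_n=\boldsymbol F_n\underline z_n$, $\tilde{\boldsymbol X}_n=\boldsymbol F_n\boldsymbol X_n$. For a spectral density $f$, $\boldsymbol D_n=\boldsymbol D_n(f)=2\pi\,\mathrm{diag}(f(0),f(\lambda_1),f(\lambda_1),\dots,f(\lambda_N),f(\lambda_N))$ for $n$ odd, with an additional last diagonal entry $2\pi f(\lambda_{n/2})$ for $n$ even. Whittle's likelihood $P_W^n(\cdot|\underline\theta,f)$ is the distribution of $\underline Z_n$ with Lebesgue density $$p_W^n(\underline z_n|\underline\theta,f)=\frac1{\sqrt{(2\pi)^n|\boldsymbol D_n|}}\exp\Big(-\tfrac12(\tilde{\underline z}_n-\tilde{\boldsymbol X}_n\underline\theta)^T\boldsymbol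 D_n^{-1}(\tilde{\underline z}_n-\tilde{\boldsymbol X}_n\underline\theta)\Big).$$ Assumption D: $\boldsymbol X_n$ has full rank for $n$ sufficiently large and $0<\liminf_n\frac1n\lambda_{\min}(\boldsymbol X_n^T\boldsymbol X_n)\le\limsup_n\frac1n\lambda_{\max}(\boldsymbol X_n^T\boldsymbol X_n)<\infty$. Assumption F: $f_0$ is uniformly bounded and uniformly bounded away from $0$, and the autocovariance function $\gamma_0(h)=\int_0^{2\pi}f_0(\omega)e^{ih\omega}d\omega$ satisfies $\sum_{h\ge0}|\gamma_0(h)|h^a<\infty$ for some $1<a\le2$. Prior. $\underline\theta$ and $f$ are a priori independent. For $0<\tau_0<\tau_1<\infty$ let $\mathcal C_{\tau_0,\tau_1}=\{f\in\mathcal C^1([0,\pi]):\|f^{-1}\|_\infty\le\tau_0^{-1},\ \|f\|_L\le\tau_1\}$, with $\|f\|_L=\|f\|_\infty+\sup_{\omega_1\ne\omega_2}|f(\omega_1)-f(\omega_2)|/|\omega_1-\omega_2|$. The Bernstein-Gamma prior $P(df)$ is the law of $f(\omega)=\sum_{j=1}^k\Phi(I_{j,k})\,b(\omega/\pi|j,k-j+1)$, $0\le\omega\le\pi$, where $I_{j,k}=((j-1)\pi/k,j\pi/k]$, $b(\cdot|j,l)$ is the $\mathrm{Beta}(j,l)$ density on $[0,1]$, $k\in\mathbb N$ has probability mass function $p(k)$, and independently $\Phi\sim\mathrm{GP}(\alpha,\beta)$ is a Gamma process on $[0,\pi]$ with $\alpha,\beta:[0,\pi]\to(0,\infty)$ (the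 completely random measure with Lévy measure $\alpha(x)s^{-1}e^{-\beta(x)s}\,ds\,dx$ on $[0,\pi]\times(0,\infty)$). $P_{\tau_0,\tau_1}(F)=P(F\cap\mathcal C_{\tau_0,\tau_1})/P(\mathcal C_{\tau_0,\tau_1})$. Assumption P: the prior $P(d\underline\theta)$ satisfies $E\|\underline\theta\|^\nu<\infty$ for some $\nu>0$ and has a Lebesgue density $g$ on $\mathbb R^r$ with $g\le C$ for some $C>0$, which is continuous and strictly positive in an open neighbourhood of $\underline\theta_0$. Assumption G: there are positive constants $g_0,g_1$ with $g_0\le\alpha(x),\beta(x)\le g_1$ for all $x\in[0,\pi]$ outside a Lebesgue null set. Assumption K: there are positive constants $A_1,A_2,\kappa_1,\kappa_2$ with $A_1\exp(-\kappa_1j\log j)\le p(j)\le A_2\exp(-\kappa_2j)$ for all $j\in\mathbb N$. The pseudo-posterior $P^n_{W;\tau_0,\tau_1}(d\underline\theta,df|\underline Z_n)$ is proportional to $p_W^n(\underline Z_n|\underline\theta,f)P(d\underline\theta)P_{\tau_0,\tau_1}(df)$.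
   Formalization: The formal statement also assumes ‖f₀‖_L ≤ τ₁ on [0,π] and takes the continuous version of f₀; if ‖f₀‖_L > τ₁, then f₀ has positive sup-distance from C_{τ₀,τ₁}, so H_n is eventually empty and the claim fails. *)

theory Defs
  imports "HOL-Probability.Probability"
begin

section \<open>Eigenvalues and design matrices\<close>

definition eigenvalues :: "real^'r^'r \<Rightarrow> real set" where
  "eigenvalues A = {l. \<exists>v. v \<noteq> 0 \<and> A *v v = l *\<^sub>R v}"

definition lambda_min :: "real^'r^'r \<Rightarrow> real" where
  "lambda_min A = Min (eigenvalues A)"

definition lambda_max :: "real^'r^'r \<Rightarrow> real" where
  "lambda_max A = Max (eigenvalues A)"

text \<open>
  The dimension r of the parameter is the cardinality of the index type 'r.  Since n varies, an
  n by r matrix is given by its rows in \<open>real^'r\<close>: \<open>X n t\<close>, with t in \<open>{1..n}\<close>, is the t-th row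
  of the n-th design matrix.  Likewise a vector with n real entries is a function on \<open>{1..n}\<close>.
\<close>

type_synonym 'r design = "nat \<Rightarrow> nat \<Rightarrow> real^'r"

definition gram :: "'r design \<Rightarrow> nat \<Rightarrow> real^'r^'r" where
  "gram X n = (\<chi> a b. \<Sum>t=1..n. X n t $ a * X n t $ b)"

definition assumption_D :: "('r::finite) design \<Rightarrow> bool" where
  "assumption_D X \<longleftrightarrow>
     (\<forall>\<^sub>F n in sequentially. dim (X n ` {1..n}) = min n CARD('r)) \<and>
     0 < liminf (\<lambda>n. ereal (lambda_min (gram X n) / real n)) \<and>
     liminf (\<lambda>n. ereal (lambda_min (gram X n) / real n))
       \<le> limsup (\<lambda>n. ereal (lambda_max (gram X n) / real n)) \<and>
     limsup (\<lambda>n. ereal (lambda_max (gram X n) / real n)) < \<infinity>"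


section \<open>Gaussian time series and spectral densities\<close>

text \<open>Normal distributions include the degenerate ones.\<close>

definition normal_rv :: "'w measure \<Rightarrow> ('w \<Rightarrow> real) \<Rightarrow> bool" where
  "normal_rv M Y \<longleftrightarrow> Y \<in> borel_measurable M \<and>
     ((\<exists>\<mu>. AE w in M. Y w = \<mu>) \<or>
      (\<exists>\<mu> \<sigma>. 0 < \<sigma> \<and> distributed M lborel Y (\<lambda>x. ennreal (normal_density \<mu> \<sigma> x))))"

definition gaussian_process :: "'w measure \<Rightarrow> (nat \<Rightarrow> 'w \<Rightarrow> real) \<Rightarrow> bool" where
  "gaussian_process M e \<longleftrightarrow>
     (\<forall>I c. finite I \<longrightarrow> normal_rv M (\<lambda>w. \<Sum>t\<in>I. c t * e t w))"

definition mean_zero :: "'w measure \<Rightarrow> (nat \<Rightarrow> 'w \<Rightarrow> real) \<Rightarrow> bool" where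
  "mean_zero M e \<longleftrightarrow> (\<forall>t. integral\<^sup>L M (e t) = 0)"

definition stationary :: "'w measure \<Rightarrow> (nat \<Rightarrow> 'w \<Rightarrow> real) \<Rightarrow> bool" where
  "stationary M e \<longleftrightarrow>
     (\<forall>n h. distr M (Pi\<^sub>M {..n} (\<lambda>_. borel)) (\<lambda>w. \<lambda>t\<in>{..n}. e (t + h) w)
          = distr M (Pi\<^sub>M {..n} (\<lambda>_. borel)) (\<lambda>w. \<lambda>t\<in>{..n}. e t w))"

definition autocov :: "(real \<Rightarrow> real) \<Rightarrow> nat \<Rightarrow> complex" where
  "autocov f h =
     set_lebesgue_integral lborel {0..2*pi} (\<lambda>\<omega>. complex_of_real (f \<omega>) * exp (\<i> * (of_nat h * of_real \<omega>)))"

definition has_spectral_density ::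
    "'w measure \<Rightarrow> (nat \<Rightarrow> 'w \<Rightarrow> real) \<Rightarrow> (real \<Rightarrow> real) \<Rightarrow> bool" where
  "has_spectral_density M e f \<longleftrightarrow>
     (\<forall>\<omega>\<in>{0..2*pi}. 0 \<le> f \<omega>) \<and> set_integrable lborel {0..2*pi} f \<and>
     (\<forall>t h. complex_of_real (integral\<^sup>L M (\<lambda>w. (e (t + h) w - integral\<^sup>L M (e (t + h)))
                                             * (e t w - integral\<^sup>L M (e t))))
            = autocov f h)"

text \<open>
  The spectral density is determined by the time series only up to null sets, whereas the
  matrix \<open>D\<^sub>n(f\<^sub>0)\<close> and sup norm distances to \<open>f\<^sub>0\<close> involve its values everywhere.
  Summability of the autocovariances yields a unique continuous version, which is the one meant.
\<close>

definition assumption_F :: "(real \<Rightarrow> real) \<Rightarrow> bool" where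
  "assumption_F f \<longleftrightarrow>
     continuous_on {0..2*pi} f \<and>
     (\<exists>c C. 0 < c \<and> (\<forall>\<omega>\<in>{0..2*pi}. c \<le> f \<omega> \<and> f \<omega> \<le> C)) \<and>
     (\<exists>a. 1 < a \<and> a \<le> 2 \<and> summable (\<lambda>h. norm (autocov f h) * real h powr a))"


section \<open>Whittle's likelihood\<close>

definition fourier_freq :: "nat \<Rightarrow> nat \<Rightarrow> real" where
  "fourier_freq n j = 2 * pi * real j / real n"

definition e_vec :: "nat \<Rightarrow> nat \<Rightarrow> nat \<Rightarrow> complex" where
  "e_vec n j t = exp (- (2 * of_real pi * \<i> * of_nat j / of_nat n)) ^ t / of_real (sqrt (real n))"

text \<open>
  Rows \<open>i \<in> {..<n}\<close> of the orthogonal matrix \<open>F\<^sub>n\<close>: row 0 is \<open>e\<^sub>0\<close>, rows \<open>2j - 1\<close> and \<open>2j\<close> are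
  \<open>c\<^sub>j\<close> and \<open>s\<^sub>j\<close>, and for even n the last row is \<open>e\<^bsub>n/2\<^esub>\<close>.  In all cases row i belongs to the
  frequency with index \<open>(i + 1) div 2\<close>.
\<close>

definition fourier_matrix :: "nat \<Rightarrow> nat \<Rightarrow> nat \<Rightarrow> real" where
  "fourier_matrix n i t =
     (if i = 0 then Re (e_vec n 0 t)
      else if even n \<and> i = n - 1 then Re (e_vec n (n div 2) t)
      else if odd i then sqrt 2 * Re (e_vec n ((i + 1) div 2) t)
      else sqrt 2 * Im (e_vec n (i div 2) t))"

definition tilde_vec :: "nat \<Rightarrow> (nat \<Rightarrow> 'v::real_vector) \<Rightarrow> nat \<Rightarrow> 'v" where
  "tilde_vec n z i = (\<Sum>t=1..n. fourier_matrix n i t *\<^sub>R z t)"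

text \<open>Diagonal entries, indexed by \<open>{..<n}\<close>, of the diagonal matrix \<open>D\<^sub>n(f)\<close>.\<close>

definition D_diag :: "nat \<Rightarrow> (real \<Rightarrow> real) \<Rightarrow> nat \<Rightarrow> real" where
  "D_diag n f i = 2 * pi * f (fourier_freq n ((i + 1) div 2))"

definition whittle_density ::
    "('r::finite) design \<Rightarrow> nat \<Rightarrow> real^'r \<Rightarrow> (real \<Rightarrow> real) \<Rightarrow> (nat \<Rightarrow> real) \<Rightarrow> real" where
  "whittle_density X n \<theta> f z =
     1 / sqrt ((2 * pi) ^ n * (\<Prod>i<n. D_diag n f i)) *
     exp (- (1/2) * (\<Sum>i<n. (tilde_vec n z i - tilde_vec n (X n) i \<bullet> \<theta>)\<^sup>2 / D_diag n f i))"

definition whittle_measure ::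
    "('r::finite) design \<Rightarrow> nat \<Rightarrow> real^'r \<Rightarrow> (real \<Rightarrow> real) \<Rightarrow> (nat \<Rightarrow> real) measure" where
  "whittle_measure X n \<theta> f =
     density (Pi\<^sub>M {1..n} (\<lambda>_. lborel)) (\<lambda>z. ennreal (whittle_density X n \<theta> f z))"

definition S_mat :: "('r::finite) design \<Rightarrow> (real \<Rightarrow> real) \<Rightarrow> nat \<Rightarrow> real^'r^'r" where
  "S_mat X f n =
     (\<chi> a b. \<Sum>i<n. tilde_vec n (X n) i $ a * (1 / D_diag n f i) * tilde_vec n (X n) i $ b)"


section \<open>Function spaces on the interval from 0 to pi\<close>

definition C1_on_interval :: "(real \<Rightarrow> real) \<Rightarrow> bool" where
  "C1_on_interval f \<longleftrightarrow>
     (\<exists>f'. continuous_on {0..pi} f' \<and>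
       (\<forall>x\<in>{0..pi}. (f has_real_derivative f' x) (at x within {0..pi})))"

definition C1_functions :: "(real \<Rightarrow> real) set" where
  "C1_functions = {f \<in> extensional {0..pi}. C1_on_interval f}"

text \<open>
  The sigma algebra is generated by the point evaluations; it is the trace of the Borel sigma
  algebra of the sup norm.  The random functions used below are polynomials.
\<close>

definition C1_space :: "(real \<Rightarrow> real) measure" where
  "C1_space = restrict_space (Pi\<^sub>M {0..pi} (\<lambda>_. borel)) C1_functions"

definition sup_norm :: "(real \<Rightarrow> real) \<Rightarrow> real" where
  "sup_norm f = (SUP \<omega>\<in>{0..pi}. \<bar>f \<omega>\<bar>)"

definition lip_norm :: "(real \<Rightarrow> real) \<Rightarrow> real" where
  "lip_norm f = sup_norm f +
     (SUP (x, y)\<in>{(x, y). x \<in> {0..pi} \<and> y \<in> {0..pi} \<and> x \<noteq> y}. \<bar>f x - f y\<bar> / \<bar>x - y\<bar>)"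

text \<open>Zeros are excluded explicitly because \<open>inverse 0 = 0\<close>.\<close>

definition C_set :: "real \<Rightarrow> real \<Rightarrow> (real \<Rightarrow> real) set" where
  "C_set \<tau>\<^sub>0 \<tau>\<^sub>1 = {f \<in> C1_functions. (\<forall>\<omega>\<in>{0..pi}. f \<omega> \<noteq> 0) \<and>
     sup_norm (\<lambda>\<omega>. inverse (f \<omega>)) \<le> inverse \<tau>\<^sub>0 \<and> lip_norm f \<le> \<tau>\<^sub>1}"


section \<open>Gamma process and Bernstein-Gamma prior\<close>

definition random_measure :: "'w measure \<Rightarrow> 's measure \<Rightarrow> ('w \<Rightarrow> 's measure) \<Rightarrow> bool" where
  "random_measure M S \<Phi> \<longleftrightarrow>
     (\<forall>w\<in>space M. sets (\<Phi> w) = sets S \<and> finite_measure (\<Phi> w)) \<and>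
     (\<forall>A\<in>sets S. (\<lambda>w. measure (\<Phi> w) A) \<in> borel_measurable M)"

definition completely_random_measure ::
    "'w measure \<Rightarrow> 's measure \<Rightarrow> ('w \<Rightarrow> 's measure) \<Rightarrow> bool" where
  "completely_random_measure M S \<Phi> \<longleftrightarrow>
     prob_space M \<and> random_measure M S \<Phi> \<and>
     (\<forall>(m::nat) A. A ` {..<m} \<subseteq> sets S \<and> disjoint_family_on A {..<m} \<longrightarrow>
        prob_space.indep_vars M (\<lambda>_. borel) (\<lambda>i w. measure (\<Phi> w) (A i)) {..<m})"

text \<open>
  The Levy-Khintchine formula for a completely random measure without deterministic part and
  without fixed atoms.
\<close>

definition has_levy_measure ::
    "'w measure \<Rightarrow> 's measure \<Rightarrow> ('w \<Rightarrow> 's measure) \<Rightarrow> ('s \<times> real) measure \<Rightarrow> bool" where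
  "has_levy_measure M S \<Phi> \<nu> \<longleftrightarrow>
     (\<forall>A\<in>sets S. \<forall>u\<ge>0.
        set_integrable \<nu> (A \<times> {0<..}) (\<lambda>(x, s). 1 - exp (- u * s)) \<and>
        integral\<^sup>L M (\<lambda>w. exp (- u * measure (\<Phi> w) A))
          = exp (- set_lebesgue_integral \<nu> (A \<times> {0<..}) (\<lambda>(x, s). 1 - exp (- u * s))))"

definition gamma_levy_measure ::
    "(real \<Rightarrow> real) \<Rightarrow> (real \<Rightarrow> real) \<Rightarrow> (real \<times> real) measure" where
  "gamma_levy_measure \<alpha> \<beta> =
     density lborel (\<lambda>(x, s). indicator ({0..pi} \<times> {0<..}) (x, s)
                              * ennreal (\<alpha> x * (1 / s) * exp (- \<beta> x * s)))"

definition gamma_process ::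
    "'w measure \<Rightarrow> ('w \<Rightarrow> real measure) \<Rightarrow> (real \<Rightarrow> real) \<Rightarrow> (real \<Rightarrow> real) \<Rightarrow> bool" where
  "gamma_process M \<Phi> \<alpha> \<beta> \<longleftrightarrow>
     completely_random_measure M (restrict_space borel {0..pi}) \<Phi> \<and>
     has_levy_measure M (restrict_space borel {0..pi}) \<Phi> (gamma_levy_measure \<alpha> \<beta>)"

definition beta_density :: "nat \<Rightarrow> nat \<Rightarrow> real \<Rightarrow> real" where
  "beta_density j l x = x ^ (j - 1) * (1 - x) ^ (l - 1) / Beta (real j) (real l)"

definition bernstein_poly :: "nat \<Rightarrow> real measure \<Rightarrow> real \<Rightarrow> real" where
  "bernstein_poly k \<phi> =
     (\<lambda>\<omega>\<in>{0..pi}. \<Sum>j=1..k.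
        measure \<phi> {real (j - 1) * pi / real k <.. real j * pi / real k}
          * beta_density j (k - j + 1) (\<omega> / pi))"

text \<open>The product measure expresses the independence of the degree and the Gamma process.\<close>

definition bernstein_gamma_prior ::
    "nat pmf \<Rightarrow> 'w measure \<Rightarrow> ('w \<Rightarrow> real measure) \<Rightarrow> (real \<Rightarrow> real) measure" where
  "bernstein_gamma_prior p M \<Phi> =
     distr (measure_pmf p \<Otimes>\<^sub>M M) C1_space (\<lambda>(k, w). bernstein_poly k (\<Phi> w))"

definition truncated_prior ::
    "(real \<Rightarrow> real) measure \<Rightarrow> real \<Rightarrow> real \<Rightarrow> (real \<Rightarrow> real) measure" where
  "truncated_prior P \<tau>\<^sub>0 \<tau>\<^sub>1 = uniform_measure P (C_set \<tau>\<^sub>0 \<tau>\<^sub>1)"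

definition assumption_P :: "(real^'r) measure \<Rightarrow> real^('r::finite) \<Rightarrow> bool" where
  "assumption_P Q \<theta>\<^sub>0 \<longleftrightarrow>
     prob_space Q \<and>
     (\<exists>\<nu>>0. (\<integral>\<^sup>+\<theta>. ennreal (norm \<theta> powr \<nu>) \<partial>Q) < \<infinity>) \<and>
     (\<exists>g C U. g \<in> borel_measurable borel \<and> Q = density lborel (\<lambda>\<theta>. ennreal (g \<theta>)) \<and>
        0 < C \<and> (\<forall>\<theta>. 0 \<le> g \<theta> \<and> g \<theta> \<le> C) \<and>
        open U \<and> \<theta>\<^sub>0 \<in> U \<and> continuous_on U g \<and> (\<forall>\<theta>\<in>U. 0 < g \<theta>))"

definition assumption_G :: "(real \<Rightarrow> real) \<Rightarrow> (real \<Rightarrow> real) \<Rightarrow> bool" where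
  "assumption_G \<alpha> \<beta> \<longleftrightarrow>
     (\<exists>g\<^sub>0 g\<^sub>1. 0 < g\<^sub>0 \<and> 0 < g\<^sub>1 \<and>
        (AE x in lborel. x \<in> {0..pi} \<longrightarrow>
           g\<^sub>0 \<le> \<alpha> x \<and> \<alpha> x \<le> g\<^sub>1 \<and> g\<^sub>0 \<le> \<beta> x \<and> \<beta> x \<le> g\<^sub>1))"

definition assumption_K :: "nat pmf \<Rightarrow> bool" where
  "assumption_K p \<longleftrightarrow>
     (\<exists>A\<^sub>1 A\<^sub>2 \<kappa>\<^sub>1 \<kappa>\<^sub>2. 0 < A\<^sub>1 \<and> 0 < A\<^sub>2 \<and> 0 < \<kappa>\<^sub>1 \<and> 0 < \<kappa>\<^sub>2 \<and>
        (\<forall>j\<ge>1. A\<^sub>1 * exp (- \<kappa>\<^sub>1 * real j * ln (real j)) \<le> pmf p j \<and>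
                pmf p j \<le> A\<^sub>2 * exp (- \<kappa>\<^sub>2 * real j)))"


section \<open>Pseudo-posterior and convergence in probability\<close>

definition pseudo_posterior ::
    "(real^('r::finite)) measure \<Rightarrow> (real \<Rightarrow> real) measure \<Rightarrow> 'r design \<Rightarrow> nat \<Rightarrow> (nat \<Rightarrow> real)
       \<Rightarrow> ((real^'r) \<times> (real \<Rightarrow> real)) measure" where
  "pseudo_posterior Q P X n z =
     density (Q \<Otimes>\<^sub>M P)
       (\<lambda>(\<theta>, f). ennreal (whittle_density X n \<theta> f z)
          / (\<integral>\<^sup>+(\<theta>', f'). ennreal (whittle_density X n \<theta>' f' z) \<partial>(Q \<Otimes>\<^sub>M P)))"

definition Theta_set ::
    "('r::finite) design \<Rightarrow> real^'r \<Rightarrow> (real \<Rightarrow> real) \<Rightarrow> nat \<Rightarrow> (real^'r) set" where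
  "Theta_set X \<theta>\<^sub>0 f\<^sub>0 n =
     {\<theta>. (\<theta> - \<theta>\<^sub>0) \<bullet> (S_mat X f\<^sub>0 n *v (\<theta> - \<theta>\<^sub>0)) \<le> sqrt (lambda_min (S_mat X f\<^sub>0 n))}"

definition H_set :: "real \<Rightarrow> real \<Rightarrow> (real \<Rightarrow> real) \<Rightarrow> nat \<Rightarrow> (real \<Rightarrow> real) set" where
  "H_set \<tau>\<^sub>0 \<tau>\<^sub>1 f\<^sub>0 n =
     {f \<in> C_set \<tau>\<^sub>0 \<tau>\<^sub>1. sup_norm (\<lambda>\<omega>. f \<omega> - f\<^sub>0 \<omega>) \<le> 1 / ln (real n)}"

text \<open>
  The n-th statistic lives on its own probability space.  Measurability is part of the notion,
  since \<^const>\<open>measure\<close> vanishes on non-measurable sets.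
\<close>

definition converges_in_prob ::
    "(nat \<Rightarrow> 'z measure) \<Rightarrow> (nat \<Rightarrow> 'z \<Rightarrow> real) \<Rightarrow> real \<Rightarrow> bool" where
  "converges_in_prob P T c \<longleftrightarrow>
     (\<forall>n. prob_space (P n) \<and> T n \<in> borel_measurable (P n)) \<and>
     (\<forall>\<epsilon>>0. (\<lambda>n. measure (P n) {z \<in> space (P n). \<epsilon> < \<bar>T n z - c\<bar>}) \<longlonglongrightarrow> 0)"

end

theory Submission
  imports Defs "HOL-Real_Asymp.Real_Asymp"
begin

text \<open>Whittle's measure is the image of white noise \<open>\<epsilon>\<close> under a linear map, so every statement about
  the data becomes a statement about \<open>\<epsilon>\<close>. As a function of \<open>\<theta>\<close> the likelihood at \<open>f\<close> is
  \<open>exp (score (\<theta> - \<theta>\<^sub>0) - info (\<theta> - \<theta>\<^sub>0) / 2)\<close>, times its value at \<open>\<theta>\<^sub>0\<close>; the latter, relative to its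
  value at \<open>(\<theta>\<^sub>0, f\<^sub>0)\<close>, is the exponential of half of
  \<open>(\<Sum>i<n. (1 - f\<^sub>0 / f) (\<epsilon> i)\<^sup>2 + ln (f\<^sub>0 / f))\<close>, a weighted sum of \<open>(\<epsilon> i)\<^sup>2 - 1\<close> minus a sum of terms
  \<open>f\<^sub>0 / f - 1 - ln (f\<^sub>0 / f)\<close>. All weights are Lipschitz in the frequency, uniformly over the prior's
  support, so summation by parts bounds the random sums for all \<open>f\<close> at once by maximal partial
  sums of \<open>\<epsilon>\<close> and \<open>\<epsilon>\<^sup>2 - 1\<close>. These stay below \<open>n powr (5/8)\<close> with probability tending to 1.

  On that event the likelihood outside \<open>\<Theta>\<^sub>n\<close> is at most \<open>exp (- const * sqrt n)\<close> relative to its value on a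
  ball of radius \<open>1 / sqrt n\<close>, whose prior mass is polynomial in \<open>n\<close>. If \<open>f\<close> deviates from \<open>f\<^sub>0\<close> by more
  than \<open>1 / ln n\<close> somewhere then, being Lipschitz, it deviates by half as much at about \<open>n / ln n\<close>
  frequencies, which costs a factor \<open>exp (- const * n / (ln n)^3)\<close>. Sup norm balls of radius
  \<open>1 / (ln n)^2\<close> around \<open>f\<^sub>0\<close> have prior mass at least \<open>exp (- const * (ln n)^8)\<close>: Bernstein polynomials of
  degree about \<open>(ln n)^4\<close> are close enough to \<open>f\<^sub>0\<close>, and a Mecke type identity, obtained by
  differentiating the Laplace functional, bounds the small ball probabilities of the Gamma process
  from below.\<close>

section \<open>Eigenvalues of symmetric matrices\<close>

text \<open>Three obstacles shape the proof. The hypothesis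
  \<open>lip_norm f\<^sub>0 \<le> \<tau>\<^sub>1\<close> contains a supremum of difference
  quotients, which carries information only if these are bounded; summable autocovariances supply
  this by way of Fejer means. The hypothesis also allows \<open>f\<^sub>0\<close> to lie on the
  boundary of the Lipschitz ball, where good approximations may fall outside the support of the
  prior; therefore the approximants are pulled towards a constant. Finally, for varying \<beta> an
  increment of the Gamma process is accessible only through its Laplace transform. The exponent 5/8
  could be any number strictly between 1/2 and 3/4. Above 1/2, moment bounds make the exceptional
  event rare; below 3/4, the squared noise level divided by \<open>n\<close>, here
  \<open>n powr (1/4)\<close>, is negligible against the decay \<open>sqrt n\<close> in the
  parameter. The radius \<open>1 / (ln n)^2\<close> makes the likelihood loss
  \<open>n / (ln n)^4\<close> near \<open>f\<^sub>0\<close> smaller by one logarithm than the loss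
  \<open>n / (ln n)^3\<close> far from it.\<close>

lemma symmetric_form_commute:
  fixes A :: "real^'r^'r"
  assumes "transpose A = A"
  shows "v \<bullet> (A *v w) = w \<bullet> (A *v v)"
  using assms by (metis dot_lmul_matrix inner_commute transpose_matrix_vector)

text \<open>First order condition at a minimum of
  \<open>v \<bullet> (A *v v) - m * (v \<bullet> v)\<close>: moving from \<open>u\<close> along the
  residual \<open>w = A *v u - m *\<^sub>R u\<close> changes this form by
  \<open>2 * t * (w \<bullet> w)\<close> up to order \<open>t\<^sup>2\<close>, so a small negative
  \<open>t\<close> would make it negative unless \<open>w = 0\<close>.\<close>

lemma form_minimizer_is_eigenvector:
  fixes A :: "real^'r^'r"
  assumes sym: "transpose A = A" and min: "\<And>v. m * (v \<bullet> v) \<le> v \<bullet> (A *v v)"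
    and u: "u \<bullet> (A *v u) = m * (u \<bullet> u)"
  shows "A *v u = m *\<^sub>R u"
proof -
  define w where "w = A *v u - m *\<^sub>R u"
  define g where "g = w \<bullet> (A *v w) - m * (w \<bullet> w)"
  have ww: "w \<bullet> w = w \<bullet> (A *v u) - m * (w \<bullet> u)"
    unfolding w_def by (simp only: inner_diff_right inner_scaleR_right)
  have *: "0 \<le> 2 * t * (w \<bullet> w) + t\<^sup>2 * g" for t
  proof -
    have "m * ((u + t *\<^sub>R w) \<bullet> (u + t *\<^sub>R w)) \<le> (u + t *\<^sub>R w) \<bullet> (A *v (u + t *\<^sub>R w))"
      by (rule min)
    moreover have "(u + t *\<^sub>R w) \<bullet> (A *v (u + t *\<^sub>R w))
        = u \<bullet> (A *v u) + 2 * t * (w \<bullet> (A *v u)) + t\<^sup>2 * (w \<bullet> (A *v w))"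
      using symmetric_form_commute[OF sym, of u w]
      by (simp add: matrix_vector_right_distrib matrix_vector_mult_scaleR inner_add_left
          power2_eq_square algebra_simps)
    moreover have "(u + t *\<^sub>R w) \<bullet> (u + t *\<^sub>R w) = u \<bullet> u + 2 * t * (w \<bullet> u) + t\<^sup>2 * (w \<bullet> w)"
      by (simp add: inner_add_left inner_commute power2_eq_square algebra_simps)
    moreover have "2 * t * (w \<bullet> w) = 2 * t * (w \<bullet> (A *v u)) - 2 * t * (m * (w \<bullet> u))"
      by (simp only: ww right_diff_distrib)
    ultimately show ?thesis
      unfolding g_def using u by (auto simp only: distrib_left right_diff_distrib mult.assoc mult.left_commute[of m])
  qed
  have "w \<bullet> w = 0"
  proof (rule ccontr)
    assume "w \<bullet> w \<noteq> 0"
    hence pos: "w \<bullet> w > 0" by simp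
    \<comment> \<open>\<open>\<bar>g\<bar> + 1\<close> is a positive bound for the quadratic
      coefficient; with this \<open>t\<close> the quadratic term makes up at most half of the linear
      one.\<close>
    define t where "t = - (w \<bullet> w) / (\<bar>g\<bar> + 1)"
    have "t\<^sup>2 * g \<le> t\<^sup>2 * (\<bar>g\<bar> + 1)" by (intro mult_left_mono) auto
    also have "\<dots> = - t * (- t * (\<bar>g\<bar> + 1))" by (simp add: power2_eq_square)
    also have "- t * (\<bar>g\<bar> + 1) = w \<bullet> w" unfolding t_def by (simp add: divide_simps)
    finally have "0 \<le> t * (w \<bullet> w)" using *[of t] by simp
    moreover have "t < 0" unfolding t_def using pos by (simp add: field_simps)
    ultimately show False using pos by (simp add: zero_le_mult_iff)
  qed
  thus ?thesis by (simp add: w_def)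
qed

text \<open>Eigenvectors of distinct eigenvalues are orthogonal, hence independent. Finiteness is
  what gives the \<open>Min\<close> and \<open>Max\<close> in \<open>lambda_min\<close> and
  \<open>lambda_max\<close> their meaning.\<close>

lemma finite_eigenvalues:
  fixes A :: "real^'r^'r"
  assumes sym: "transpose A = A"
  shows "finite (eigenvalues A)"
proof -
  define v where "v l = (SOME x. x \<noteq> 0 \<and> A *v x = l *\<^sub>R x)" for l
  have v: "v l \<noteq> 0" "A *v v l = l *\<^sub>R v l" if "l \<in> eigenvalues A" for l
    using that someI_ex[of "\<lambda>x. x \<noteq> 0 \<and> A *v x = l *\<^sub>R x"] unfolding v_def eigenvalues_def by auto
  have orth: "v l \<bullet> v k = 0" if "l \<in> eigenvalues A" "k \<in> eigenvalues A" "l \<noteq> k" for l k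
    using symmetric_form_commute[OF sym, of "v l" "v k"] v that by (simp add: inner_commute)
  have inj: "inj_on v (eigenvalues A)"
    by (rule inj_onI) (metis orth v(1) inner_eq_zero_iff)
  have "independent (v ` eigenvalues A)"
    by (rule pairwise_orthogonal_independent)
       (auto simp: pairwise_def orthogonal_def intro!: orth dest: v)
  thus ?thesis
    using inj finiteI_independent finite_imageD by blast
qed

text \<open>Rayleigh quotient: the form attains its minimum on the compact unit sphere, a minimiser
  is an eigenvector, and testing with any other eigenvector shows that its eigenvalue is no smaller.
  In particular an eigenvalue exists.\<close>

lemma lambda_min_form:
  fixes A :: "real^'r^'r"
  assumes sym: "transpose A = A"
  shows "lambda_min A \<in> eigenvalues A" "lambda_min A * (v \<bullet> v) \<le> v \<bullet> (A *v v)"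
proof -
  have "\<exists>u\<in>sphere 0 1. \<forall>x\<in>sphere 0 1. u \<bullet> (A *v u) \<le> x \<bullet> (A *v x)"
    by (intro continuous_attains_inf compact_sphere continuous_intros linear_continuous_on
        matrix_vector_mul_bounded_linear) (auto simp: sphere_eq_empty)
  then obtain u where u: "norm u = 1" "\<And>x. norm x = 1 \<Longrightarrow> u \<bullet> (A *v u) \<le> x \<bullet> (A *v x)" by auto
  define m where "m = u \<bullet> (A *v u)"
  have uu: "u \<bullet> u = 1" using u(1) by (simp add: dot_square_norm)
  have min: "m * (v \<bullet> v) \<le> v \<bullet> (A *v v)" for v
  proof (cases "v = 0")
    case False
    have "norm (sgn v) = 1" using False by (simp add: norm_sgn)
    hence "m \<le> sgn v \<bullet> (A *v sgn v)" unfolding m_def by (rule u(2))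
    also have "\<dots> = v \<bullet> (A *v v) / (v \<bullet> v)"
      using False by (simp add: sgn_div_norm matrix_vector_mult_scaleR dot_square_norm
          power2_eq_square divide_simps)
    finally show ?thesis using False by (simp add: field_simps)
  qed simp
  have "A *v u = m *\<^sub>R u"
    by (rule form_minimizer_is_eigenvector[OF sym min]) (simp add: m_def uu)
  hence m_in: "m \<in> eigenvalues A" using u(1) unfolding eigenvalues_def by (intro CollectI exI[of _ u]) auto
  have "m \<le> l" if "l \<in> eigenvalues A" for l
  proof -
    from that have "\<exists>x. x \<noteq> 0 \<and> A *v x = l *\<^sub>R x" unfolding eigenvalues_def mem_Collect_eq .
    then obtain x where x: "x \<noteq> 0 \<and> A *v x = l *\<^sub>R x" ..
    from min[of x] show ?thesis using x by simp
  qed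
  hence "lambda_min A = m" unfolding lambda_min_def
    using m_in finite_eigenvalues[OF sym] by (intro Min_eqI) auto
  thus "lambda_min A \<in> eigenvalues A" "lambda_min A * (v \<bullet> v) \<le> v \<bullet> (A *v v)"
    using m_in min by auto
qed

lemma le_lambda_minI:
  fixes A :: "real^'r^'r"
  assumes sym: "transpose A = A" and "\<And>v. c * (v \<bullet> v) \<le> v \<bullet> (A *v v)"
  shows "c \<le> lambda_min A"
proof -
  obtain x where x: "x \<noteq> 0" "A *v x = lambda_min A *\<^sub>R x"
    using lambda_min_form(1)[OF sym] unfolding eigenvalues_def by auto
  from assms(2)[of x] show ?thesis using x by simp
qed

text \<open>Apply the minimum to \<open>- A\<close>, whose least eigenvalue is minus an eigenvalue
  of \<open>A\<close>.\<close>

lemma lambda_max_form: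
  fixes A :: "real^'r^'r"
  assumes sym: "transpose A = A"
  shows "v \<bullet> (A *v v) \<le> lambda_max A * (v \<bullet> v)"
proof -
  have "transpose (- A) = - A" using sym by (simp add: transpose_def vec_eq_iff)
  note min = lambda_min_form[OF this]
  have neg: "- A *v x = - (A *v x)" for x
    by (simp add: matrix_vector_mult_def vec_eq_iff sum_negf)
  have "- lambda_min (- A) \<in> eigenvalues A"
    using min(1) unfolding eigenvalues_def neg by (auto simp: minus_equation_iff[of "A *v _"])
  hence "- lambda_min (- A) \<le> lambda_max A"
    unfolding lambda_max_def using finite_eigenvalues[OF sym] by (intro Max_ge)
  hence "- lambda_min (- A) * (v \<bullet> v) \<le> lambda_max A * (v \<bullet> v)"
    by (intro mult_right_mono) auto
  thus ?thesis using min(2)[of v] by (simp add: neg)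
qed

section \<open>The discrete Fourier matrix is orthogonal\<close>

lemma e_vec_eq_cis: "e_vec n j t = cis (- (2 * pi * real j * real t / real n)) / of_real (sqrt (real n))"
proof -
  have "exp (- (2 * of_real pi * \<i> * of_nat j / of_nat n)) = cis (- (2 * pi * real j / real n))"
    by (simp add: cis_conv_exp mult_ac)
  moreover have "cis (- (2 * pi * real j / real n)) ^ t = cis (- (2 * pi * real j * real t / real n))"
    by (subst Complex.DeMoivre, rule arg_cong[of _ _ cis]) simp
  ultimately show ?thesis unfolding e_vec_def by simp
qed

lemma Re_e_vec: "Re (e_vec n j t) = cos (2 * pi * real j * real t / real n) / sqrt (real n)"
  and Im_e_vec: "Im (e_vec n j t) = - sin (2 * pi * real j * real t / real n) / sqrt (real n)"
  unfolding e_vec_eq_cis by (simp_all add: Re_divide_of_real Im_divide_of_real)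

text \<open>Real part of a geometric sum over the powers of an n-th root of unity different from
  1.\<close>

lemma sum_cos_roots_of_unity:
  fixes d :: int
  assumes "n > 0" "\<not> int n dvd d"
  shows "(\<Sum>j<n. cos (2 * pi * real j * real_of_int d / real n)) = 0"
proof -
  define w where "w = cis (2 * pi * real_of_int d / real n)"
  have wj: "w ^ j = cis (2 * pi * real j * real_of_int d / real n)" for j
    unfolding w_def by (subst Complex.DeMoivre, rule arg_cong[of _ _ cis]) simp
  have wn: "w ^ n = 1"
    unfolding wj using assms(1) cis_multiple_2pi[of "real_of_int d"] by (simp add: mult_ac)
  have "w \<noteq> 1"
  proof
    assume "w = 1"
    hence "cos (2 * pi * real_of_int d / real n) = 1" by (metis Re_complex_of_real cis.sel(1) of_real_1 w_def)
    then obtain k :: int where "2 * pi * real_of_int d / real n = real_of_int k * 2 * pi"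
      by (metis cos_one_2pi_int)
    hence "real_of_int d = real_of_int (k * int n)"
      using assms(1) by (simp add: field_simps)
    hence "d = k * int n" by linarith
    thus False using assms(2) by simp
  qed
  hence "(\<Sum>j<n. w ^ j) = 0" using wn by (simp add: sum_gp_strict)
  hence "Re (\<Sum>j<n. w ^ j) = 0" by simp
  thus ?thesis by (simp add: wj)
qed

text \<open>The \<open>n\<close> real rows are matched with the \<open>n\<close> complex
  frequencies: the two rows of frequency \<open>j\<close> stand for \<open>j\<close> and its mirror
  image \<open>n - j\<close>, while 0 and, for even \<open>n\<close>, \<open>n div 2\<close> are
  their own mirror images and own a single row.\<close>

lemma sum_by_frequency:
  fixes g a :: "nat \<Rightarrow> real"
  assumes "n > 0" and sym: "\<And>j. 0 < j \<Longrightarrow> j < n \<Longrightarrow> g (n - j) = g j"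
    and "a 0 = g 0" and "\<And>j. 1 \<le> j \<Longrightarrow> j \<le> (n - 1) div 2 \<Longrightarrow> a (2 * j - 1) + a (2 * j) = 2 * g j"
    and "even n \<Longrightarrow> a (n - 1) = g (n div 2)"
  shows "(\<Sum>i<n. a i) = (\<Sum>j<n. g j)"
proof -
  define N where "N = (n - 1) div 2"
  have pairs: "(\<Sum>i<2 * K + 1. a i) = g 0 + 2 * (\<Sum>j=1..K. g j)" if "K \<le> N" for K
    using that
  proof (induction K)
    case (Suc K)
    have "a (2 * K + 1) + a (2 * K + 2) = 2 * g (Suc K)"
      using assms(4)[of "Suc K"] Suc.prems by (simp add: N_def)
    thus ?case using Suc by simp
  qed (use assms in simp)
  have refl: "(\<Sum>j=1..N. g (n - j)) = (\<Sum>j=1..N. g j)"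
    by (intro sum.cong sym) (auto simp: N_def)
  have flip: "(\<Sum>j=n-N..<n. g j) = (\<Sum>j=1..N. g (n - j))"
    by (rule sum.reindex_bij_witness[of _ "\<lambda>j. n - j" "\<lambda>j. n - j"])
       (use assms(1) in \<open>auto simp: N_def\<close>)
  show ?thesis
  proof (cases "even n")
    case True
    hence n: "n = 2 * N + 2" unfolding N_def using assms(1) by (auto elim!: evenE)
    have "{..<n} = {..<N + 1} \<union> {N + 1} \<union> {n-N..<n}" using n by auto
    hence "(\<Sum>j<n. g j) = (\<Sum>j<N + 1. g j) + g (N + 1) + (\<Sum>j=n-N..<n. g j)"
      using n by (simp only: sum.union_disjoint) (subst sum.union_disjoint | force)+
    moreover have "(\<Sum>j<N + 1. g j) = g 0 + (\<Sum>j=1..N. g j)"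
      by (simp add: lessThan_Suc_atMost sum.atMost_shift sum.atLeast1_atMost_eq)
    moreover have "(\<Sum>i<n. a i) = g 0 + 2 * (\<Sum>j=1..N. g j) + g (N + 1)"
    proof -
      have "{..<n} = {..<2 * N + 1} \<union> {n - 1}" using n by auto
      thus ?thesis using pairs[of N] n assms(5) by (simp add: sum.union_disjoint)
    qed
    ultimately show ?thesis using flip refl by simp
  next
    case False
    hence n: "n = 2 * N + 1" unfolding N_def by (auto elim!: oddE)
    have "{..<n} = {..<N + 1} \<union> {n-N..<n}" using n by auto
    hence "(\<Sum>j<n. g j) = (\<Sum>j<N + 1. g j) + (\<Sum>j=n-N..<n. g j)"
      using n by (metis finite_lessThan finite_atLeastLessThan sum.union_disjoint ivl_disj_int_one(2)
          lessThan_atLeast0 ivl_disj_int_two(3) add_diff_cancel_right' mult_2 add.commute add.assoc)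
    moreover have "(\<Sum>j<N + 1. g j) = g 0 + (\<Sum>j=1..N. g j)"
      by (simp add: lessThan_Suc_atMost sum.atMost_shift sum.atLeast1_atMost_eq)
    ultimately show ?thesis using pairs[of N] flip refl unfolding n by simp
  qed
qed

text \<open>At each frequency \<open>j\<close> the cosine and sine products add up to
  \<open>cos (2 * pi * j * (t - s) / n)\<close>, and these sum to zero over all frequencies because
  \<open>0 < \<bar>t - s\<bar> < n\<close> when \<open>t \<noteq> s\<close>.\<close>

lemma fourier_matrix_columns:
  assumes t: "t \<in> {1..n}" and s: "s \<in> {1..n}"
  shows "(\<Sum>i<n. fourier_matrix n i t * fourier_matrix n i s) = (if t = s then 1 else 0)"
proof -
  have n: "n > 0" using t by auto
  define d where "d = int t - int s"
  define g where "g j = cos (2 * pi * real j * real_of_int d / real n) / real n" for j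
  have sym: "g (n - j) = g j" if "j < n" for j
  proof -
    have "cos (2 * pi * real (n - j) * real_of_int d / real n)
        = cos (2 * pi * real_of_int d - 2 * pi * real j * real_of_int d / real n)"
      using that n by (simp add: of_nat_diff field_simps)
    also have "\<dots> = cos (2 * pi * real j * real_of_int d / real n)"
      unfolding cos_diff by (simp only: cos_int_2pin sin_int_2pin)
    finally show ?thesis by (simp add: g_def)
  qed
  define h where "h j = Re (e_vec n j t) * Re (e_vec n j s)" for j
  define k where "k j = Im (e_vec n j t) * Im (e_vec n j s)" for j
  have hk: "h j + k j = g j" for j
  proof -
    have "g j = cos (2 * pi * real j * real t / real n - 2 * pi * real j * real s / real n) / real n"
      unfolding g_def d_def by (simp add: right_diff_distrib diff_divide_distrib)
    thus ?thesis
      unfolding h_def k_def Re_e_vec Im_e_vec cos_diff using n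
      by (simp add: field_simps)
  qed
  \<comment> \<open>The sine part vanishes at the frequencies 0 and \<open>n div 2\<close>; hence
    their single row, without the factor \<open>sqrt 2\<close>, already carries the full
    contribution.\<close>
  have k0: "k 0 = 0" by (simp add: k_def Im_e_vec)
  have kn: "k (n div 2) = 0" if "even n"
  proof -
    have "2 * pi * real (n div 2) * real t / real n = pi * real t"
      using n that by (auto elim!: evenE)
    thus ?thesis by (simp add: k_def Im_e_vec)
  qed
  have "(\<Sum>i<n. fourier_matrix n i t * fourier_matrix n i s) = (\<Sum>j<n. g j)"
  proof (rule sum_by_frequency[OF n, of g])
    show "fourier_matrix n 0 t * fourier_matrix n 0 s = g 0"
      using k0 hk[of 0] by (simp add: fourier_matrix_def h_def)
    show "fourier_matrix n (n - 1) t * fourier_matrix n (n - 1) s = g (n div 2)" if "even n"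
      using that kn[OF that] hk[of "n div 2"] n by (auto simp: fourier_matrix_def h_def)
    show "fourier_matrix n (2 * j - 1) t * fourier_matrix n (2 * j - 1) s +
        fourier_matrix n (2 * j) t * fourier_matrix n (2 * j) s = 2 * g j"
      if "1 \<le> j" "j \<le> (n - 1) div 2" for j
    proof -
      have parity: "2 * j - 1 \<noteq> 0" "odd (2 * j - 1)" "\<not> (even n \<and> 2 * j - 1 = n - 1)"
          "2 * j \<noteq> 0" "\<not> odd (2 * j)" "(2 * j - 1 + 1) div 2 = j" "2 * j div 2 = j"
        using that by auto
      have "\<not> (even n \<and> 2 * j = n - 1)" using that n by presburger
      hence "fourier_matrix n (2 * j - 1) u = sqrt 2 * Re (e_vec n j u)"
          "fourier_matrix n (2 * j) u = sqrt 2 * Im (e_vec n j u)" for u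
        unfolding fourier_matrix_def by (simp_all only: parity if_False if_True not_False_eq_True)
      moreover have "sqrt 2 * x * (sqrt 2 * y) = 2 * (x * y)" for x y :: real
        using real_sqrt_mult_self[of 2] by (simp only: mult.assoc mult.left_commute[of x "sqrt 2"]) simp
      ultimately show ?thesis using hk[of j] by (simp only: h_def k_def distrib_left[symmetric])
    qed
  qed (use sym in auto)
  also have "\<dots> = (if t = s then 1 else 0)"
  proof (cases "t = s")
    case False
    have "\<not> int n dvd d"
    proof
      assume "int n dvd d"
      hence "int n \<le> \<bar>d\<bar>" using False by (intro zdvd_imp_le) (auto simp: d_def)
      thus False using t s by (auto simp: d_def)
    qed
    from sum_cos_roots_of_unity[OF n this] False show ?thesis
      unfolding g_def by (simp flip: sum_divide_distrib)
  qed (use n in \<open>simp add: g_def d_def\<close>)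
  finally show ?thesis .
qed

text \<open>A square matrix with orthonormal columns has orthonormal rows: for \<open>P = F F\<^sup>T\<close> the squared
  Frobenius norm of \<open>I - P\<close> is \<open>n - 2 tr P + tr (P P\<^sup>T) = n - 2 n + n\<close>.\<close>

lemma fourier_matrix_rows:
  assumes "i < n" "k < n"
  shows "(\<Sum>t=1..n. fourier_matrix n i t * fourier_matrix n k t) = (if i = k then 1 else 0)"
proof -
  let ?F = "fourier_matrix n"
  define P where "P i k = (\<Sum>t=1..n. ?F i t * ?F k t)" for i k
  define E where "E i k = (if i = k then 1 else 0 :: real)" for i k :: nat
  have tr: "(\<Sum>i<n. P i i) = real n"
  proof -
    have "(\<Sum>i<n. P i i) = (\<Sum>t=1..n. \<Sum>i<n. ?F i t * ?F i t)"
      unfolding P_def by (rule sum.swap)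
    also have "\<dots> = (\<Sum>t=1..n. 1)"
      by (intro sum.cong refl) (subst fourier_matrix_columns; simp)
    finally show ?thesis by simp
  qed
  have "(\<Sum>i<n. \<Sum>k<n. P i k * P i k) = (\<Sum>i<n. \<Sum>k<n. \<Sum>t=1..n. \<Sum>s=1..n. (?F i t * ?F k t) * (?F i s * ?F k s))"
    unfolding P_def by (simp add: sum_product)
  also have "\<dots> = (\<Sum>i<n. \<Sum>t=1..n. \<Sum>k<n. \<Sum>s=1..n. (?F i t * ?F k t) * (?F i s * ?F k s))"
    by (intro sum.cong refl sum.swap)
  also have "\<dots> = (\<Sum>t=1..n. \<Sum>i<n. \<Sum>k<n. \<Sum>s=1..n. (?F i t * ?F k t) * (?F i s * ?F k s))"
    by (rule sum.swap)
  also have "\<dots> = (\<Sum>t=1..n. \<Sum>i<n. \<Sum>s=1..n. \<Sum>k<n. (?F i t * ?F k t) * (?F i s * ?F k s))"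
    by (intro sum.cong refl sum.swap)
  also have "\<dots> = (\<Sum>t=1..n. \<Sum>s=1..n. \<Sum>i<n. \<Sum>k<n. (?F i t * ?F k t) * (?F i s * ?F k s))"
    by (intro sum.cong refl sum.swap)
  also have "\<dots> = (\<Sum>t=1..n. \<Sum>s=1..n. (\<Sum>i<n. ?F i t * ?F i s) * (\<Sum>k<n. ?F k t * ?F k s))"
    unfolding sum_product by (intro sum.cong refl) (simp add: mult_ac)
  also have "\<dots> = (\<Sum>t=1..n. \<Sum>s=1..n. if t = s then 1 else 0)"
    by (intro sum.cong refl, subst (1 2) fourier_matrix_columns) auto
  also have "\<dots> = real n" by simp
  finally have sq: "(\<Sum>i<n. \<Sum>k<n. P i k * P i k) = real n" .
  have "(\<Sum>i<n. \<Sum>k<n. (P i k - E i k)\<^sup>2)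
      = (\<Sum>i<n. \<Sum>k<n. P i k * P i k) - 2 * (\<Sum>i<n. \<Sum>k<n. P i k * E i k) + (\<Sum>i<n. \<Sum>k<n. E i k * E i k)"
    by (simp add: power2_diff sum.distrib sum_subtractf mult.assoc flip: sum_distrib_left power2_eq_square)
  also have "(\<Sum>i<n. \<Sum>k<n. P i k * E i k) = (\<Sum>i<n. P i i)"
    unfolding E_def by (simp add: if_distrib cong: if_cong)
  also have "(\<Sum>i<n. \<Sum>k<n. E i k * E i k) = real n"
    unfolding E_def by (simp add: if_distrib cong: if_cong)
  finally have "(\<Sum>i<n. \<Sum>k<n. (P i k - E i k)\<^sup>2) = 0" using sq tr by simp
  hence "\<forall>i<n. \<forall>k<n. (P i k - E i k)\<^sup>2 = 0"
    by (simp add: sum_nonneg_eq_0_iff sum_nonneg)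
  hence "P i k = E i k" using assms by simp
  thus ?thesis unfolding P_def E_def .
qed

lemma tilde_vec_parseval:
  "(\<Sum>i<n. tilde_vec n z i * tilde_vec n y i) = (\<Sum>t=1..n. z t * y t :: real)"
proof -
  have "(\<Sum>i<n. tilde_vec n z i * tilde_vec n y i)
      = (\<Sum>i<n. \<Sum>t=1..n. \<Sum>s=1..n. (fourier_matrix n i t * z t) * (fourier_matrix n i s * y s))"
    unfolding tilde_vec_def by (simp add: sum_product)
  also have "\<dots> = (\<Sum>t=1..n. \<Sum>i<n. \<Sum>s=1..n. (fourier_matrix n i t * z t) * (fourier_matrix n i s * y s))"
    by (rule sum.swap)
  also have "\<dots> = (\<Sum>t=1..n. \<Sum>s=1..n. \<Sum>i<n. (fourier_matrix n i t * z t) * (fourier_matrix n i s * y s))"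
    by (intro sum.cong refl sum.swap)
  also have "\<dots> = (\<Sum>t=1..n. \<Sum>s=1..n. z t * y s * (\<Sum>i<n. fourier_matrix n i t * fourier_matrix n i s))"
    by (simp add: sum_distrib_left mult_ac)
  also have "\<dots> = (\<Sum>t=1..n. \<Sum>s=1..n. z t * y s * (if t = s then 1 else 0))"
    by (intro sum.cong refl, subst fourier_matrix_columns) auto
  finally show ?thesis by (simp add: if_distrib cong: if_cong)
qed

lemma tilde_vec_inner: "tilde_vec n X i \<bullet> v = tilde_vec n (\<lambda>t. X t \<bullet> v) i"
  by (simp add: tilde_vec_def inner_sum_left)

section \<open>Linear changes of variables in finite products of Lebesgue measures\<close>

lemma distr_PiM_componentwise:
  assumes I: "finite I" and sf: "\<And>i. sigma_finite_measure (M i)" "\<And>i. sigma_finite_measure (N i)"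
    and [measurable]: "\<And>i. i \<in> I \<Longrightarrow> \<phi> i \<in> measurable (M i) (N i)"
    and distr: "\<And>i. i \<in> I \<Longrightarrow> distr (M i) (N i) (\<phi> i) = N i"
  shows "distr (Pi\<^sub>M I M) (Pi\<^sub>M I N) (\<lambda>x. \<lambda>i\<in>I. \<phi> i (x i)) = Pi\<^sub>M I N"
proof -
  interpret M: product_sigma_finite M by (simp add: product_sigma_finite_def sf)
  interpret N: product_sigma_finite N by (simp add: product_sigma_finite_def sf)
  show ?thesis
  proof (rule N.PiM_eqI[OF I])
    fix A assume A: "\<And>i. i \<in> I \<Longrightarrow> A i \<in> sets (N i)"
    have "(\<lambda>x. \<lambda>i\<in>I. \<phi> i (x i)) -` Pi\<^sub>E I A \<inter> space (Pi\<^sub>M I M)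
        = Pi\<^sub>E I (\<lambda>i. \<phi> i -` A i \<inter> space (M i))"
      by (auto simp: space_PiM PiE_iff Pi_iff)
    moreover have "Pi\<^sub>E I A \<in> sets (Pi\<^sub>M I N)" using A I by (intro sets_PiM_I_finite) auto
    moreover have "\<phi> i -` A i \<inter> space (M i) \<in> sets (M i)" if "i \<in> I" for i
      using A that by measurable
    ultimately have "emeasure (distr (Pi\<^sub>M I M) (Pi\<^sub>M I N) (\<lambda>x. \<lambda>i\<in>I. \<phi> i (x i))) (Pi\<^sub>E I A)
        = (\<Prod>i\<in>I. emeasure (M i) (\<phi> i -` A i \<inter> space (M i)))"
      using I by (subst emeasure_distr) (auto simp: M.emeasure_PiM)
    also have "\<dots> = (\<Prod>i\<in>I. emeasure (N i) (A i))"
      using A distr by (intro prod.cong refl) (metis (no_types, lifting) emeasure_distr assms(4))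
    finally show "emeasure (distr (Pi\<^sub>M I M) (Pi\<^sub>M I N) (\<lambda>x. \<lambda>i\<in>I. \<phi> i (x i))) (Pi\<^sub>E I A)
        = (\<Prod>i\<in>I. emeasure (N i) (A i))" .
  qed simp
qed

lemma nn_integral_PiM_lborel_translate:
  fixes a :: "'i \<Rightarrow> real"
  assumes "finite I" and [measurable]: "f \<in> borel_measurable (Pi\<^sub>M I (\<lambda>_. lborel))"
  shows "(\<integral>\<^sup>+x. f (\<lambda>i\<in>I. a i + x i) \<partial>Pi\<^sub>M I (\<lambda>_. lborel)) = (\<integral>\<^sup>+x. f x \<partial>Pi\<^sub>M I (\<lambda>_. lborel))"
proof -
  have "distr lborel lborel ((+) (a i)) = lborel" for i
    using lborel_distr_plus[of "a i"] by (simp cong: distr_cong)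
  hence "distr (Pi\<^sub>M I (\<lambda>_. lborel)) (Pi\<^sub>M I (\<lambda>_. lborel)) (\<lambda>x. \<lambda>i\<in>I. a i + x i) = Pi\<^sub>M I (\<lambda>_. lborel)"
    using assms(1) by (intro distr_PiM_componentwise) (auto simp: lborel.sigma_finite_measure_axioms)
  hence "(\<integral>\<^sup>+x. f x \<partial>Pi\<^sub>M I (\<lambda>_. lborel))
      = (\<integral>\<^sup>+x. f x \<partial>distr (Pi\<^sub>M I (\<lambda>_. lborel)) (Pi\<^sub>M I (\<lambda>_. lborel)) (\<lambda>x. \<lambda>i\<in>I. a i + x i))"
    by simp
  also have "\<dots> = (\<integral>\<^sup>+x. f (\<lambda>i\<in>I. a i + x i) \<partial>Pi\<^sub>M I (\<lambda>_. lborel))"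
    by (rule nn_integral_distr) measurable
  finally show ?thesis ..
qed

text \<open>The uniqueness argument for Haar measure: integrating against an auxiliary probability density
  \<open>g\<close> and applying Fubini twice shows that the two sides differ by the factor
  \<open>\<integral> g (- F y) dy\<close>, which is 1 for the standard normal density.\<close>

lemma nn_integral_PiM_lborel_orthogonal:
  fixes F :: "'i \<Rightarrow> 'j \<Rightarrow> real"
  assumes fin: "finite I" "finite J" and card: "card I = card J"
    and col: "\<And>t s. t \<in> J \<Longrightarrow> s \<in> J \<Longrightarrow> (\<Sum>i\<in>I. F i t * F i s) = (if t = s then 1 else 0)"
    and row: "\<And>i k. i \<in> I \<Longrightarrow> k \<in> I \<Longrightarrow> (\<Sum>t\<in>J. F i t * F k t) = (if i = k then 1 else 0)"
    and h[measurable]: "h \<in> borel_measurable (Pi\<^sub>M J (\<lambda>_. lborel))"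
  shows "(\<integral>\<^sup>+y. h (\<lambda>t\<in>J. \<Sum>i\<in>I. F i t * y i) \<partial>Pi\<^sub>M I (\<lambda>_. lborel)) = (\<integral>\<^sup>+x. h x \<partial>Pi\<^sub>M J (\<lambda>_. lborel))"
proof -
  let ?I = "Pi\<^sub>M I (\<lambda>_. lborel :: real measure)" and ?J = "Pi\<^sub>M J (\<lambda>_. lborel :: real measure)"
  interpret product_sigma_finite "\<lambda>_ :: 'i. lborel :: real measure" by standard
  interpret J: product_sigma_finite "\<lambda>_ :: 'j. lborel :: real measure" by standard
  interpret MI: sigma_finite_measure ?I by (rule sigma_finite) fact
  interpret MJ: sigma_finite_measure ?J by (rule J.sigma_finite) fact
  interpret P: pair_sigma_finite ?I ?J by standard
  define T where "T y = (\<lambda>t\<in>J. \<Sum>i\<in>I. F i t * y i)" for y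
  define S where "S x = (\<lambda>i\<in>I. \<Sum>t\<in>J. F i t * x t)" for x
  define g where "g x = (\<Prod>t\<in>J. ennreal (std_normal_density (x t)))" for x
  have T[measurable]: "T \<in> measurable ?I ?J" unfolding T_def by measurable
  have Tt[measurable]: "(\<lambda>y. T y t) \<in> borel_measurable ?I" if "t \<in> J" for t
    using that unfolding T_def by simp
  have S[measurable]: "S \<in> measurable ?J ?I" unfolding S_def by measurable
  have g[measurable]: "g \<in> borel_measurable ?J" unfolding g_def by measurable
  have std: "(\<integral>\<^sup>+x. ennreal (std_normal_density x) \<partial>lborel) = 1"
    using prob_space.emeasure_space_1[OF prob_space_normal_density[of 1 0]]
    by (simp add: emeasure_density)
  have g1: "(\<integral>\<^sup>+x. g x \<partial>?J) = 1"
    unfolding g_def using fin std by (subst J.product_nn_integral_prod) auto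
  \<comment> \<open>\<open>T (S x) = x\<close> because the columns of \<open>F\<close> are
    orthonormal. A shift of the values of \<open>T\<close> by \<open>x\<close> is therefore a shift
    of its argument by \<open>S x\<close>, which Lebesgue measure does not see.\<close>
  have TS: "T (\<lambda>i\<in>I. S x i + y i) = (\<lambda>t\<in>J. x t + T y t)" for x y
  proof -
    have "(\<Sum>i\<in>I. F i t * ((\<Sum>s\<in>J. F i s * x s) + y i)) = x t + (\<Sum>i\<in>I. F i t * y i)" if t: "t \<in> J" for t
    proof -
      have "(\<Sum>i\<in>I. F i t * (\<Sum>s\<in>J. F i s * x s)) = (\<Sum>s\<in>J. \<Sum>i\<in>I. F i t * F i s * x s)"
        by (simp add: sum_distrib_left mult.assoc) (rule sum.swap)
      also have "\<dots> = (\<Sum>s\<in>J. (if t = s then 1 else 0) * x s)"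
        using t by (intro sum.cong refl) (simp flip: sum_distrib_right add: col)
      also have "\<dots> = x t" using t fin by (simp add: if_distrib[of "\<lambda>c. c * _"] cong: if_cong)
      finally show ?thesis by (simp add: distrib_left sum.distrib)
    qed
    thus ?thesis unfolding T_def S_def by (auto simp: fun_eq_iff)
  qed
  \<comment> \<open>\<open>T\<close> preserves the Euclidean norm, and both index sets have the same
    size, so the auxiliary density turns into the standard normal density over
    \<open>I\<close>.\<close>
  have gT: "g (\<lambda>t\<in>J. - T y t) = (\<Prod>i\<in>I. ennreal (std_normal_density (y i)))" for y
  proof -
    have "(\<Sum>t\<in>J. (T y t)\<^sup>2) = (\<Sum>t\<in>J. \<Sum>i\<in>I. \<Sum>k\<in>I. (F i t * y i) * (F k t * y k))"
      unfolding T_def by (simp add: power2_eq_square sum_product)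
    also have "\<dots> = (\<Sum>i\<in>I. \<Sum>t\<in>J. \<Sum>k\<in>I. (F i t * y i) * (F k t * y k))" by (rule sum.swap)
    also have "\<dots> = (\<Sum>i\<in>I. \<Sum>k\<in>I. \<Sum>t\<in>J. (F i t * y i) * (F k t * y k))"
      by (intro sum.cong refl sum.swap)
    also have "\<dots> = (\<Sum>i\<in>I. \<Sum>k\<in>I. y i * y k * (\<Sum>t\<in>J. F i t * F k t))"
      by (simp add: sum_distrib_left mult_ac)
    also have "\<dots> = (\<Sum>i\<in>I. \<Sum>k\<in>I. y i * y k * (if i = k then 1 else 0))"
      by (intro sum.cong refl) (simp add: row)
    also have "\<dots> = (\<Sum>i\<in>I. (y i)\<^sup>2)"
      using fin by (simp add: if_distrib power2_eq_square cong: if_cong)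
    finally have sq: "(\<Sum>t\<in>J. (T y t)\<^sup>2) = (\<Sum>i\<in>I. (y i)\<^sup>2)" .
    have std_prod: "(\<Prod>i\<in>K. std_normal_density (z i))
        = (1 / sqrt (2 * pi)) ^ card K * exp (- (\<Sum>i\<in>K. (z i)\<^sup>2) / 2)" if "finite K" for K and z :: "'k \<Rightarrow> real"
    proof -
      have "(\<Prod>i\<in>K. std_normal_density (z i)) = (\<Prod>i\<in>K. 1 / sqrt (2 * pi) * exp (- (z i)\<^sup>2 / 2))"
        by (simp add: std_normal_density_def)
      also have "\<dots> = (1 / sqrt (2 * pi)) ^ card K * exp (\<Sum>i\<in>K. - (z i)\<^sup>2 / 2)"
        using that by (simp only: prod.distrib prod_constant exp_sum)
      finally show ?thesis by (simp add: sum_negf sum_divide_distrib)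
    qed
    have "(\<Prod>t\<in>J. std_normal_density (- T y t)) = (\<Prod>i\<in>I. std_normal_density (y i))"
      using fin card by (simp add: std_prod sq)
    thus ?thesis unfolding g_def by (simp add: prod_ennreal)
  qed
  have trJ: "(\<integral>\<^sup>+x. f (\<lambda>i\<in>J. a i + x i) \<partial>?J) = (\<integral>\<^sup>+x. f x \<partial>?J)"
    if "f \<in> borel_measurable ?J" for f and a :: "'j \<Rightarrow> real"
    using nn_integral_PiM_lborel_translate[OF fin(2) that] .
  have trI: "(\<integral>\<^sup>+x. f (\<lambda>i\<in>I. a i + x i) \<partial>?I) = (\<integral>\<^sup>+x. f x \<partial>?I)"
    if "f \<in> borel_measurable ?I" for f and a :: "'i \<Rightarrow> real"
    using nn_integral_PiM_lborel_translate[OF fin(1) that] .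
  have "(\<integral>\<^sup>+y. h (T y) \<partial>?I) = (\<integral>\<^sup>+x. g x * (\<integral>\<^sup>+y. h (T y) \<partial>?I) \<partial>?J)"
    by (simp add: nn_integral_multc g1)
  also have "\<dots> = (\<integral>\<^sup>+x. \<integral>\<^sup>+y. g x * h (\<lambda>t\<in>J. x t + T y t) \<partial>?I \<partial>?J)"
  proof (rule nn_integral_cong)
    fix x
    have "(\<integral>\<^sup>+y. h (T y) \<partial>?I) = (\<integral>\<^sup>+y. h (T (\<lambda>i\<in>I. S x i + y i)) \<partial>?I)"
      by (rule trI[symmetric]) measurable
    thus "g x * (\<integral>\<^sup>+y. h (T y) \<partial>?I) = (\<integral>\<^sup>+y. g x * h (\<lambda>t\<in>J. x t + T y t) \<partial>?I)"
      unfolding TS by (simp only:, intro nn_integral_cmult[symmetric]) measurable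
  qed
  also have "\<dots> = (\<integral>\<^sup>+y. \<integral>\<^sup>+x. g x * h (\<lambda>t\<in>J. x t + T y t) \<partial>?J \<partial>?I)"
    by (rule P.Fubini') measurable
  also have "\<dots> = (\<integral>\<^sup>+y. \<integral>\<^sup>+x. g (\<lambda>t\<in>J. - T y t + x t) * h x \<partial>?J \<partial>?I)"
  proof (rule nn_integral_cong)
    fix y assume y: "y \<in> space ?I"
    have *: "(\<lambda>t\<in>J. (\<lambda>t\<in>J. - T y t + x t) t + T y t) = x" if "x \<in> space ?J" for x
      using that by (auto simp: space_PiM PiE_iff extensional_def fun_eq_iff)
    have "(\<integral>\<^sup>+x. g x * h (\<lambda>t\<in>J. x t + T y t) \<partial>?J)
        = (\<integral>\<^sup>+x. g (\<lambda>t\<in>J. - T y t + x t) * h (\<lambda>t\<in>J. (\<lambda>t\<in>J. - T y t + x t) t + T y t) \<partial>?J)"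
      by (rule trJ[symmetric]) measurable
    also have "\<dots> = (\<integral>\<^sup>+x. g (\<lambda>t\<in>J. - T y t + x t) * h x \<partial>?J)"
      by (intro nn_integral_cong) (simp only: *)
    finally show "(\<integral>\<^sup>+x. g x * h (\<lambda>t\<in>J. x t + T y t) \<partial>?J) = \<dots>" .
  qed
  also have "\<dots> = (\<integral>\<^sup>+x. \<integral>\<^sup>+y. g (\<lambda>t\<in>J. - T y t + x t) * h x \<partial>?I \<partial>?J)"
    by (rule P.Fubini'[symmetric]) measurable
  also have "\<dots> = (\<integral>\<^sup>+x. \<integral>\<^sup>+y. g (\<lambda>t\<in>J. - T y t) * h x \<partial>?I \<partial>?J)"
  proof (rule nn_integral_cong)
    fix x assume x: "x \<in> space ?J"
    have "(\<integral>\<^sup>+y. g (\<lambda>t\<in>J. - T y t + x t) * h x \<partial>?I)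
        = (\<integral>\<^sup>+y. g (\<lambda>t\<in>J. - T (\<lambda>i\<in>I. S x i + y i) t + x t) * h x \<partial>?I)"
      using x by (intro trI[symmetric]) measurable
    also have "\<dots> = (\<integral>\<^sup>+y. g (\<lambda>t\<in>J. - T y t) * h x \<partial>?I)"
      unfolding TS by (intro nn_integral_cong arg_cong2[of _ _ _ _ "(*)"] arg_cong[of _ _ g]) auto
    finally show "(\<integral>\<^sup>+y. g (\<lambda>t\<in>J. - T y t + x t) * h x \<partial>?I) = \<dots>" .
  qed
  also have "\<dots> = (\<integral>\<^sup>+x. h x \<partial>?J)"
  proof -
    have "(\<integral>\<^sup>+y. g (\<lambda>t\<in>J. - T y t) \<partial>?I) = 1"
      unfolding gT using fin std by (subst product_nn_integral_prod) auto
    thus ?thesis by (simp add: nn_integral_multc)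
  qed
  finally show ?thesis unfolding T_def .
qed

lemma PiM_density:
  fixes f :: "'i \<Rightarrow> 'a \<Rightarrow> ennreal"
  assumes I: "finite I" and sf: "\<And>i. sigma_finite_measure (M i)" "\<And>i. sigma_finite_measure (density (M i) (f i))"
    and [measurable]: "\<And>i. f i \<in> borel_measurable (M i)"
  shows "density (Pi\<^sub>M I M) (\<lambda>x. \<Prod>i\<in>I. f i (x i)) = Pi\<^sub>M I (\<lambda>i. density (M i) (f i))"
proof -
  interpret M: product_sigma_finite M by (simp add: product_sigma_finite_def sf)
  interpret N: product_sigma_finite "\<lambda>i. density (M i) (f i)" by (simp add: product_sigma_finite_def sf)
  show ?thesis
  proof (rule N.PiM_eqI[OF I])
    show "sets (density (Pi\<^sub>M I M) (\<lambda>x. \<Prod>i\<in>I. f i (x i))) = sets (Pi\<^sub>M I (\<lambda>i. density (M i) (f i)))"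
      by (simp cong: sets_PiM_cong)
    fix A assume A: "\<And>i. i \<in> I \<Longrightarrow> A i \<in> sets (density (M i) (f i))"
    hence [measurable]: "Pi\<^sub>E I A \<in> sets (Pi\<^sub>M I M)" using I by (intro sets_PiM_I_finite) auto
    have "emeasure (density (Pi\<^sub>M I M) (\<lambda>x. \<Prod>i\<in>I. f i (x i))) (Pi\<^sub>E I A)
        = (\<integral>\<^sup>+x. (\<Prod>i\<in>I. f i (x i)) * indicator (Pi\<^sub>E I A) x \<partial>Pi\<^sub>M I M)"
      by (intro emeasure_density) measurable
    also have "\<dots> = (\<integral>\<^sup>+x. (\<Prod>i\<in>I. f i (x i) * indicator (A i) (x i)) \<partial>Pi\<^sub>M I M)"
    proof (rule nn_integral_cong)
      fix x assume "x \<in> space (Pi\<^sub>M I M)"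
      hence "x \<in> extensional I" by (auto simp: space_PiM PiE_def)
      hence "indicator (Pi\<^sub>E I A) x = (\<Prod>i\<in>I. indicator (A i) (x i) :: ennreal)"
        using I by (auto simp: indicator_def PiE_def Pi_iff prod_zero_iff)
      thus "(\<Prod>i\<in>I. f i (x i)) * indicator (Pi\<^sub>E I A) x = (\<Prod>i\<in>I. f i (x i) * indicator (A i) (x i))"
        by (simp add: prod.distrib)
    qed
    also have "\<dots> = (\<Prod>i\<in>I. \<integral>\<^sup>+x. f i x * indicator (A i) x \<partial>M i)"
      using A I by (intro M.product_nn_integral_prod) auto
    also have "\<dots> = (\<Prod>i\<in>I. emeasure (density (M i) (f i)) (A i))"
      using A by (intro prod.cong refl emeasure_density[symmetric]) auto
    finally show "emeasure (density (Pi\<^sub>M I M) (\<lambda>x. \<Prod>i\<in>I. f i (x i))) (Pi\<^sub>E I A)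
        = (\<Prod>i\<in>I. emeasure (density (M i) (f i)) (A i))" .
  qed
qed

section \<open>Whittle's measure as the law of a linear image of white noise\<close>

definition white_noise :: "nat \<Rightarrow> (nat \<Rightarrow> real) measure" where
  "white_noise n = Pi\<^sub>M {..<n} (\<lambda>_. density lborel std_normal_density)"

lemma prob_space_white_noise: "prob_space (white_noise n)"
  unfolding white_noise_def using prob_space_normal_density[of 1 0] by (intro prob_space_PiM) simp

lemma sets_white_noise [measurable_cong]: "sets (white_noise n) = sets (Pi\<^sub>M {..<n} (\<lambda>_. borel))"
  unfolding white_noise_def by (intro sets_PiM_cong) auto

text \<open>In matrix notation \<open>X \<theta> + F^T D^(1/2) \<epsilon>\<close>: the regression
  function plus the inverse Fourier transform of a vector whose independent coordinates have the
  variances on the diagonal of \<open>D\<close>.\<close>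

definition synthesis :: "('r::finite) design \<Rightarrow> nat \<Rightarrow> real^'r \<Rightarrow> (real \<Rightarrow> real) \<Rightarrow> (nat \<Rightarrow> real) \<Rightarrow> nat \<Rightarrow> real" where
  "synthesis X n \<theta> f \<epsilon> = (\<lambda>t\<in>{1..n}. X n t \<bullet> \<theta> + (\<Sum>i<n. fourier_matrix n i t * (sqrt (D_diag n f i) * \<epsilon> i)))"

lemma tilde_vec_synthesis:
  assumes "i < n"
  shows "tilde_vec n (synthesis X n \<theta> f \<epsilon>) i - tilde_vec n (X n) i \<bullet> \<theta> = sqrt (D_diag n f i) * \<epsilon> i"
proof -
  have "tilde_vec n (synthesis X n \<theta> f \<epsilon>) i - tilde_vec n (X n) i \<bullet> \<theta>
      = (\<Sum>t=1..n. \<Sum>k<n. fourier_matrix n i t * (fourier_matrix n k t * (sqrt (D_diag n f k) * \<epsilon> k)))"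
    unfolding tilde_vec_inner by (simp add: tilde_vec_def synthesis_def distrib_left sum.distrib sum_distrib_left)
  also have "\<dots> = (\<Sum>k<n. \<Sum>t=1..n. fourier_matrix n i t * (fourier_matrix n k t * (sqrt (D_diag n f k) * \<epsilon> k)))"
    by (rule sum.swap)
  also have "\<dots> = (\<Sum>k<n. (\<Sum>t=1..n. fourier_matrix n i t * fourier_matrix n k t) * (sqrt (D_diag n f k) * \<epsilon> k))"
    by (simp add: sum_distrib_right mult.assoc)
  also have "\<dots> = (\<Sum>k<n. (if i = k then 1 else 0) * (sqrt (D_diag n f k) * \<epsilon> k))"
    by (intro sum.cong refl, subst fourier_matrix_rows[OF assms]) auto
  finally show ?thesis using assms by (simp add: if_distrib[of "\<lambda>c. c * _"] cong: if_cong)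
qed

lemma borel_measurable_tilde_vec [measurable]:
  "i < n \<Longrightarrow> (\<lambda>z. tilde_vec n z i :: real) \<in> borel_measurable (Pi\<^sub>M {1..n} (\<lambda>_. lborel))"
  unfolding tilde_vec_def by measurable

lemma borel_measurable_whittle_density [measurable]:
  "whittle_density X n \<theta> f \<in> borel_measurable (Pi\<^sub>M {1..n} (\<lambda>_. lborel))"
  unfolding whittle_density_def by measurable

lemma measurable_synthesis [measurable]:
  "synthesis X n \<theta> f \<in> measurable (white_noise n) (Pi\<^sub>M {1..n} (\<lambda>_. lborel))"
  unfolding synthesis_def by measurable

text \<open>The product form in the Fourier residuals serves twice: it identifies the law of the
  data, and it allows likelihoods at different \<open>f\<close> to be compared coordinate by
  coordinate.\<close>

lemma whittle_density_shifted:
  assumes pos: "\<And>i. i < n \<Longrightarrow> 0 < D_diag n f i"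
    and z: "\<And>i. i < n \<Longrightarrow> tilde_vec n z i - tilde_vec n (X n) i \<bullet> \<theta> = y i"
  shows "whittle_density X n \<theta> f z = (\<Prod>i<n. normal_density 0 (sqrt (D_diag n f i)) (y i))"
proof -
  have sqrt_prod: "(\<Prod>i<m. sqrt (h i)) = sqrt (\<Prod>i<m. h i)" for m :: nat and h :: "nat \<Rightarrow> real"
    by (induction m) (auto simp: real_sqrt_mult)
  have "(\<Prod>i<n. normal_density 0 (sqrt (D_diag n f i)) (y i))
      = (\<Prod>i<n. 1 / sqrt (2 * pi * D_diag n f i) * exp (- (1/2) * ((y i)\<^sup>2 / D_diag n f i)))"
    using pos by (intro prod.cong refl) (simp add: normal_density_def less_imp_le)
  also have "\<dots> = 1 / (\<Prod>i<n. sqrt (2 * pi * D_diag n f i)) * exp (\<Sum>i<n. - (1/2) * ((y i)\<^sup>2 / D_diag n f i))"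
    by (simp add: prod.distrib exp_sum prod_dividef)
  also have "(\<Prod>i<n. sqrt (2 * pi * D_diag n f i)) = sqrt (\<Prod>i<n. 2 * pi * D_diag n f i)"
    by (rule sqrt_prod)
  also have "(\<Prod>i<n. 2 * pi * D_diag n f i) = (2 * pi) ^ n * (\<Prod>i<n. D_diag n f i)"
    by (simp add: prod.distrib)
  finally show ?thesis
    unfolding whittle_density_def by (simp add: sum_distrib_left z)
qed

text \<open>Three changes of variables do it: a translation by the regression function, the
  orthogonal map given by the transposed Fourier matrix, and a rescaling of each coordinate.\<close>

theorem whittle_measure_eq_distr:
  assumes pos: "\<And>i. i < n \<Longrightarrow> 0 < D_diag n f i"
  shows "whittle_measure X n \<theta> f = distr (white_noise n) (Pi\<^sub>M {1..n} (\<lambda>_. lborel)) (synthesis X n \<theta> f)"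
proof -
  let ?I = "Pi\<^sub>M {..<n} (\<lambda>_. lborel :: real measure)" and ?J = "Pi\<^sub>M {1..n} (\<lambda>_. lborel :: real measure)"
  \<comment> \<open>The value 1 from \<open>n\<close> on is a default: the theory of finite product
    measures asks for a sigma-finite factor at every index, also outside the index set.\<close>
  define \<sigma> where "\<sigma> i = (if i < n then sqrt (D_diag n f i) else 1)" for i
  have \<sigma>: "\<sigma> i > 0" for i using pos by (simp add: \<sigma>_def)
  define L where "L y = (\<lambda>t\<in>{1..n}. \<Sum>i\<in>{..<n}. fourier_matrix n i t * y i)" for y
  define m where "m = (\<lambda>t. X n t \<bullet> \<theta>)"
  have L[measurable]: "L \<in> measurable ?I ?J" unfolding L_def by measurable
  have Lt[measurable]: "(\<lambda>y. L y t) \<in> borel_measurable ?I" if "t \<in> {1..n}" for t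
    using that unfolding L_def by simp
  define NP where "NP = Pi\<^sub>M {..<n} (\<lambda>i. density lborel (normal_density 0 (\<sigma> i)))"
  have sfn: "sigma_finite_measure (density lborel (\<lambda>x. ennreal (normal_density 0 s x)))" if "s > 0" for s
    using prob_space_normal_density[OF that, of 0] by (intro prob_space_imp_sigma_finite)
  have NP: "NP = density ?I (\<lambda>y. \<Prod>i<n. ennreal (normal_density 0 (\<sigma> i) (y i)))"
    unfolding NP_def using \<sigma>
    by (intro PiM_density[symmetric] sfn) (auto simp: lborel.sigma_finite_measure_axioms)
  have NP2: "NP = distr (white_noise n) NP (\<lambda>\<epsilon>. \<lambda>i\<in>{..<n}. \<sigma> i * \<epsilon> i)"
    unfolding NP_def white_noise_def
  proof (rule distr_PiM_componentwise[symmetric])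
    fix i
    interpret P: prob_space "density lborel std_normal_density" using prob_space_normal_density[of 1 0] by simp
    have "distributed (density lborel std_normal_density) lborel (\<lambda>x. x) std_normal_density"
      unfolding distributed_def by (auto intro!: distr_id2)
    from P.normal_density_affine[OF this, of "\<sigma> i" 0] \<sigma>[of i]
    have "distributed (density lborel std_normal_density) lborel (\<lambda>x. \<sigma> i * x) (normal_density 0 (\<sigma> i))"
      by simp
    hence "distr (density lborel std_normal_density) lborel ((*) (\<sigma> i)) = density lborel (normal_density 0 (\<sigma> i))"
      by (simp add: distributed_def)
    thus "distr (density lborel std_normal_density) (density lborel (normal_density 0 (\<sigma> i))) ((*) (\<sigma> i))
        = density lborel (normal_density 0 (\<sigma> i))" by (simp cong: distr_cong)
  qed (use \<sigma> sfn[of 1] in \<open>auto intro!: sfn\<close>)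
  have [measurable_cong]: "sets NP = sets ?I" unfolding NP by simp
  have synth: "(\<lambda>t\<in>{1..n}. m t + L (\<lambda>i\<in>{..<n}. \<sigma> i * \<epsilon> i) t) = synthesis X n \<theta> f \<epsilon>" for \<epsilon>
    unfolding synthesis_def L_def m_def by (auto simp: fun_eq_iff \<sigma>_def intro!: sum.cong)
  have dens: "ennreal (whittle_density X n \<theta> f (\<lambda>t\<in>{1..n}. m t + L y t))
      = (\<Prod>i<n. ennreal (normal_density 0 (\<sigma> i) (y i)))" for y
  proof -
    have "(\<lambda>t\<in>{1..n}. m t + L y t) = synthesis X n \<theta> f (\<lambda>i. y i / \<sigma> i)"
      unfolding synth[symmetric] L_def using \<sigma> by (auto simp: fun_eq_iff less_le)
    hence "tilde_vec n (\<lambda>t\<in>{1..n}. m t + L y t) i - tilde_vec n (X n) i \<bullet> \<theta> = y i" if "i < n" for i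
      using that \<sigma>[of i] by (simp add: tilde_vec_synthesis) (simp add: \<sigma>_def)
    from whittle_density_shifted[where n = n and X = X and \<theta> = \<theta> and f = f, OF pos this] show ?thesis by (simp add: prod_ennreal \<sigma>_def)
  qed
  show ?thesis
  proof (rule measure_eqI)
    fix A assume "A \<in> sets (whittle_measure X n \<theta> f)"
    hence A[measurable]: "A \<in> sets ?J" by (simp add: whittle_measure_def)
    have "emeasure (whittle_measure X n \<theta> f) A
        = (\<integral>\<^sup>+z. ennreal (whittle_density X n \<theta> f z) * indicator A z \<partial>?J)"
      unfolding whittle_measure_def by (intro emeasure_density) measurable
    also have "\<dots> = (\<integral>\<^sup>+z. ennreal (whittle_density X n \<theta> f (\<lambda>t\<in>{1..n}. m t + z t)) * indicator A (\<lambda>t\<in>{1..n}. m t + z t) \<partial>?J)"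
      by (rule nn_integral_PiM_lborel_translate[symmetric]) measurable
    also have "\<dots> = (\<integral>\<^sup>+y. ennreal (whittle_density X n \<theta> f (\<lambda>t\<in>{1..n}. m t + L y t)) * indicator A (\<lambda>t\<in>{1..n}. m t + L y t) \<partial>?I)"
      unfolding L_def
      by (rule nn_integral_PiM_lborel_orthogonal[symmetric],
          simp_all only: finite_lessThan finite_atLeastAtMost card_lessThan card_atLeastAtMost
            diff_Suc_1 lessThan_iff fourier_matrix_columns fourier_matrix_rows) measurable
    also have "\<dots> = (\<integral>\<^sup>+y. indicator A (\<lambda>t\<in>{1..n}. m t + L y t) \<partial>NP)"
      unfolding NP dens by (rule nn_integral_density[symmetric]) measurable
    also have "\<dots> = (\<integral>\<^sup>+y. indicator A (\<lambda>t\<in>{1..n}. m t + L y t)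
        \<partial>distr (white_noise n) NP (\<lambda>\<epsilon>. \<lambda>i\<in>{..<n}. \<sigma> i * \<epsilon> i))"
      by (rule arg_cong[OF NP2])
    also have "\<dots> = (\<integral>\<^sup>+\<epsilon>. indicator A (synthesis X n \<theta> f \<epsilon>) \<partial>white_noise n)"
      unfolding synth[symmetric] by (rule nn_integral_distr) measurable
    also have "\<dots> = (\<integral>\<^sup>+z. indicator A z \<partial>distr (white_noise n) ?J (synthesis X n \<theta> f))"
      by (rule nn_integral_distr[symmetric]) measurable
    also have "\<dots> = emeasure (distr (white_noise n) ?J (synthesis X n \<theta> f)) A"
      by (rule nn_integral_indicator) (use A in simp)
    finally show "emeasure (whittle_measure X n \<theta> f) A
        = emeasure (distr (white_noise n) ?J (synthesis X n \<theta> f)) A" .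
  qed (simp add: whittle_measure_def)
qed

section \<open>Maximal partial sums and summation by parts\<close>

text \<open>The last partial sum plus the average absolute partial sum. The average takes the place
  of a maximum, so that second moments and Markov's inequality suffice and no maximal inequality
  enters. For \<open>n = 0\<close> both parts vanish.\<close>

definition partial_sum_size :: "nat \<Rightarrow> (nat \<Rightarrow> real) \<Rightarrow> real" where
  "partial_sum_size n y = \<bar>\<Sum>i<n. y i\<bar> + (\<Sum>j<n. \<bar>\<Sum>i<j. y i\<bar>) / real n"

lemma summation_by_parts:
  fixes h y :: "nat \<Rightarrow> real"
  shows "(\<Sum>i<Suc m. h i * y i) = h m * (\<Sum>i<Suc m. y i) - (\<Sum>j<m. (h (Suc j) - h j) * (\<Sum>i<Suc j. y i))"
  by (induction m) (auto simp: algebra_simps)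

text \<open>In the summation by parts the end value of \<open>h\<close> multiplies the full sum, and
  the increments of \<open>h\<close>, of order \<open>1 / n\<close>, turn the other partial sums
  into their average. Only \<open>B\<close> and \<Lambda> are kept of \<open>h\<close>, so one bound
  on \<open>y\<close> serves a whole family of weights.\<close>

lemma abs_sum_le_partial_sum_size:
  fixes h y :: "nat \<Rightarrow> real"
  assumes B: "\<And>i. i < n \<Longrightarrow> \<bar>h i\<bar> \<le> B" and \<Lambda>: "\<And>i. Suc i < n \<Longrightarrow> \<bar>h (Suc i) - h i\<bar> \<le> \<Lambda> / real n"
    and "0 \<le> B" "0 \<le> \<Lambda>"
  shows "\<bar>\<Sum>i<n. h i * y i\<bar> \<le> (B + \<Lambda>) * partial_sum_size n y"
proof (cases n)
  case (Suc m)
  define S where "S j = (\<Sum>i<j. y i)" for j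
  have "\<bar>\<Sum>i<n. h i * y i\<bar> \<le> \<bar>h m * S n\<bar> + \<bar>\<Sum>j<m. (h (Suc j) - h j) * S (Suc j)\<bar>"
    unfolding Suc summation_by_parts S_def by (rule abs_triangle_ineq4)
  also have "\<bar>h m * S n\<bar> \<le> B * \<bar>S n\<bar>"
    unfolding abs_mult using B[of m] Suc by (intro mult_right_mono) auto
  also have "\<bar>\<Sum>j<m. (h (Suc j) - h j) * S (Suc j)\<bar> \<le> (\<Sum>j<m. \<Lambda> / real n * \<bar>S (Suc j)\<bar>)"
    unfolding abs_mult
    by (rule order_trans[OF sum_abs], unfold abs_mult, intro sum_mono mult_right_mono \<Lambda>) (auto simp: Suc)
  also have "\<dots> = \<Lambda> / real n * (\<Sum>j<m. \<bar>S (Suc j)\<bar>)" by (simp add: sum_distrib_left)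
  also have "(\<Sum>j<m. \<bar>S (Suc j)\<bar>) = (\<Sum>j<n. \<bar>S j\<bar>)"
    unfolding Suc sum.lessThan_Suc_shift by (simp add: S_def)
  finally have "\<bar>\<Sum>i<n. h i * y i\<bar> \<le> B * \<bar>S n\<bar> + \<Lambda> * ((\<Sum>j<n. \<bar>S j\<bar>) / real n)" by simp
  also have "\<dots> \<le> (B + \<Lambda>) * \<bar>S n\<bar> + (B + \<Lambda>) * ((\<Sum>j<n. \<bar>S j\<bar>) / real n)"
    using assms(3,4) by (intro add_mono mult_right_mono divide_nonneg_nonneg sum_nonneg) auto
  finally show ?thesis unfolding partial_sum_size_def S_def distrib_left .
qed (simp add: partial_sum_size_def)

text \<open>Independence and mean zero kill the cross terms. The function may depend on the
  coordinate, which leaves room for weights.\<close>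

lemma white_noise_sum_square:
  fixes \<phi> :: "nat \<Rightarrow> real \<Rightarrow> real"
  assumes K: "K \<subseteq> {..<n}"
    and [measurable]: "\<And>i. \<phi> i \<in> borel_measurable borel"
    and int: "\<And>i. integrable (density lborel std_normal_density) (\<phi> i)"
    and mean: "\<And>i. (\<integral>x. \<phi> i x \<partial>density lborel std_normal_density) = 0"
    and int2: "\<And>i. integrable (density lborel std_normal_density) (\<lambda>x. (\<phi> i x)\<^sup>2)"
  shows "integrable (white_noise n) (\<lambda>\<epsilon>. (\<Sum>i\<in>K. \<phi> i (\<epsilon> i))\<^sup>2)"
    and "(\<integral>\<epsilon>. (\<Sum>i\<in>K. \<phi> i (\<epsilon> i))\<^sup>2 \<partial>white_noise n)
      = (\<Sum>i\<in>K. \<integral>x. (\<phi> i x)\<^sup>2 \<partial>density lborel std_normal_density)"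
proof -
  let ?N = "density lborel (\<lambda>x. ennreal (std_normal_density x))"
  interpret N: prob_space ?N using prob_space_normal_density[of 1 0] by simp
  interpret product_sigma_finite "\<lambda>_ :: nat. ?N" by standard
  have fin: "finite K" using K finite_subset by blast
  \<comment> \<open>The factor in coordinate \<open>j\<close> of
    \<open>\<phi> i (\<epsilon> i) * \<phi> k (\<epsilon> k)\<close>, padded with 1, so that the
    integral over the product measure factorises.\<close>
  define f where "f i k j x = (if j = i then if k = i then (\<phi> i x)\<^sup>2 else \<phi> i x else if j = k then \<phi> k x else 1)"
    for i k j :: nat and x
  have f: "\<phi> i (\<epsilon> i) * \<phi> k (\<epsilon> k) = (\<Prod>j<n. f i k j (\<epsilon> j))" if "i \<in> K" "k \<in> K" for i k \<epsilon>
  proof -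
    have ik: "i < n" "k < n" using that K by auto
    have "(\<Prod>j<n. f i k j (\<epsilon> j)) = (\<Prod>j\<in>{i, k}. f i k j (\<epsilon> j))"
      using ik by (intro prod.mono_neutral_right) (auto simp: f_def)
    thus ?thesis by (cases "i = k") (auto simp: f_def power2_eq_square)
  qed
  have intf: "integrable ?N (f i k j)" for i k j
    unfolding f_def by (cases "j = i"; cases "k = i"; cases "j = k") (auto intro: int int2)
  have int_prod: "integrable (white_noise n) (\<lambda>\<epsilon>. \<phi> i (\<epsilon> i) * \<phi> k (\<epsilon> k))" if "i \<in> K" "k \<in> K" for i k
    unfolding f[OF that] white_noise_def by (intro product_integrable_prod intf) simp
  have E: "(\<integral>\<epsilon>. \<phi> i (\<epsilon> i) * \<phi> k (\<epsilon> k) \<partial>white_noise n) = (if i = k then (\<integral>x. (\<phi> i x)\<^sup>2 \<partial>?N) else 0)"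
    if "i \<in> K" "k \<in> K" for i k
  proof -
    have ik: "i < n" "k < n" using that K by auto
    have "(\<integral>\<epsilon>. \<phi> i (\<epsilon> i) * \<phi> k (\<epsilon> k) \<partial>white_noise n) = (\<Prod>j<n. \<integral>x. f i k j x \<partial>?N)"
      unfolding f[OF that] white_noise_def by (intro product_integral_prod intf) simp
    also have "\<dots> = (\<Prod>j\<in>{i, k}. \<integral>x. f i k j x \<partial>?N)"
      using ik by (intro prod.mono_neutral_right) (auto simp: f_def N.prob_space[simplified])
    also have "\<dots> = (if i = k then (\<integral>x. (\<phi> i x)\<^sup>2 \<partial>?N) else 0)"
      by (auto simp: f_def mean)
    finally show ?thesis .
  qed
  have sq: "(\<Sum>i\<in>K. \<phi> i (\<epsilon> i))\<^sup>2 = (\<Sum>i\<in>K. \<Sum>k\<in>K. \<phi> i (\<epsilon> i) * \<phi> k (\<epsilon> k))" for \<epsilon>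
    by (simp add: power2_eq_square sum_product)
  show "integrable (white_noise n) (\<lambda>\<epsilon>. (\<Sum>i\<in>K. \<phi> i (\<epsilon> i))\<^sup>2)"
    unfolding sq by (intro Bochner_Integration.integrable_sum int_prod)
  have "(\<integral>\<epsilon>. (\<Sum>i\<in>K. \<phi> i (\<epsilon> i))\<^sup>2 \<partial>white_noise n)
      = (\<Sum>i\<in>K. \<integral>\<epsilon>. (\<Sum>k\<in>K. \<phi> i (\<epsilon> i) * \<phi> k (\<epsilon> k)) \<partial>white_noise n)"
    unfolding sq by (intro Bochner_Integration.integral_sum Bochner_Integration.integrable_sum int_prod)
  also have "\<dots> = (\<Sum>i\<in>K. \<Sum>k\<in>K. \<integral>\<epsilon>. \<phi> i (\<epsilon> i) * \<phi> k (\<epsilon> k) \<partial>white_noise n)"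
    by (intro sum.cong refl Bochner_Integration.integral_sum int_prod)
  also have "\<dots> = (\<Sum>i\<in>K. \<Sum>k\<in>K. if i = k then (\<integral>x. (\<phi> i x)\<^sup>2 \<partial>?N) else 0)"
    by (intro sum.cong refl E)
  finally show "(\<integral>\<epsilon>. (\<Sum>i\<in>K. \<phi> i (\<epsilon> i))\<^sup>2 \<partial>white_noise n) = (\<Sum>i\<in>K. \<integral>x. (\<phi> i x)\<^sup>2 \<partial>?N)"
    using fin by simp
qed

text \<open>Nonnegativity of the variance of \<open>\<bar>Y\<bar>\<close>.\<close>

lemma (in prob_space) expectation_abs_le_sqrt:
  fixes Y :: "'a \<Rightarrow> real"
  assumes [measurable]: "Y \<in> borel_measurable M" and "integrable M (\<lambda>x. (Y x)\<^sup>2)"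
    and v: "(\<integral>x. (Y x)\<^sup>2 \<partial>M) \<le> v"
  shows "integrable M Y" "(\<integral>x. \<bar>Y x\<bar> \<partial>M) \<le> sqrt v"
proof -
  show int: "integrable M Y"
    by (rule square_integrable_imp_integrable) (use assms in auto)
  have "variance (\<lambda>x. \<bar>Y x\<bar>) = (\<integral>x. (Y x)\<^sup>2 \<partial>M) - (\<integral>x. \<bar>Y x\<bar> \<partial>M)\<^sup>2"
    using int assms by (subst variance_eq) auto
  moreover have "variance (\<lambda>x. \<bar>Y x\<bar>) \<ge> 0" by (rule variance_positive)
  ultimately have "(\<integral>x. \<bar>Y x\<bar> \<partial>M)\<^sup>2 \<le> v" using v by simp
  thus "(\<integral>x. \<bar>Y x\<bar> \<partial>M) \<le> sqrt v" by (rule real_le_rsqrt)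
qed

text \<open>Every partial sum has second moment at most \<open>v\<close>, hence mean absolute value
  at most \<open>sqrt v\<close>. The last one and the average contribute one \<open>sqrt v\<close>
  each; the rest is Markov's inequality.\<close>

lemma white_noise_partial_sum_size:
  fixes \<phi> :: "nat \<Rightarrow> real \<Rightarrow> real"
  assumes [measurable]: "\<And>i. \<phi> i \<in> borel_measurable borel"
    and int: "\<And>i. integrable (density lborel std_normal_density) (\<phi> i)"
    and mean: "\<And>i. (\<integral>x. \<phi> i x \<partial>density lborel std_normal_density) = 0"
    and int2: "\<And>i. integrable (density lborel std_normal_density) (\<lambda>x. (\<phi> i x)\<^sup>2)"
    and v: "(\<Sum>i<n. \<integral>x. (\<phi> i x)\<^sup>2 \<partial>density lborel std_normal_density) \<le> v" and a: "a > 0"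
  shows "measure (white_noise n) {\<epsilon> \<in> space (white_noise n). a \<le> partial_sum_size n (\<lambda>i. \<phi> i (\<epsilon> i))} \<le> 2 * sqrt v / a"
proof -
  interpret prob_space "white_noise n" by (rule prob_space_white_noise)
  define S where "S j = (\<lambda>\<epsilon>. \<Sum>i<j. \<phi> i (\<epsilon> i))" for j :: nat
  have S: "integrable (white_noise n) (S j)" "(\<integral>\<epsilon>. \<bar>S j \<epsilon>\<bar> \<partial>white_noise n) \<le> sqrt v" if "j \<le> n" for j
  proof -
    have sub: "{..<j} \<subseteq> {..<n}" using that by auto
    have m[measurable]: "S j \<in> borel_measurable (white_noise n)"
      unfolding S_def by (intro borel_measurable_sum, rule measurable_compose[where N = borel]) (use that in simp_all)
    have "(\<Sum>i<j. \<integral>x. (\<phi> i x)\<^sup>2 \<partial>density lborel std_normal_density) \<le> v"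
      by (rule order_trans[OF sum_mono2 v]) (use that in auto)
    thus "integrable (white_noise n) (S j)" "(\<integral>\<epsilon>. \<bar>S j \<epsilon>\<bar> \<partial>white_noise n) \<le> sqrt v"
      using expectation_abs_le_sqrt[OF m, of v] white_noise_sum_square[OF sub assms(1) int mean int2]
      unfolding S_def by auto
  qed
  have eq: "partial_sum_size n (\<lambda>i. \<phi> i (\<epsilon> i)) = \<bar>S n \<epsilon>\<bar> + (\<Sum>j<n. \<bar>S j \<epsilon>\<bar>) / real n" for \<epsilon>
    unfolding partial_sum_size_def S_def ..
  have int_abs: "integrable (white_noise n) (\<lambda>\<epsilon>. \<bar>S j \<epsilon>\<bar>)" if "j \<le> n" for j
    using S(1)[OF that] by simp
  have int_sum: "integrable (white_noise n) (\<lambda>\<epsilon>. \<Sum>j<n. \<bar>S j \<epsilon>\<bar>)"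
    by (rule Bochner_Integration.integrable_sum) (auto intro: int_abs)
  have int: "integrable (white_noise n) (\<lambda>\<epsilon>. \<bar>S n \<epsilon>\<bar> + (\<Sum>j<n. \<bar>S j \<epsilon>\<bar>) / real n)"
    using int_abs[of n] int_sum by simp
  have "0 \<le> v" by (rule order_trans[OF _ v]) (auto intro!: sum_nonneg)
  have "(\<integral>\<epsilon>. \<bar>S n \<epsilon>\<bar> + (\<Sum>j<n. \<bar>S j \<epsilon>\<bar>) / real n \<partial>white_noise n)
      = (\<integral>\<epsilon>. \<bar>S n \<epsilon>\<bar> \<partial>white_noise n) + (\<Sum>j<n. \<integral>\<epsilon>. \<bar>S j \<epsilon>\<bar> \<partial>white_noise n) / real n"
    using int_abs int_sum by (simp add: Bochner_Integration.integral_sum)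
  also have "\<dots> \<le> sqrt v + (\<Sum>j<n. sqrt v) / real n"
    by (intro add_mono divide_right_mono sum_mono S(2)) auto
  also have "\<dots> \<le> 2 * sqrt v" using \<open>0 \<le> v\<close> by (cases "n = 0") auto
  finally have E: "(\<integral>\<epsilon>. \<bar>S n \<epsilon>\<bar> + (\<Sum>j<n. \<bar>S j \<epsilon>\<bar>) / real n \<partial>white_noise n) \<le> 2 * sqrt v" .
  have "prob {\<epsilon> \<in> space (white_noise n). a \<le> \<bar>S n \<epsilon>\<bar> + (\<Sum>j<n. \<bar>S j \<epsilon>\<bar>) / real n}
      \<le> (\<integral>\<epsilon>. \<bar>S n \<epsilon>\<bar> + (\<Sum>j<n. \<bar>S j \<epsilon>\<bar>) / real n \<partial>white_noise n) / a"
    using int a by (intro integral_Markov_inequality_measure[where A = "{}"])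
      (auto intro!: AE_I2 add_nonneg_nonneg divide_nonneg_nonneg sum_nonneg)
  also have "\<dots> \<le> 2 * sqrt v / a" using E a by (intro divide_right_mono) auto
  finally show ?thesis unfolding eq .
qed

lemma std_normal_moments:
  "integrable (density lborel std_normal_density) (\<lambda>x. x ^ k)"
  "(\<integral>x. x \<partial>density lborel std_normal_density) = 0"
  "(\<integral>x. x\<^sup>2 \<partial>density lborel std_normal_density) = 1"
  "(\<integral>x. x ^ 4 \<partial>density lborel std_normal_density) = 3"
proof -
  show "integrable (density lborel std_normal_density) (\<lambda>x. x ^ k)"
    using integrable_std_normal_moment[of k] by (subst integrable_density) auto
  show "(\<integral>x. x \<partial>density lborel std_normal_density) = 0"
    using integral_std_normal_moment_odd[of 0] by (subst integral_density) auto
  show "(\<integral>x. x\<^sup>2 \<partial>density lborel std_normal_density) = 1"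
    using integral_std_normal_moment_even[of 1] by (subst integral_density) (auto simp: fact_numeral)
  show "(\<integral>x. x ^ 4 \<partial>density lborel std_normal_density) = 3"
    using integral_std_normal_moment_even[of 2] by (subst integral_density) (auto simp: fact_numeral)
qed

lemma std_normal_linear_moments:
  "integrable (density lborel std_normal_density) (\<lambda>x. c * x)"
  "(\<integral>x. c * x \<partial>density lborel std_normal_density) = 0"
  "integrable (density lborel std_normal_density) (\<lambda>x. (c * x)\<^sup>2)"
  "(\<integral>x. (c * x)\<^sup>2 \<partial>density lborel std_normal_density) = c\<^sup>2"
  using std_normal_moments(1)[of 1] std_normal_moments(1)[of 2] std_normal_moments(2,3)
  by (auto simp: power_mult_distrib)

lemma std_normal_square_moments:
  "integrable (density lborel std_normal_density) (\<lambda>x. x\<^sup>2 - 1)"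
  "(\<integral>x. x\<^sup>2 - 1 \<partial>density lborel std_normal_density) = 0"
  "integrable (density lborel std_normal_density) (\<lambda>x. (x\<^sup>2 - 1)\<^sup>2)"
  "(\<integral>x. (x\<^sup>2 - 1)\<^sup>2 \<partial>density lborel std_normal_density) = 2"
proof -
  interpret N: prob_space "density lborel (\<lambda>x. ennreal (std_normal_density x))"
    using prob_space_normal_density[of 1 0] by simp
  note [simp] = std_normal_moments(1)[of 2] std_normal_moments(1)[of 4] std_normal_moments(3,4)
  have sq: "(x\<^sup>2 - 1)\<^sup>2 = x ^ 4 - 2 * x\<^sup>2 + 1" for x :: real by (simp add: power2_eq_square power4_eq_xxxx algebra_simps)
  show "integrable (density lborel std_normal_density) (\<lambda>x. x\<^sup>2 - 1)"
    "(\<integral>x. x\<^sup>2 - 1 \<partial>density lborel std_normal_density) = 0"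
    by (simp_all add: N.prob_space[simplified])
  show "integrable (density lborel std_normal_density) (\<lambda>x. (x\<^sup>2 - 1)\<^sup>2)"
    "(\<integral>x. (x\<^sup>2 - 1)\<^sup>2 \<partial>density lborel std_normal_density) = 2"
    unfolding sq by (simp_all add: N.prob_space[simplified])
qed

section \<open>Summable autocovariances give a Lipschitz spectral density\<close>

text \<open>The double sum is the squared modulus of the geometric sum
  \<open>\<Sum>j<n. cis (j * s)\<close>, that is, \<open>n\<close> times the Fejer kernel.\<close>

lemma fejer_kernel_nonneg_bound:
  "0 \<le> (\<Sum>j<n. \<Sum>k<n. cos ((real j - real k) * s))"
  "sin (s / 2) \<noteq> 0 \<Longrightarrow> (\<Sum>j<n. \<Sum>k<n. cos ((real j - real k) * s)) \<le> 1 / (sin (s / 2))\<^sup>2"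
proof -
  define z where "z = (\<Sum>j<n. cis (real j * s))"
  have "(norm z)\<^sup>2 = (\<Sum>j<n. cos (real j * s))\<^sup>2 + (\<Sum>j<n. sin (real j * s))\<^sup>2"
    unfolding z_def cmod_power2 by simp
  also have "\<dots> = (\<Sum>j<n. \<Sum>k<n. cos ((real j - real k) * s))"
    by (simp add: power2_eq_square sum_product left_diff_distrib cos_diff sum.distrib)
  finally have eq: "(\<Sum>j<n. \<Sum>k<n. cos ((real j - real k) * s)) = (norm z)\<^sup>2" ..
  show "0 \<le> (\<Sum>j<n. \<Sum>k<n. cos ((real j - real k) * s))" unfolding eq by simp
  assume s: "sin (s / 2) \<noteq> 0"
  have sq: "(norm (1 - cis a))\<^sup>2 = 4 * (sin (a / 2))\<^sup>2" for a
  proof -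
    have "(norm (1 - cis a))\<^sup>2 = (1 - cos a)\<^sup>2 + (sin a)\<^sup>2" unfolding cmod_power2 by simp
    also have "\<dots> = 2 - 2 * cos a" using sin_cos_squared_add[of a] by (simp add: power2_diff algebra_simps)
    also have "cos a = 1 - 2 * (sin (a / 2))\<^sup>2" using cos_double_sin[of "a / 2"] by simp
    finally show ?thesis by simp
  qed
  have "cis s \<noteq> 1" using sq[of s] s by auto
  moreover have "z = (\<Sum>j<n. cis s ^ j)" unfolding z_def Complex.DeMoivre ..
  ultimately have "z * (1 - cis s) = 1 - cis (real n * s)"
    by (simp add: sum_gp_strict flip: Complex.DeMoivre)
  hence "(norm z)\<^sup>2 * (norm (1 - cis s))\<^sup>2 = (norm (1 - cis (real n * s)))\<^sup>2"
    by (metis norm_mult power_mult_distrib)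
  hence "(norm z)\<^sup>2 * (sin (s / 2))\<^sup>2 = (sin (real n * s / 2))\<^sup>2" unfolding sq by simp
  also have "\<dots> \<le> 1" using abs_sin_le_one[of "real n * s / 2"] by (simp add: abs_square_le_1)
  finally have "(norm z)\<^sup>2 * (sin (s / 2))\<^sup>2 \<le> 1" .
  thus "(\<Sum>j<n. \<Sum>k<n. cos ((real j - real k) * s)) \<le> 1 / (sin (s / 2))\<^sup>2"
    unfolding eq using s by (simp add: le_divide_eq)
qed

section \<open>Fejer means of a continuous function on \<open>{0..2*pi}\<close>\<close>

context
  fixes f :: "real \<Rightarrow> real"
  assumes cont: "continuous_on {0..2*pi} f"
begin

text \<open>For a natural number \<open>m\<close> this is the real part of
  \<open>cis (- m * x) * autocov f m\<close>; since the cosine is even, the sign of \<open>m\<close>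
  does not matter.\<close>

definition cos_coeff :: "real \<Rightarrow> real \<Rightarrow> real" where
  "cos_coeff m x = (LBINT t:{0..2*pi}. f t * cos (m * (x - t)))"

text \<open>\<open>2 * pi * n\<close> times the Fejer mean of order \<open>n\<close>. Summing over
  pairs \<open>(j, k)\<close> produces the triangular weights \<open>n - \<bar>h\<bar>\<close> on
  the lags \<open>h = j - k\<close> without writing them down.\<close>

definition fejer :: "nat \<Rightarrow> real \<Rightarrow> real" where
  "fejer n x = (LBINT t:{0..2*pi}. f t * (\<Sum>j<n. \<Sum>k<n. cos ((real j - real k) * (x - t))))"

lemma fejer_eq: "fejer n x = (\<Sum>j<n. \<Sum>k<n. cos_coeff (real j - real k) x)"
proof -
  have int: "set_integrable lborel {0..2*pi} (\<lambda>t. f t * cos (m * (x - t)))" for m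
    by (intro borel_integrable_atLeastAtMost' continuous_intros cont)
  have "fejer n x = (LBINT t:{0..2*pi}. (\<Sum>j<n. \<Sum>k<n. f t * cos ((real j - real k) * (x - t))))"
    unfolding fejer_def by (simp add: sum_distrib_left)
  also have "\<dots> = (\<Sum>j<n. \<Sum>k<n. cos_coeff (real j - real k) x)"
    using int unfolding cos_coeff_def set_lebesgue_integral_def set_integrable_def scaleR_sum_right
    by (subst Bochner_Integration.integral_sum | intro Bochner_Integration.integrable_sum sum.cong refl | assumption)+
  finally show ?thesis .
qed

text \<open>The point enters only through the factor \<open>cis (- h * x)\<close> of the
  autocovariance at lag \<open>h\<close>, and this factor is Lipschitz with constant
  \<open>h\<close>.\<close>

lemma cos_coeff_lipschitz:
  "\<bar>cos_coeff (real j - real k) x - cos_coeff (real j - real k) y\<bar>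
    \<le> real (nat \<bar>int j - int k\<bar>) * norm (autocov f (nat \<bar>int j - int k\<bar>)) * \<bar>x - y\<bar>"
proof -
  define h where "h = nat \<bar>int j - int k\<bar>"
  have hd: "\<bar>real j - real k\<bar> = real h" by (simp add: h_def)
  have "cos ((real j - real k) * a) = cos (real h * a)" for a
  proof -
    have "real j - real k = real h \<or> real j - real k = - real h" using hd by linarith
    thus ?thesis by (metis cos_minus mult_minus_left)
  qed
  hence coeff: "cos_coeff (real j - real k) z = (LBINT t:{0..2*pi}. f t * cos (real h * (z - t)))" for z
    unfolding cos_coeff_def by simp
  have int: "set_integrable lborel {0..2*pi} (\<lambda>t. complex_of_real (f t) * exp (\<i> * (of_nat h * of_real t)))"
    by (intro borel_integrable_atLeastAtMost' continuous_intros cont)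
  have "cos_coeff (real j - real k) z = Re (cis (- (real h * z)) * autocov f h)" for z
  proof -
    have "cis (- (real h * z)) * autocov f h
        = (LBINT t:{0..2*pi}. cis (- (real h * z)) * (complex_of_real (f t) * exp (\<i> * (of_nat h * of_real t))))"
      unfolding autocov_def by (rule set_integral_mult_right[symmetric])
    moreover have "Re (LBINT t:{0..2*pi}. cis (- (real h * z)) * (complex_of_real (f t) * exp (\<i> * (of_nat h * of_real t)))) = (LBINT t:{0..2*pi}. Re (cis (- (real h * z)) * (complex_of_real (f t) * exp (\<i> * (of_nat h * of_real t)))))"
      using set_integrable_mult_right[of "cis (- (real h * z))", OF int]
      unfolding set_lebesgue_integral_def set_integrable_def by (simp flip: integral_Re)
    moreover have "\<dots> = (LBINT t:{0..2*pi}. f t * cos (real h * (z - t)))"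
    proof (intro set_lebesgue_integral_cong allI impI)
      fix t
      have "exp (\<i> * (of_nat h * of_real t)) = cis (real h * t)" by (simp add: cis_conv_exp)
      hence "cis (- (real h * z)) * exp (\<i> * (of_nat h * of_real t)) = cis (real h * t - real h * z)"
        by (simp add: cis_mult)
      hence "cis (- (real h * z)) * (complex_of_real (f t) * exp (\<i> * (of_nat h * of_real t))) = of_real (f t) * cis (real h * t - real h * z)"
        by (simp only: mult.left_commute[of "cis _"])
      hence "Re (cis (- (real h * z)) * (complex_of_real (f t) * exp (\<i> * (of_nat h * of_real t)))) = Re (of_real (f t) * cis (real h * t - real h * z))"
        by (rule arg_cong)
      also have "\<dots> = f t * cos (real h * t - real h * z)" by simp
      also have "cos (real h * t - real h * z) = cos (real h * (z - t))"
        by (metis cos_minus minus_diff_eq right_diff_distrib)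
      finally show "Re (cis (- (real h * z)) * (complex_of_real (f t) * exp (\<i> * (of_nat h * of_real t)))) = f t * cos (real h * (z - t))" .
    qed simp
    ultimately show ?thesis unfolding coeff by simp
  qed
  hence "\<bar>cos_coeff (real j - real k) x - cos_coeff (real j - real k) y\<bar>
      = \<bar>Re ((cis (- (real h * x)) - cis (- (real h * y))) * autocov f h)\<bar>"
    by (simp add: left_diff_distrib)
  also have "\<dots> \<le> norm (cis (- (real h * x)) - cis (- (real h * y))) * norm (autocov f h)"
    unfolding norm_mult[symmetric] by (rule abs_Re_le_cmod)
  also have "norm (cis (- (real h * x)) - cis (- (real h * y))) \<le> \<bar>- (real h * x) - - (real h * y)\<bar>"
  proof -
    have "cis a - cis b = cis b * (cis (a - b) - 1)" for a b by (simp add: right_diff_distrib cis_mult)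
    hence "norm (cis a - cis b) = norm (exp (\<i> * of_real (a - b)) - 1)" for a b
      by (simp add: norm_mult cis_conv_exp)
    hence "norm (cis a - cis b) = 2 * \<bar>sin ((a - b) / 2)\<bar>" for a b by (simp only: dist_exp_i_1)
    thus ?thesis using abs_sin_x_le_abs_x[of "(- (real h * x) - - (real h * y)) / 2"] by simp
  qed
  also have "\<dots> = real h * \<bar>x - y\<bar>" by (simp add: abs_mult right_diff_distrib[symmetric] abs_minus_commute)
  finally show ?thesis unfolding h_def[symmetric] by (simp add: mult_right_mono mult_ac)
qed

text \<open>For fixed \<open>j\<close> every lag occurs at most twice among the \<open>k\<close>, so
  each of the \<open>n\<close> rows of the double sum contributes at most twice the weighted sum of
  the autocovariances.\<close>

lemma fejer_lipschitz:
  assumes sm: "summable (\<lambda>h. real h * norm (autocov f h))"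
  shows "\<bar>fejer n x - fejer n y\<bar> \<le> real n * (2 * (\<Sum>h. real h * norm (autocov f h))) * \<bar>x - y\<bar>"
proof -
  define w where "w h = real h * norm (autocov f h)" for h
  have w: "w h \<ge> 0" for h by (simp add: w_def)
  have row: "(\<Sum>k<n. w (nat \<bar>int j - int k\<bar>)) \<le> 2 * (\<Sum>h. w h)" if j: "j < n" for j
  proof -
    have "(\<Sum>k<n. w (nat \<bar>int j - int k\<bar>)) = (\<Sum>k\<in>{..j}. w (nat \<bar>int j - int k\<bar>)) + (\<Sum>k\<in>{j<..<n}. w (nat \<bar>int j - int k\<bar>))"
      using j by (subst sum.union_disjoint[symmetric]) (auto intro!: sum.cong)
    also have "(\<Sum>k\<in>{..j}. w (nat \<bar>int j - int k\<bar>)) = (\<Sum>h\<in>{..j}. w h)"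
      by (rule sum.reindex_bij_witness[of _ "\<lambda>h. j - h" "\<lambda>k. j - k"]) (auto simp: of_nat_diff nat_diff_distrib)
    also have "(\<Sum>k\<in>{j<..<n}. w (nat \<bar>int j - int k\<bar>)) = (\<Sum>h\<in>{0<..<n - j}. w h)"
      using j by (intro sum.reindex_bij_witness[of _ "\<lambda>h. j + h" "\<lambda>k. k - j"]) (auto intro!: arg_cong[of _ _ w])
    also have "(\<Sum>h\<in>{..j}. w h) \<le> (\<Sum>h. w h)" using sm w unfolding w_def[symmetric] by (intro sum_le_suminf) auto
    also have "(\<Sum>h\<in>{0<..<n - j}. w h) \<le> (\<Sum>h. w h)" using sm w unfolding w_def[symmetric] by (intro sum_le_suminf) auto
    finally show ?thesis by simp
  qed
  have "\<bar>fejer n x - fejer n y\<bar> = \<bar>\<Sum>j<n. \<Sum>k<n. cos_coeff (real j - real k) x - cos_coeff (real j - real k) y\<bar>"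
    unfolding fejer_eq by (simp add: sum_subtractf)
  also have "\<dots> \<le> (\<Sum>j<n. \<Sum>k<n. \<bar>cos_coeff (real j - real k) x - cos_coeff (real j - real k) y\<bar>)"
    by (rule order_trans[OF sum_abs sum_mono[OF sum_abs]])
  also have "\<dots> \<le> (\<Sum>j<n. \<Sum>k<n. w (nat \<bar>int j - int k\<bar>) * \<bar>x - y\<bar>)"
    unfolding w_def by (intro sum_mono cos_coeff_lipschitz)
  also have "\<dots> = (\<Sum>j<n. (\<Sum>k<n. w (nat \<bar>int j - int k\<bar>))) * \<bar>x - y\<bar>" by (simp add: sum_distrib_right)
  also have "\<dots> \<le> (\<Sum>j<n. 2 * (\<Sum>h. w h)) * \<bar>x - y\<bar>"
    by (intro mult_right_mono sum_mono row) auto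
  finally show ?thesis by (simp add: w_def)
qed

lemma integral_fejer_kernel:
  "(LBINT t:{0..2*pi}. (\<Sum>j<n. \<Sum>k<n. cos ((real j - real k) * (x - t)))) = 2 * pi * real n"
proof -
  have int: "set_integrable lborel {0..2*pi} (\<lambda>t. cos (m * (x - t)))" for m
    by (intro borel_integrable_atLeastAtMost' continuous_intros)
  have one: "(LBINT t:{0..2*pi}. cos ((real j - real k) * (x - t))) = (if j = k then 2 * pi else 0)" for j k :: nat
  proof (cases "j = k")
    case False
    define m where "m = real j - real k"
    have m: "m \<noteq> 0" using False by (simp add: m_def)
    have "(LBINT t:{0..2*pi}. cos (m * (x - t))) = - sin (m * (x - 2 * pi)) / m - - sin (m * (x - 0)) / m"
      unfolding set_lebesgue_integral_def
    proof (rule integral_FTC_Icc)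
      show "((\<lambda>t. - sin (m * (x - t)) / m) has_vector_derivative cos (m * (x - t))) (at t within {0..2*pi})"
        if "0 \<le> t" "t \<le> 2 * pi" for t
        unfolding has_real_derivative_iff_has_vector_derivative[symmetric]
        using m by (auto intro!: derivative_eq_intros)
    qed (auto intro!: continuous_intros)
    also have "sin (m * (x - 2 * pi)) = sin (m * x - 2 * pi * real_of_int (int j - int k))"
      by (simp add: m_def algebra_simps)
    also have "\<dots> = sin (m * x)" unfolding sin_diff by (simp only: cos_int_2pin sin_int_2pin mult_1_right mult_zero_right diff_zero)
    finally show ?thesis using False by (simp add: m_def)
  qed (simp add: set_integral_const)
  have "(LBINT t:{0..2*pi}. (\<Sum>j<n. \<Sum>k<n. cos ((real j - real k) * (x - t))))
      = (\<Sum>j<n. \<Sum>k<n. (LBINT t:{0..2*pi}. cos ((real j - real k) * (x - t))))"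
    using int unfolding set_lebesgue_integral_def set_integrable_def scaleR_sum_right
    by (subst Bochner_Integration.integral_sum | intro Bochner_Integration.integrable_sum sum.cong refl | assumption)+
  thus ?thesis unfolding one by simp
qed

text \<open>The normalised kernel is an approximate identity. The endpoints are left out because the
  kernel is periodic with period \<open>2 * pi\<close>, while nothing here relates
  \<open>f 0\<close> to \<open>f (2 * pi)\<close>.\<close>

lemma fejer_tendsto:
  assumes x: "x \<in> {0<..<2*pi}"
  shows "(\<lambda>n. fejer (Suc n) x / (2 * pi * real (Suc n))) \<longlonglongrightarrow> f x"
proof (rule LIMSEQ_I)
  fix r :: real assume r: "0 < r"
  obtain B where B: "\<And>t. t \<in> {0..2*pi} \<Longrightarrow> \<bar>f t\<bar> \<le> B"
    using compact_imp_bounded[OF compact_continuous_image[OF cont compact_Icc]]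
    unfolding bounded_iff real_norm_def by blast
  obtain d where d: "d > 0" "\<And>t. t \<in> {0..2*pi} \<Longrightarrow> \<bar>t - x\<bar> < d \<Longrightarrow> \<bar>f t - f x\<bar> < r / 2"
    using cont x r unfolding continuous_on_iff dist_real_def by (metis atLeastAtMost_iff greaterThanLessThan_iff half_gt_zero less_imp_le)
  \<comment> \<open>\<delta> is also at most the distance of \<open>x\<close> from the endpoints.
    Thus a point \<open>t\<close> at distance at least \<delta> has
    \<open>\<bar>x - t\<bar> / 2\<close> between \<open>\<delta> / 2\<close> and
    \<open>pi - \<delta> / 2\<close>, where the sine is at least
    \<open>sin (\<delta> / 2)\<close>.\<close>
  define \<delta> where "\<delta> = min d (min x (2 * pi - x))"
  have \<delta>: "0 < \<delta>" "\<delta> \<le> d" "\<delta> \<le> x" "\<delta> \<le> 2 * pi - x" "\<delta> \<le> pi" using d x unfolding \<delta>_def by auto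
  define S where "S = (sin (\<delta> / 2))\<^sup>2"
  have S: "S > 0" using sin_gt_zero[of "\<delta> / 2"] \<delta> by (auto simp: S_def)
  define K where "K n t = (\<Sum>j<n. \<Sum>k<n. cos ((real j - real k) * (x - t)))" for n t
  have K0: "0 \<le> K n t" for n t unfolding K_def by (rule fejer_kernel_nonneg_bound)
  have K_far: "K n t \<le> 1 / S" if t: "t \<in> {0..2*pi}" "\<delta> \<le> \<bar>t - x\<bar>" for n t
  proof -
    define y where "y = \<bar>x - t\<bar> / 2"
    have y: "\<delta> / 2 \<le> y" "y \<le> pi - \<delta> / 2" using t x \<delta> by (auto simp: y_def)
    have "sin (\<delta> / 2) \<le> sin y"
    proof (cases "y \<le> pi / 2")
      case True
      thus ?thesis using y \<delta> by (intro sin_monotone_2pi_le) auto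
    next
      case False
      have "sin (\<delta> / 2) \<le> sin (pi - y)" using y False \<delta> by (intro sin_monotone_2pi_le) auto
      thus ?thesis by simp
    qed
    moreover have "0 < sin (\<delta> / 2)" using \<delta> by (intro sin_gt_zero) auto
    moreover have "sin ((x - t) / 2) = sin y \<or> sin ((x - t) / 2) = - sin y"
      unfolding y_def by (cases "x \<ge> t") (auto simp: minus_diff_eq[of x t, symmetric] simp del: minus_diff_eq)
    ultimately have "S \<le> (sin y)\<^sup>2" "0 < sin y" "sin ((x - t) / 2) = sin y \<or> sin ((x - t) / 2) = - sin y"
      unfolding S_def by (auto intro!: power_mono)
    hence "S \<le> (sin ((x - t) / 2))\<^sup>2" "sin ((x - t) / 2) \<noteq> 0" by auto
    hence "1 / (sin ((x - t) / 2))\<^sup>2 \<le> 1 / S" using S by (intro frac_le) auto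
    thus ?thesis
      using fejer_kernel_nonneg_bound(2)[of "x - t" n] \<open>sin ((x - t) / 2) \<noteq> 0\<close> unfolding K_def by linarith
  qed
  have Kc: "continuous_on A (K n)" for A n unfolding K_def by (intro continuous_intros)
  have Kint: "set_integrable lborel {0..2*pi} (K n)" for n
    by (intro borel_integrable_atLeastAtMost' Kc)
  have main: "\<bar>fejer n x - 2 * pi * real n * f x\<bar> \<le> r / 2 * (2 * pi * real n) + 2 * B / S * (2 * pi)" for n
  proof -
    have fK: "set_integrable lborel {0..2*pi} (\<lambda>t. f t * K n t)"
      by (intro borel_integrable_atLeastAtMost' continuous_intros Kc cont)
    have "fejer n x - 2 * pi * real n * f x = (LBINT t:{0..2*pi}. f t * K n t) - (LBINT t:{0..2*pi}. f x * K n t)"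
      using integral_fejer_kernel[where n = n and x = x] unfolding fejer_def K_def[symmetric] by simp
    also have "\<dots> = (LBINT t:{0..2*pi}. f t * K n t - f x * K n t)"
      using fK Kint by (intro set_integral_diff(2)[symmetric]) auto
    also have "\<bar>\<dots>\<bar> \<le> (LBINT t:{0..2*pi}. \<bar>f t * K n t - f x * K n t\<bar>)"
      by (rule set_integral_norm_bound[where 'a = real, unfolded real_norm_def])
         (intro borel_integrable_atLeastAtMost' continuous_intros Kc cont)
    also have "\<dots> \<le> (LBINT t:{0..2*pi}. r / 2 * K n t + 2 * B / S)"
    proof (rule set_integral_mono)
      show "set_integrable lborel {0..2*pi} (\<lambda>t. \<bar>f t * K n t - f x * K n t\<bar>)"
        "set_integrable lborel {0..2*pi} (\<lambda>t. r / 2 * K n t + 2 * B / S)"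
        by (intro borel_integrable_atLeastAtMost' continuous_intros Kc cont)+
      fix t assume t: "t \<in> {0..2*pi}"
      have eq: "\<bar>f t * K n t - f x * K n t\<bar> = \<bar>f t - f x\<bar> * K n t"
        using K0[of n t] by (simp add: abs_mult flip: left_diff_distrib)
      have Bx: "\<bar>f x\<bar> \<le> B" "\<bar>f t\<bar> \<le> B" using B x t by auto
      show "\<bar>f t * K n t - f x * K n t\<bar> \<le> r / 2 * K n t + 2 * B / S"
      proof (cases "\<bar>t - x\<bar> < \<delta>")
        case True
        hence "\<bar>f t - f x\<bar> * K n t \<le> r / 2 * K n t"
          using d(2)[OF t] \<delta> K0 by (intro mult_right_mono) auto
        moreover have "0 \<le> 2 * B / S" using S Bx by auto
        ultimately show ?thesis unfolding eq by linarith
      next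
        case False
        hence "\<bar>f t - f x\<bar> * K n t \<le> (2 * B) * (1 / S)"
          using Bx K0 K_far[OF t] by (intro mult_mono) auto
        moreover have "0 \<le> r / 2 * K n t" using r K0 by simp
        ultimately show ?thesis unfolding eq by simp
      qed
    qed
    also have "\<dots> = (LBINT t:{0..2*pi}. r / 2 * K n t) + (LBINT t:{0..2*pi}. 2 * B / S)"
      by (intro set_integral_add(2) borel_integrable_atLeastAtMost' continuous_intros Kc)
    also have "(LBINT t:{0..2*pi}. r / 2 * K n t) = r / 2 * (2 * pi * real n)"
      unfolding set_integral_mult_right using integral_fejer_kernel[where n = n and x = x]
      by (simp add: K_def)
    also have "(LBINT t:{0..2*pi}. 2 * B / S) = 2 * B / S * (2 * pi)"
      by (simp add: set_integral_const)
    finally show ?thesis .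
  qed
  obtain n0 where n0: "real n0 > 4 * B / (S * r)" using reals_Archimedean2 by blast
  show "\<exists>no. \<forall>n\<ge>no. norm (fejer (Suc n) x / (2 * pi * real (Suc n)) - f x) < r"
  proof (intro exI[of _ n0] allI impI)
    fix n assume "n0 \<le> n"
    hence n: "4 * B / (S * r) < real (Suc n)" using n0 by linarith
    have pos: "0 < 2 * pi * real (Suc n)" by simp
    have "2 * B / S * (2 * pi) < r / 2 * (2 * pi * real (Suc n))"
    proof -
      have "4 * B < S * r * real (Suc n)" using n S r by (simp only: divide_less_eq mult_pos_pos mult.commute)
      hence "4 * B * pi < S * r * real (Suc n) * pi" by (rule mult_strict_right_mono) simp
      hence "4 * B * pi / S < r * real (Suc n) * pi" using S by (subst pos_divide_less_eq) (simp_all only: ac_simps)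
      moreover have "2 * B / S * (2 * pi) = 4 * B * pi / S" by simp
      moreover have "r / 2 * (2 * pi * real (Suc n)) = r * real (Suc n) * pi" by (simp del: of_nat_Suc)
      ultimately show ?thesis by linarith
    qed
    hence "\<bar>fejer (Suc n) x - 2 * pi * real (Suc n) * f x\<bar> < r * (2 * pi * real (Suc n))"
      using main[of "Suc n"] by (simp add: field_simps)
    moreover have "fejer (Suc n) x / (2 * pi * real (Suc n)) - f x = (fejer (Suc n) x - 2 * pi * real (Suc n) * f x) / (2 * pi * real (Suc n))"
      using pos by (simp add: diff_divide_distrib)
    ultimately show "norm (fejer (Suc n) x / (2 * pi * real (Suc n)) - f x) < r"
      using pos by (simp add: abs_divide divide_less_eq)
  qed
qed

text \<open>The normalised Fejer means share one Lipschitz constant, which passes to their limit on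
  the open interval and by continuity to the closed one. This is what bounds the difference
  quotients whose supremum occurs in \<open>lip_norm f\<close>.\<close>

theorem lipschitz_of_summable_autocov:
  assumes sm: "summable (\<lambda>h. real h * norm (autocov f h))"
  obtains L where "\<And>x y. x \<in> {0..2*pi} \<Longrightarrow> y \<in> {0..2*pi} \<Longrightarrow> \<bar>f x - f y\<bar> \<le> L * \<bar>x - y\<bar>"
proof -
  define L where "L = (\<Sum>h. real h * norm (autocov f h)) / pi"
  have inner: "\<bar>f x - f y\<bar> \<le> L * \<bar>x - y\<bar>" if "x \<in> {0<..<2*pi}" "y \<in> {0<..<2*pi}" for x y
  proof (rule LIMSEQ_le_const2)
    show "(\<lambda>n. \<bar>fejer (Suc n) x / (2 * pi * real (Suc n)) - fejer (Suc n) y / (2 * pi * real (Suc n))\<bar>) \<longlonglongrightarrow> \<bar>f x - f y\<bar>"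
      by (intro tendsto_intros fejer_tendsto that)
    show "\<exists>N. \<forall>n\<ge>N. \<bar>fejer (Suc n) x / (2 * pi * real (Suc n)) - fejer (Suc n) y / (2 * pi * real (Suc n))\<bar> \<le> L * \<bar>x - y\<bar>"
    proof (intro exI allI impI)
      fix n
      have "\<bar>fejer (Suc n) x - fejer (Suc n) y\<bar> / (2 * pi * real (Suc n))
          \<le> real (Suc n) * (2 * (\<Sum>h. real h * norm (autocov f h))) * \<bar>x - y\<bar> / (2 * pi * real (Suc n))"
        by (intro divide_right_mono fejer_lipschitz[OF sm]) simp
      also have "\<dots> = L * \<bar>x - y\<bar>" unfolding L_def by (simp add: field_simps del: of_nat_Suc)
      finally show "\<bar>fejer (Suc n) x / (2 * pi * real (Suc n)) - fejer (Suc n) y / (2 * pi * real (Suc n))\<bar> \<le> L * \<bar>x - y\<bar>"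
        by (simp add: abs_divide flip: diff_divide_distrib)
    qed
  qed
  have "\<bar>f x - f y\<bar> \<le> L * \<bar>x - y\<bar>" if xy: "x \<in> {0..2*pi}" "y \<in> {0..2*pi}" for x y
  proof (rule LIMSEQ_le)
    \<comment> \<open>\<open>X z n\<close> slides \<open>z\<close> towards the midpoint
      \<open>pi\<close>, hence into the open interval, and tends to \<open>z\<close>.\<close>
    define X where "X z n = z + (pi - z) * (1 / real (Suc (Suc n)))" for z n
    have lim: "X z \<longlonglongrightarrow> z" for z
    proof -
      have "(\<lambda>n. z + (pi - z) * (1 / real (Suc (Suc n)))) \<longlonglongrightarrow> z + (pi - z) * 0"
        by (intro tendsto_intros LIMSEQ_Suc lim_1_over_n)
      thus ?thesis unfolding X_def by simp
    qed
    have X_in: "X z n \<in> {0<..<2*pi}" if z: "z \<in> {0..2*pi}" for z n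
    proof -
      define s where "s = 1 / real (Suc (Suc n))"
      have s: "0 < s" "s < 1" by (auto simp: s_def)
      have "0 < (1 - s) * z + s * pi" using s z by (intro add_nonneg_pos) auto
      moreover have "(1 - s) * z + s * pi < (1 - s) * (2 * pi) + s * (2 * pi)"
        using s z by (intro add_le_less_mono mult_left_mono) auto
      ultimately show ?thesis unfolding X_def s_def[symmetric] by (auto simp: algebra_simps)
    qed
    have "(\<lambda>n. f (X z n)) \<longlonglongrightarrow> f z" if z: "z \<in> {0..2*pi}" for z
    proof (rule continuous_on_tendsto_compose[OF cont lim z])
      show "\<forall>\<^sub>F n in sequentially. X z n \<in> {0..2*pi}" using X_in[OF z]
        by (intro always_eventually allI) (metis atLeastAtMost_iff greaterThanLessThan_iff less_imp_le)
    qed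
    thus "(\<lambda>n. \<bar>f (X x n) - f (X y n)\<bar>) \<longlonglongrightarrow> \<bar>f x - f y\<bar>" using xy by (intro tendsto_intros) auto
    show "(\<lambda>n. L * \<bar>X x n - X y n\<bar>) \<longlonglongrightarrow> L * \<bar>x - y\<bar>" by (intro tendsto_intros lim)
    show "\<exists>N. \<forall>n\<ge>N. \<bar>f (X x n) - f (X y n)\<bar> \<le> L * \<bar>X x n - X y n\<bar>" using inner X_in xy by blast
  qed
  thus thesis by (rule that)
qed

end

section \<open>The Lipschitz balls\<close>

lemma C1_functions_continuous: "f \<in> C1_functions \<Longrightarrow> continuous_on {0..pi} f"
  unfolding C1_functions_def C1_on_interval_def by (blast intro: DERIV_continuous_on)

lemma C1_functions_lipschitz:
  assumes "f \<in> C1_functions"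
  obtains L where "\<And>x y. x \<in> {0..pi} \<Longrightarrow> y \<in> {0..pi} \<Longrightarrow> \<bar>f x - f y\<bar> \<le> L * \<bar>x - y\<bar>"
proof -
  obtain f' where f': "continuous_on {0..pi} f'"
      "\<And>x. x \<in> {0..pi} \<Longrightarrow> (f has_real_derivative f' x) (at x within {0..pi})"
    using assms unfolding C1_functions_def C1_on_interval_def by auto
  have "bounded (f' ` {0..pi})"
    by (intro compact_imp_bounded compact_continuous_image f') auto
  then obtain L where L: "\<And>x. x \<in> {0..pi} \<Longrightarrow> norm (f' x) \<le> L" unfolding bounded_iff by blast
  have "\<bar>f x - f y\<bar> \<le> L * \<bar>x - y\<bar>" if "x \<in> {0..pi}" "y \<in> {0..pi}" for x y
    using field_differentiable_bound[of "{0..pi}" f f' L x y] f'(2) L that by simp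
  thus thesis by (rule that)
qed

lemma sup_norm_le_iff:
  assumes "bdd_above ((\<lambda>x. \<bar>f x\<bar>) ` {0..pi})"
  shows "sup_norm f \<le> c \<longleftrightarrow> (\<forall>x\<in>{0..pi}. \<bar>f x\<bar> \<le> c)"
  unfolding sup_norm_def using assms by (intro cSUP_le_iff) auto

lemma bdd_above_abs_continuous:
  "continuous_on {0..pi} (f :: real \<Rightarrow> real) \<Longrightarrow> bdd_above ((\<lambda>x. \<bar>f x\<bar>) ` {0..pi})"
  by (intro bounded_imp_bdd_above compact_imp_bounded compact_continuous_image continuous_intros) auto

text \<open>Both suprema dissolve into one inequality for three points. It is multiplied by
  \<open>\<bar>y - z\<bar>\<close>, so that \<open>y = z\<close> is harmless and every point enters
  continuously. The Lipschitz hypothesis, with whatever constant, bounds the set of difference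
  quotients; the supremum of an unbounded set would be unspecified.\<close>

lemma lip_norm_le_iff:
  assumes L: "\<And>x y. x \<in> {0..pi} \<Longrightarrow> y \<in> {0..pi} \<Longrightarrow> \<bar>f x - f y\<bar> \<le> L * \<bar>x - y\<bar>"
  shows "lip_norm f \<le> c \<longleftrightarrow>
    (\<forall>x\<in>{0..pi}. \<forall>y\<in>{0..pi}. \<forall>z\<in>{0..pi}. \<bar>f x\<bar> * \<bar>y - z\<bar> + \<bar>f y - f z\<bar> \<le> c * \<bar>y - z\<bar>)"
proof -
  define S where "S = {(x, y). x \<in> {0..pi} \<and> y \<in> {0..pi} \<and> x \<noteq> y}"
  define q where "q = (\<lambda>(x, y). \<bar>f x - f y\<bar> / \<bar>x - y\<bar>)"
  have "(0, pi) \<in> S" unfolding S_def by simp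
  hence S: "S \<noteq> {}" by blast
  have bddq: "bdd_above (q ` S)"
    using L unfolding S_def q_def by (intro bdd_aboveI[of _ L]) (auto simp: divide_le_eq)
  have "continuous_on {0..pi} f"
    by (rule lipschitz_on_continuous_on[of "\<bar>L\<bar>"], rule lipschitz_onI)
       (auto simp: dist_real_def intro!: order_trans[OF L] mult_right_mono)
  hence bdd: "bdd_above ((\<lambda>x. \<bar>f x\<bar>) ` {0..pi})" by (rule bdd_above_abs_continuous)
  have "lip_norm f \<le> c \<longleftrightarrow> (SUP p\<in>S. q p) \<le> c - sup_norm f"
    unfolding lip_norm_def S_def q_def by auto
  also have "\<dots> \<longleftrightarrow> (\<forall>p\<in>S. q p \<le> c - sup_norm f)"
    using S bddq by (rule cSUP_le_iff)
  also have "\<dots> \<longleftrightarrow> (\<forall>p\<in>S. sup_norm f \<le> c - q p)" by (auto simp: algebra_simps)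
  also have "\<dots> \<longleftrightarrow> (\<forall>p\<in>S. \<forall>x\<in>{0..pi}. \<bar>f x\<bar> \<le> c - q p)"
    by (simp only: sup_norm_le_iff[OF bdd])
  also have "\<dots> \<longleftrightarrow> (\<forall>x\<in>{0..pi}. \<forall>y\<in>{0..pi}. \<forall>z\<in>{0..pi}. y \<noteq> z \<longrightarrow> \<bar>f x\<bar> \<le> c - q (y, z))"
    unfolding S_def by blast
  also have "\<dots> \<longleftrightarrow> (\<forall>x\<in>{0..pi}. \<forall>y\<in>{0..pi}. \<forall>z\<in>{0..pi}. \<bar>f x\<bar> * \<bar>y - z\<bar> + \<bar>f y - f z\<bar> \<le> c * \<bar>y - z\<bar>)"
  proof (intro ball_cong refl)
    fix x y z
    show "(y \<noteq> z \<longrightarrow> \<bar>f x\<bar> \<le> c - q (y, z)) \<longleftrightarrow> \<bar>f x\<bar> * \<bar>y - z\<bar> + \<bar>f y - f z\<bar> \<le> c * \<bar>y - z\<bar>"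
    proof (cases "y = z")
      case False
      hence "\<bar>f x\<bar> \<le> c - q (y, z) \<longleftrightarrow> \<bar>f x\<bar> * \<bar>y - z\<bar> \<le> (c - q (y, z)) * \<bar>y - z\<bar>" by simp
      also have "(c - q (y, z)) * \<bar>y - z\<bar> = c * \<bar>y - z\<bar> - \<bar>f y - f z\<bar>"
        using False by (simp add: q_def left_diff_distrib)
      finally show ?thesis using False by (simp add: algebra_simps)
    qed simp
  qed
  finally show ?thesis .
qed

text \<open>The pointwise form of the ball. The norm of the inverse bounds only
  \<open>\<bar>f\<bar>\<close> from below, so functions that are negative throughout may belong to
  it.\<close>

lemma C_set_iff:
  assumes "0 < \<tau>\<^sub>0"
  shows "f \<in> C_set \<tau>\<^sub>0 \<tau>\<^sub>1 \<longleftrightarrow> f \<in> C1_functions \<and> (\<forall>x\<in>{0..pi}. \<tau>\<^sub>0 \<le> \<bar>f x\<bar>) \<and>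
    (\<forall>x\<in>{0..pi}. \<forall>y\<in>{0..pi}. \<forall>z\<in>{0..pi}. \<bar>f x\<bar> * \<bar>y - z\<bar> + \<bar>f y - f z\<bar> \<le> \<tau>\<^sub>1 * \<bar>y - z\<bar>)"
proof (cases "f \<in> C1_functions")
  case True
  obtain L where L: "\<And>x y. x \<in> {0..pi} \<Longrightarrow> y \<in> {0..pi} \<Longrightarrow> \<bar>f x - f y\<bar> \<le> L * \<bar>x - y\<bar>"
    using C1_functions_lipschitz[OF True] by blast
  have "(\<forall>x\<in>{0..pi}. f x \<noteq> 0) \<and> sup_norm (\<lambda>x. inverse (f x)) \<le> inverse \<tau>\<^sub>0 \<longleftrightarrow> (\<forall>x\<in>{0..pi}. \<tau>\<^sub>0 \<le> \<bar>f x\<bar>)"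
  proof (cases "\<forall>x\<in>{0..pi}. f x \<noteq> 0")
    case nz: True
    hence "continuous_on {0..pi} (\<lambda>x. inverse (f x))"
      using C1_functions_continuous[OF True] by (intro continuous_intros) auto
    hence "sup_norm (\<lambda>x. inverse (f x)) \<le> inverse \<tau>\<^sub>0 \<longleftrightarrow> (\<forall>x\<in>{0..pi}. \<bar>inverse (f x)\<bar> \<le> inverse \<tau>\<^sub>0)"
      by (intro sup_norm_le_iff bdd_above_abs_continuous)
    also have "\<dots> \<longleftrightarrow> (\<forall>x\<in>{0..pi}. \<tau>\<^sub>0 \<le> \<bar>f x\<bar>)"
      using nz assms by (intro ball_cong refl) (auto simp: abs_inverse)
    finally show ?thesis using nz by simp
  qed (use assms in force)
  thus ?thesis unfolding C_set_def using lip_norm_le_iff[OF L] True by auto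
qed (simp add: C_set_def)

text \<open>A continuous function with \<open>\<tau>\<^sub>0 \<le> \<bar>f\<bar>\<close> cannot
  change sign, so positivity at 0 fixes the sign everywhere. The upper bound and the Lipschitz bound
  each drop one of the two terms of the three-point inequality.\<close>

lemma C_set_bounds:
  assumes "0 < \<tau>\<^sub>0" and f: "f \<in> C_set \<tau>\<^sub>0 \<tau>\<^sub>1" and pos: "0 < f 0"
  shows "x \<in> {0..pi} \<Longrightarrow> \<tau>\<^sub>0 \<le> f x" "x \<in> {0..pi} \<Longrightarrow> f x \<le> \<tau>\<^sub>1"
    "x \<in> {0..pi} \<Longrightarrow> y \<in> {0..pi} \<Longrightarrow> \<bar>f x - f y\<bar> \<le> \<tau>\<^sub>1 * \<bar>x - y\<bar>"
proof -
  note f' = f[unfolded C_set_iff[OF assms(1)]]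
  have cont: "continuous_on {0..pi} f" using f' C1_functions_continuous by auto
  have *: "\<bar>f x\<bar> * \<bar>y - z\<bar> + \<bar>f y - f z\<bar> \<le> \<tau>\<^sub>1 * \<bar>y - z\<bar>" if "x \<in> {0..pi}" "y \<in> {0..pi}" "z \<in> {0..pi}" for x y z
    using f' that by blast
  show ge: "\<tau>\<^sub>0 \<le> f x" if x: "x \<in> {0..pi}"
  proof (rule ccontr)
    assume "\<not> \<tau>\<^sub>0 \<le> f x"
    moreover have "\<tau>\<^sub>0 \<le> \<bar>f x\<bar>" using f' x by blast
    ultimately have "f x \<le> 0" by linarith
    then obtain t where "0 \<le> t" "t \<le> x" "f t = 0"
      using IVT2'[of f x 0 0] pos x continuous_on_subset[OF cont, of "{0..x}"] by auto
    moreover have "t \<in> {0..pi}" using x \<open>0 \<le> t\<close> \<open>t \<le> x\<close> by simp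
    hence "\<tau>\<^sub>0 \<le> \<bar>f t\<bar>" using f' by blast
    ultimately show False using assms(1) by simp
  qed
  show "f x \<le> \<tau>\<^sub>1" if x: "x \<in> {0..pi}"
  proof -
    have "\<bar>f x\<bar> * pi + \<bar>f 0 - f pi\<bar> \<le> \<tau>\<^sub>1 * pi" using *[OF x, of 0 pi] by simp
    hence "\<bar>f x\<bar> * pi \<le> \<tau>\<^sub>1 * pi" using abs_ge_zero[of "f 0 - f pi"] by linarith
    hence "\<bar>f x\<bar> \<le> \<tau>\<^sub>1" using pi_gt_zero by (simp only: mult_le_cancel_right_pos)
    thus ?thesis by simp
  qed
  show "\<bar>f x - f y\<bar> \<le> \<tau>\<^sub>1 * \<bar>x - y\<bar>" if "x \<in> {0..pi}" "y \<in> {0..pi}"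
  proof -
    have "0 \<le> \<bar>f x\<bar> * \<bar>x - y\<bar>" by simp
    thus ?thesis using *[OF that(1) that] by linarith
  qed
qed

section \<open>Measurability of the Lipschitz and sup norm balls\<close>

lemma space_C1_space: "space C1_space = C1_functions"
  unfolding C1_space_def space_restrict_space space_PiM
  by (auto simp: C1_functions_def PiE_def)

lemma evaluation_measurable:
  "x \<in> {0..pi} \<Longrightarrow> (\<lambda>f. f x) \<in> borel_measurable C1_space"
  unfolding C1_space_def by (intro measurable_restrict_space1 measurable_component_singleton)

lemma continuous_le_on_dense:
  fixes g :: "real \<Rightarrow> real"
  assumes "continuous_on {0..pi} g" "D \<subseteq> {0..pi}" "{0..pi} \<subseteq> closure D" "\<And>x. x \<in> D \<Longrightarrow> g x \<le> c" "x \<in> {0..pi}"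
  shows "g x \<le> c"
proof -
  have "closure D = {0..pi}" using assms(2,3) by (intro antisym closure_minimal) auto
  thus ?thesis using continuous_le_on_closure[of D g x c] assms by auto
qed

text \<open>With a sigma algebra generated by evaluations only countably many points can be used at
  once. Continuity in each variable separately extends the inequality from a countable dense set,
  one variable after the other. Three variables fit the three-point inequality; conditions at a
  single point ignore the other two.\<close>

lemma sets_C1_space_Collect_le:
  fixes G :: "real \<Rightarrow> real \<Rightarrow> real \<Rightarrow> (real \<Rightarrow> real) \<Rightarrow> real"
  assumes meas: "\<And>x y z. x \<in> {0..pi} \<Longrightarrow> y \<in> {0..pi} \<Longrightarrow> z \<in> {0..pi} \<Longrightarrow> G x y z \<in> borel_measurable C1_space"
    and cont: "\<And>f y z. f \<in> C1_functions \<Longrightarrow> y \<in> {0..pi} \<Longrightarrow> z \<in> {0..pi} \<Longrightarrow> continuous_on {0..pi} (\<lambda>x. G x y z f)"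
      "\<And>f x z. f \<in> C1_functions \<Longrightarrow> x \<in> {0..pi} \<Longrightarrow> z \<in> {0..pi} \<Longrightarrow> continuous_on {0..pi} (\<lambda>y. G x y z f)"
      "\<And>f x y. f \<in> C1_functions \<Longrightarrow> x \<in> {0..pi} \<Longrightarrow> y \<in> {0..pi} \<Longrightarrow> continuous_on {0..pi} (\<lambda>z. G x y z f)"
  shows "{f \<in> C1_functions. \<forall>x\<in>{0..pi}. \<forall>y\<in>{0..pi}. \<forall>z\<in>{0..pi}. G x y z f \<le> c} \<in> sets C1_space"
proof -
  obtain D :: "real set" where D: "countable D" "D \<subseteq> {0..pi}" "{0..pi} \<subseteq> closure D"
    using separable[of "{0..pi}"] by blast
  have "{f \<in> C1_functions. \<forall>x\<in>{0..pi}. \<forall>y\<in>{0..pi}. \<forall>z\<in>{0..pi}. G x y z f \<le> c}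
      = {f \<in> space C1_space. \<forall>x\<in>D. \<forall>y\<in>D. \<forall>z\<in>D. G x y z f \<le> c}" (is "?A = ?B")
  proof (intro equalityI subsetI)
    fix f assume "f \<in> ?B"
    hence f: "f \<in> C1_functions" and le: "\<And>x y z. x \<in> D \<Longrightarrow> y \<in> D \<Longrightarrow> z \<in> D \<Longrightarrow> G x y z f \<le> c"
      by (auto simp: space_C1_space)
    have le: "G x y z f \<le> c" if "x \<in> D" "y \<in> D" "z \<in> {0..pi}" for x y z
      using continuous_le_on_dense[of "\<lambda>z. G x y z f" D c z] cont(3)[OF f, of x y] D(2,3) le that by blast
    have le: "G x y z f \<le> c" if "x \<in> D" "y \<in> {0..pi}" "z \<in> {0..pi}" for x y z
      using continuous_le_on_dense[of "\<lambda>y. G x y z f" D c y] cont(2)[OF f, of x z] D(2,3) le that by blast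
    have "G x y z f \<le> c" if "x \<in> {0..pi}" "y \<in> {0..pi}" "z \<in> {0..pi}" for x y z
      using continuous_le_on_dense[of "\<lambda>x. G x y z f" D c x] cont(1)[OF f, of y z] D(2,3) le that by blast
    thus "f \<in> ?A" using f by blast
  next
    fix f assume "f \<in> ?A"
    thus "f \<in> ?B" using D(2) unfolding space_C1_space by blast
  qed
  also have "\<dots> \<in> sets C1_space"
  proof (intro sets.sets_Collect_countable_All' D(1))
    fix x y z assume "x \<in> D" "y \<in> D" "z \<in> D"
    hence [measurable]: "G x y z \<in> borel_measurable C1_space" using D(2) by (intro meas) auto
    show "{f \<in> space C1_space. G x y z f \<le> c} \<in> sets C1_space" by measurable
  qed
  finally show ?thesis .
qed

lemma C_set_measurable:
  assumes "0 < \<tau>\<^sub>0"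
  shows "C_set \<tau>\<^sub>0 \<tau>\<^sub>1 \<in> sets C1_space"
proof -
  have "{f \<in> C1_functions. \<forall>x\<in>{0..pi}. \<forall>y\<in>{0..pi}. \<forall>z\<in>{0..pi}. - \<bar>f x\<bar> \<le> - \<tau>\<^sub>0} \<in> sets C1_space"
    by (rule sets_C1_space_Collect_le)
       (auto dest: C1_functions_continuous intro!: continuous_intros borel_measurable_abs borel_measurable_uminus evaluation_measurable)
  moreover have "{f \<in> C1_functions. \<forall>x\<in>{0..pi}. \<forall>y\<in>{0..pi}. \<forall>z\<in>{0..pi}.
      \<bar>f x\<bar> * \<bar>y - z\<bar> + \<bar>f y - f z\<bar> - \<tau>\<^sub>1 * \<bar>y - z\<bar> \<le> 0} \<in> sets C1_space"
    by (rule sets_C1_space_Collect_le)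
       (auto dest: C1_functions_continuous intro!: continuous_intros borel_measurable_abs borel_measurable_add
          borel_measurable_times borel_measurable_diff evaluation_measurable)
  ultimately have "{f \<in> C1_functions. \<forall>x\<in>{0..pi}. \<forall>y\<in>{0..pi}. \<forall>z\<in>{0..pi}. - \<bar>f x\<bar> \<le> - \<tau>\<^sub>0}
      \<inter> {f \<in> C1_functions. \<forall>x\<in>{0..pi}. \<forall>y\<in>{0..pi}. \<forall>z\<in>{0..pi}.
      \<bar>f x\<bar> * \<bar>y - z\<bar> + \<bar>f y - f z\<bar> - \<tau>\<^sub>1 * \<bar>y - z\<bar> \<le> 0} \<in> sets C1_space" (is "?S \<in> _") by (rule sets.Int)
  moreover have "?S = C_set \<tau>\<^sub>0 \<tau>\<^sub>1"
    unfolding set_eq_iff C_set_iff[OF assms] by (auto simp: ex_in_conv)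
  ultimately show ?thesis by simp
qed

lemma sup_norm_diff_le_iff:
  assumes "f \<in> C1_functions" "continuous_on {0..pi} f\<^sub>0"
  shows "sup_norm (\<lambda>\<omega>. f \<omega> - f\<^sub>0 \<omega>) \<le> c \<longleftrightarrow> (\<forall>\<omega>\<in>{0..pi}. \<bar>f \<omega> - f\<^sub>0 \<omega>\<bar> \<le> c)"
  using assms C1_functions_continuous
  by (intro sup_norm_le_iff bdd_above_abs_continuous continuous_intros) auto

lemma sup_ball_measurable:
  assumes "0 < \<tau>\<^sub>0" "continuous_on {0..pi} f\<^sub>0"
  shows "{f \<in> C_set \<tau>\<^sub>0 \<tau>\<^sub>1. sup_norm (\<lambda>\<omega>. f \<omega> - f\<^sub>0 \<omega>) \<le> c} \<in> sets C1_space"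
proof -
  have "{f \<in> C1_functions. \<forall>x\<in>{0..pi}. \<forall>y\<in>{0..pi}. \<forall>z\<in>{0..pi}. \<bar>f x - f\<^sub>0 x\<bar> \<le> c} \<in> sets C1_space"
    using assms(2)
    by (intro sets_C1_space_Collect_le)
       (auto dest: C1_functions_continuous intro!: continuous_intros borel_measurable_abs borel_measurable_diff evaluation_measurable)
  hence "C_set \<tau>\<^sub>0 \<tau>\<^sub>1 \<inter> {f \<in> C1_functions. \<forall>x\<in>{0..pi}. \<forall>y\<in>{0..pi}. \<forall>z\<in>{0..pi}. \<bar>f x - f\<^sub>0 x\<bar> \<le> c} \<in> sets C1_space"
    (is "?S \<in> _") by (intro sets.Int C_set_measurable assms)
  moreover have "?S = {f \<in> C_set \<tau>\<^sub>0 \<tau>\<^sub>1. sup_norm (\<lambda>\<omega>. f \<omega> - f\<^sub>0 \<omega>) \<le> c}"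
    using sup_norm_diff_le_iff[OF _ assms(2)] unfolding set_eq_iff by (auto simp: C_set_iff[OF assms(1)] ex_in_conv)
  ultimately show ?thesis by simp
qed

section \<open>Bernstein polynomials with nearly Lipschitz coefficients\<close>

lemma Bernstein_combination_bounds:
  assumes x: "0 \<le> x" "x \<le> 1" and c: "\<And>j. j \<le> m \<Longrightarrow> a \<le> c j" "\<And>j. j \<le> m \<Longrightarrow> c j \<le> b"
  shows "a \<le> (\<Sum>j\<le>m. c j * Bernstein m j x)" "(\<Sum>j\<le>m. c j * Bernstein m j x) \<le> b"
proof -
  have "a = (\<Sum>j\<le>m. a * Bernstein m j x)" by (simp flip: sum_distrib_left)
  also have "\<dots> \<le> (\<Sum>j\<le>m. c j * Bernstein m j x)"
    by (intro sum_mono mult_right_mono c Bernstein_nonneg x) auto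
  finally show "a \<le> (\<Sum>j\<le>m. c j * Bernstein m j x)" .
  have "(\<Sum>j\<le>m. c j * Bernstein m j x) \<le> (\<Sum>j\<le>m. b * Bernstein m j x)"
    by (intro sum_mono mult_right_mono c Bernstein_nonneg x) auto
  also have "\<dots> = b" by (simp flip: sum_distrib_left)
  finally show "(\<Sum>j\<le>m. c j * Bernstein m j x) \<le> b" .
qed

text \<open>The values \<open>Bernstein m j x\<close> are binomial probabilities, and the mean
  absolute deviation of the relative frequency is at most its standard deviation.\<close>

lemma sum_abs_dev_Bernstein:
  assumes x: "0 \<le> x" "x \<le> 1" and m: "m > 0"
  shows "(\<Sum>j\<le>m. \<bar>real j / real m - x\<bar> * Bernstein m j x) \<le> 1 / sqrt (real m)"
proof -
  define \<mu> where "\<mu> j = Bernstein m j x" for j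
  have \<mu>0: "\<mu> j \<ge> 0" for j unfolding \<mu>_def by (rule Bernstein_nonneg[OF x])
  have "(\<Sum>j\<le>m. (real j - real m * x)\<^sup>2 * \<mu> j)
      = (\<Sum>j\<le>m. real j * (real j - 1) * \<mu> j) + (1 - 2 * real m * x) * (\<Sum>j\<le>m. real j * \<mu> j) + (real m * x)\<^sup>2 * (\<Sum>j\<le>m. \<mu> j)"
    by (simp add: power2_eq_square algebra_simps sum.distrib sum_subtractf sum_distrib_left)
  also have "\<dots> = real m * x * (1 - x)"
    unfolding \<mu>_def sum_Bernstein sum_k_Bernstein sum_kk_Bernstein by (simp add: power2_eq_square algebra_simps)
  also have "\<dots> \<le> real m * 1 * 1" using x by (intro mult_mono) auto
  finally have var: "(\<Sum>j\<le>m. (real j - real m * x)\<^sup>2 * \<mu> j) \<le> real m" by simp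
  have "(\<Sum>j\<le>m. \<bar>real j / real m - x\<bar> * \<mu> j)\<^sup>2 = (\<Sum>j\<le>m. (\<bar>real j / real m - x\<bar> * sqrt (\<mu> j)) * sqrt (\<mu> j))\<^sup>2"
    using \<mu>0 by (simp add: mult.assoc)
  also have "\<dots> \<le> (\<Sum>j\<le>m. (\<bar>real j / real m - x\<bar> * sqrt (\<mu> j))\<^sup>2) * (\<Sum>j\<le>m. (sqrt (\<mu> j))\<^sup>2)"
    by (rule Cauchy_Schwarz_ineq_sum)
  also have "(\<Sum>j\<le>m. (sqrt (\<mu> j))\<^sup>2) = 1" using \<mu>0 by (simp add: \<mu>_def)
  also have "(\<Sum>j\<le>m. (\<bar>real j / real m - x\<bar> * sqrt (\<mu> j))\<^sup>2) = (\<Sum>j\<le>m. (real j - real m * x)\<^sup>2 * \<mu> j) / (real m)\<^sup>2"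
    unfolding sum_divide_distrib using m \<mu>0
    by (intro sum.cong refl) (simp add: power_mult_distrib field_simps power2_eq_square)
  also have "\<dots> * 1 \<le> real m / (real m)\<^sup>2" using var by (simp add: divide_right_mono)
  also have "\<dots> = (1 / sqrt (real m))\<^sup>2" using m by (simp add: power_divide power2_eq_square)
  finally show ?thesis unfolding \<mu>_def by (rule power2_le_imp_le) simp
qed

lemma Bernstein_operator_error:
  assumes x: "0 \<le> x" "x \<le> 1" and m: "m > 0"
    and lip: "\<And>s t. s \<in> {0..1} \<Longrightarrow> t \<in> {0..1} \<Longrightarrow> \<bar>h s - h t\<bar> \<le> L * \<bar>s - t\<bar>"
  shows "\<bar>(\<Sum>j\<le>m. h (real j / real m) * Bernstein m j x) - h x\<bar> \<le> L / sqrt (real m)"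
proof -
  have "0 \<le> L" using lip[of 0 1] abs_ge_zero[of "h 0 - h 1"] by simp
  have "(\<Sum>j\<le>m. h (real j / real m) * Bernstein m j x) - h x
      = (\<Sum>j\<le>m. (h (real j / real m) - h x) * Bernstein m j x)"
    by (simp add: left_diff_distrib sum_subtractf flip: sum_distrib_left)
  also have "\<bar>\<dots>\<bar> \<le> (\<Sum>j\<le>m. \<bar>h (real j / real m) - h x\<bar> * Bernstein m j x)"
    by (rule order_trans[OF sum_abs]) (simp add: abs_mult Bernstein_nonneg x)
  also have "\<dots> \<le> (\<Sum>j\<le>m. (L * \<bar>real j / real m - x\<bar>) * Bernstein m j x)"
    using x by (intro sum_mono mult_right_mono lip Bernstein_nonneg) (auto simp: divide_simps)
  also have "\<dots> = L * (\<Sum>j\<le>m. \<bar>real j / real m - x\<bar> * Bernstein m j x)"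
    by (simp add: sum_distrib_left mult.assoc)
  also have "\<dots> \<le> L * (1 / sqrt (real m))"
    by (intro mult_left_mono sum_abs_dev_Bernstein x m \<open>0 \<le> L\<close>)
  finally show ?thesis by simp
qed

text \<open>Differentiation replaces the coefficients by their forward differences. Slopes between
  neighbouring coefficients thus bound the derivative without loss, which is what keeps a random
  curve inside the Lipschitz ball.\<close>

lemma has_real_derivative_Bernstein_combination:
  "((\<lambda>x. \<Sum>j\<le>Suc m. c j * Bernstein (Suc m) j x) has_real_derivative
     real (Suc m) * (\<Sum>j\<le>m. (c (Suc j) - c j) * Bernstein m j x)) (at x)"
proof -
  define u where "u j = real (Suc m choose j) * real j * x ^ (j - 1) * (1 - x) ^ (Suc m - j)" for j
  define v where "v j = real (Suc m choose j) * real (Suc m - j) * x ^ j * (1 - x) ^ (Suc m - j - 1)" for j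
  have "((\<lambda>x. Bernstein (Suc m) j x) has_real_derivative u j - v j) (at x)" for j
    unfolding Bernstein_def u_def v_def
    by (rule derivative_eq_intros refl)+ (simp add: algebra_simps)
  hence deriv: "((\<lambda>x. \<Sum>j\<le>Suc m. c j * Bernstein (Suc m) j x) has_real_derivative
      (\<Sum>j\<le>Suc m. c j * (u j - v j))) (at x)"
    by (intro DERIV_sum DERIV_cmult)
  have uj: "u (Suc j) = real (Suc m) * Bernstein m j x" if "j \<le> m" for j
  proof -
    have "real (Suc m choose Suc j) * real (Suc j) = real (Suc m) * real (m choose j)"
      using Suc_times_binomial_eq[of m j] by (metis of_nat_mult)
    thus ?thesis unfolding u_def Bernstein_def by simp
  qed
  have vj: "v j = real (Suc m) * Bernstein m j x" if "j \<le> m" for j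
  proof -
    have "(Suc m - j) * (Suc m choose j) = Suc m * (m choose j)"
      using binomial_absorb_comp[of "Suc m" j] by simp
    hence "real (Suc m choose j) * real (Suc m - j) = real (Suc m) * real (m choose j)"
      by (metis of_nat_mult mult.commute)
    thus ?thesis unfolding v_def Bernstein_def using that by (simp add: Suc_diff_le)
  qed
  have "(\<Sum>j\<le>Suc m. c j * (u j - v j)) = (\<Sum>j\<le>Suc m. c j * u j) - (\<Sum>j\<le>Suc m. c j * v j)"
    by (simp only: right_diff_distrib sum_subtractf)
  also have "(\<Sum>j\<le>Suc m. c j * u j) = (\<Sum>j\<le>m. c (Suc j) * u (Suc j))"
    by (subst sum.atMost_Suc_shift) (simp add: u_def)
  also have "\<dots> = (\<Sum>j\<le>m. c (Suc j) * (real (Suc m) * Bernstein m j x))"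
    by (intro sum.cong refl) (simp only: uj atMost_iff)
  also have "(\<Sum>j\<le>Suc m. c j * v j) = (\<Sum>j\<le>m. c j * v j)"
    by (simp add: v_def)
  also have "\<dots> = (\<Sum>j\<le>m. c j * (real (Suc m) * Bernstein m j x))"
    by (intro sum.cong refl) (simp only: vj atMost_iff)
  also have "(\<Sum>j\<le>m. c (Suc j) * (real (Suc m) * Bernstein m j x)) - \<dots>
      = real (Suc m) * (\<Sum>j\<le>m. (c (Suc j) - c j) * Bernstein m j x)"
    unfolding sum_subtractf[symmetric] sum_distrib_left
    by (intro sum.cong refl) (simp add: left_diff_distrib right_diff_distrib mult.left_commute)
  finally show ?thesis using deriv by simp
qed

section \<open>Small balls of the Gamma process\<close>

text \<open>Weierstrass on \<open>{0..1}\<close>: equal moments of the weighted laws of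
  \<open>V1\<close> and \<open>V2\<close> give equal integrals of polynomials and then of continuous
  functions. The weights need only be integrable, and the two sides may live on different
  spaces.\<close>

lemma integral_eq_of_moments_eq:
  fixes W1 V1 :: "'a \<Rightarrow> real" and W2 V2 :: "'b \<Rightarrow> real" and h :: "real \<Rightarrow> real"
  assumes W: "integrable M1 W1" "integrable M2 W2"
    and [measurable]: "V1 \<in> borel_measurable M1" "V2 \<in> borel_measurable M2"
    and V: "\<And>x. V1 x \<in> {0..1}" "\<And>x. V2 x \<in> {0..1}"
    and eq: "\<And>m. (\<integral>x. W1 x * V1 x ^ m \<partial>M1) = (\<integral>x. W2 x * V2 x ^ m \<partial>M2)"
    and h: "continuous_on UNIV h"
  shows "(\<integral>x. W1 x * h (V1 x) \<partial>M1) = (\<integral>x. W2 x * h (V2 x) \<partial>M2)"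
proof -
  have hm[measurable]: "h \<in> borel_measurable borel" using h by (rule borel_measurable_continuous_onI)
  have int: "integrable M (\<lambda>x. W x * g (V x))"
    if [measurable]: "V \<in> borel_measurable M" and "integrable M W" "\<And>x. V x \<in> {0..1}" "continuous_on UNIV g"
    for M :: "'c measure" and W V and g :: "real \<Rightarrow> real"
  proof -
    have [measurable]: "g \<in> borel_measurable borel" using that(4) by (rule borel_measurable_continuous_onI)
    have "bounded (g ` {0..1})"
      by (intro compact_imp_bounded compact_continuous_image continuous_on_subset[OF that(4)]) auto
    then obtain B where "\<And>x. x \<in> {0..1} \<Longrightarrow> \<bar>g x\<bar> \<le> B" unfolding bounded_iff real_norm_def by blast
    hence "\<bar>W x * g (V x)\<bar> \<le> \<bar>W x * B\<bar>" for x
      using that(3)[of x] abs_ge_self[of B] unfolding abs_mult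
      by (intro mult_left_mono) (auto intro: order_trans)
    thus ?thesis
      using that(2) by (intro Bochner_Integration.integrable_bound[OF integrable_mult_left[OF that(2), of B]]) auto
  qed
  define C where "C = (\<integral>x. \<bar>W1 x\<bar> \<partial>M1) + (\<integral>x. \<bar>W2 x\<bar> \<partial>M2)"
  have "C \<ge> 0" unfolding C_def by simp
  have *: "\<bar>(\<integral>x. W1 x * h (V1 x) \<partial>M1) - (\<integral>x. W2 x * h (V2 x) \<partial>M2)\<bar> \<le> e * C" if e: "e > 0" for e
  proof -
    obtain g where g: "real_polynomial_function g" "\<And>x. x \<in> {0..1} \<Longrightarrow> \<bar>h x - g x\<bar> < e"
      using Stone_Weierstrass_real_polynomial_function[of "{0..1::real}" h e] e h continuous_on_subset by blast
    obtain a n where ga: "g = (\<lambda>x. \<Sum>i\<le>n. a i * x ^ i)"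
      using g(1) unfolding real_polynomial_function_iff_sum by auto
    have gc: "continuous_on UNIV g" unfolding ga by (intro continuous_intros)
    have poly: "(\<integral>x. W x * g (V x) \<partial>M) = (\<Sum>i\<le>n. a i * (\<integral>x. W x * V x ^ i \<partial>M))"
      if [measurable]: "V \<in> borel_measurable M" and "integrable M W" "\<And>x. V x \<in> {0..1}" for M :: "'c measure" and W V
    proof -
      have i: "integrable M (\<lambda>x. W x * V x ^ i)" for i
        by (rule int[OF that, of "\<lambda>x. x ^ i", OF continuous_on_power[OF continuous_on_id]])
      have "(\<integral>x. W x * g (V x) \<partial>M) = (\<integral>x. (\<Sum>i\<le>n. a i * (W x * V x ^ i)) \<partial>M)"
        unfolding ga by (simp add: sum_distrib_left mult_ac)
      also have "\<dots> = (\<Sum>i\<le>n. \<integral>x. a i * (W x * V x ^ i) \<partial>M)"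
        by (intro Bochner_Integration.integral_sum integrable_mult_right i)
      finally show ?thesis by simp
    qed
    have close: "\<bar>(\<integral>x. W x * h (V x) \<partial>M) - (\<integral>x. W x * g (V x) \<partial>M)\<bar> \<le> e * (\<integral>x. \<bar>W x\<bar> \<partial>M)"
      if [measurable]: "V \<in> borel_measurable M" and WV: "integrable M W" "\<And>x. V x \<in> {0..1}" for M :: "'c measure" and W V
    proof -
      have "(\<integral>x. W x * h (V x) \<partial>M) - (\<integral>x. W x * g (V x) \<partial>M) = (\<integral>x. W x * h (V x) - W x * g (V x) \<partial>M)"
        using int[OF that h] int[OF that gc] by simp
      also have "\<bar>\<dots>\<bar> \<le> (\<integral>x. \<bar>W x * h (V x) - W x * g (V x)\<bar> \<partial>M)"
        by (rule integral_abs_bound)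
      also have "\<dots> \<le> (\<integral>x. e * \<bar>W x\<bar> \<partial>M)"
      proof (intro integral_mono)
        fix x
        have "\<bar>W x * h (V x) - W x * g (V x)\<bar> = \<bar>h (V x) - g (V x)\<bar> * \<bar>W x\<bar>"
          by (simp flip: abs_mult add: right_diff_distrib mult.commute)
        also have "\<dots> \<le> e * \<bar>W x\<bar>" using g(2)[OF WV(2)[of x]] by (intro mult_right_mono) auto
        finally show "\<bar>W x * h (V x) - W x * g (V x)\<bar> \<le> e * \<bar>W x\<bar>" .
      qed (use int[OF that h] int[OF that gc] WV in auto)
      finally show ?thesis by simp
    qed
    have "(\<integral>x. W1 x * g (V1 x) \<partial>M1) = (\<integral>x. W2 x * g (V2 x) \<partial>M2)"
      using poly[of V1 M1 W1] poly[of V2 M2 W2] W V eq by simp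
    thus ?thesis
      using close[of V1 M1 W1] close[of V2 M2 W2] W V unfolding C_def distrib_left by (simp add: abs_le_iff)
  qed
  have "\<bar>(\<integral>x. W1 x * h (V1 x) \<partial>M1) - (\<integral>x. W2 x * h (V2 x) \<partial>M2)\<bar> \<le> e" if "e > 0" for e
  proof -
    have "e / (C + 1) * C \<le> e" using that \<open>C \<ge> 0\<close> by (simp add: field_simps)
    moreover have "e / (C + 1) > 0" using that \<open>C \<ge> 0\<close> by simp
    ultimately show ?thesis using * by (meson order_trans)
  qed
  hence "\<bar>(\<integral>x. W1 x * h (V1 x) \<partial>M1) - (\<integral>x. W2 x * h (V2 x) \<partial>M2)\<bar> \<le> 0"
    by (rule field_le_epsilon) simp
  thus ?thesis by simp
qed

text \<open>The quotient tends to \<open>y\<close> as \<open>h\<close> tends to 0 and is dominated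
  by \<open>y\<close>. The same bounds serve for differentiating under an integral and for
  differentiating the exponential of the Laplace exponent.\<close>

lemma exp_quotient_bounds:
  fixes y h :: real
  assumes "0 \<le> y" "0 < h"
  shows "0 \<le> (1 - exp (- h * y)) / h" "(1 - exp (- h * y)) / h \<le> y"
    "y - h * y\<^sup>2 \<le> (1 - exp (- h * y)) / h"
proof -
  show "0 \<le> (1 - exp (- h * y)) / h" using assms by simp
  show "(1 - exp (- h * y)) / h \<le> y"
    using exp_ge_add_one_self[of "- h * y"] assms by (simp add: divide_le_eq mult.commute)
  have "exp (- x) \<le> 1 - x + x\<^sup>2" if "x \<ge> 0" for x :: real
  proof -
    have "(1 - x + x\<^sup>2) * (1 + x) = 1 + x ^ 3" by (simp add: power2_eq_square power3_eq_cube algebra_simps)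
    hence "1 / (1 + x) \<le> 1 - x + x\<^sup>2" using that by (simp add: divide_le_eq)
    moreover have "exp (- x) \<le> 1 / (1 + x)"
      using exp_ge_add_one_self[of x] that by (simp add: exp_minus inverse_eq_divide frac_le)
    ultimately show ?thesis by linarith
  qed
  from this[of "h * y"] assms have "h * (y - h * y\<^sup>2) \<le> 1 - exp (- h * y)"
    by (simp add: power_mult_distrib power2_eq_square algebra_simps)
  thus "y - h * y\<^sup>2 \<le> (1 - exp (- h * y)) / h" using assms by (simp add: le_divide_eq mult.commute)
qed

lemma tendsto_integral_exp_quotient:
  fixes W Y :: "'a \<Rightarrow> real"
  assumes [measurable]: "W \<in> borel_measurable M" "Y \<in> borel_measurable M"
    and Y: "\<And>x. 0 \<le> Y x" and int: "integrable M (\<lambda>x. W x * Y x)"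
  shows "(\<lambda>n. \<integral>x. W x * ((1 - exp (- (1 / real (Suc n)) * Y x)) / (1 / real (Suc n))) \<partial>M)
    \<longlonglongrightarrow> (\<integral>x. W x * Y x \<partial>M)"
proof (rule integral_dominated_convergence)
  show "integrable M (\<lambda>x. \<bar>W x * Y x\<bar>)" using int by simp
  show "AE x in M. (\<lambda>n. W x * ((1 - exp (- (1 / real (Suc n)) * Y x)) / (1 / real (Suc n)))) \<longlonglongrightarrow> W x * Y x"
  proof (intro AE_I2 tendsto_mult_left)
    fix x
    show "(\<lambda>n. (1 - exp (- (1 / real (Suc n)) * Y x)) / (1 / real (Suc n))) \<longlonglongrightarrow> Y x"
    proof (rule tendsto_sandwich)
      have "(\<lambda>n. Y x - 1 / real (Suc n) * (Y x)\<^sup>2) \<longlonglongrightarrow> Y x - 0 * (Y x)\<^sup>2"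
        by (intro tendsto_intros LIMSEQ_Suc lim_1_over_n)
      thus "(\<lambda>n. Y x - 1 / real (Suc n) * (Y x)\<^sup>2) \<longlonglongrightarrow> Y x" by simp
    next
      show "\<forall>\<^sub>F n in sequentially. Y x - 1 / real (Suc n) * (Y x)\<^sup>2 \<le> (1 - exp (- (1 / real (Suc n)) * Y x)) / (1 / real (Suc n))"
        by (intro always_eventually allI exp_quotient_bounds(3)[OF Y]) simp
      show "\<forall>\<^sub>F n in sequentially. (1 - exp (- (1 / real (Suc n)) * Y x)) / (1 / real (Suc n)) \<le> Y x"
        by (intro always_eventually allI exp_quotient_bounds(2)[OF Y]) simp
    qed (rule tendsto_const)
  qed
  show "AE x in M. norm (W x * ((1 - exp (- (1 / real (Suc n)) * Y x)) / (1 / real (Suc n)))) \<le> \<bar>W x * Y x\<bar>" for n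
  proof (intro AE_I2)
    fix x
    show "norm (W x * ((1 - exp (- (1 / real (Suc n)) * Y x)) / (1 / real (Suc n)))) \<le> \<bar>W x * Y x\<bar>"
      using exp_quotient_bounds(1,2)[OF Y[of x], of "1 / real (Suc n)"] Y[of x]
      unfolding real_norm_def abs_mult by (intro mult_left_mono) auto
  qed
qed measurable

text \<open>One increment \<open>Y\<close> of the process over a set \<open>A\<close>. The Laplace
  transform is all that is known about its law; for varying \<beta> this is in general not a gamma
  law. The bounds hold almost everywhere on \<open>A\<close>, whereas measurability and
  nonnegativity are asked for everywhere, so that integrands make sense on the whole plane.\<close>

locale gamma_increment = prob_space N for N :: "'v measure" +
  fixes Y :: "'v \<Rightarrow> real" and A :: "real set" and \<alpha> \<beta> :: "real \<Rightarrow> real" and g\<^sub>0 g\<^sub>1 :: real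
  assumes Y[measurable]: "Y \<in> borel_measurable N" and Y_nonneg: "\<And>w. 0 \<le> Y w"
    and A[measurable]: "A \<in> sets borel" and A_fin: "emeasure lborel A < \<infinity>"
    and \<alpha>[measurable]: "\<alpha> \<in> borel_measurable borel" and \<beta>[measurable]: "\<beta> \<in> borel_measurable borel"
    and g0: "0 < g\<^sub>0" and g1: "0 < g\<^sub>1"
    and \<alpha>\<beta>_nonneg: "\<And>x. 0 \<le> \<alpha> x" "\<And>x. 0 \<le> \<beta> x"
    and bounds: "AE x in lborel. x \<in> A \<longrightarrow> g\<^sub>0 \<le> \<alpha> x \<and> \<alpha> x \<le> g\<^sub>1 \<and> g\<^sub>0 \<le> \<beta> x \<and> \<beta> x \<le> g\<^sub>1"
    and laplace: "\<And>u. 0 \<le> u \<Longrightarrow> (\<integral>w. exp (- u * Y w) \<partial>N) =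
      exp (- (\<integral>z. indicator (A \<times> {0<..}) z * (\<alpha> (fst z) / snd z * exp (- \<beta> (fst z) * snd z)) * (1 - exp (- u * snd z)) \<partial>lborel))"
begin

text \<open>The Levy density times the jump size \<open>snd z\<close>: the factor cancels the
  singularity at jump size zero and leaves an integrable function, the unnormalised density of
  size-biased jumps.\<close>

definition \<kappa> :: "real \<times> real \<Rightarrow> real" where
  "\<kappa> z = indicator (A \<times> {0<..}) z * (\<alpha> (fst z) * exp (- \<beta> (fst z) * snd z))"

lemma A_times[measurable]: "A \<times> {0<..} \<in> sets (borel :: (real \<times> real) measure)"
  unfolding borel_prod[symmetric] by measurable

lemma \<kappa>_measurable[measurable]: "\<kappa> \<in> borel_measurable borel"
proof -
  have [measurable]: "fst \<in> borel_measurable (borel :: (real \<times> real) measure)"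
    "snd \<in> borel_measurable (borel :: (real \<times> real) measure)"
    unfolding borel_prod[symmetric] by measurable
  show ?thesis unfolding \<kappa>_def by measurable
qed

lemma AE_bounds: "AE z in (lborel :: (real \<times> real) measure). fst z \<in> A \<longrightarrow> g\<^sub>0 \<le> \<alpha> (fst z) \<and> \<alpha> (fst z) \<le> g\<^sub>1 \<and> g\<^sub>0 \<le> \<beta> (fst z) \<and> \<beta> (fst z) \<le> g\<^sub>1"
proof -
  define R where "R x \<longleftrightarrow> (x \<in> A \<longrightarrow> g\<^sub>0 \<le> \<alpha> x \<and> \<alpha> x \<le> g\<^sub>1 \<and> g\<^sub>0 \<le> \<beta> x \<and> \<beta> x \<le> g\<^sub>1)" for x
  have [measurable]: "Measurable.pred borel R" unfolding R_def by measurable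
  have "AE x in lborel. AE y in (lborel :: real measure). R x"
    by (rule AE_mp[OF bounds[folded R_def]], rule AE_I2, rule impI, rule AE_I2, assumption)
  moreover have "{z \<in> space (lborel \<Otimes>\<^sub>M (lborel :: real measure)). R (fst z)} \<in> sets (lborel \<Otimes>\<^sub>M (lborel :: real measure))"
    by measurable
  ultimately have "AE z in lborel \<Otimes>\<^sub>M (lborel :: real measure). R (fst z)"
    using lborel_pair.AE_pair_measure[of "\<lambda>z. R (fst z)"] by (simp only: fst_conv)
  thus ?thesis unfolding lborel_prod R_def .
qed

lemma \<kappa>_nonneg: "0 \<le> \<kappa> z"
  unfolding \<kappa>_def using \<alpha>\<beta>_nonneg by (auto simp: indicator_def)

lemma integral_product_form:
  fixes q :: "real \<Rightarrow> real"
  assumes [measurable]: "q \<in> borel_measurable borel" and q: "integrable lborel q" "\<And>s. 0 \<le> q s"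
  shows "integrable lborel (\<lambda>z. indicator A (fst z) * q (snd z))"
    "(\<integral>z. indicator A (fst z) * q (snd z) \<partial>lborel) = measure lborel A * (\<integral>s. q s \<partial>lborel)"
proof -
  have m[measurable]: "(\<lambda>z. indicator A (fst z) * q (snd z)) \<in> borel_measurable (lborel \<Otimes>\<^sub>M (lborel :: real measure))"
    by measurable
  have *: "(\<integral>\<^sup>+z. ennreal (indicator A (fst z) * q (snd z)) \<partial>lborel) = ennreal (measure lborel A * (\<integral>s. q s \<partial>lborel))"
  proof -
    have "(\<integral>\<^sup>+z. ennreal (indicator A (fst z) * q (snd z)) \<partial>lborel)
        = (\<integral>\<^sup>+z. ennreal (indicator A (fst z) * q (snd z)) \<partial>(lborel \<Otimes>\<^sub>M (lborel :: real measure)))"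
      by (simp add: lborel_prod)
    also have "\<dots> = (\<integral>\<^sup>+x. \<integral>\<^sup>+s. ennreal (indicator A x * q s) \<partial>lborel \<partial>lborel)"
      by (subst lborel.nn_integral_fst[symmetric]) auto
    also have "\<dots> = (\<integral>\<^sup>+x. indicator A x * (\<integral>\<^sup>+s. ennreal (q s) \<partial>lborel) \<partial>lborel)"
      by (intro nn_integral_cong) (auto simp: indicator_def)
    also have "\<dots> = emeasure lborel A * (\<integral>\<^sup>+s. ennreal (q s) \<partial>lborel)"
      by (simp add: nn_integral_multc)
    also have "\<dots> = ennreal (measure lborel A * (\<integral>s. q s \<partial>lborel))"
      using A_fin q by (simp add: emeasure_eq_ennreal_measure nn_integral_eq_integral ennreal_mult less_top)
    finally show ?thesis .
  qed
  have meas: "(\<lambda>z. indicator A (fst z) * q (snd z)) \<in> borel_measurable lborel"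
    using m unfolding lborel_prod .
  show "integrable lborel (\<lambda>z. indicator A (fst z) * q (snd z))"
    using * meas q by (intro integrableI_nn_integral_finite[OF _ _ *]) auto
  have "(\<integral>z. indicator A (fst z) * q (snd z) \<partial>lborel) = enn2real (\<integral>\<^sup>+z. ennreal (indicator A (fst z) * q (snd z)) \<partial>lborel)"
    using meas q by (intro integral_eq_nn_integral) auto
  thus "(\<integral>z. indicator A (fst z) * q (snd z) \<partial>lborel) = measure lborel A * (\<integral>s. q s \<partial>lborel)"
    unfolding * using q by (simp add: enn2real_ennreal)
qed

lemma integrable_exp_tail: "integrable lborel (\<lambda>s. indicator {0..} s * exp (- g\<^sub>0 * s))"
  "(\<integral>s. indicator {0..} s * exp (- g\<^sub>0 * s) \<partial>lborel) = 1 / g\<^sub>0"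
proof -
  have "prob_space (density lborel (exponential_density g\<^sub>0))" by (rule prob_space_exponential_density[OF g0])
  from prob_space.emeasure_space_1[OF this]
  have nn: "(\<integral>\<^sup>+s. ennreal (exponential_density g\<^sub>0 s) \<partial>lborel) = ennreal 1" by (simp add: emeasure_density)
  have int: "integrable lborel (exponential_density g\<^sub>0)" 
    using g0 by (intro integrableI_nn_integral_finite[OF _ _ nn]) (auto simp: exponential_density_nonneg)
  have val: "(\<integral>s. exponential_density g\<^sub>0 s \<partial>lborel) = 1"
    using nn g0 by (subst integral_eq_nn_integral) (auto simp: exponential_density_nonneg)
  have eq: "indicator {0..} s * exp (- g\<^sub>0 * s) = exponential_density g\<^sub>0 s / g\<^sub>0" for s :: real
    using g0 by (auto simp: exponential_density_def indicator_def mult.commute)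
  show "integrable lborel (\<lambda>s. indicator {0..} s * exp (- g\<^sub>0 * s))" unfolding eq using int by simp
  show "(\<integral>s. indicator {0..} s * exp (- g\<^sub>0 * s) \<partial>lborel) = 1 / g\<^sub>0" unfolding eq using val by simp
qed

lemma \<kappa>_bound: "AE z in lborel. \<kappa> z \<le> g\<^sub>1 * (indicator A (fst z) * (indicator {0..} (snd z) * exp (- g\<^sub>0 * snd z)))"
  using AE_bounds
proof eventually_elim
  case (elim z)
  show ?case
  proof (cases "z \<in> A \<times> {0<..}")
    case True
    hence "fst z \<in> A" "snd z > 0" by auto
    with elim have "\<alpha> (fst z) * exp (- \<beta> (fst z) * snd z) \<le> g\<^sub>1 * exp (- g\<^sub>0 * snd z)"
      using g1 by (intro mult_mono) auto
    thus ?thesis using True by (auto simp: \<kappa>_def)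
  qed (use g1 in \<open>auto simp: \<kappa>_def indicator_def\<close>)
qed

lemma \<kappa>_integrable: "integrable lborel \<kappa>"
proof -
  have "integrable lborel (\<lambda>z. g\<^sub>1 * (indicator A (fst z) * (indicator {0..} (snd z) * exp (- g\<^sub>0 * snd z))))"
    using integrable_exp_tail by (intro integrable_mult_right integral_product_form) auto
  thus ?thesis
    by (rule Bochner_Integration.integrable_bound) (use \<kappa>_bound \<kappa>_nonneg g1 in \<open>auto simp: abs_of_nonneg\<close>)
qed

text \<open>The Laplace exponent, with the jump size divided out again. Absolute values keep the
  quotient between 0 and \<open>u\<close> on the whole plane for \<open>u \<ge> 0\<close>, while
  \<kappa> vanishes unless \<open>snd z\<close> is positive.\<close>

definition \<Lambda> :: "real \<Rightarrow> real" where
  "\<Lambda> u = (\<integral>z. \<kappa> z * ((1 - exp (- u * \<bar>snd z\<bar>)) / \<bar>snd z\<bar>) \<partial>lborel)"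

lemma laplace_\<Lambda>: "0 \<le> u \<Longrightarrow> expectation (\<lambda>w. exp (- u * Y w)) = exp (- \<Lambda> u)"
  unfolding laplace \<Lambda>_def \<kappa>_def
  by (intro arg_cong[of _ _ exp] arg_cong[of _ _ uminus] Bochner_Integration.integral_cong refl)
     (auto simp: indicator_def)

lemma snd_measurable[measurable]: "snd \<in> borel_measurable (borel :: (real \<times> real) measure)"
  unfolding borel_prod[symmetric] by measurable

lemma \<Lambda>_integrable: assumes "0 \<le> u"
  shows "integrable lborel (\<lambda>z. \<kappa> z * ((1 - exp (- u * \<bar>snd z\<bar>)) / \<bar>snd z\<bar>))"
proof (rule Bochner_Integration.integrable_bound[OF integrable_mult_left[OF \<kappa>_integrable, of u]])
  show "AE z in lborel. norm (\<kappa> z * ((1 - exp (- u * \<bar>snd z\<bar>)) / \<bar>snd z\<bar>)) \<le> norm (\<kappa> z * u)"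
  proof (rule AE_I2)
    fix z :: "real \<times> real"
    have "\<bar>(1 - exp (- u * \<bar>snd z\<bar>)) / \<bar>snd z\<bar>\<bar> \<le> \<bar>u\<bar>"
      using exp_quotient_bounds(1,2)[of u "\<bar>snd z\<bar>"] assms by (cases "snd z = 0") (auto simp: mult.commute)
    thus "norm (\<kappa> z * ((1 - exp (- u * \<bar>snd z\<bar>)) / \<bar>snd z\<bar>)) \<le> norm (\<kappa> z * u)"
      unfolding real_norm_def abs_mult by (intro mult_left_mono) auto
  qed
qed measurable

lemma exp_Y_integrable: "0 \<le> u \<Longrightarrow> integrable N (\<lambda>w. exp (- u * Y w))"
  using Y_nonneg by (intro integrable_const_bound[where B = 1]) auto

lemma Y_exp_integrable: "0 < u \<Longrightarrow> integrable N (\<lambda>w. Y w * exp (- u * Y w))"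
proof (intro integrable_const_bound[where B = "1 / u"] AE_I2)
  fix w assume "0 < u"
  have "u * Y w \<le> exp (u * Y w)" using exp_ge_add_one_self[of "u * Y w"] by linarith
  hence "Y w * exp (- u * Y w) \<le> 1 / u" using \<open>0 < u\<close> by (simp add: exp_minus field_simps)
  thus "norm (Y w * exp (- u * Y w)) \<le> 1 / u" using Y_nonneg[of w] by simp
qed measurable

lemma \<kappa>_exp_integrable: "0 \<le> u \<Longrightarrow> integrable lborel (\<lambda>z. \<kappa> z * exp (- u * \<bar>snd z\<bar>))"
proof (rule Bochner_Integration.integrable_bound[OF \<kappa>_integrable])
  assume "0 \<le> u"
  thus "AE z in lborel. norm (\<kappa> z * exp (- u * \<bar>snd z\<bar>)) \<le> norm (\<kappa> z)"
    by (intro AE_I2) (auto simp: abs_mult mult_left_le)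
qed measurable

text \<open>The derivative of the Laplace transform in \<open>u\<close>, computed under the expectation and in the
  exponent. Since polynomials in \<open>exp (- Y)\<close> determine the law of \<open>Y\<close>, it yields the Mecke type
  identity \<open>tilted_eq_convolution\<close>.\<close>

lemma laplace_derivative:
  assumes u: "0 < u"
  shows "expectation (\<lambda>w. Y w * exp (- u * Y w))
    = expectation (\<lambda>w. exp (- u * Y w)) * (\<integral>z. \<kappa> z * exp (- u * \<bar>snd z\<bar>) \<partial>lborel)"
proof -
  define h where "h n = 1 / real (Suc n)" for n
  have h: "h n > 0" for n by (simp add: h_def)
  have h0: "h \<longlonglongrightarrow> 0" unfolding h_def by (intro LIMSEQ_Suc lim_1_over_n)
  \<comment> \<open>Difference quotient of \<Lambda> at \<open>u\<close>; its limit is the integral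
    over \<kappa> in the claim.\<close>
  define a where "a n = (\<Lambda> (u + h n) - \<Lambda> u) / h n" for n
  define a' where "a' = (\<integral>z. \<kappa> z * exp (- u * \<bar>snd z\<bar>) \<partial>lborel)"
  have a_eq: "a n = (\<integral>z. (\<kappa> z * exp (- u * \<bar>snd z\<bar>) / \<bar>snd z\<bar>) * ((1 - exp (- h n * \<bar>snd z\<bar>)) / h n) \<partial>lborel)" for n
  proof -
    have "\<Lambda> (u + h n) - \<Lambda> u = (\<integral>z. \<kappa> z * ((1 - exp (- (u + h n) * \<bar>snd z\<bar>)) / \<bar>snd z\<bar>) - \<kappa> z * ((1 - exp (- u * \<bar>snd z\<bar>)) / \<bar>snd z\<bar>) \<partial>lborel)"
      unfolding \<Lambda>_def using u h[of n]
      by (intro Bochner_Integration.integral_diff[symmetric] \<Lambda>_integrable) auto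
    also have "\<dots> = (\<integral>z. (\<kappa> z * exp (- u * \<bar>snd z\<bar>) / \<bar>snd z\<bar>) * (1 - exp (- h n * \<bar>snd z\<bar>)) \<partial>lborel)"
    proof (intro Bochner_Integration.integral_cong refl)
      fix z :: "real \<times> real"
      have e: "exp (- (u + h n) * \<bar>snd z\<bar>) = exp (- u * \<bar>snd z\<bar>) * exp (- h n * \<bar>snd z\<bar>)"
        by (simp add: exp_add[symmetric] algebra_simps)
      show "\<kappa> z * ((1 - exp (- (u + h n) * \<bar>snd z\<bar>)) / \<bar>snd z\<bar>) - \<kappa> z * ((1 - exp (- u * \<bar>snd z\<bar>)) / \<bar>snd z\<bar>)
          = (\<kappa> z * exp (- u * \<bar>snd z\<bar>) / \<bar>snd z\<bar>) * (1 - exp (- h n * \<bar>snd z\<bar>))"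
        unfolding e by (simp add: right_diff_distrib diff_divide_distrib mult.assoc)
    qed
    finally have *: "\<Lambda> (u + h n) - \<Lambda> u = (\<integral>z. (\<kappa> z * exp (- u * \<bar>snd z\<bar>) / \<bar>snd z\<bar>) * (1 - exp (- h n * \<bar>snd z\<bar>)) \<partial>lborel)" .
    show ?thesis unfolding a_def * integral_divide_zero[symmetric] times_divide_eq_right by (rule refl)
  qed
  have "(\<lambda>n. \<integral>z. (\<kappa> z * exp (- u * \<bar>snd z\<bar>) / \<bar>snd z\<bar>) * ((1 - exp (- h n * \<bar>snd z\<bar>)) / h n) \<partial>lborel)
      \<longlonglongrightarrow> (\<integral>z. (\<kappa> z * exp (- u * \<bar>snd z\<bar>) / \<bar>snd z\<bar>) * \<bar>snd z\<bar> \<partial>lborel)"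
    unfolding h_def
  proof (rule tendsto_integral_exp_quotient)
    have "(\<lambda>z. (\<kappa> z * exp (- u * \<bar>snd z\<bar>) / \<bar>snd z\<bar>) * \<bar>snd z\<bar>) = (\<lambda>z. \<kappa> z * exp (- u * \<bar>snd z\<bar>))"
      by (auto simp: fun_eq_iff \<kappa>_def indicator_def)
    thus "integrable lborel (\<lambda>z. (\<kappa> z * exp (- u * \<bar>snd z\<bar>) / \<bar>snd z\<bar>) * \<bar>snd z\<bar>)"
      using \<kappa>_exp_integrable[of u] u by simp
  qed auto
  moreover have "(\<integral>z. (\<kappa> z * exp (- u * \<bar>snd z\<bar>) / \<bar>snd z\<bar>) * \<bar>snd z\<bar> \<partial>lborel) = a'"
    unfolding a'_def by (intro Bochner_Integration.integral_cong refl) (auto simp: \<kappa>_def indicator_def)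
  moreover have "a = (\<lambda>n. \<integral>z. (\<kappa> z * exp (- u * \<bar>snd z\<bar>) / \<bar>snd z\<bar>) * ((1 - exp (- h n * \<bar>snd z\<bar>)) / h n) \<partial>lborel)"
    by (rule ext) (rule a_eq)
  ultimately have a: "a \<longlonglongrightarrow> a'" by (simp only:)
  have a_nonneg: "a n \<ge> 0" for n
    unfolding a_eq using exp_quotient_bounds(1)[OF abs_ge_zero h] \<kappa>_nonneg
    by (intro integral_nonneg_AE AE_I2 mult_nonneg_nonneg divide_nonneg_nonneg) (auto simp: less_imp_le[OF h])
  \<comment> \<open>The outer exponential is differentiated by the same elementary bounds, now with
    the nonnegative and convergent \<open>a n\<close> in the role of the variable.\<close>
  have "(\<lambda>n. (1 - exp (- h n * a n)) / h n) \<longlonglongrightarrow> a'"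
  proof (rule tendsto_sandwich)
    have "(\<lambda>n. a n - h n * (a n)\<^sup>2) \<longlonglongrightarrow> a' - 0 * a'\<^sup>2"
      by (intro tendsto_intros a h0)
    thus "(\<lambda>n. a n - h n * (a n)\<^sup>2) \<longlonglongrightarrow> a'" by simp
    show "\<forall>\<^sub>F n in sequentially. a n - h n * (a n)\<^sup>2 \<le> (1 - exp (- h n * a n)) / h n"
      by (intro always_eventually allI exp_quotient_bounds(3) a_nonneg h)
    show "\<forall>\<^sub>F n in sequentially. (1 - exp (- h n * a n)) / h n \<le> a n"
      by (intro always_eventually allI exp_quotient_bounds(2) a_nonneg h)
  qed (rule a)
  hence t1: "(\<lambda>n. exp (- \<Lambda> u) * ((1 - exp (- h n * a n)) / h n)) \<longlonglongrightarrow> exp (- \<Lambda> u) * a'"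
    by (rule tendsto_mult_left)
  have eq: "exp (- \<Lambda> u) * ((1 - exp (- h n * a n)) / h n)
      = expectation (\<lambda>w. exp (- u * Y w) * ((1 - exp (- h n * Y w)) / h n))" for n
  proof -
    have "exp (- u * Y w) * ((1 - exp (- h n * Y w)) / h n) = (exp (- u * Y w) - exp (- (u + h n) * Y w)) / h n" for w
      by (simp add: right_diff_distrib exp_add[symmetric] algebra_simps)
    hence "expectation (\<lambda>w. exp (- u * Y w) * ((1 - exp (- h n * Y w)) / h n))
        = expectation (\<lambda>w. (exp (- u * Y w) - exp (- (u + h n) * Y w)) / h n)"
      by (intro Bochner_Integration.integral_cong refl)
    also have "\<dots> = (expectation (\<lambda>w. exp (- u * Y w)) - expectation (\<lambda>w. exp (- (u + h n) * Y w))) / h n"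
      using exp_Y_integrable[of u] exp_Y_integrable[of "u + h n"] u h[of n]
      by (subst integral_divide_zero) (simp only: Bochner_Integration.integral_diff add_nonneg_nonneg less_imp_le)
    also have "\<dots> = (exp (- \<Lambda> u) - exp (- \<Lambda> (u + h n))) / h n"
      using u h[of n] by (simp only: laplace_\<Lambda> less_imp_le add_nonneg_nonneg)
    also have "\<Lambda> (u + h n) = \<Lambda> u + h n * a n" unfolding a_def using h[of n] by simp
    also have "(exp (- \<Lambda> u) - exp (- (\<Lambda> u + h n * a n))) / h n = exp (- \<Lambda> u) * ((1 - exp (- h n * a n)) / h n)"
      by (simp add: right_diff_distrib exp_add[symmetric] algebra_simps)
    finally show ?thesis ..
  qed
  have t2: "(\<lambda>n. expectation (\<lambda>w. exp (- u * Y w) * ((1 - exp (- h n * Y w)) / h n)))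
      \<longlonglongrightarrow> expectation (\<lambda>w. exp (- u * Y w) * Y w)"
    unfolding h_def using Y_exp_integrable[OF u] Y_nonneg
    by (intro tendsto_integral_exp_quotient) (auto simp: mult.commute)
  have "expectation (\<lambda>w. exp (- u * Y w) * Y w) = exp (- \<Lambda> u) * a'"
    by (rule LIMSEQ_unique[OF t2 t1[unfolded eq]])
  thus ?thesis unfolding laplace_\<Lambda>[OF less_imp_le[OF u]] a'_def by (simp only: mult.commute[of "Y _"])
qed

text \<open>Size-biasing \<open>Y\<close> amounts to adding an independent jump with density
  \<kappa>, up to normalisation. The factor \<open>exp (- Y)\<close> makes the weight integrable
  without any moment of \<open>Y\<close>. Both sides have the same moments in
  \<open>exp (- Y)\<close>: the m-th one is the derivative of the Laplace transform at
  \<open>u = m + 1\<close>.\<close>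

lemma tilted_eq_convolution:
  assumes h: "continuous_on UNIV (h :: real \<Rightarrow> real)"
  shows "expectation (\<lambda>w. Y w * exp (- Y w) * h (exp (- Y w)))
    = expectation (\<lambda>w. \<integral>z. \<kappa> z * exp (- (Y w + \<bar>snd z\<bar>)) * h (exp (- (Y w + \<bar>snd z\<bar>))) \<partial>lborel)"
    and "integrable N (\<lambda>w. \<integral>z. \<kappa> z * exp (- (Y w + \<bar>snd z\<bar>)) * h (exp (- (Y w + \<bar>snd z\<bar>))) \<partial>lborel)"
proof -
  interpret P: pair_sigma_finite N "lborel :: (real \<times> real) measure" by standard
  let ?P = "N \<Otimes>\<^sub>M (lborel :: (real \<times> real) measure)"
  define W where "W p = \<kappa> (snd p) * exp (- (Y (fst p) + \<bar>snd (snd p)\<bar>))" for p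
  define V where "V p = exp (- (Y (fst p) + \<bar>snd (snd p)\<bar>))" for p :: "'v \<times> real \<times> real"
  have Wm[measurable]: "W \<in> borel_measurable ?P" unfolding W_def by measurable
  have Vm[measurable]: "V \<in> borel_measurable ?P" unfolding V_def by measurable
  have hm[measurable]: "h \<in> borel_measurable borel" using h by (rule borel_measurable_continuous_onI)
  have split: "exp (- (u + \<bar>s\<bar>)) = exp (- 1 * u) * exp (- 1 * \<bar>s\<bar>)" for u s :: real
    by (simp add: exp_add[symmetric])
  have V01: "V p \<in> {0..1}" for p
    using add_nonneg_nonneg[OF Y_nonneg[of "fst p"] abs_ge_zero[of "snd (snd p)"]]
    unfolding V_def atLeastAtMost_iff by (simp only: exp_ge_zero exp_le_one_iff neg_le_0_iff_le simp_thms)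
  have W_int: "integrable ?P W"
  proof (rule P.Fubini_integrable[OF Wm])
    have "(\<integral>z. norm (W (w, z)) \<partial>lborel) = exp (- 1 * Y w) * (\<integral>z. \<kappa> z * exp (- 1 * \<bar>snd z\<bar>) \<partial>lborel)" for w
      unfolding W_def split using \<kappa>_nonneg by (simp add: abs_mult mult_ac flip: integral_mult_right_zero)
    thus "integrable N (\<lambda>w. \<integral>z. norm (W (w, z)) \<partial>lborel)"
      using exp_Y_integrable[of 1] by simp
    have "integrable lborel (\<lambda>z. W (w, z))" for w
      using integrable_mult_right[OF \<kappa>_exp_integrable[of 1], of "exp (- 1 * Y w)"]
      unfolding W_def split by (simp add: mult_ac)
    thus "AE w in N. integrable lborel (\<lambda>z. W (w, z))" by simp
  qed
  have moments: "expectation (\<lambda>w. Y w * exp (- Y w) * exp (- Y w) ^ m) = (\<integral>p. W p * V p ^ m \<partial>?P)" for m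
  proof -
    define u where "u = real (Suc m)"
    have u: "u > 0" by (simp add: u_def)
    have pow: "exp (- y) * exp (- y) ^ m = exp (- u * y)" for y :: real
      using exp_of_nat_mult[of "Suc m" "- y"] by (simp only: u_def power_Suc mult_minus_left mult_minus_right)
    have int: "integrable ?P (\<lambda>p. W p * V p ^ m)"
    proof (rule Bochner_Integration.integrable_bound[OF W_int])
      show "AE p in ?P. norm (W p * V p ^ m) \<le> norm (W p)"
        using V01 by (intro AE_I2) (auto simp: abs_mult intro!: mult_left_le power_le_one)
    qed measurable
    have WV: "W (w, z) * V (w, z) ^ m = exp (- u * Y w) * (\<kappa> z * exp (- u * \<bar>snd z\<bar>))" for w z
    proof -
      have "W (w, z) * V (w, z) ^ m = \<kappa> z * (exp (- (Y w + \<bar>snd z\<bar>)) * exp (- (Y w + \<bar>snd z\<bar>)) ^ m)"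
        by (simp add: W_def V_def)
      also have "exp (- (Y w + \<bar>snd z\<bar>)) * exp (- (Y w + \<bar>snd z\<bar>)) ^ m = exp (- u * Y w) * exp (- u * \<bar>snd z\<bar>)"
        unfolding pow exp_add[symmetric] by (simp add: algebra_simps)
      finally show ?thesis by (simp add: mult_ac)
    qed
    have "(\<integral>p. W p * V p ^ m \<partial>?P) = expectation (\<lambda>w. \<integral>z. W (w, z) * V (w, z) ^ m \<partial>lborel)"
      by (rule P.integral_fst'[OF int, symmetric])
    also have "\<dots> = expectation (\<lambda>w. exp (- u * Y w)) * (\<integral>z. \<kappa> z * exp (- u * \<bar>snd z\<bar>) \<partial>lborel)"
      unfolding WV by simp
    also have "\<dots> = expectation (\<lambda>w. Y w * exp (- u * Y w))" by (rule laplace_derivative[OF u, symmetric])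
    finally show ?thesis by (simp only: pow mult.assoc)
  qed
  have int: "integrable ?P (\<lambda>p. W p * h (V p))"
  proof -
    have "bounded (h ` {0..1})"
      by (intro compact_imp_bounded compact_continuous_image continuous_on_subset[OF h]) auto
    then obtain B where B: "\<And>x. x \<in> {0..1} \<Longrightarrow> \<bar>h x\<bar> \<le> B" unfolding bounded_iff real_norm_def by blast
    show ?thesis
    proof (rule Bochner_Integration.integrable_bound[OF integrable_mult_left[OF W_int, of B]])
      show "AE p in ?P. norm (W p * h (V p)) \<le> norm (W p * B)"
        unfolding real_norm_def abs_mult
        by (intro AE_I2 mult_left_mono order_trans[OF B[OF V01] abs_ge_self] abs_ge_zero)
    qed measurable
  qed
  have "expectation (\<lambda>w. Y w * exp (- Y w) * h (exp (- Y w))) = (\<integral>p. W p * h (V p) \<partial>?P)"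
  proof (rule integral_eq_of_moments_eq[of N "\<lambda>w. Y w * exp (- Y w)" ?P W "\<lambda>w. exp (- Y w)" V h])
    show "integrable N (\<lambda>w. Y w * exp (- Y w))" using Y_exp_integrable[of 1] by simp
    show "exp (- Y w) \<in> {0..1}" for w using Y_nonneg[of w] by simp
  qed (use W_int moments V01 h in simp_all)
  also have "\<dots> = expectation (\<lambda>w. \<integral>z. W (w, z) * h (V (w, z)) \<partial>lborel)"
    by (rule P.integral_fst'[OF int, symmetric])
  finally show "expectation (\<lambda>w. Y w * exp (- Y w) * h (exp (- Y w)))
    = expectation (\<lambda>w. \<integral>z. \<kappa> z * exp (- (Y w + \<bar>snd z\<bar>)) * h (exp (- (Y w + \<bar>snd z\<bar>))) \<partial>lborel)"
    by (simp add: W_def V_def)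
  show "integrable N (\<lambda>w. \<integral>z. \<kappa> z * exp (- (Y w + \<bar>snd z\<bar>)) * h (exp (- (Y w + \<bar>snd z\<bar>))) \<partial>lborel)"
    using P.integrable_fst'[OF int] by (simp add: W_def V_def)
qed

lemma indicator_integrable: "S \<in> events \<Longrightarrow> integrable N (indicat_real S)"
  by (intro integrable_real_indicator) (auto simp: emeasure_eq_measure)

text \<open>The identity is tested with a bump that lives where
  \<open>a \<le> Y \<le> a + \<eta>\<close>. One side is at most \<open>a + \<eta>\<close> times the
  probability in question. The other is at least a constant times the probability of
  \<open>Y \<le> a\<close>, since a jump of suitable size carries such a \<open>Y\<close> into the
  middle third of the interval.\<close>

lemma small_ball_by_lower_tail:
  assumes a: "0 \<le> a" and \<eta>: "0 < \<eta>"
  shows "prob {w \<in> space N. Y w \<le> a} * (measure lborel A * (g\<^sub>0 * (\<eta>\<^sup>2 / 9) * exp (- (2 + g\<^sub>1) * (a + \<eta>))))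
    \<le> (a + \<eta>) * prob {w \<in> space N. a \<le> Y w \<and> Y w \<le> a + \<eta>}"
proof -
  define lo hi where "lo = exp (- (a + \<eta>))" and "hi = exp (- a)"
  \<comment> \<open>A tent in the variable \<open>x = exp (- v)\<close>: the identity admits
    continuous functions only, not the indicator itself.\<close>
  define h where "h x = max 0 (min (x - lo) (hi - x))" for x :: real
  have h: "continuous_on UNIV h" unfolding h_def by (intro continuous_intros)
  have h0: "0 \<le> h x" for x by (simp add: h_def)
  have h1: "h (exp (- v)) \<le> indicator {a..a + \<eta>} v" if "0 \<le> v" for v
  proof -
    have "hi \<le> 1" "lo \<ge> 0" using a by (auto simp: hi_def lo_def)
    hence "h x \<le> 1" if "0 \<le> x" "x \<le> 1" for x using that by (auto simp: h_def)
    moreover have "h (exp (- v)) = 0" if "v \<notin> {a..a + \<eta>}"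
    proof -
      have "exp (- v) \<le> lo \<or> hi \<le> exp (- v)" using that by (auto simp: lo_def hi_def)
      thus ?thesis by (auto simp: h_def)
    qed
    ultimately show ?thesis using that by (auto simp: indicator_def)
  qed
  \<comment> \<open>On the middle third both flanks of the tent are at least this high, because
    \<open>exp (- v)\<close> changes by at least \<open>lo * (\<eta> / 3)\<close> across either
    outer third.\<close>
  have h2: "lo * (\<eta> / 3) \<le> h (exp (- v))" if v: "a + \<eta> / 3 \<le> v" "v \<le> a + 2 * \<eta> / 3" for v
  proof -
    have "lo * (1 + \<eta> / 3) \<le> lo * exp (\<eta> / 3)" unfolding lo_def by (intro mult_left_mono exp_ge_add_one_self) auto
    also have "\<dots> \<le> exp (- v)" unfolding lo_def exp_add[symmetric] using v by simp
    finally have "lo * (\<eta> / 3) \<le> exp (- v) - lo" by (simp add: algebra_simps)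
    moreover have "exp (- v) * (1 + \<eta> / 3) \<le> exp (- v) * exp (\<eta> / 3)" by (intro mult_left_mono exp_ge_add_one_self) auto
    hence "exp (- v) * (1 + \<eta> / 3) \<le> hi" using v unfolding hi_def exp_add[symmetric]
      by (elim order_trans) simp
    moreover have "lo * (\<eta> / 3) \<le> exp (- v) * (\<eta> / 3)" using v \<eta> by (intro mult_right_mono) (auto simp: lo_def)
    ultimately have "lo * (\<eta> / 3) \<le> min (exp (- v) - lo) (hi - exp (- v))" by (simp add: algebra_simps)
    thus ?thesis unfolding h_def by (rule max.coboundedI2)
  qed
  define G where "G w = (\<integral>z. \<kappa> z * exp (- (Y w + \<bar>snd z\<bar>)) * h (exp (- (Y w + \<bar>snd z\<bar>))) \<partial>lborel)" for w
  \<comment> \<open>Product of three lower bounds valid for jumps into the middle third: for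
    \<kappa>, for the tilt and for the tent.\<close>
  define c where "c = g\<^sub>0 * exp (- g\<^sub>1 * (a + \<eta>)) * lo * (lo * (\<eta> / 3))"
  have [measurable]: "h \<in> borel_measurable borel" using h by (rule borel_measurable_continuous_onI)
  have G0: "0 \<le> G w" for w
    unfolding G_def using \<kappa>_nonneg h0 by (intro integral_nonneg_AE AE_I2) simp
  have G: "c * (measure lborel A * (\<eta> / 3)) \<le> G w" if w: "Y w \<le> a" for w
  proof -
    \<comment> \<open>Jump sizes leading from \<open>Y w\<close> into the middle third; they are
      positive because \<open>Y w \<le> a\<close>.\<close>
    define q where "q = (indicator {a + \<eta> / 3 - Y w..a + 2 * \<eta> / 3 - Y w} :: real \<Rightarrow> real)"
    have q: "q \<in> borel_measurable borel" "integrable lborel q" "(\<integral>s. q s \<partial>lborel) = \<eta> / 3" "\<And>s. 0 \<le> q s"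
      unfolding q_def using \<eta> by auto
    have "c * (measure lborel A * (\<eta> / 3)) = (\<integral>z. c * (indicator A (fst z) * q (snd z)) \<partial>lborel)"
      using integral_product_form(2)[OF q(1,2,4)] q(3) by simp
    also have "\<dots> \<le> G w"
      unfolding G_def
    proof (rule integral_mono_AE)
      show "integrable lborel (\<lambda>z. c * (indicator A (fst z) * q (snd z)))"
        by (intro integrable_mult_right integral_product_form q)
      show "integrable lborel (\<lambda>z. \<kappa> z * exp (- (Y w + \<bar>snd z\<bar>)) * h (exp (- (Y w + \<bar>snd z\<bar>))))"
      proof (rule Bochner_Integration.integrable_bound[OF \<kappa>_integrable])
        show "AE z in lborel. norm (\<kappa> z * exp (- (Y w + \<bar>snd z\<bar>)) * h (exp (- (Y w + \<bar>snd z\<bar>)))) \<le> norm (\<kappa> z)"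
        proof (rule AE_I2)
          fix z :: "real \<times> real"
          have "h (exp (- (Y w + \<bar>snd z\<bar>))) \<le> 1"
            by (rule order_trans[OF h1 indicator_le_1]) (use Y_nonneg[of w] in simp)
          moreover have "exp (- (Y w + \<bar>snd z\<bar>)) \<le> 1" using Y_nonneg[of w] by simp
          ultimately have "exp (- (Y w + \<bar>snd z\<bar>)) * h (exp (- (Y w + \<bar>snd z\<bar>))) \<le> 1 * 1"
            using h0 by (intro mult_mono) auto
          thus "norm (\<kappa> z * exp (- (Y w + \<bar>snd z\<bar>)) * h (exp (- (Y w + \<bar>snd z\<bar>)))) \<le> norm (\<kappa> z)"
            using h0 by (simp add: abs_mult mult.assoc mult_left_le)
        qed
      qed measurable
      show "AE z in lborel. c * (indicator A (fst z) * q (snd z)) \<le> \<kappa> z * exp (- (Y w + \<bar>snd z\<bar>)) * h (exp (- (Y w + \<bar>snd z\<bar>)))"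
        using AE_bounds
      proof eventually_elim
        case (elim z)
        show ?case
        proof (cases "fst z \<in> A \<and> snd z \<in> {a + \<eta> / 3 - Y w..a + 2 * \<eta> / 3 - Y w}")
          case True
          with w \<eta> have s: "0 < snd z" "a + \<eta> / 3 \<le> Y w + \<bar>snd z\<bar>" "Y w + \<bar>snd z\<bar> \<le> a + 2 * \<eta> / 3" by auto
          have "snd z \<le> a + \<eta>" using s Y_nonneg[of w] \<eta> by simp
          hence "\<beta> (fst z) * snd z \<le> g\<^sub>1 * (a + \<eta>)" using elim True s g1 by (intro mult_mono) auto
          hence "g\<^sub>0 * exp (- g\<^sub>1 * (a + \<eta>)) \<le> \<alpha> (fst z) * exp (- \<beta> (fst z) * snd z)"
            using elim True g0 by (intro mult_mono) auto
          also have "\<dots> = \<kappa> z" using True s by (simp add: \<kappa>_def indicator_def mem_Times_iff)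
          finally have "g\<^sub>0 * exp (- g\<^sub>1 * (a + \<eta>)) * lo * (lo * (\<eta> / 3)) \<le> \<kappa> z * exp (- (Y w + \<bar>snd z\<bar>)) * h (exp (- (Y w + \<bar>snd z\<bar>)))"
            using h2[OF s(2,3)] s(3) \<eta> g0 \<kappa>_nonneg by (intro mult_mono) (auto simp: lo_def)
          thus ?thesis using True by (simp add: c_def q_def)
        qed (use \<kappa>_nonneg h0 in \<open>auto simp: q_def indicator_def\<close>)
      qed
    qed
    finally show ?thesis .
  qed
  have "prob {w \<in> space N. Y w \<le> a} * (measure lborel A * (g\<^sub>0 * (\<eta>\<^sup>2 / 9) * exp (- (2 + g\<^sub>1) * (a + \<eta>))))
      = c * (measure lborel A * (\<eta> / 3)) * prob {w \<in> space N. Y w \<le> a}"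
  proof -
    have "exp (- (2 + g\<^sub>1) * (a + \<eta>)) = exp (- g\<^sub>1 * (a + \<eta>)) * lo * lo"
      unfolding lo_def exp_add[symmetric] by (simp add: algebra_simps)
    thus ?thesis unfolding c_def by (simp add: power2_eq_square)
  qed
  also have "\<dots> = expectation (\<lambda>w. c * (measure lborel A * (\<eta> / 3)) * indicator {w \<in> space N. Y w \<le> a} w)"
    by simp
  also have "\<dots> \<le> expectation G"
  proof (rule integral_mono)
    show "integrable N G" unfolding G_def by (rule tilted_eq_convolution(2)[OF h])
    show "integrable N (\<lambda>w. c * (measure lborel A * (\<eta> / 3)) * indicator {w \<in> space N. Y w \<le> a} w)"
      by (rule integrable_mult_right[OF indicator_integrable]) measurable
  qed (use G G0 in \<open>auto simp: indicator_def\<close>)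
  also have "\<dots> = expectation (\<lambda>w. Y w * exp (- Y w) * h (exp (- Y w)))"
    unfolding G_def by (rule tilted_eq_convolution(1)[OF h, symmetric])
  also have "\<dots> \<le> expectation (\<lambda>w. (a + \<eta>) * indicator {w \<in> space N. a \<le> Y w \<and> Y w \<le> a + \<eta>} w)"
  proof (rule integral_mono')
    fix w assume w: "w \<in> space N"
    have "exp (- Y w) * h (exp (- Y w)) \<le> 1 * indicator {a..a + \<eta>} (Y w)"
      using h1[OF Y_nonneg[of w]] Y_nonneg[of w] h0 by (intro mult_mono) auto
    hence "Y w * (exp (- Y w) * h (exp (- Y w))) \<le> Y w * indicator {a..a + \<eta>} (Y w)"
      using Y_nonneg[of w] by (intro mult_left_mono) auto
    also have "\<dots> \<le> (a + \<eta>) * indicator {w \<in> space N. a \<le> Y w \<and> Y w \<le> a + \<eta>} w"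
      using w by (auto simp: indicator_def)
    finally show "Y w * exp (- Y w) * h (exp (- Y w)) \<le> (a + \<eta>) * indicator {w \<in> space N. a \<le> Y w \<and> Y w \<le> a + \<eta>} w"
      by (simp only: mult.assoc)
  next
    show "integrable N (\<lambda>w. (a + \<eta>) * indicator {w \<in> space N. a \<le> Y w \<and> Y w \<le> a + \<eta>} w)"
      by (rule integrable_mult_right[OF indicator_integrable]) measurable
  qed (use a \<eta> in \<open>auto simp: indicator_def\<close>)
  also have "\<dots> = (a + \<eta>) * prob {w \<in> space N. a \<le> Y w \<and> Y w \<le> a + \<eta>}" by simp
  finally show ?thesis .
qed

text \<open>Jumps are split at \<sigma>: the quotient \<open>(1 - exp (- u * s)) / s\<close> is at
  most \<open>u\<close> for the small ones and at most \<open>1 / \<sigma>\<close> for the large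
  ones, which the exponential tail controls.\<close>

lemma \<Lambda>_upper:
  assumes u: "0 \<le> u" and \<sigma>: "0 < \<sigma>"
  shows "\<Lambda> u \<le> measure lborel A * g\<^sub>1 * (u * \<sigma> + 1 / (\<sigma> * g\<^sub>0))"
proof -
  define q where "q s = u * indicator {0..\<sigma>} s + (1 / \<sigma>) * (indicator {0..} s * exp (- g\<^sub>0 * s))" for s :: real
  have q: "q \<in> borel_measurable borel" "integrable lborel q" "\<And>s. 0 \<le> q s"
    unfolding q_def using integrable_exp_tail(1) u \<sigma> by auto
  have qv: "(\<integral>s. q s \<partial>lborel) = u * \<sigma> + 1 / (\<sigma> * g\<^sub>0)"
    unfolding q_def using integrable_exp_tail u \<sigma> by (subst Bochner_Integration.integral_add) auto
  have "\<Lambda> u \<le> (\<integral>z. g\<^sub>1 * (indicator A (fst z) * q (snd z)) \<partial>lborel)"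
    unfolding \<Lambda>_def
  proof (rule integral_mono_AE)
    show "integrable lborel (\<lambda>z. g\<^sub>1 * (indicator A (fst z) * q (snd z)))"
      by (intro integrable_mult_right integral_product_form q)
    show "AE z in lborel. \<kappa> z * ((1 - exp (- u * \<bar>snd z\<bar>)) / \<bar>snd z\<bar>) \<le> g\<^sub>1 * (indicator A (fst z) * q (snd z))"
      using AE_bounds
    proof eventually_elim
      case (elim z)
      define s where "s = snd z"
      show ?case
      proof (cases "z \<in> A \<times> {0<..}")
        case True
        hence z: "fst z \<in> A" "s > 0" by (auto simp: s_def)
        have "(1 - exp (- u * s)) / s \<le> u" using exp_quotient_bounds(2)[of u s] u z by (simp add: mult.commute)
        moreover have "(1 - exp (- u * s)) / s \<le> 1 / \<sigma>" if "\<sigma> \<le> s"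
          using that \<sigma> z by (intro frac_le) auto
        moreover have "0 \<le> (1 - exp (- u * s)) / s" using u z by simp
        moreover have "exp (- \<beta> (fst z) * s) \<le> exp (- g\<^sub>0 * s)" using elim z by simp
        ultimately have "exp (- \<beta> (fst z) * s) * ((1 - exp (- u * s)) / s) \<le> q s"
        proof (cases "s \<le> \<sigma>")
          case True
          have "exp (- \<beta> (fst z) * s) * ((1 - exp (- u * s)) / s) \<le> 1 * u"
            using \<open>(1 - exp (- u * s)) / s \<le> u\<close> \<open>0 \<le> (1 - exp (- u * s)) / s\<close> z \<alpha>\<beta>_nonneg
            by (intro mult_mono) auto
          thus ?thesis using True z \<sigma> by (simp add: q_def add_increasing2)
        next
          case False
          have "exp (- \<beta> (fst z) * s) * ((1 - exp (- u * s)) / s) \<le> exp (- g\<^sub>0 * s) * (1 / \<sigma>)"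
            using \<open>\<sigma> \<le> s \<Longrightarrow> (1 - exp (- u * s)) / s \<le> 1 / \<sigma>\<close> \<open>0 \<le> (1 - exp (- u * s)) / s\<close>
              \<open>exp (- \<beta> (fst z) * s) \<le> exp (- g\<^sub>0 * s)\<close> False
            by (intro mult_mono) auto
          thus ?thesis using False z by (simp add: q_def mult.commute)
        qed
        hence "\<alpha> (fst z) * (exp (- \<beta> (fst z) * s) * ((1 - exp (- u * s)) / s)) \<le> g\<^sub>1 * q s"
          using elim z u g1 by (intro mult_mono) auto
        thus ?thesis using True z by (simp add: \<kappa>_def s_def mult.assoc)
      qed (use q g1 in \<open>auto simp: \<kappa>_def indicator_def\<close>)
    qed
  qed (rule \<Lambda>_integrable[OF u])
  also have "\<dots> = measure lborel A * g\<^sub>1 * (u * \<sigma> + 1 / (\<sigma> * g\<^sub>0))"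
    using integral_product_form(2)[OF q] qv by simp
  finally show ?thesis .
qed

text \<open>The Laplace transform at \<open>u\<close> is at most the wanted probability plus
  \<open>exp (- u * a)\<close>. By hypothesis the Laplace exponent is at most half of
  \<open>u * a\<close>, so the transform exceeds \<open>exp (- u * a)\<close> by a definite
  amount.\<close>

lemma lower_tail:
  assumes u: "0 \<le> u" and \<sigma>: "0 < \<sigma>" and a: "0 \<le> a"
    and le: "measure lborel A * g\<^sub>1 * (u * \<sigma> + 1 / (\<sigma> * g\<^sub>0)) \<le> u * a / 2"
  shows "u * a / 2 * exp (- u * a) \<le> prob {w \<in> space N. Y w \<le> a}"
proof -
  have "exp (- (u * a / 2)) \<le> exp (- \<Lambda> u)" using order_trans[OF \<Lambda>_upper[OF u \<sigma>] le] by simp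
  also have "\<dots> = expectation (\<lambda>w. exp (- u * Y w))" by (rule laplace_\<Lambda>[OF u, symmetric])
  also have "\<dots> \<le> expectation (\<lambda>w. indicator {w \<in> space N. Y w \<le> a} w + exp (- u * a))"
  proof (rule integral_mono)
    fix w assume "w \<in> space N"
    have "u * a \<le> u * Y w" if "a < Y w" using that u by (intro mult_left_mono) auto
    thus "exp (- u * Y w) \<le> indicator {w \<in> space N. Y w \<le> a} w + exp (- u * a)"
      using \<open>w \<in> space N\<close> u Y_nonneg[of w] by (auto simp: indicator_def add_increasing2)
  next
    show "integrable N (\<lambda>w. indicator {w \<in> space N. Y w \<le> a} w + exp (- u * a))"
      by (rule Bochner_Integration.integrable_add[OF indicator_integrable integrable_const]) measurable
  qed (rule exp_Y_integrable[OF u])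
  also have "\<dots> = prob {w \<in> space N. Y w \<le> a} + exp (- u * a)"
    by (subst Bochner_Integration.integral_add)
       (auto simp: prob_space intro!: indicator_integrable[unfolded indicator_def[abs_def]] indicator_integrable)
  finally have "exp (- (u * a / 2)) - exp (- u * a) \<le> prob {w \<in> space N. Y w \<le> a}" by simp
  moreover have "u * a / 2 * exp (- u * a) \<le> exp (- (u * a / 2)) - exp (- u * a)"
  proof -
    have "exp (- u * a) * (1 + u * a / 2) \<le> exp (- u * a) * exp (u * a / 2)"
      by (intro mult_left_mono exp_ge_add_one_self) auto
    also have "\<dots> = exp (- (u * a / 2))" by (simp add: exp_add[symmetric])
    finally show ?thesis by (simp add: algebra_simps)
  qed
  ultimately show ?thesis by linarith
qed

end

section \<open>From the Gamma process to uniform small ball bounds\<close>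

lemma (in prob_space) gamma_process_increment:
  fixes \<Phi> :: "'a \<Rightarrow> real measure"
  assumes gp: "gamma_process M \<Phi> \<alpha> \<beta>"
    and \<alpha>: "\<alpha> \<in> borel_measurable (restrict_space borel {0..pi})"
    and \<beta>: "\<beta> \<in> borel_measurable (restrict_space borel {0..pi})"
    and pos: "\<And>x. x \<in> {0..pi} \<Longrightarrow> 0 < \<alpha> x \<and> 0 < \<beta> x"
    and g: "0 < g\<^sub>0" "0 < g\<^sub>1" "AE x in lborel. x \<in> {0..pi} \<longrightarrow> g\<^sub>0 \<le> \<alpha> x \<and> \<alpha> x \<le> g\<^sub>1 \<and> g\<^sub>0 \<le> \<beta> x \<and> \<beta> x \<le> g\<^sub>1"
    and A: "A \<in> sets borel" "A \<subseteq> {0..pi}"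
  shows "gamma_increment M (\<lambda>w. measure (\<Phi> w) A) A
    (\<lambda>x. indicator {0..pi} x * \<alpha> x) (\<lambda>x. indicator {0..pi} x * \<beta> x) g\<^sub>0 g\<^sub>1"
proof -
  \<comment> \<open>Measurability is given on \<open>{0..pi}\<close> only; extension by zero makes
    the two functions Borel on the line.\<close>
  define \<alpha>' where "\<alpha>' x = indicator {0..pi} x * \<alpha> x" for x
  define \<beta>' where "\<beta>' x = indicator {0..pi} x * \<beta> x" for x
  have [measurable]: "\<alpha>' \<in> borel_measurable borel" "\<beta>' \<in> borel_measurable borel"
    using \<alpha> \<beta> unfolding \<alpha>'_def \<beta>'_def by (simp_all add: borel_measurable_restrict_space_iff mult.commute)
  have [measurable]: "fst \<in> borel_measurable (borel :: (real \<times> real) measure)"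
    "snd \<in> borel_measurable (borel :: (real \<times> real) measure)"
    unfolding borel_prod[symmetric] by measurable
  have times[measurable]: "B \<times> {0<..} \<in> sets (borel :: (real \<times> real) measure)" if "B \<in> sets borel" for B :: "real set"
    using that unfolding borel_prod[symmetric] by measurable
  have A': "A \<in> sets (restrict_space borel {0..pi})"
    using A by (auto simp: sets_restrict_space_iff)
  define \<rho> where "\<rho> z = indicator ({0..pi} \<times> {0<..}) z * (\<alpha>' (fst z) / snd z * exp (- \<beta>' (fst z) * snd z))" for z :: "real \<times> real"
  have \<rho>[measurable]: "\<rho> \<in> borel_measurable borel" unfolding \<rho>_def by measurable
  have \<rho>0: "0 \<le> \<rho> z" for z unfolding \<rho>_def \<alpha>'_def using pos[of "fst z"] by (auto simp: indicator_def)
  have \<nu>: "gamma_levy_measure \<alpha> \<beta> = density lborel (\<lambda>z. ennreal (\<rho> z))"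
    unfolding gamma_levy_measure_def
    by (intro arg_cong[of _ _ "density lborel"] ext) (auto simp: \<rho>_def \<alpha>'_def \<beta>'_def indicator_def)
  have laplace: "(\<integral>w. exp (- u * measure (\<Phi> w) A) \<partial>M)
      = exp (- (\<integral>z. indicator (A \<times> {0<..}) z * (\<alpha>' (fst z) / snd z * exp (- \<beta>' (fst z) * snd z)) * (1 - exp (- u * snd z)) \<partial>lborel))"
    if "0 \<le> u" for u
  proof -
    have "(\<integral>w. exp (- u * measure (\<Phi> w) A) \<partial>M)
        = exp (- set_lebesgue_integral (gamma_levy_measure \<alpha> \<beta>) (A \<times> {0<..}) (\<lambda>(x, s). 1 - exp (- u * s)))"
      using gp A' that unfolding gamma_process_def has_levy_measure_def by blast
    also have "set_lebesgue_integral (gamma_levy_measure \<alpha> \<beta>) (A \<times> {0<..}) (\<lambda>(x, s). 1 - exp (- u * s))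
        = (\<integral>z. indicator (A \<times> {0<..}) z *\<^sub>R (1 - exp (- u * snd z)) \<partial>density lborel (\<lambda>z. ennreal (\<rho> z)))"
      unfolding set_lebesgue_integral_def \<nu> by (simp add: case_prod_beta)
    also have "\<dots> = (\<integral>z. \<rho> z *\<^sub>R (indicator (A \<times> {0<..}) z *\<^sub>R (1 - exp (- u * snd z))) \<partial>lborel)"
      using A(1) \<rho>0 by (intro integral_density) auto
    also have "\<dots> = (\<integral>z. indicator (A \<times> {0<..}) z * (\<alpha>' (fst z) / snd z * exp (- \<beta>' (fst z) * snd z)) * (1 - exp (- u * snd z)) \<partial>lborel)"
      using A(2) by (intro Bochner_Integration.integral_cong refl) (auto simp: \<rho>_def indicator_def)
    finally show ?thesis .
  qed
  have "gamma_increment_axioms M (\<lambda>w. measure (\<Phi> w) A) A \<alpha>' \<beta>' g\<^sub>0 g\<^sub>1"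
  proof
    show "(\<lambda>w. measure (\<Phi> w) A) \<in> borel_measurable M"
      using gp A' unfolding gamma_process_def completely_random_measure_def random_measure_def by blast
    have "emeasure lborel A \<le> emeasure lborel {0..pi}" using A by (intro emeasure_mono) auto
    thus "emeasure lborel A < \<infinity>" by (rule order_le_less_trans) simp
    show "AE x in lborel. x \<in> A \<longrightarrow> g\<^sub>0 \<le> \<alpha>' x \<and> \<alpha>' x \<le> g\<^sub>1 \<and> g\<^sub>0 \<le> \<beta>' x \<and> \<beta>' x \<le> g\<^sub>1"
      using g(3) by eventually_elim (use A(2) in \<open>auto simp: \<alpha>'_def \<beta>'_def\<close>)
    show "0 \<le> \<alpha>' x" "0 \<le> \<beta>' x" for x
      unfolding \<alpha>'_def \<beta>'_def using pos[of x] by (auto simp: indicator_def)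
  qed (use A g laplace in auto)
  thus ?thesis
    unfolding \<alpha>'_def[abs_def] \<beta>'_def[abs_def] by (intro gamma_increment.intro prob_space_axioms)
qed

text \<open>The point is uniformity: \<open>q\<close> depends neither on the cell nor on
  \<open>k\<close>. Both the length of \<open>A\<close> and the target \<open>a\<close> are of order
  \<open>1 / k\<close>, so one choice of \<open>u\<close> and \<sigma> meets the requirement of the
  lower tail bound for every \<open>k\<close>. One factor \<open>1 / k\<close> is lost to the lower
  tail and one to the length of the cell.\<close>

lemma gamma_small_ball:
  fixes g\<^sub>0 g\<^sub>1 c C :: real
  assumes "0 < g\<^sub>0" "0 < g\<^sub>1" "0 < c" "c \<le> C"
  obtains q where "0 < q" and "\<And>(N :: 'v measure) Y A \<alpha> \<beta> k a \<eta>. gamma_increment N Y A \<alpha> \<beta> g\<^sub>0 g\<^sub>1 \<Longrightarrow> 1 \<le> k \<Longrightarrow>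
      measure lborel A = pi / real k \<Longrightarrow> c / real k \<le> a \<Longrightarrow> a \<le> C / real k \<Longrightarrow> 0 < \<eta> \<Longrightarrow> \<eta> \<le> 1 \<Longrightarrow>
      q * \<eta>\<^sup>2 / (real k)\<^sup>2 \<le> measure N {w \<in> space N. a \<le> Y w \<and> Y w \<le> a + \<eta>}"
proof -
  \<comment> \<open>\<sigma> and \<open>u\<close> are chosen such that each of the two terms in the
    bound on \<Lambda> becomes a quarter of \<open>u * c / k\<close>, so that their sum is at most
    half of \<open>u * a\<close>.\<close>
  define \<sigma> where "\<sigma> = c / (4 * pi * g\<^sub>1)"
  define u where "u = 4 * pi * g\<^sub>1 / (c * \<sigma> * g\<^sub>0)"
  have pos: "0 < \<sigma>" "0 < u" "0 < C" using assms by (auto simp: \<sigma>_def u_def)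
  define q where "q = (u * c / 2) * exp (- u * C) * (pi * (g\<^sub>0 / 9) * exp (- (2 + g\<^sub>1) * (C + 1))) / (C + 1)"
  show thesis
  proof (rule that)
    show "0 < q" unfolding q_def using assms pos by simp
    fix N :: "'v measure" and Y A \<alpha> \<beta> and k :: nat and a \<eta> :: real
    assume "gamma_increment N Y A \<alpha> \<beta> g\<^sub>0 g\<^sub>1" and k: "1 \<le> k" and content: "measure lborel A = pi / real k"
      and a: "c / real k \<le> a" "a \<le> C / real k" and \<eta>: "0 < \<eta>" "\<eta> \<le> 1"
    interpret gamma_increment N Y A \<alpha> \<beta> g\<^sub>0 g\<^sub>1 by fact
    have "0 < c / real k" using k assms by simp
    hence a0: "0 < a" using a by linarith
    have "C / real k \<le> C" using k pos by (simp add: divide_le_eq)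
    hence aC: "a \<le> C" using a by linarith
    have "pi * g\<^sub>1 * (u * \<sigma>) = u * c / 4" using assms by (simp add: \<sigma>_def field_simps)
    moreover have "pi * g\<^sub>1 * (1 / (\<sigma> * g\<^sub>0)) = u * c / 4" using assms pos by (simp add: u_def field_simps)
    ultimately have total: "pi * g\<^sub>1 * (u * \<sigma> + 1 / (\<sigma> * g\<^sub>0)) = u * c / 2"
      by (subst distrib_left) linarith
    have "pi / real k * g\<^sub>1 * (u * \<sigma> + 1 / (\<sigma> * g\<^sub>0)) = pi * g\<^sub>1 * (u * \<sigma> + 1 / (\<sigma> * g\<^sub>0)) / real k"
      by simp
    also have "\<dots> = u * (c / real k) / 2" unfolding total by simp
    also have "\<dots> \<le> u * a / 2" using a pos by (intro divide_right_mono mult_left_mono) auto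
    finally have "u * a / 2 * exp (- u * a) \<le> prob {w \<in> space N. Y w \<le> a}"
      using a0 pos by (intro lower_tail[where \<sigma> = \<sigma>]) (auto simp: content)
    moreover have "(u * c / 2) / real k * exp (- u * C) \<le> u * a / 2 * exp (- u * a)"
    proof (intro mult_mono)
      show "(u * c / 2) / real k \<le> u * a / 2" using mult_left_mono[OF a(1), of u] pos by simp
    qed (use pos a0 aC in auto)
    ultimately have tail: "(u * c / 2) / real k * exp (- u * C) \<le> prob {w \<in> space N. Y w \<le> a}" by linarith
    have "q * \<eta>\<^sup>2 / (real k)\<^sup>2 = ((u * c / 2) / real k * exp (- u * C)) * (pi / real k * (g\<^sub>0 * (\<eta>\<^sup>2 / 9) * exp (- (2 + g\<^sub>1) * (C + 1)))) / (C + 1)"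
    proof -
      have "a * b * (pi * (g\<^sub>0 / 9) * e) / D * \<eta>\<^sup>2 / (real k)\<^sup>2
          = (a / real k * b) * (pi / real k * (g\<^sub>0 * (\<eta>\<^sup>2 / 9) * e)) / D" for a b e D
        by (simp add: power2_eq_square mult_ac)
      thus ?thesis unfolding q_def .
    qed
    also have "\<dots> \<le> prob {w \<in> space N. Y w \<le> a} * (pi / real k * (g\<^sub>0 * (\<eta>\<^sup>2 / 9) * exp (- (2 + g\<^sub>1) * (a + \<eta>)))) / (C + 1)"
    proof (intro divide_right_mono mult_mono tail)
      have "(2 + g\<^sub>1) * (a + \<eta>) \<le> (2 + g\<^sub>1) * (C + 1)" using aC \<eta> assms by (intro mult_left_mono) auto
      thus "exp (- (2 + g\<^sub>1) * (C + 1)) \<le> exp (- (2 + g\<^sub>1) * (a + \<eta>))" by (simp add: algebra_simps)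
    qed (use assms pos in auto)
    also have "\<dots> \<le> (a + \<eta>) * prob {w \<in> space N. a \<le> Y w \<and> Y w \<le> a + \<eta>} / (C + 1)"
      using small_ball_by_lower_tail[of a \<eta>] a0 \<eta> pos by (intro divide_right_mono) (auto simp: content)
    also have "\<dots> \<le> (C + 1) * prob {w \<in> space N. a \<le> Y w \<and> Y w \<le> a + \<eta>} / (C + 1)"
      using aC \<eta> pos by (intro divide_right_mono mult_right_mono) auto
    also have "\<dots> = prob {w \<in> space N. a \<le> Y w \<and> Y w \<le> a + \<eta>}" using pos by simp
    finally show "q * \<eta>\<^sup>2 / (real k)\<^sup>2 \<le> prob {w \<in> space N. a \<le> Y w \<and> Y w \<le> a + \<eta>}" .
  qed
qed

section \<open>Prior mass of sup norm neighbourhoods\<close>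

text \<open>The deterministic part of \<open>bernstein_poly\<close>, with free coefficients in place
  of scaled cell masses. A prior draw with \<open>Suc m\<close> cells is a curve of degree
  \<open>m\<close>.\<close>

definition bernstein_curve :: "nat \<Rightarrow> (nat \<Rightarrow> real) \<Rightarrow> real \<Rightarrow> real" where
  "bernstein_curve m c = (\<lambda>\<omega>\<in>{0..pi}. \<Sum>j\<le>m. c j * Bernstein m j (\<omega> / pi))"

lemma beta_density_eq_Bernstein:
  assumes "i \<le> m"
  shows "beta_density (Suc i) (Suc m - Suc i + 1) x = real (Suc m) * Bernstein m i x"
proof -
  have G: "Gamma (real (Suc n)) = fact n" for n
    using Gamma_fact[of n, where 'a = real] by (simp add: add.commute)
  have "Beta (real (Suc i)) (real (Suc (m - i))) = fact i * fact (m - i) / fact (Suc m)"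
  proof -
    have "real (Suc i) + real (Suc (m - i)) = real (Suc (Suc m))" using assms by simp
    thus ?thesis unfolding Beta_def by (simp only: G)
  qed
  hence dens: "beta_density (Suc i) (Suc m - Suc i + 1) x
      = x ^ i * (1 - x) ^ (m - i) / (fact i * fact (m - i) / fact (Suc m))"
    unfolding beta_density_def by simp
  have choose: "real (m choose i) = fact m / (fact i * fact (m - i))" using assms by (rule binomial_fact)
  show ?thesis unfolding dens Bernstein_def choose by (simp add: fact_Suc)
qed

lemma bernstein_poly_eq_curve:
  "bernstein_poly (Suc m) \<phi>
    = bernstein_curve m (\<lambda>i. real (Suc m) * measure \<phi> {real i * pi / real (Suc m) <.. real (Suc i) * pi / real (Suc m)})"
proof -
  have "(\<Sum>j=1..Suc m. measure \<phi> {real (j - 1) * pi / real (Suc m) <.. real j * pi / real (Suc m)}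
          * beta_density j (Suc m - j + 1) x)
      = (\<Sum>i\<le>m. measure \<phi> {real i * pi / real (Suc m) <.. real (Suc i) * pi / real (Suc m)} * beta_density (Suc i) (Suc m - Suc i + 1) x)" for x
    unfolding atLeast0AtMost[symmetric] One_nat_def sum.shift_bounds_cl_Suc_ivl by simp
  also have "\<dots> x = (\<Sum>i\<le>m. real (Suc m) * measure \<phi> {real i * pi / real (Suc m) <.. real (Suc i) * pi / real (Suc m)} * Bernstein m i x)" for x
    by (intro sum.cong refl) (simp only: beta_density_eq_Bernstein atMost_iff mult_ac)
  finally show ?thesis unfolding bernstein_poly_def bernstein_curve_def by simp
qed

lemma bernstein_curve_has_derivative:
  assumes x: "x \<in> {0..pi}"
  shows "(bernstein_curve (Suc m) c has_real_derivative
    real (Suc m) * (\<Sum>j\<le>m. (c (Suc j) - c j) * Bernstein m j (x / pi)) / pi) (at x within {0..pi})"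
proof -
  have "((\<lambda>\<omega>. \<Sum>j\<le>Suc m. c j * Bernstein (Suc m) j (\<omega> / pi)) has_real_derivative
      real (Suc m) * (\<Sum>j\<le>m. (c (Suc j) - c j) * Bernstein m j (x / pi)) * (1 / pi)) (at x within {0..pi})"
    by (rule DERIV_chain2[OF has_real_derivative_Bernstein_combination]) (auto intro!: derivative_eq_intros)
  hence "(bernstein_curve (Suc m) c has_real_derivative
      real (Suc m) * (\<Sum>j\<le>m. (c (Suc j) - c j) * Bernstein m j (x / pi)) * (1 / pi)) (at x within {0..pi})"
    unfolding has_field_derivative_def
    by (rule has_derivative_transform[rotated 2]) (use x in \<open>auto simp: bernstein_curve_def\<close>)
  thus ?thesis by simp
qed

lemma bernstein_curve_in_C1: "bernstein_curve m c \<in> C1_functions"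
proof -
  have "\<exists>f'. continuous_on {0..pi} f' \<and> (\<forall>x\<in>{0..pi}. (bernstein_curve m c has_real_derivative f' x) (at x within {0..pi}))"
  proof (cases m)
    case 0
    have "(bernstein_curve m c has_real_derivative 0) (at x within {0..pi})" if "x \<in> {0..pi}" for x
      unfolding has_field_derivative_def
      by (rule has_derivative_transform[OF that _ DERIV_const[of "c 0", unfolded has_field_derivative_def]])
         (auto simp: bernstein_curve_def 0 Bernstein_def)
    thus ?thesis by (intro exI[of _ "\<lambda>_. 0"]) auto
  next
    case (Suc k)
    have "continuous_on {0..pi} (\<lambda>x. real (Suc k) * (\<Sum>j\<le>k. (c (Suc j) - c j) * Bernstein k j (x / pi)) / pi)"
      unfolding Bernstein_def by (intro continuous_intros) auto
    thus ?thesis unfolding Suc using bernstein_curve_has_derivative by blast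
  qed
  thus ?thesis unfolding C1_functions_def C1_on_interval_def bernstein_curve_def by auto
qed

text \<open>The coefficients follow the shrunken function \<open>(1 - d) f\<^sub>0 + d (\<tau>\<^sub>0 + \<tau>\<^sub>1) / 2\<close>, which leaves room
  of order \<open>d\<close> in all constraints defining the Lipschitz ball.\<close>

lemma bernstein_curve_near:
  fixes f\<^sub>0 :: "real \<Rightarrow> real"
  assumes \<tau>: "0 < \<tau>\<^sub>0" "\<tau>\<^sub>0 < \<tau>\<^sub>1" and cont: "continuous_on {0..pi} f\<^sub>0"
    and ge: "\<And>x. x \<in> {0..pi} \<Longrightarrow> \<tau>\<^sub>0 \<le> f\<^sub>0 x"
    and lip: "\<And>x y z. x \<in> {0..pi} \<Longrightarrow> y \<in> {0..pi} \<Longrightarrow> z \<in> {0..pi} \<Longrightarrow> \<bar>f\<^sub>0 x\<bar> * \<bar>y - z\<bar> + \<bar>f\<^sub>0 y - f\<^sub>0 z\<bar> \<le> \<tau>\<^sub>1 * \<bar>y - z\<bar>"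
    and m: "1 \<le> m" and d: "0 < d" "d \<le> 1"
    and w: "\<And>j. j \<le> m \<Longrightarrow> \<bar>w j - ((1 - d) * f\<^sub>0 (real j * pi / real m) + d * ((\<tau>\<^sub>0 + \<tau>\<^sub>1) / 2))\<bar> \<le> d * (\<tau>\<^sub>1 - \<tau>\<^sub>0) / (2 * real (Suc m))"
  shows "bernstein_curve m w \<in> C_set \<tau>\<^sub>0 \<tau>\<^sub>1" and "\<And>x. x \<in> {0..pi} \<Longrightarrow> \<tau>\<^sub>0 \<le> bernstein_curve m w x"
    and "\<And>x. x \<in> {0..pi} \<Longrightarrow> \<bar>bernstein_curve m w x - f\<^sub>0 x\<bar> \<le> 2 * \<tau>\<^sub>1 * d + pi * \<tau>\<^sub>1 / sqrt (real m)"
proof -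
  define \<eta> where "\<eta> = d * (\<tau>\<^sub>1 - \<tau>\<^sub>0) / (2 * real (Suc m))"
  define cb where "cb = (\<tau>\<^sub>0 + \<tau>\<^sub>1) / 2"
  define t where "t j = real j * pi / real m" for j
  have t: "t j \<in> {0..pi}" if "j \<le> m" for j using that m by (auto simp: t_def divide_le_eq)
  have \<eta>: "0 < \<eta>" "\<eta> * real (Suc m) = d * (\<tau>\<^sub>1 - cb)" "\<eta> \<le> d * (cb - \<tau>\<^sub>0)"
  proof -
    show "0 < \<eta>" using \<tau> d by (simp add: \<eta>_def)
    show "\<eta> * real (Suc m) = d * (\<tau>\<^sub>1 - cb)" unfolding \<eta>_def cb_def by (simp add: field_simps del: of_nat_Suc)
    have "\<eta> \<le> d * (\<tau>\<^sub>1 - \<tau>\<^sub>0) / 2" unfolding \<eta>_def using \<tau> d by (intro divide_left_mono) auto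
    thus "\<eta> \<le> d * (cb - \<tau>\<^sub>0)" by (simp add: cb_def field_simps)
  qed
  \<comment> \<open>At a maximum point the three-point inequality leaves only
    \<open>L = \<tau>\<^sub>1 - M\<close> as Lipschitz constant of \<open>f\<^sub>0\<close>, so
    height and slope together stay within \<open>\<tau>\<^sub>1\<close>.\<close>
  obtain xm where xm: "xm \<in> {0..pi}" "\<And>x. x \<in> {0..pi} \<Longrightarrow> f\<^sub>0 x \<le> f\<^sub>0 xm"
    using continuous_attains_sup[OF compact_Icc _ cont] pi_ge_zero by auto
  define M where "M = f\<^sub>0 xm"
  define L where "L = \<tau>\<^sub>1 - M"
  have M: "\<tau>\<^sub>0 \<le> M" unfolding M_def using ge xm by auto
  have L: "\<bar>f\<^sub>0 y - f\<^sub>0 z\<bar> \<le> L * \<bar>y - z\<bar>" if "y \<in> {0..pi}" "z \<in> {0..pi}" for y z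
    using lip[OF xm(1) that] M \<tau> unfolding L_def M_def by (simp add: left_diff_distrib)
  have "0 \<le> L * pi" using L[of 0 pi] abs_ge_zero[of "f\<^sub>0 0 - f\<^sub>0 pi"] by simp
  hence L0: "0 \<le> L" by (metis zero_le_mult_iff pi_gt_zero not_le)
  have M1: "M \<le> \<tau>\<^sub>1" using L0 by (simp add: L_def)
  have wj: "\<bar>w j - ((1 - d) * f\<^sub>0 (t j) + d * cb)\<bar> \<le> \<eta>" if "j \<le> m" for j
    using w[OF that] unfolding \<eta>_def cb_def t_def .
  have w_lo: "\<tau>\<^sub>0 \<le> w j" if j: "j \<le> m" for j
  proof -
    have "(1 - d) * \<tau>\<^sub>0 \<le> (1 - d) * f\<^sub>0 (t j)" using ge[OF t[OF j]] d by (intro mult_left_mono) auto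
    thus ?thesis using wj[OF j] \<eta>(3) by (simp add: algebra_simps abs_le_iff)
  qed
  have w_hi: "w j \<le> (1 - d) * M + d * cb + \<eta>" if j: "j \<le> m" for j
  proof -
    have "(1 - d) * f\<^sub>0 (t j) \<le> (1 - d) * M" using xm(2)[OF t[OF j]] d unfolding M_def by (intro mult_left_mono) auto
    thus ?thesis using wj[OF j] by (simp add: abs_le_iff)
  qed
  have w_step: "\<bar>w (Suc j) - w j\<bar> \<le> (1 - d) * L * pi / real m + 2 * \<eta>" if j: "Suc j \<le> m" for j
  proof -
    have "\<bar>f\<^sub>0 (t (Suc j)) - f\<^sub>0 (t j)\<bar> \<le> L * \<bar>t (Suc j) - t j\<bar>" using t j by (intro L) auto
    also have "t (Suc j) - t j = pi / real m" unfolding t_def by (simp add: distrib_right add_divide_distrib)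
    finally have "(1 - d) * \<bar>f\<^sub>0 (t (Suc j)) - f\<^sub>0 (t j)\<bar> \<le> (1 - d) * (L * \<bar>pi / real m\<bar>)"
      using d by (intro mult_left_mono) auto
    hence "\<bar>(1 - d) * f\<^sub>0 (t (Suc j)) - (1 - d) * f\<^sub>0 (t j)\<bar> \<le> (1 - d) * L * pi / real m"
      using d by (simp add: abs_mult right_diff_distrib[symmetric])
    thus ?thesis using wj[of j] wj[of "Suc j"] j by linarith
  qed
  have curve: "bernstein_curve m w x = (\<Sum>j\<le>m. w j * Bernstein m j (x / pi))" if "x \<in> {0..pi}" for x
    using that by (simp add: bernstein_curve_def)
  have x01: "0 \<le> x / pi" "x / pi \<le> 1" if "x \<in> {0..pi}" for x using that by auto
  show lo: "\<tau>\<^sub>0 \<le> bernstein_curve m w x" if x: "x \<in> {0..pi}" for x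
    unfolding curve[OF x] by (rule Bernstein_combination_bounds(1)[OF x01[OF x] w_lo w_hi])
  have hi: "bernstein_curve m w x \<le> (1 - d) * M + d * cb + \<eta>" if x: "x \<in> {0..pi}" for x
    unfolding curve[OF x] by (rule Bernstein_combination_bounds(2)[OF x01[OF x] w_lo w_hi])
  obtain m' where m': "m = Suc m'" using m by (cases m) auto
  define Lw where "Lw = real m * ((1 - d) * L * pi / real m + 2 * \<eta>) / pi"
  have deriv: "\<bar>real (Suc m') * (\<Sum>j\<le>m'. (w (Suc j) - w j) * Bernstein m' j (x / pi)) / pi\<bar> \<le> Lw" if x: "x \<in> {0..pi}" for x
  proof -
    define s where "s = (1 - d) * L * pi / real m + 2 * \<eta>"
    have "w (Suc j) - w j \<le> s" "- s \<le> w (Suc j) - w j" if "j \<le> m'" for j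
      using w_step[of j] that unfolding m' s_def by (auto simp: abs_le_iff)
    hence "\<bar>\<Sum>j\<le>m'. (w (Suc j) - w j) * Bernstein m' j (x / pi)\<bar> \<le> s"
      unfolding abs_le_iff
      using Bernstein_combination_bounds[OF x01[OF x], of m' "- s" "\<lambda>j. w (Suc j) - w j" s] by auto
    hence "real m * \<bar>\<Sum>j\<le>m'. (w (Suc j) - w j) * Bernstein m' j (x / pi)\<bar> / pi \<le> real m * s / pi"
      by (intro divide_right_mono mult_left_mono) auto
    thus ?thesis unfolding Lw_def s_def m' by (simp add: abs_mult)
  qed
  have Lip: "\<bar>bernstein_curve m w y - bernstein_curve m w z\<bar> \<le> Lw * \<bar>y - z\<bar>" if "y \<in> {0..pi}" "z \<in> {0..pi}" for y z
    using field_differentiable_bound[of "{0..pi}" "bernstein_curve m w"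
        "\<lambda>x. real (Suc m') * (\<Sum>j\<le>m'. (w (Suc j) - w j) * Bernstein m' j (x / pi)) / pi" Lw y z]
      bernstein_curve_has_derivative deriv that unfolding m' by simp
  \<comment> \<open>The budget: the shrunken \<open>f\<^sub>0\<close> consumes
    \<open>(1 - d) * (M + L) = (1 - d) * \<tau>\<^sub>1\<close> and the constant
    \<open>d * cb\<close>. The remaining \<open>d * (\<tau>\<^sub>1 - cb) = \<eta> * (m + 1)\<close>
    pays for the coefficient errors, \<eta> in height and at most \<open>\<eta> * m\<close> in
    slope. This dictates the factor \<open>1 / (m + 1)\<close> in the tolerance.\<close>
  have total: "(1 - d) * M + d * cb + \<eta> + Lw \<le> \<tau>\<^sub>1"
  proof -
    have "Lw = (1 - d) * L + 2 * \<eta> * real m / pi" unfolding Lw_def using m by (simp add: field_simps)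
    moreover have "2 * \<eta> * real m / pi \<le> \<eta> * real m"
    proof -
      have "\<eta> * real m * 2 \<le> \<eta> * real m * pi" using \<eta>(1) pi_ge_two by (intro mult_left_mono) auto
      thus ?thesis by (simp add: divide_le_eq mult_ac)
    qed
    moreover have "\<eta> + \<eta> * real m = d * (\<tau>\<^sub>1 - cb)" using \<eta>(2) by (simp add: algebra_simps)
    moreover have "(1 - d) * M + (1 - d) * L = (1 - d) * \<tau>\<^sub>1" by (simp add: L_def algebra_simps)
    ultimately show ?thesis by (simp add: algebra_simps)
  qed
  show "bernstein_curve m w \<in> C_set \<tau>\<^sub>0 \<tau>\<^sub>1"
    unfolding C_set_iff[OF \<tau>(1)]
  proof (intro conjI ballI bernstein_curve_in_C1)
    show "\<tau>\<^sub>0 \<le> \<bar>bernstein_curve m w x\<bar>" if "x \<in> {0..pi}" for x using lo[OF that] by linarith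
    fix x y z assume xyz: "x \<in> {0..pi}" "y \<in> {0..pi}" "z \<in> {0..pi}"
    have "\<bar>bernstein_curve m w x\<bar> \<le> \<tau>\<^sub>1 - Lw" using lo[OF xyz(1)] hi[OF xyz(1)] \<tau> total by simp
    hence "\<bar>bernstein_curve m w x\<bar> * \<bar>y - z\<bar> \<le> (\<tau>\<^sub>1 - Lw) * \<bar>y - z\<bar>" by (intro mult_right_mono) auto
    thus "\<bar>bernstein_curve m w x\<bar> * \<bar>y - z\<bar> + \<bar>bernstein_curve m w y - bernstein_curve m w z\<bar> \<le> \<tau>\<^sub>1 * \<bar>y - z\<bar>"
      using Lip[OF xyz(2,3)] by (simp add: algebra_simps)
  qed
  fix x assume x: "x \<in> {0..pi}"
  define h where "h s = f\<^sub>0 (pi * s)" for s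
  have h_lip: "\<bar>h s - h s'\<bar> \<le> (L * pi) * \<bar>s - s'\<bar>" if "s \<in> {0..1}" "s' \<in> {0..1}" for s s'
    using L[of "pi * s" "pi * s'"] that unfolding h_def by (simp add: mult_left_le abs_mult right_diff_distrib[symmetric])
  have "\<bar>(\<Sum>j\<le>m. h (real j / real m) * Bernstein m j (x / pi)) - h (x / pi)\<bar> \<le> L * pi / sqrt (real m)"
    using m by (intro Bernstein_operator_error x01[OF x] h_lip) auto
  moreover have "L * pi / sqrt (real m) \<le> pi * \<tau>\<^sub>1 / sqrt (real m)"
    using M \<tau> by (intro divide_right_mono) (auto simp: L_def)
  moreover have "h (x / pi) = f\<^sub>0 x" by (simp add: h_def)
  moreover have "\<bar>bernstein_curve m w x - (\<Sum>j\<le>m. h (real j / real m) * Bernstein m j (x / pi))\<bar> \<le> 2 * \<tau>\<^sub>1 * d"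
  proof -
    have dev: "\<bar>w j - h (real j / real m)\<bar> \<le> 2 * \<tau>\<^sub>1 * d" if j: "j \<le> m" for j
    proof -
      have hj: "h (real j / real m) = f\<^sub>0 (t j)" by (simp add: h_def t_def mult.commute)
      have "\<bar>cb - f\<^sub>0 (t j)\<bar> \<le> \<tau>\<^sub>1"
        using ge[OF t[OF j]] xm(2)[OF t[OF j]] M1 \<tau> unfolding M_def cb_def by (auto simp: abs_le_iff field_simps)
      hence "d * \<bar>cb - f\<^sub>0 (t j)\<bar> \<le> d * \<tau>\<^sub>1" using d by (intro mult_left_mono) auto
      moreover have "\<eta> \<le> d * \<tau>\<^sub>1"
      proof -
        have "d * (cb - \<tau>\<^sub>0) \<le> d * \<tau>\<^sub>1" using d \<tau> by (intro mult_left_mono) (auto simp: cb_def field_simps)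
        thus ?thesis using \<eta>(3) by linarith
      qed
      moreover have "\<bar>w j - f\<^sub>0 (t j)\<bar> \<le> \<eta> + \<bar>d * (cb - f\<^sub>0 (t j))\<bar>"
        using wj[OF j] by (simp add: algebra_simps)
      moreover have "\<bar>d * (cb - f\<^sub>0 (t j))\<bar> = d * \<bar>cb - f\<^sub>0 (t j)\<bar>" using d by (simp add: abs_mult)
      moreover have "2 * \<tau>\<^sub>1 * d = d * \<tau>\<^sub>1 + d * \<tau>\<^sub>1" by simp
      ultimately show ?thesis unfolding hj by linarith
    qed
    have "w j - h (real j / real m) \<le> 2 * \<tau>\<^sub>1 * d" "- (2 * \<tau>\<^sub>1 * d) \<le> w j - h (real j / real m)" if "j \<le> m" for j
      using dev[OF that] by linarith+
    moreover have "bernstein_curve m w x - (\<Sum>j\<le>m. h (real j / real m) * Bernstein m j (x / pi))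
        = (\<Sum>j\<le>m. (w j - h (real j / real m)) * Bernstein m j (x / pi))"
      unfolding curve[OF x] by (simp add: left_diff_distrib sum_subtractf)
    ultimately show ?thesis
      using Bernstein_combination_bounds[OF x01[OF x], of m "- (2 * \<tau>\<^sub>1 * d)" "\<lambda>j. w j - h (real j / real m)" "2 * \<tau>\<^sub>1 * d"]
      by (simp add: abs_le_iff)
  qed
  ultimately show "\<bar>bernstein_curve m w x - f\<^sub>0 x\<bar> \<le> 2 * \<tau>\<^sub>1 * d + pi * \<tau>\<^sub>1 / sqrt (real m)" by linarith
qed

section \<open>The prior as a law on functions\<close>

lemma bernstein_poly_degree_0: "bernstein_poly 0 \<phi> = (\<lambda>\<omega>\<in>{0..pi}. 0)"
  by (simp add: bernstein_poly_def)

lemma greaterThanAtMost_subset_atLeastAtMost: "0 \<le> (a :: real) \<Longrightarrow> b \<le> c \<Longrightarrow> {a<..b} \<subseteq> {0..c}"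
  by auto

text \<open>Since \<open>k\<close> is discrete, joint measurability reduces to fixed
  \<open>k\<close>, where the coefficients are measurable cell masses.\<close>

lemma bernstein_poly_measurable:
  assumes gp: "gamma_process N \<Phi> \<alpha> \<beta>"
  shows "(\<lambda>(k, w). bernstein_poly k (\<Phi> w)) \<in> measurable (measure_pmf p \<Otimes>\<^sub>M N) C1_space"
proof -
  have m: "(\<lambda>w. measure (\<Phi> w) A) \<in> borel_measurable N" if "A \<in> sets (restrict_space borel {0..pi})" for A
    using gp that unfolding gamma_process_def completely_random_measure_def random_measure_def by blast
  have k: "(\<lambda>w. bernstein_poly k (\<Phi> w)) \<in> measurable N C1_space" for k
    unfolding C1_space_def
  proof (rule measurable_restrict_space2)
    have "bernstein_poly k \<phi> \<in> C1_functions" for \<phi>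
    proof (cases k)
      case 0
      have "bernstein_poly k \<phi> = bernstein_curve 0 (\<lambda>_. 0)"
        by (simp add: 0 bernstein_poly_degree_0 bernstein_curve_def)
      thus ?thesis using bernstein_curve_in_C1 by simp
    qed (simp add: bernstein_poly_eq_curve bernstein_curve_in_C1)
    thus "(\<lambda>w. bernstein_poly k (\<Phi> w)) \<in> space N \<rightarrow> C1_functions" by auto
    have I: "{real (j - 1) * pi / real k <.. real j * pi / real k} \<in> sets (restrict_space borel {0..pi})" if "j \<in> {1..k}" for j
    proof -
      have "real j * pi / real k \<le> pi" "0 \<le> real (j - 1) * pi / real k" using that by (auto simp: divide_le_eq)
      hence "{real (j - 1) * pi / real k <.. real j * pi / real k} \<subseteq> {0..pi}"
        by (intro greaterThanAtMost_subset_atLeastAtMost)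
      thus ?thesis by (auto simp: sets_restrict_space_iff)
    qed
    show "(\<lambda>w. bernstein_poly k (\<Phi> w)) \<in> measurable N (Pi\<^sub>M {0..pi} (\<lambda>_. borel))"
      unfolding bernstein_poly_def
      by (intro measurable_restrict borel_measurable_sum borel_measurable_times m I borel_measurable_const)
  qed
  have "(\<lambda>p. bernstein_poly (fst p) (\<Phi> (snd p))) \<in> measurable (count_space UNIV \<Otimes>\<^sub>M N) C1_space"
    by (rule measurable_pair_measure_countable1) (auto intro: k)
  moreover have "sets (measure_pmf p \<Otimes>\<^sub>M N) = sets (count_space UNIV \<Otimes>\<^sub>M N)"
    by (rule sets_pair_measure_cong) auto
  ultimately show ?thesis by (simp add: case_prod_beta' cong: measurable_cong_sets)
qed

text \<open>Selects the positive branch of the Lipschitz ball, whose definition leaves the sign of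
  \<open>f\<close> open.\<close>

lemma bernstein_gamma_prior_nonneg:
  assumes gp: "gamma_process N \<Phi> \<alpha> \<beta>"
  shows "AE f in bernstein_gamma_prior p N \<Phi>. 0 \<le> f 0"
proof -
  have [measurable]: "(\<lambda>f. f 0) \<in> borel_measurable C1_space" by (rule evaluation_measurable) simp
  have nonneg: "0 \<le> bernstein_poly k \<phi> 0" for k \<phi>
  proof (cases k)
    case (Suc m)
    have "(\<Sum>j\<le>m. real (Suc m) * measure \<phi> {real j * pi / real (Suc m) <.. real (Suc j) * pi / real (Suc m)} * Bernstein m j 0) \<ge> 0"
      by (intro sum_nonneg mult_nonneg_nonneg Bernstein_nonneg) auto
    thus ?thesis unfolding Suc bernstein_poly_eq_curve bernstein_curve_def by simp
  qed (simp add: bernstein_poly_degree_0)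
  show ?thesis
    unfolding bernstein_gamma_prior_def
    by (subst AE_distr_iff[OF bernstein_poly_measurable[OF gp]]) (use nonneg in \<open>auto simp: case_prod_beta\<close>)
qed

text \<open>For given \<open>k\<close>, closeness of all coefficients to their targets is an
  intersection of \<open>k\<close> independent cell events, each of probability at least
  \<open>b / k ^ 8\<close>. With the lower bound on the weight of \<open>k\<close> this amounts to
  \<open>exp (- const * k * ln k)\<close>, relaxed to \<open>exp (- B * k\<^sup>2)\<close>; a power
  of \<open>ln n\<close> in the place of \<open>k\<close> keeps even this cheap.\<close>

lemma bernstein_gamma_prior_mass:
  fixes \<Phi> :: "'v \<Rightarrow> real measure"
  assumes gp: "gamma_process N \<Phi> \<alpha> \<beta>"
    and \<alpha>: "\<alpha> \<in> borel_measurable (restrict_space borel {0..pi})"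
    and \<beta>: "\<beta> \<in> borel_measurable (restrict_space borel {0..pi})"
    and pos: "\<And>x. x \<in> {0..pi} \<Longrightarrow> 0 < \<alpha> x \<and> 0 < \<beta> x"
    and G: "assumption_G \<alpha> \<beta>" and K: "assumption_K p"
    and \<tau>: "0 < \<tau>\<^sub>0" "\<tau>\<^sub>0 < \<tau>\<^sub>1" and cont: "continuous_on {0..pi} f\<^sub>0"
    and ge: "\<And>x. x \<in> {0..pi} \<Longrightarrow> \<tau>\<^sub>0 \<le> f\<^sub>0 x"
    and lip: "\<And>x y z. x \<in> {0..pi} \<Longrightarrow> y \<in> {0..pi} \<Longrightarrow> z \<in> {0..pi} \<Longrightarrow> \<bar>f\<^sub>0 x\<bar> * \<bar>y - z\<bar> + \<bar>f\<^sub>0 y - f\<^sub>0 z\<bar> \<le> \<tau>\<^sub>1 * \<bar>y - z\<bar>"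
  obtains R B where "0 < R" "0 < B"
    and "\<And>k V. 2 \<le> k \<Longrightarrow> V \<in> sets C1_space \<Longrightarrow>
      {f \<in> C_set \<tau>\<^sub>0 \<tau>\<^sub>1. 0 < f 0 \<and> (\<forall>x\<in>{0..pi}. \<bar>f x - f\<^sub>0 x\<bar> \<le> R / sqrt (real k))} \<subseteq> V \<Longrightarrow>
      exp (- B * (real k)\<^sup>2) \<le> measure (bernstein_gamma_prior p N \<Phi>) V"
proof -
  obtain g\<^sub>0 g\<^sub>1 where g: "0 < g\<^sub>0" "0 < g\<^sub>1"
      "AE x in lborel. x \<in> {0..pi} \<longrightarrow> g\<^sub>0 \<le> \<alpha> x \<and> \<alpha> x \<le> g\<^sub>1 \<and> g\<^sub>0 \<le> \<beta> x \<and> \<beta> x \<le> g\<^sub>1"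
    using G unfolding assumption_G_def by blast
  obtain A\<^sub>1 \<kappa>\<^sub>1 where K1: "0 < A\<^sub>1" "0 < \<kappa>\<^sub>1" "\<And>j. 1 \<le> j \<Longrightarrow> A\<^sub>1 * exp (- \<kappa>\<^sub>1 * real j * ln (real j)) \<le> pmf p j"
    using K unfolding assumption_K_def by blast
  have crm: "completely_random_measure N (restrict_space borel {0..pi}) \<Phi>"
    using gp unfolding gamma_process_def by blast
  interpret N: prob_space N using crm unfolding completely_random_measure_def by blast
  have "\<tau>\<^sub>0 \<le> \<tau>\<^sub>1" using \<tau> by simp
  obtain q where q: "0 < q" and ball: "\<And>(N :: 'v measure) Y A \<alpha> \<beta> k a \<eta>. gamma_increment N Y A \<alpha> \<beta> g\<^sub>0 g\<^sub>1 \<Longrightarrow> 1 \<le> k \<Longrightarrow>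
      measure lborel A = pi / real k \<Longrightarrow> \<tau>\<^sub>0 / real k \<le> a \<Longrightarrow> a \<le> \<tau>\<^sub>1 / real k \<Longrightarrow> 0 < \<eta> \<Longrightarrow> \<eta> \<le> 1 \<Longrightarrow>
      q * \<eta>\<^sup>2 / (real k)\<^sup>2 \<le> measure N {w \<in> space N. a \<le> Y w \<and> Y w \<le> a + \<eta>}"
    using gamma_small_ball[OF g(1,2) \<tau>(1) \<open>\<tau>\<^sub>0 \<le> \<tau>\<^sub>1\<close>] by blast
  \<comment> \<open>The cap 1 keeps the interval lengths within the range of the small ball
    bound.\<close>
  define D where "D = min 1 (\<tau>\<^sub>1 - \<tau>\<^sub>0)"
  have D: "0 < D" "D \<le> 1" "D \<le> \<tau>\<^sub>1 - \<tau>\<^sub>0" using \<tau> by (auto simp: D_def)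
  define b where "b = q * D\<^sup>2"
  have b: "0 < b" using q D by (simp add: b_def)
  \<comment> \<open>\<open>2 * \<tau>\<^sub>1\<close> covers the shrinking with
    \<open>d = 1 / k\<close>. The rest covers the Bernstein error, doubled because the degree is
    \<open>m = k - 1\<close> and \<open>sqrt k \<le> 2 * sqrt m\<close>.\<close>
  define R where "R = 2 * \<tau>\<^sub>1 + 2 * pi * \<tau>\<^sub>1"
  define B where "B = \<kappa>\<^sub>1 + \<bar>ln A\<^sub>1\<bar> + \<bar>ln b\<bar> + 8"
  have mass: "A\<^sub>1 * exp (- \<kappa>\<^sub>1 * real k * ln (real k)) * (b / real k ^ 8) ^ k \<le> measure (bernstein_gamma_prior p N \<Phi>) V"
    if k: "2 \<le> k" and V: "V \<in> sets C1_space"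
      and sub: "{f \<in> C_set \<tau>\<^sub>0 \<tau>\<^sub>1. 0 < f 0 \<and> (\<forall>x\<in>{0..pi}. \<bar>f x - f\<^sub>0 x\<bar> \<le> R / sqrt (real k))} \<subseteq> V" for k V
  proof -
    obtain m where m: "k = Suc m" "1 \<le> m" using k by (cases k) auto
    define d where "d = 1 / real k"
    have d: "0 < d" "d \<le> 1" using k by (auto simp: d_def)
    define I where "I i = {real i * pi / real k <.. real (Suc i) * pi / real k}" for i
    define c where "c j = (1 - d) * f\<^sub>0 (real j * pi / real m) + d * ((\<tau>\<^sub>0 + \<tau>\<^sub>1) / 2)" for j
    define \<eta> where "\<eta> = d * D / (2 * real k)"
    \<comment> \<open>A coefficient is \<open>k\<close> times a cell mass, so the window of
      half-width \<eta> around \<open>c j\<close> becomes the interval of length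
      \<open>2 * \<eta> / k\<close> starting at \<open>a j\<close>.\<close>
    define a where "a j = (c j - \<eta>) / real k" for j
    define Y where "Y i w = measure (\<Phi> w) (I i)" for i w
    define E where "E i = {w \<in> space N. a i \<le> Y i w \<and> Y i w \<le> a i + 2 * \<eta> / real k}" for i
    have I_sub: "I i \<subseteq> {0..pi}" "I i \<in> sets borel" if "i < k" for i
    proof -
      have "real (Suc i) * pi / real k \<le> pi" "0 \<le> real i * pi / real k"
        using that k by (auto simp: divide_le_eq intro!: mult_right_mono)
      thus "I i \<subseteq> {0..pi}" unfolding I_def by (intro greaterThanAtMost_subset_atLeastAtMost)
    qed (simp add: I_def)
    have I_sets: "I i \<in> sets (restrict_space borel {0..pi})" if "i < k" for i
      using I_sub[OF that] by (auto simp: sets_restrict_space_iff)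
    have "disjoint_family_on I {..<k}"
    proof (unfold disjoint_family_on_def, intro ballI impI)
      have *: "I i \<inter> I j = {}" if "i < j" for i j
      proof -
        have "real (Suc i) * pi / real k \<le> real j * pi / real k"
          using that by (intro divide_right_mono mult_right_mono) auto
        thus ?thesis unfolding I_def by auto
      qed
      fix i j :: nat assume "i \<noteq> j"
      thus "I i \<inter> I j = {}" using *[of i j] *[of j i] by (cases "i < j") auto
    qed
    hence indep: "N.indep_vars (\<lambda>_. borel) Y {..<k}"
      using crm I_sets unfolding completely_random_measure_def Y_def[abs_def] by blast
    have ball_i: "b / real k ^ 8 \<le> N.prob (E i)" if i: "i < k" for i
    proof -
      have inc: "gamma_increment N (Y i) (I i) (\<lambda>x. indicator {0..pi} x * \<alpha> x) (\<lambda>x. indicator {0..pi} x * \<beta> x) g\<^sub>0 g\<^sub>1"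
        unfolding Y_def by (rule N.gamma_process_increment[OF gp \<alpha> \<beta> pos g I_sub(2,1)[OF i]])
      have t: "real i * pi / real m \<in> {0..pi}" using i m by (auto simp: divide_le_eq)
      have "f\<^sub>0 (real i * pi / real m) \<le> \<tau>\<^sub>1"
      proof -
        have "\<bar>f\<^sub>0 (real i * pi / real m)\<bar> * pi + \<bar>f\<^sub>0 0 - f\<^sub>0 pi\<bar> \<le> \<tau>\<^sub>1 * pi"
          using lip[OF t, of 0 pi] by simp
        hence "\<bar>f\<^sub>0 (real i * pi / real m)\<bar> * pi \<le> \<tau>\<^sub>1 * pi" using abs_ge_zero[of "f\<^sub>0 0 - f\<^sub>0 pi"] by linarith
        hence "\<bar>f\<^sub>0 (real i * pi / real m)\<bar> \<le> \<tau>\<^sub>1" using pi_gt_zero by (simp only: mult_le_cancel_right_pos)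
        thus ?thesis by simp
      qed
      hence c1: "c i \<le> (1 - d) * \<tau>\<^sub>1 + d * \<tau>\<^sub>1"
        unfolding c_def using d \<tau> by (intro add_mono mult_left_mono) auto
      have c0: "(1 - d) * \<tau>\<^sub>0 + d * ((\<tau>\<^sub>0 + \<tau>\<^sub>1) / 2) \<le> c i"
        unfolding c_def using d ge[OF t] by (intro add_mono mult_left_mono) auto
      have \<eta>0: "0 < \<eta>" using d D k by (simp add: \<eta>_def)
      have "\<eta> \<le> d * D / 2" unfolding \<eta>_def using k d D by (intro divide_left_mono) auto
      also have "\<dots> \<le> d * ((\<tau>\<^sub>1 - \<tau>\<^sub>0) / 2)" using d D by simp
      finally have "\<eta> \<le> d * ((\<tau>\<^sub>1 - \<tau>\<^sub>0) / 2)" .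
      moreover have "(1 - d) * \<tau>\<^sub>0 + d * ((\<tau>\<^sub>0 + \<tau>\<^sub>1) / 2) = \<tau>\<^sub>0 + d * ((\<tau>\<^sub>1 - \<tau>\<^sub>0) / 2)"
        by (simp add: field_simps)
      ultimately have \<eta>1: "\<tau>\<^sub>0 \<le> c i - \<eta>" using c0 by linarith
      \<comment> \<open>One factor \<open>1 / k\<close> comes from \<open>d\<close>, one from the
        tolerance and one from the scaling of the mass. Squared and divided by
        \<open>k\<^sup>2\<close> as in the small ball bound, this gives the power 8.\<close>
      have \<eta>2: "2 * \<eta> / real k = D / (real k) ^ 3" unfolding \<eta>_def d_def by (simp add: power3_eq_cube)
      have "1 \<le> real k ^ 3" using k by (intro one_le_power) simp
      hence le1: "2 * \<eta> / real k \<le> 1" unfolding \<eta>2 using D by (subst divide_le_eq_1_pos) linarith+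
      have len: "measure lborel (I i) = pi / real k"
        unfolding I_def using k by (simp add: diff_divide_distrib[symmetric] left_diff_distrib[symmetric] divide_right_mono)
      have "q * (2 * \<eta> / real k)\<^sup>2 / (real k)\<^sup>2 \<le> N.prob (E i)"
        unfolding E_def
      proof (rule ball[OF inc _ len])
        show "\<tau>\<^sub>0 / real k \<le> a i" unfolding a_def using \<eta>1 by (intro divide_right_mono) auto
        show "a i \<le> \<tau>\<^sub>1 / real k" unfolding a_def using c1 \<eta>0 by (intro divide_right_mono) (auto simp: algebra_simps)
        show "0 < 2 * \<eta> / real k" using \<eta>0 k by simp
      qed (use k le1 in auto)
      moreover have "q * (2 * \<eta> / real k)\<^sup>2 / (real k)\<^sup>2 = b / real k ^ 8"
        unfolding \<eta>2 b_def by (simp add: power_divide flip: power_add power_mult)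
      ultimately show ?thesis by simp
    qed
    have in_V: "bernstein_poly k (\<Phi> w) \<in> V" if w: "\<And>i. i < k \<Longrightarrow> w \<in> E i" for w
    proof -
      define W where "W i = real (Suc m) * measure (\<Phi> w) {real i * pi / real (Suc m) <.. real (Suc i) * pi / real (Suc m)}" for i
      have W: "\<bar>W j - c j\<bar> \<le> d * (\<tau>\<^sub>1 - \<tau>\<^sub>0) / (2 * real (Suc m))" if j: "j \<le> m" for j
      proof -
        have Wj: "W j = real k * Y j w" by (simp add: W_def Y_def I_def m)
        have "a j \<le> Y j w" "Y j w \<le> a j + 2 * \<eta> / real k" using w[of j] j m by (auto simp: E_def)
        hence "real k * a j \<le> W j" "W j \<le> real k * (a j + 2 * \<eta> / real k)"
          unfolding Wj by (intro mult_left_mono; simp)+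
        moreover have "real k * a j = c j - \<eta>" "real k * (a j + 2 * \<eta> / real k) = c j + \<eta>"
          using k by (auto simp: a_def distrib_left)
        ultimately have "\<bar>W j - c j\<bar> \<le> \<eta>" by linarith
        also have "\<eta> \<le> d * (\<tau>\<^sub>1 - \<tau>\<^sub>0) / (2 * real (Suc m))"
          unfolding \<eta>_def m using D d by (intro divide_right_mono mult_left_mono) auto
        finally show ?thesis .
      qed
      have eq: "bernstein_poly k (\<Phi> w) = bernstein_curve m W"
        unfolding m bernstein_poly_eq_curve W_def ..
      note near = bernstein_curve_near[OF \<tau> cont ge lip m(2) d W[unfolded c_def], folded eq]
      have le: "2 * \<tau>\<^sub>1 * d + pi * \<tau>\<^sub>1 / sqrt (real m) \<le> R / sqrt (real k)"
      proof -
        have "sqrt (real k) \<le> real k" using k by (intro real_le_lsqrt) (auto simp: power2_eq_square)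
        hence "d \<le> 1 / sqrt (real k)" unfolding d_def using k by (intro frac_le) auto
        hence "2 * \<tau>\<^sub>1 * d \<le> 2 * \<tau>\<^sub>1 * (1 / sqrt (real k))" using \<tau> by (intro mult_left_mono) auto
        moreover have "sqrt (real k) \<le> sqrt (4 * real m)" using m by (intro real_sqrt_le_mono) simp
        hence "sqrt (real k) \<le> 2 * sqrt (real m)" by (simp add: real_sqrt_mult)
        hence "pi * \<tau>\<^sub>1 / sqrt (real m) \<le> pi * \<tau>\<^sub>1 * (2 / sqrt (real k))"
        proof -
          assume "sqrt (real k) \<le> 2 * sqrt (real m)"
          hence "1 / sqrt (real m) \<le> 2 / sqrt (real k)" using m k by (simp add: field_simps)
          hence "pi * \<tau>\<^sub>1 * (1 / sqrt (real m)) \<le> pi * \<tau>\<^sub>1 * (2 / sqrt (real k))" using \<tau> by (intro mult_left_mono) auto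
          thus ?thesis by simp
        qed
        moreover have "R / sqrt (real k) = 2 * \<tau>\<^sub>1 * (1 / sqrt (real k)) + pi * \<tau>\<^sub>1 * (2 / sqrt (real k))"
          by (simp add: R_def add_divide_distrib)
        ultimately show ?thesis by linarith
      qed
      have "\<bar>bernstein_poly k (\<Phi> w) x - f\<^sub>0 x\<bar> \<le> R / sqrt (real k)" if "x \<in> {0..pi}" for x
        by (rule order_trans[OF near(3) le]) (use that in auto)
      moreover have "0 < bernstein_poly k (\<Phi> w) 0" using near(2)[of 0] \<tau> by simp
      ultimately have "bernstein_poly k (\<Phi> w) \<in> {f \<in> C_set \<tau>\<^sub>0 \<tau>\<^sub>1. 0 < f 0 \<and> (\<forall>x\<in>{0..pi}. \<bar>f x - f\<^sub>0 x\<bar> \<le> R / sqrt (real k))}"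
        using near(1) by blast
      thus ?thesis using sub by blast
    qed
    have "0 \<in> {..<k}" using k by simp
    hence ne: "{..<k} \<noteq> {}" by blast
    have E_ev: "E i \<in> {Y i -` A \<inter> space N | A. A \<in> sets borel}" for i
      unfolding E_def by (auto intro!: exI[of _ "{a i..a i + 2 * \<eta> / real k}"])
    have "(b / real k ^ 8) ^ k = (\<Prod>i\<in>{..<k}. b / real k ^ 8)" by simp
    also have "\<dots> \<le> (\<Prod>i\<in>{..<k}. N.prob (E i))" using ball_i b by (intro prod_mono) auto
    also have "\<dots> = N.prob (\<Inter>i\<in>{..<k}. E i)"
    proof (rule N.indep_setsD[symmetric])
      show "N.indep_sets (\<lambda>i. {Y i -` A \<inter> space N | A. A \<in> sets borel}) {..<k}"
        using indep unfolding N.indep_vars_def2 by blast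
      show "{..<k} \<noteq> {}" by (rule ne)
    qed (use E_ev in blast)+
    finally have box: "(b / real k ^ 8) ^ k \<le> N.prob (\<Inter>i\<in>{..<k}. E i)" .
    interpret P: pair_prob_space "measure_pmf p" N ..
    have Y_meas: "Y i \<in> borel_measurable N" if "i < k" for i
      using indep that unfolding N.indep_vars_def2 by auto
    have E_meas: "E i \<in> sets N" if "i < k" for i
      unfolding E_def using Y_meas[OF that] by measurable
    have box_meas: "(\<Inter>i\<in>{..<k}. E i) \<in> sets N" using E_meas ne by (intro sets.finite_INT) auto
    have meas: "(\<lambda>(k, w). bernstein_poly k (\<Phi> w)) \<in> measurable (measure_pmf p \<Otimes>\<^sub>M N) C1_space"
      by (rule bernstein_poly_measurable[OF gp])
    have "pmf p k * (b / real k ^ 8) ^ k \<le> pmf p k * N.prob (\<Inter>i\<in>{..<k}. E i)"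
      using box by (intro mult_left_mono) auto
    also have "\<dots> = measure (measure_pmf p \<Otimes>\<^sub>M N) ({k} \<times> (\<Inter>i\<in>{..<k}. E i))"
      using box_meas by (simp add: measure_def N.emeasure_pair_measure_Times enn2real_mult pmf.rep_eq)
    also have "\<dots> \<le> measure (measure_pmf p \<Otimes>\<^sub>M N) ((\<lambda>(k, w). bernstein_poly k (\<Phi> w)) -` V \<inter> space (measure_pmf p \<Otimes>\<^sub>M N))"
    proof (rule P.finite_measure_mono)
      show "{k} \<times> (\<Inter>i\<in>{..<k}. E i) \<subseteq> (\<lambda>(k, w). bernstein_poly k (\<Phi> w)) -` V \<inter> space (measure_pmf p \<Otimes>\<^sub>M N)"
        using in_V k by (force simp: space_pair_measure E_def)
      show "(\<lambda>(k, w). bernstein_poly k (\<Phi> w)) -` V \<inter> space (measure_pmf p \<Otimes>\<^sub>M N) \<in> sets (measure_pmf p \<Otimes>\<^sub>M N)"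
        by (rule measurable_sets[OF meas V])
    qed
    also have "\<dots> = measure (bernstein_gamma_prior p N \<Phi>) V"
      unfolding bernstein_gamma_prior_def by (rule measure_distr[OF meas V, symmetric])
    finally have "pmf p k * (b / real k ^ 8) ^ k \<le> measure (bernstein_gamma_prior p N \<Phi>) V" .
    moreover have "A\<^sub>1 * exp (- \<kappa>\<^sub>1 * real k * ln (real k)) * (b / real k ^ 8) ^ k \<le> pmf p k * (b / real k ^ 8) ^ k"
      using K1(3)[of k] k b by (intro mult_right_mono) auto
    ultimately show ?thesis by linarith
  qed
  show thesis
  proof (rule that)
    show "0 < R" using \<tau> by (simp add: R_def add_pos_pos)
    show "0 < B" using K1 by (simp add: B_def)
    fix k V
    assume k: "2 \<le> k" and V: "V \<in> sets C1_space"
      and sub: "{f \<in> C_set \<tau>\<^sub>0 \<tau>\<^sub>1. 0 < f 0 \<and> (\<forall>x\<in>{0..pi}. \<bar>f x - f\<^sub>0 x\<bar> \<le> R / sqrt (real k))} \<subseteq> V"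
    have k1: "1 \<le> real k" using k by simp
    have lnk: "0 \<le> ln (real k)" "ln (real k) \<le> real k" using k1 ln_le_minus_one[of "real k"] by (auto intro: ln_ge_zero)
    have "- B * (real k)\<^sup>2 \<le> ln A\<^sub>1 - \<kappa>\<^sub>1 * real k * ln (real k) + real k * (ln b - 8 * ln (real k))"
    proof -
      have "real k \<le> (real k)\<^sup>2" "1 \<le> (real k)\<^sup>2" using self_le_power[OF k1, of 2] one_le_power[OF k1, of 2] by auto
      have "- \<bar>ln A\<^sub>1\<bar> * (real k)\<^sup>2 \<le> ln A\<^sub>1"
        using mult_left_mono[OF \<open>1 \<le> (real k)\<^sup>2\<close>, of "\<bar>ln A\<^sub>1\<bar>"] by linarith
      moreover have "- \<bar>ln b\<bar> * (real k)\<^sup>2 \<le> real k * ln b"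
      proof -
        have "\<bar>ln b\<bar> * real k \<le> \<bar>ln b\<bar> * (real k)\<^sup>2" using \<open>real k \<le> (real k)\<^sup>2\<close> by (intro mult_left_mono) auto
        moreover have "- (\<bar>ln b\<bar> * real k) \<le> ln b * real k"
          using mult_right_mono[of "- \<bar>ln b\<bar>" "ln b" "real k"] by simp
        ultimately show ?thesis by (simp add: mult.commute)
      qed
      moreover have "real k * ln (real k) \<le> (real k)\<^sup>2" using lnk k1 by (simp add: power2_eq_square)
      hence "\<kappa>\<^sub>1 * (real k * ln (real k)) \<le> \<kappa>\<^sub>1 * (real k)\<^sup>2" "8 * (real k * ln (real k)) \<le> 8 * (real k)\<^sup>2"
        using K1 by auto
      ultimately show ?thesis unfolding B_def by (simp add: algebra_simps)
    qed
    hence "exp (- B * (real k)\<^sup>2) \<le> exp (ln A\<^sub>1 + - \<kappa>\<^sub>1 * real k * ln (real k) + real k * (ln b - 8 * ln (real k)))" by simp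
    also have "\<dots> = A\<^sub>1 * exp (- \<kappa>\<^sub>1 * real k * ln (real k)) * (b / real k ^ 8) ^ k"
    proof -
      have "exp (ln b - 8 * ln (real k)) = b / real k ^ 8"
        using b k1 exp_of_nat_mult[of 8 "ln (real k)"] by (simp add: exp_diff)
      thus ?thesis using K1(1) by (simp only: exp_add exp_of_nat_mult exp_ln)
    qed
    also have "\<dots> \<le> measure (bernstein_gamma_prior p N \<Phi>) V" by (rule mass[OF k V sub])
    finally show "exp (- B * (real k)\<^sup>2) \<le> measure (bernstein_gamma_prior p N \<Phi>) V" .
  qed
qed

text \<open>Near \<open>\<theta>\<^sub>0\<close> the density is at least half of its value there, so
  the volume of the ball decides.\<close>

lemma prior_ball_mass:
  fixes \<theta>\<^sub>0 :: "real^('r::finite)"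
  assumes "assumption_P Q \<theta>\<^sub>0"
  obtains q \<rho>\<^sub>0 where "0 < q" "0 < \<rho>\<^sub>0" "\<And>\<rho>. 0 < \<rho> \<Longrightarrow> \<rho> \<le> \<rho>\<^sub>0 \<Longrightarrow> q * \<rho> ^ CARD('r) \<le> measure Q (cball \<theta>\<^sub>0 \<rho>)"
proof -
  obtain g U where Q: "prob_space Q" and g[measurable]: "g \<in> borel_measurable borel"
      and Qg: "Q = density lborel (\<lambda>\<theta>. ennreal (g \<theta>))" and g0: "\<And>\<theta>. 0 \<le> g \<theta>"
      and U: "open U" "\<theta>\<^sub>0 \<in> U" "continuous_on U g" "\<forall>\<theta>\<in>U. 0 < g \<theta>"
    using assms unfolding assumption_P_def by blast
  interpret Q: prob_space Q by fact
  have gpos: "0 < g \<theta>\<^sub>0" using U by blast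
  have "isCont g \<theta>\<^sub>0" using U by (simp add: continuous_on_eq_continuous_at)
  then obtain d where d: "d > 0" "\<And>\<theta>. dist \<theta> \<theta>\<^sub>0 < d \<Longrightarrow> dist (g \<theta>) (g \<theta>\<^sub>0) < g \<theta>\<^sub>0 / 2"
    using gpos unfolding continuous_at_eps_delta by (meson half_gt_zero)
  define q where "q = g \<theta>\<^sub>0 / 2 * unit_ball_vol (real CARD('r))"
  show thesis
  proof (rule that)
    show "0 < q" using gpos by (simp add: q_def)
    show "0 < d / 2" using d by simp
    fix \<rho> :: real assume \<rho>: "0 < \<rho>" "\<rho> \<le> d / 2"
    have "ennreal (q * \<rho> ^ CARD('r)) = ennreal (g \<theta>\<^sub>0 / 2) * emeasure lborel (cball \<theta>\<^sub>0 \<rho>)"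
      using \<rho> gpos by (simp add: emeasure_cball q_def ennreal_mult[symmetric])
    also have "\<dots> = (\<integral>\<^sup>+\<theta>. ennreal (g \<theta>\<^sub>0 / 2) * indicator (cball \<theta>\<^sub>0 \<rho>) \<theta> \<partial>lborel)"
      by (simp add: nn_integral_cmult_indicator)
    also have "\<dots> \<le> (\<integral>\<^sup>+\<theta>. ennreal (g \<theta>) * indicator (cball \<theta>\<^sub>0 \<rho>) \<theta> \<partial>lborel)"
    proof (rule nn_integral_mono)
      fix \<theta>
      show "ennreal (g \<theta>\<^sub>0 / 2) * indicator (cball \<theta>\<^sub>0 \<rho>) \<theta> \<le> ennreal (g \<theta>) * indicator (cball \<theta>\<^sub>0 \<rho>) \<theta>"
      proof (cases "\<theta> \<in> cball \<theta>\<^sub>0 \<rho>")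
        case True
        hence "dist \<theta> \<theta>\<^sub>0 < d" using \<rho> d by (simp add: dist_commute)
        from d(2)[OF this] have "g \<theta>\<^sub>0 / 2 \<le> g \<theta>" unfolding dist_real_def by arith
        thus ?thesis using True by (simp add: ennreal_leI)
      qed simp
    qed
    also have "\<dots> = emeasure Q (cball \<theta>\<^sub>0 \<rho>)" unfolding Qg by (intro emeasure_density[symmetric]) auto
    also have "\<dots> = ennreal (measure Q (cball \<theta>\<^sub>0 \<rho>))" by (rule Q.emeasure_eq_measure)
    finally show "q * \<rho> ^ CARD('r) \<le> measure Q (cball \<theta>\<^sub>0 \<rho>)" by (simp add: ennreal_le_iff)
  qed
qed

section \<open>A deterministic bound for posterior probabilities\<close>

text \<open>The weight splits into \<open>a f\<close>, free of the parameter, and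
  \<open>b x f\<close>, bounded uniformly in \<open>f\<close>. Outside \<open>T\<close> the integral
  of \<open>a\<close> cancels between numerator and denominator, so the small prior mass
  \<open>v\<close> enters only the bound outside \<open>H\<close>. \<open>G\<close> describes the
  good \<open>f\<close>, which have full prior measure.\<close>

lemma posterior_mass_lower:
  fixes w :: "'a \<Rightarrow> 'b \<Rightarrow> real" and a :: "'b \<Rightarrow> real" and b :: "'a \<Rightarrow> 'b \<Rightarrow> real"
  assumes Q: "prob_space Q" and P: "prob_space P"
    and w[measurable]: "(\<lambda>(x, f). w x f) \<in> borel_measurable (Q \<Otimes>\<^sub>M P)"
    and a[measurable]: "a \<in> borel_measurable P"
    and T[measurable]: "T \<in> sets Q" and H[measurable]: "H \<in> sets P" and V[measurable]: "V \<in> sets P" and B[measurable]: "B \<in> sets Q"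
    and G: "AE f in P. G f"
    and fact: "\<And>x f. G f \<Longrightarrow> w x f = a f * b x f"
    and a_pos: "\<And>f. G f \<Longrightarrow> 0 < a f" and a_le: "\<And>f. G f \<Longrightarrow> a f \<le> A\<^sub>0"
    and b0: "\<And>x f. G f \<Longrightarrow> 0 \<le> b x f" and b1: "\<And>x f. G f \<Longrightarrow> b x f \<le> B\<^sub>1"
    and b2: "\<And>x f. G f \<Longrightarrow> x \<notin> T \<Longrightarrow> b x f \<le> B\<^sub>2"
    and b3: "\<And>x f. G f \<Longrightarrow> x \<in> B \<Longrightarrow> B\<^sub>3 \<le> b x f"
    and a1: "\<And>f. G f \<Longrightarrow> f \<notin> H \<Longrightarrow> a f \<le> A\<^sub>1" and a2: "\<And>f. G f \<Longrightarrow> f \<in> V \<Longrightarrow> A\<^sub>2 \<le> a f"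
    and pos: "0 < B\<^sub>2" "0 < B\<^sub>3" "0 < A\<^sub>1" "0 < A\<^sub>2" "0 < q" "0 < v"
    and qB: "q \<le> measure Q B" and vV: "v \<le> measure P V"
  shows "measure (density (Q \<Otimes>\<^sub>M P) (\<lambda>(x, f). ennreal (w x f) / (\<integral>\<^sup>+(x', f'). ennreal (w x' f') \<partial>(Q \<Otimes>\<^sub>M P)))) (T \<times> H)
    \<ge> 1 - (B\<^sub>2 / (B\<^sub>3 * q) + A\<^sub>1 * B\<^sub>1 / (A\<^sub>2 * v * (B\<^sub>3 * q)))"
    and "measure (density (Q \<Otimes>\<^sub>M P) (\<lambda>(x, f). ennreal (w x f) / (\<integral>\<^sup>+(x', f'). ennreal (w x' f') \<partial>(Q \<Otimes>\<^sub>M P)))) (T \<times> H) \<le> 1"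
proof -
  interpret Q: prob_space Q by fact
  interpret P: prob_space P by fact
  interpret QP: pair_prob_space Q P ..
  let ?QP = "Q \<Otimes>\<^sub>M P"
  define Den where "Den = (\<integral>\<^sup>+(x, f). ennreal (w x f) \<partial>?QP)"
  define D where "D = density ?QP (\<lambda>(x, f). ennreal (w x f) / Den)"
  \<comment> \<open>The integral that cancels. It is finite by \<open>A\<^sub>0\<close> and positive
    by the mass of \<open>V\<close>.\<close>
  define J where "J = (\<integral>\<^sup>+f. ennreal (a f) \<partial>P)"
  have wf[measurable]: "(\<lambda>x. w x f) \<in> borel_measurable Q" if "f \<in> space P" for f
    using measurable_compose[OF measurable_Pair2'[OF that] w] by simp
  have iterated: "(\<integral>\<^sup>+(x, f). ennreal (w x f) * indicator S (x, f) \<partial>?QP) = (\<integral>\<^sup>+f. \<integral>\<^sup>+x. ennreal (w x f) * indicator S (x, f) \<partial>Q \<partial>P)"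
    if [measurable]: "S \<in> sets ?QP" for S
    by (subst QP.nn_integral_snd[symmetric]) (auto simp: case_prod_beta)
  have Den_eq: "Den = (\<integral>\<^sup>+f. \<integral>\<^sup>+x. ennreal (w x f) \<partial>Q \<partial>P)"
    unfolding Den_def by (subst QP.nn_integral_snd[symmetric]) (auto simp: case_prod_beta)
  obtain f\<^sub>0 where "G f\<^sub>0" using G P.AE_False by (metis (mono_tags, lifting) AE_mp AE_I2)
  have B1: "0 \<le> B\<^sub>1" using b0[OF \<open>G f\<^sub>0\<close>] b1[OF \<open>G f\<^sub>0\<close>] order_trans by blast
  have A0: "0 \<le> A\<^sub>0" using a_pos[OF \<open>G f\<^sub>0\<close>] a_le[OF \<open>G f\<^sub>0\<close>] by simp
  have J_fin: "J < \<infinity>"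
  proof -
    have "J \<le> (\<integral>\<^sup>+f. ennreal A\<^sub>0 \<partial>P)"
      unfolding J_def by (rule nn_integral_mono_AE, rule AE_mp[OF G]) (auto intro!: ennreal_leI a_le)
    also have "\<dots> = ennreal A\<^sub>0" by (simp add: P.emeasure_space_1)
    finally show ?thesis by (rule order_le_less_trans) simp
  qed
  have J_ge: "ennreal (A\<^sub>2 * v) \<le> J"
  proof -
    have "ennreal (A\<^sub>2 * v) \<le> ennreal A\<^sub>2 * emeasure P V"
      unfolding P.emeasure_eq_measure using pos vV by (auto simp: ennreal_mult[symmetric] intro!: ennreal_leI mult_left_mono)
    also have "\<dots> = (\<integral>\<^sup>+f. ennreal A\<^sub>2 * indicator V f \<partial>P)" by (simp add: nn_integral_cmult_indicator)
    also have "\<dots> \<le> J"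
      unfolding J_def by (rule nn_integral_mono_AE, rule AE_mp[OF G]) (auto simp: indicator_def intro!: ennreal_leI a2)
    finally show ?thesis .
  qed
  \<comment> \<open>For each good \<open>f\<close> the parameter is restricted to \<open>B\<close>,
    where \<open>b\<close> is at least \<open>B\<^sub>3\<close>.\<close>
  have Den_ge: "J * ennreal (B\<^sub>3 * q) \<le> Den"
  proof -
    have "J * ennreal (B\<^sub>3 * q) = (\<integral>\<^sup>+f. ennreal (a f) * ennreal (B\<^sub>3 * q) \<partial>P)"
      unfolding J_def by (simp add: nn_integral_multc)
    also have "\<dots> \<le> (\<integral>\<^sup>+f. \<integral>\<^sup>+x. ennreal (w x f) \<partial>Q \<partial>P)"
    proof (rule nn_integral_mono_AE, rule AE_mp[OF G], rule AE_I2, rule impI)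
      fix f assume f: "f \<in> space P" "G f"
      have "ennreal (a f) * ennreal (B\<^sub>3 * q) \<le> ennreal (a f) * (ennreal B\<^sub>3 * emeasure Q B)"
        unfolding Q.emeasure_eq_measure using pos qB
        by (intro mult_left_mono) (auto simp: ennreal_mult[symmetric] intro!: ennreal_leI mult_left_mono)
      also have "\<dots> = (\<integral>\<^sup>+x. ennreal (a f) * (ennreal B\<^sub>3 * indicator B x) \<partial>Q)"
        by (simp add: nn_integral_cmult nn_integral_cmult_indicator)
      also have "\<dots> \<le> (\<integral>\<^sup>+x. ennreal (w x f) \<partial>Q)"
      proof (rule nn_integral_mono)
        fix x
        show "ennreal (a f) * (ennreal B\<^sub>3 * indicator B x) \<le> ennreal (w x f)"
          using a_pos[OF f(2)] b3[OF f(2)] pos fact[OF f(2)]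
          by (auto simp: indicator_def ennreal_mult[symmetric] intro!: ennreal_leI mult_left_mono)
      qed
      finally show "ennreal (a f) * ennreal (B\<^sub>3 * q) \<le> (\<integral>\<^sup>+x. ennreal (w x f) \<partial>Q)" .
    qed
    finally show ?thesis unfolding Den_eq .
  qed
  have Den_le: "Den \<le> J * ennreal B\<^sub>1"
  proof -
    have "Den \<le> (\<integral>\<^sup>+f. ennreal (a f) * ennreal B\<^sub>1 \<partial>P)"
      unfolding Den_eq
    proof (rule nn_integral_mono_AE, rule AE_mp[OF G], rule AE_I2, rule impI)
      fix f assume f: "f \<in> space P" "G f"
      have "(\<integral>\<^sup>+x. ennreal (w x f) \<partial>Q) \<le> (\<integral>\<^sup>+x. ennreal (a f) * ennreal B\<^sub>1 \<partial>Q)"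
        using a_pos[OF f(2)] b1[OF f(2)] fact[OF f(2)] B1
        by (intro nn_integral_mono) (auto simp: ennreal_mult[symmetric] intro!: ennreal_leI mult_left_mono)
      thus "(\<integral>\<^sup>+x. ennreal (w x f) \<partial>Q) \<le> ennreal (a f) * ennreal B\<^sub>1" by (simp add: Q.emeasure_space_1)
    qed
    thus ?thesis unfolding J_def by (simp add: nn_integral_multc)
  qed
  define N1 where "N1 = (\<integral>\<^sup>+(x, f). ennreal (w x f) * indicator ((space Q - T) \<times> space P) (x, f) \<partial>?QP)"
  define N2 where "N2 = (\<integral>\<^sup>+(x, f). ennreal (w x f) * indicator (space Q \<times> (space P - H)) (x, f) \<partial>?QP)"
  have N1: "N1 \<le> J * ennreal B\<^sub>2"
  proof -
    have "N1 \<le> (\<integral>\<^sup>+f. ennreal (a f) * ennreal B\<^sub>2 \<partial>P)"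
      unfolding N1_def
    proof (subst iterated, measurable, rule nn_integral_mono_AE, rule AE_mp[OF G], rule AE_I2, rule impI)
      fix f assume f: "f \<in> space P" "G f"
      have "(\<integral>\<^sup>+x. ennreal (w x f) * indicator ((space Q - T) \<times> space P) (x, f) \<partial>Q) \<le> (\<integral>\<^sup>+x. ennreal (a f) * ennreal B\<^sub>2 \<partial>Q)"
      proof (rule nn_integral_mono)
        fix x
        show "ennreal (w x f) * indicator ((space Q - T) \<times> space P) (x, f) \<le> ennreal (a f) * ennreal B\<^sub>2"
          using a_pos[OF f(2)] b2[OF f(2), of x] fact[OF f(2)] pos
          by (auto simp: indicator_def ennreal_mult[symmetric] intro!: ennreal_leI mult_left_mono)
      qed
      thus "(\<integral>\<^sup>+x. ennreal (w x f) * indicator ((space Q - T) \<times> space P) (x, f) \<partial>Q) \<le> ennreal (a f) * ennreal B\<^sub>2"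
        by (simp add: Q.emeasure_space_1)
    qed
    thus ?thesis unfolding J_def by (simp add: nn_integral_multc)
  qed
  have N2: "N2 \<le> ennreal (A\<^sub>1 * B\<^sub>1)"
  proof -
    have "N2 \<le> (\<integral>\<^sup>+f. ennreal (A\<^sub>1 * B\<^sub>1) \<partial>P)"
      unfolding N2_def
    proof (subst iterated, measurable, rule nn_integral_mono_AE, rule AE_mp[OF G], rule AE_I2, rule impI)
      fix f assume f: "f \<in> space P" "G f"
      have "(\<integral>\<^sup>+x. ennreal (w x f) * indicator (space Q \<times> (space P - H)) (x, f) \<partial>Q) \<le> (\<integral>\<^sup>+x. ennreal (A\<^sub>1 * B\<^sub>1) \<partial>Q)"
      proof (rule nn_integral_mono)
        fix x
        show "ennreal (w x f) * indicator (space Q \<times> (space P - H)) (x, f) \<le> ennreal (A\<^sub>1 * B\<^sub>1)"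
          using a_pos[OF f(2)] b0[OF f(2), of x] b1[OF f(2), of x] a1[OF f(2)] fact[OF f(2)] pos
          by (auto simp: indicator_def intro!: ennreal_leI mult_mono)
      qed
      thus "(\<integral>\<^sup>+x. ennreal (w x f) * indicator (space Q \<times> (space P - H)) (x, f) \<partial>Q) \<le> ennreal (A\<^sub>1 * B\<^sub>1)"
        by (simp add: Q.emeasure_space_1)
    qed
    thus ?thesis by (simp add: P.emeasure_space_1)
  qed
  obtain j where j: "J = ennreal j" "0 \<le> j" using J_fin by (cases J) auto
  have j_ge: "A\<^sub>2 * v \<le> j" using J_ge j by (simp add: ennreal_le_iff)
  have "Den < \<infinity>" by (rule order_le_less_trans[OF Den_le]) (simp add: j ennreal_mult[symmetric] B1)
  then obtain dd where dd: "Den = ennreal dd" "0 \<le> dd" by (cases Den) auto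
  have dd_ge: "j * (B\<^sub>3 * q) \<le> dd" using Den_ge j dd pos by (simp add: ennreal_mult[symmetric] ennreal_le_iff)
  have jpos: "0 < j" using j_ge pos by (meson mult_pos_pos order_less_le_trans)
  have dpos: "0 < dd" using dd_ge jpos pos by (meson mult_pos_pos order_less_le_trans)
  have emD: "emeasure D S = (\<integral>\<^sup>+(x, f). ennreal (w x f) * indicator S (x, f) \<partial>?QP) / Den" if [measurable]: "S \<in> sets ?QP" for S
  proof -
    have "emeasure D S = (\<integral>\<^sup>+p. (ennreal (case p of (x, f) \<Rightarrow> w x f) * indicator S p) / Den \<partial>?QP)"
      unfolding D_def by (subst emeasure_density) (auto simp: case_prod_beta divide_ennreal_def mult_ac intro!: nn_integral_cong)
    also have "\<dots> = (\<integral>\<^sup>+p. ennreal (case p of (x, f) \<Rightarrow> w x f) * indicator S p \<partial>?QP) / Den"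
      by (rule nn_integral_divide) measurable
    also have "(\<integral>\<^sup>+p. ennreal (case p of (x, f) \<Rightarrow> w x f) * indicator S p \<partial>?QP)
        = (\<integral>\<^sup>+(x, f). ennreal (w x f) * indicator S (x, f) \<partial>?QP)"
      by (intro nn_integral_cong) (auto split: prod.split)
    finally show ?thesis .
  qed
  have "emeasure D (space D) = 1"
  proof -
    have "emeasure D (space D) = (\<integral>\<^sup>+(x, f). ennreal (w x f) * indicator (space ?QP) (x, f) \<partial>?QP) / Den"
      by (subst emD[symmetric]) (auto simp: D_def)
    also have "(\<integral>\<^sup>+(x, f). ennreal (w x f) * indicator (space ?QP) (x, f) \<partial>?QP) = Den"
      unfolding Den_def by (intro nn_integral_cong) (auto simp: indicator_def)
    finally show ?thesis using dpos dd by (simp add: divide_ennreal)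
  qed
  then interpret D: prob_space D by (rule prob_spaceI)
  have [simp]: "sets D = sets ?QP" "space D = space ?QP" by (auto simp: D_def)
  have m1: "measure D ((space Q - T) \<times> space P) \<le> B\<^sub>2 / (B\<^sub>3 * q)"
  proof -
    have "emeasure D ((space Q - T) \<times> space P) \<le> (J * ennreal B\<^sub>2) / Den"
      using N1 unfolding N1_def by (subst emD) (auto intro: divide_right_mono_ennreal)
    also have "\<dots> = ennreal (j * B\<^sub>2 / dd)" using j dd dpos pos by (simp add: ennreal_mult[symmetric] divide_ennreal)
    also have "j * B\<^sub>2 / dd \<le> j * B\<^sub>2 / (j * (B\<^sub>3 * q))" using dd_ge jpos dpos pos by (intro divide_left_mono) auto
    hence "ennreal (j * B\<^sub>2 / dd) \<le> ennreal (B\<^sub>2 / (B\<^sub>3 * q))" using jpos by (intro ennreal_leI) simp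
    finally show ?thesis unfolding D.emeasure_eq_measure using pos by (simp add: ennreal_le_iff)
  qed
  have m2: "measure D (space Q \<times> (space P - H)) \<le> A\<^sub>1 * B\<^sub>1 / (A\<^sub>2 * v * (B\<^sub>3 * q))"
  proof -
    have "emeasure D (space Q \<times> (space P - H)) \<le> ennreal (A\<^sub>1 * B\<^sub>1) / Den"
      using N2 unfolding N2_def by (subst emD) (auto intro: divide_right_mono_ennreal)
    also have "\<dots> = ennreal (A\<^sub>1 * B\<^sub>1 / dd)" using dd dpos pos B1 by (simp add: divide_ennreal)
    also have "A\<^sub>1 * B\<^sub>1 / dd \<le> A\<^sub>1 * B\<^sub>1 / (A\<^sub>2 * v * (B\<^sub>3 * q))"
    proof (intro divide_left_mono)
      show "A\<^sub>2 * v * (B\<^sub>3 * q) \<le> dd" using j_ge dd_ge pos by (meson mult_right_mono mult_nonneg_nonneg less_imp_le order_trans)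
    qed (use pos B1 dpos in auto)
    hence "ennreal (A\<^sub>1 * B\<^sub>1 / dd) \<le> ennreal (A\<^sub>1 * B\<^sub>1 / (A\<^sub>2 * v * (B\<^sub>3 * q)))" by (rule ennreal_leI)
    finally show ?thesis unfolding D.emeasure_eq_measure using pos B1 by (simp add: ennreal_le_iff)
  qed
  have "space ?QP - T \<times> H \<subseteq> ((space Q - T) \<times> space P) \<union> (space Q \<times> (space P - H))"
    by (auto simp: space_pair_measure)
  hence "measure D (space ?QP - T \<times> H) \<le> measure D (((space Q - T) \<times> space P) \<union> (space Q \<times> (space P - H)))"
    by (intro D.finite_measure_mono) auto
  also have "\<dots> \<le> measure D ((space Q - T) \<times> space P) + measure D (space Q \<times> (space P - H))"
    by (rule measure_Un_le) auto
  also have "measure D (space ?QP - T \<times> H) = 1 - measure D (T \<times> H)"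
    using D.prob_compl[of "T \<times> H"] by simp
  finally have "1 - (B\<^sub>2 / (B\<^sub>3 * q) + A\<^sub>1 * B\<^sub>1 / (A\<^sub>2 * v * (B\<^sub>3 * q))) \<le> measure D (T \<times> H)" using m1 m2 by linarith
  thus "measure (density (Q \<Otimes>\<^sub>M P) (\<lambda>(x, f). ennreal (w x f) / (\<integral>\<^sup>+(x', f'). ennreal (w x' f') \<partial>(Q \<Otimes>\<^sub>M P)))) (T \<times> H)
    \<ge> 1 - (B\<^sub>2 / (B\<^sub>3 * q) + A\<^sub>1 * B\<^sub>1 / (A\<^sub>2 * v * (B\<^sub>3 * q)))"
    unfolding D_def Den_def .
  show "measure (density (Q \<Otimes>\<^sub>M P) (\<lambda>(x, f). ennreal (w x f) / (\<integral>\<^sup>+(x', f'). ennreal (w x' f') \<partial>(Q \<Otimes>\<^sub>M P)))) (T \<times> H) \<le> 1"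
    using D.prob_le_1 unfolding D_def Den_def .
qed

section \<open>Likelihood ratios\<close>

abbreviation freq :: "nat \<Rightarrow> nat \<Rightarrow> real" where
  "freq n i \<equiv> fourier_freq n ((i + 1) div 2)"

lemma freq_range: "i < n \<Longrightarrow> freq n i \<in> {0..pi}"
proof -
  assume i: "i < n"
  have "2 * ((i + 1) div 2) \<le> n" using i by linarith
  hence "2 * real ((i + 1) div 2) \<le> real n" by (metis of_nat_le_iff of_nat_mult of_nat_numeral)
  hence "2 * real ((i + 1) div 2) * pi \<le> real n * pi" by (intro mult_right_mono) auto
  thus ?thesis using i by (simp add: fourier_freq_def divide_le_eq mult_ac)
qed

text \<open>Rows \<open>2 * j - 1\<close> and \<open>2 * j\<close> share one frequency, so row
  \<open>i\<close> sits at \<open>pi * i / n\<close> up to rounding.\<close>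

lemma freq_close: "\<bar>freq n i - pi * real i / real n\<bar> \<le> pi / real n"
proof -
  have "2 * ((i + 1) div 2) = i \<or> 2 * ((i + 1) div 2) = i + 1" by (cases "even i") auto
  hence "2 * real ((i + 1) div 2) = real i \<or> 2 * real ((i + 1) div 2) = real i + 1"
    by (metis of_nat_mult of_nat_numeral of_nat_add of_nat_1)
  hence "\<bar>2 * real ((i + 1) div 2) - real i\<bar> \<le> 1" by auto
  hence "pi * \<bar>2 * real ((i + 1) div 2) - real i\<bar> \<le> pi * 1" by (intro mult_left_mono) auto
  hence "\<bar>pi * (2 * real ((i + 1) div 2) - real i)\<bar> / real n \<le> pi / real n"
    by (intro divide_right_mono) (auto simp: abs_mult)
  moreover have "freq n i - pi * real i / real n = pi * (2 * real ((i + 1) div 2) - real i) / real n"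
    by (simp add: fourier_freq_def right_diff_distrib diff_divide_distrib)
  ultimately show ?thesis by (simp add: abs_divide)
qed

lemma freq_step: "\<bar>freq n (Suc i) - freq n i\<bar> \<le> 2 * pi / real n"
proof -
  have "(Suc i + 1) div 2 = (i + 1) div 2 \<or> (Suc i + 1) div 2 = Suc ((i + 1) div 2)" by (cases "even i") auto
  thus ?thesis
  proof (elim disjE)
    assume e: "(Suc i + 1) div 2 = Suc ((i + 1) div 2)"
    show ?thesis unfolding fourier_freq_def e by (simp add: distrib_left add_divide_distrib)
  qed simp
qed

section \<open>Exact likelihood ratios\<close>

definition score :: "('r::finite) design \<Rightarrow> nat \<Rightarrow> (real \<Rightarrow> real) \<Rightarrow> (nat \<Rightarrow> real) \<Rightarrow> real^'r \<Rightarrow> real" where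
  "score X n f u \<delta> = (\<Sum>i<n. (tilde_vec n (X n) i \<bullet> \<delta>) * u i / D_diag n f i)"

definition info :: "('r::finite) design \<Rightarrow> nat \<Rightarrow> (real \<Rightarrow> real) \<Rightarrow> real^'r \<Rightarrow> real" where
  "info X n f \<delta> = (\<Sum>i<n. (tilde_vec n (X n) i \<bullet> \<delta>)\<^sup>2 / D_diag n f i)"

lemma whittle_density_theta_ratio:
  assumes pos: "\<And>i. i < n \<Longrightarrow> 0 < D_diag n f i"
    and u: "\<And>i. i < n \<Longrightarrow> tilde_vec n z i - tilde_vec n (X n) i \<bullet> \<theta>\<^sub>0 = u i"
  shows "whittle_density X n \<theta> f z
    = whittle_density X n \<theta>\<^sub>0 f z * exp (score X n f u (\<theta> - \<theta>\<^sub>0) - info X n f (\<theta> - \<theta>\<^sub>0) / 2)"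
proof -
  have "(\<Sum>i<n. (tilde_vec n z i - tilde_vec n (X n) i \<bullet> \<theta>)\<^sup>2 / D_diag n f i)
      = (\<Sum>i<n. (tilde_vec n z i - tilde_vec n (X n) i \<bullet> \<theta>\<^sub>0)\<^sup>2 / D_diag n f i
          - 2 * ((tilde_vec n (X n) i \<bullet> (\<theta> - \<theta>\<^sub>0)) * u i / D_diag n f i)
          + (tilde_vec n (X n) i \<bullet> (\<theta> - \<theta>\<^sub>0))\<^sup>2 / D_diag n f i)"
  proof (rule sum.cong[OF refl])
    fix i assume "i \<in> {..<n}"
    hence i: "i < n" by simp
    define y where "y = tilde_vec n (X n) i \<bullet> (\<theta> - \<theta>\<^sub>0)"
    have e: "tilde_vec n z i - tilde_vec n (X n) i \<bullet> \<theta> = u i - y"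
      using u[OF i] by (simp add: y_def inner_diff_right)
    show "(tilde_vec n z i - tilde_vec n (X n) i \<bullet> \<theta>)\<^sup>2 / D_diag n f i
        = (tilde_vec n z i - tilde_vec n (X n) i \<bullet> \<theta>\<^sub>0)\<^sup>2 / D_diag n f i
          - 2 * ((tilde_vec n (X n) i \<bullet> (\<theta> - \<theta>\<^sub>0)) * u i / D_diag n f i)
          + (tilde_vec n (X n) i \<bullet> (\<theta> - \<theta>\<^sub>0))\<^sup>2 / D_diag n f i"
      unfolding e u[OF i] y_def[symmetric] by (simp add: power2_diff add_divide_distrib diff_divide_distrib)
  qed
  also have "\<dots> = (\<Sum>i<n. (tilde_vec n z i - tilde_vec n (X n) i \<bullet> \<theta>\<^sub>0)\<^sup>2 / D_diag n f i)
      - 2 * score X n f u (\<theta> - \<theta>\<^sub>0) + info X n f (\<theta> - \<theta>\<^sub>0)"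
    unfolding score_def info_def by (simp only: sum.distrib sum_subtractf sum_distrib_left)
  finally show ?thesis unfolding whittle_density_def by (simp add: exp_add[symmetric] algebra_simps)
qed

text \<open>Twice the Kullback-Leibler divergence between centered normal laws with variance ratio \<open>r\<close>.\<close>

definition defect :: "real \<Rightarrow> real" where "defect r = r - 1 - ln r"

definition spec_ratio :: "nat \<Rightarrow> (real \<Rightarrow> real) \<Rightarrow> (real \<Rightarrow> real) \<Rightarrow> nat \<Rightarrow> real" where
  "spec_ratio n f\<^sub>0 f i = f\<^sub>0 (freq n i) / f (freq n i)"

lemma whittle_density_f_ratio:
  assumes pos: "\<And>i. i < n \<Longrightarrow> 0 < f (freq n i)" and pos0: "\<And>i. i < n \<Longrightarrow> 0 < f\<^sub>0 (freq n i)"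
    and z: "\<And>i. i < n \<Longrightarrow> tilde_vec n z i - tilde_vec n (X n) i \<bullet> \<theta>\<^sub>0 = sqrt (D_diag n f\<^sub>0 i) * \<epsilon> i"
  shows "whittle_density X n \<theta>\<^sub>0 f z = whittle_density X n \<theta>\<^sub>0 f\<^sub>0 z *
    exp (- (\<Sum>i<n. defect (spec_ratio n f\<^sub>0 f i)) / 2 - (\<Sum>i<n. (spec_ratio n f\<^sub>0 f i - 1) * ((\<epsilon> i)\<^sup>2 - 1)) / 2)"
proof -
  have D: "0 < D_diag n f i" "0 < D_diag n f\<^sub>0 i" if "i < n" for i
    using pos[OF that] pos0[OF that] by (auto simp: D_diag_def)
  have one: "normal_density 0 (sqrt d) (sqrt d0 * e)
      = normal_density 0 (sqrt d0) (sqrt d0 * e) * exp (- defect (d0 / d) / 2 - (d0 / d - 1) * (e\<^sup>2 - 1) / 2)"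
    if "0 < d" "0 < d0" for d d0 e :: real
  proof -
    have "exp (ln (d0 / d) / 2) = sqrt (d0 / d)"
      using that by (simp add: exp_powr_real powr_half_sqrt[symmetric] powr_def)
    hence "sqrt d0 / sqrt d = exp (ln (d0 / d) / 2)" by (simp add: real_sqrt_divide)
    hence *: "1 / sqrt d = (1 / sqrt d0) * exp (ln (d0 / d) / 2)" using that by (simp add: field_simps)
    have "normal_density 0 (sqrt d) (sqrt d0 * e) = (1 / sqrt d) * (1 / sqrt (2 * pi)) * exp (- (d0 / d) * e\<^sup>2 / 2)"
      using that by (simp add: normal_density_def power_mult_distrib real_sqrt_mult mult_ac)
    also have "\<dots> = (1 / sqrt d0) * (1 / sqrt (2 * pi)) * exp (ln (d0 / d) / 2 + - (d0 / d) * e\<^sup>2 / 2)"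
      unfolding * exp_add by simp
    \<comment> \<open>Writing \<open>e\<^sup>2 = 1 + (e\<^sup>2 - 1)\<close> separates the
      deterministic loss \<open>defect\<close> from a centred fluctuation.\<close>
    also have "ln (d0 / d) / 2 + - (d0 / d) * e\<^sup>2 / 2 = - e\<^sup>2 / 2 + (- defect (d0 / d) / 2 - (d0 / d - 1) * (e\<^sup>2 - 1) / 2)"
      by (simp add: defect_def algebra_simps add_divide_distrib diff_divide_distrib)
    also have "(1 / sqrt d0) * (1 / sqrt (2 * pi)) * exp (- e\<^sup>2 / 2 + (- defect (d0 / d) / 2 - (d0 / d - 1) * (e\<^sup>2 - 1) / 2))
        = ((1 / sqrt d0) * (1 / sqrt (2 * pi)) * exp (- e\<^sup>2 / 2)) * exp (- defect (d0 / d) / 2 - (d0 / d - 1) * (e\<^sup>2 - 1) / 2)"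
      unfolding exp_add by simp
    also have "(1 / sqrt d0) * (1 / sqrt (2 * pi)) * exp (- e\<^sup>2 / 2) = normal_density 0 (sqrt d0) (sqrt d0 * e)"
      using that by (simp add: normal_density_def power_mult_distrib real_sqrt_mult mult_ac)
    finally show ?thesis .
  qed
  have ratio: "D_diag n f\<^sub>0 i / D_diag n f i = spec_ratio n f\<^sub>0 f i" for i by (simp add: D_diag_def spec_ratio_def)
  have "whittle_density X n \<theta>\<^sub>0 f z = (\<Prod>i<n. normal_density 0 (sqrt (D_diag n f i)) (sqrt (D_diag n f\<^sub>0 i) * \<epsilon> i))"
    by (rule whittle_density_shifted[where n = n and X = X, OF D(1) z])
  also have "\<dots> = (\<Prod>i<n. normal_density 0 (sqrt (D_diag n f\<^sub>0 i)) (sqrt (D_diag n f\<^sub>0 i) * \<epsilon> i) *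
      exp (- defect (spec_ratio n f\<^sub>0 f i) / 2 - (spec_ratio n f\<^sub>0 f i - 1) * ((\<epsilon> i)\<^sup>2 - 1) / 2))"
    by (intro prod.cong refl) (simp only: one[OF D] lessThan_iff ratio)
  also have "\<dots> = whittle_density X n \<theta>\<^sub>0 f\<^sub>0 z * exp (\<Sum>i<n. - defect (spec_ratio n f\<^sub>0 f i) / 2 - (spec_ratio n f\<^sub>0 f i - 1) * ((\<epsilon> i)\<^sup>2 - 1) / 2)"
    by (simp only: prod.distrib exp_sum[OF finite_lessThan] whittle_density_shifted[where n = n and X = X, OF D(2) z])
  also have "(\<Sum>i<n. - defect (spec_ratio n f\<^sub>0 f i) / 2 - (spec_ratio n f\<^sub>0 f i - 1) * ((\<epsilon> i)\<^sup>2 - 1) / 2)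
      = - (\<Sum>i<n. defect (spec_ratio n f\<^sub>0 f i)) / 2 - (\<Sum>i<n. (spec_ratio n f\<^sub>0 f i - 1) * ((\<epsilon> i)\<^sup>2 - 1)) / 2"
    by (simp add: sum_subtractf sum_negf flip: sum_divide_distrib)
  finally show ?thesis .
qed

text \<open>From below, \<open>ln r \<le> 2 * (sqrt r - 1)\<close> gives the Hellinger type quantity
  \<open>(sqrt r - 1)\<^sup>2\<close>; from above, \<open>- ln r \<le> 1 / r - 1\<close>. The loss
  is thus comparable to the squared difference as long as both values are bounded and bounded away
  from zero.\<close>

lemma defect_bounds:
  assumes "0 < x" "0 < y" "x \<le> t" "y \<le> t"
  shows "(x - y)\<^sup>2 / (4 * t\<^sup>2) \<le> defect (x / y)" "defect (x / y) \<le> (x - y)\<^sup>2 / (x * y)"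
proof -
  have r: "0 < x / y" using assms by simp
  have "ln (x / y) = 2 * ln (sqrt (x / y))" using r by (simp add: ln_sqrt)
  also have "\<dots> \<le> 2 * (sqrt (x / y) - 1)" using r ln_le_minus_one[of "sqrt (x / y)"] by simp
  finally have "(sqrt (x / y) - 1)\<^sup>2 \<le> defect (x / y)"
    using r by (simp add: defect_def power2_diff)
  moreover have "(x - y)\<^sup>2 / (4 * t\<^sup>2) \<le> (sqrt (x / y) - 1)\<^sup>2"
  proof -
    have sx: "sqrt x * sqrt x = x" "sqrt y * sqrt y = y" "0 < sqrt y" "0 < sqrt x" using assms by auto
    have "(sqrt x + sqrt y)\<^sup>2 \<le> (2 * sqrt t)\<^sup>2" using assms by (intro power_mono) (auto intro: add_mono[where b = "sqrt t" and d = "sqrt t", simplified])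
    hence "(sqrt x + sqrt y)\<^sup>2 * y \<le> 4 * t * t" using assms by (intro mult_mono) (auto simp: power_mult_distrib)
    hence "(x - y)\<^sup>2 / (4 * t\<^sup>2) \<le> (x - y)\<^sup>2 / ((sqrt x + sqrt y)\<^sup>2 * y)"
      using sx assms by (intro divide_left_mono mult_pos_pos zero_less_power add_pos_pos) (auto simp: power2_eq_square)
    also have "x - y = (sqrt x - sqrt y) * (sqrt x + sqrt y)" using sx by (simp add: algebra_simps)
    hence "(x - y)\<^sup>2 / ((sqrt x + sqrt y)\<^sup>2 * y) = (sqrt x - sqrt y)\<^sup>2 / y"
      using sx by (simp add: power_mult_distrib add_pos_pos less_imp_neq[symmetric])
    also have "\<dots> = (sqrt (x / y) - 1)\<^sup>2"
    proof -
      have "sqrt (x / y) - 1 = (sqrt x - sqrt y) / sqrt y" using sx by (simp add: real_sqrt_divide diff_divide_distrib)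
      thus ?thesis using assms by (simp add: power_divide)
    qed
    finally show ?thesis .
  qed
  ultimately show "(x - y)\<^sup>2 / (4 * t\<^sup>2) \<le> defect (x / y)" by simp
  have "ln (y / x) \<le> y / x - 1" using assms by (intro ln_le_minus_one) simp
  hence "- ln (x / y) \<le> y / x - 1" using assms by (simp add: ln_div)
  hence "defect (x / y) \<le> x / y - 2 + y / x" by (simp add: defect_def)
  also have "\<dots> = (x - y)\<^sup>2 / (x * y)" using assms by (simp add: field_simps power2_eq_square)
  finally show "defect (x / y) \<le> (x - y)\<^sup>2 / (x * y)" .
qed

text \<open>A Lipschitz function of size \<open>h\<close> at \<open>xs\<close> keeps half of this
  within distance \<open>h / (2 * L)\<close>. On one side of \<open>xs\<close> this range holds
  about \<open>n * h / (2 * pi * L)\<close> rows; at least half that many survive the rounding, and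
  each contributes \<open>h\<^sup>2 / 4\<close>.\<close>

lemma sum_squares_at_freqs:
  fixes g :: "real \<Rightarrow> real"
  assumes L: "0 < L" and lip: "\<And>x y. x \<in> {0..pi} \<Longrightarrow> y \<in> {0..pi} \<Longrightarrow> \<bar>g x - g y\<bar> \<le> L * \<bar>x - y\<bar>"
    and xs: "xs \<in> {0..pi}" and h: "0 < h" "h \<le> \<bar>g xs\<bar>"
    and n: "8 * pi * L \<le> real n * h" and hL: "h \<le> L"
  shows "real n * h ^ 3 / (16 * pi * L) \<le> (\<Sum>i<n. (g (freq n i))\<^sup>2)"
proof -
  define \<rho> where "\<rho> = h / (2 * L)"
  have npos: "0 < real n"
  proof (rule ccontr)
    assume "\<not> 0 < real n"
    moreover have "0 < 8 * pi * L" using L by simp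
    ultimately show False using n by simp
  qed
  \<comment> \<open>Two grid steps are given away: one between \<open>freq n i\<close> and
    \<open>pi * i / n\<close>, one between \<open>xs\<close> and the grid point with index
    \<open>c\<close>.\<close>
  define m where "m = nat \<lfloor>real n * \<rho> / pi\<rfloor> - 2"
  have big: "4 \<le> real n * \<rho> / pi" using n L by (simp add: \<rho>_def field_simps)
  have mr: "real m \<le> real n * \<rho> / pi - 2" "real n * \<rho> / pi - 3 \<le> real m"
  proof -
    define F where "F = nat \<lfloor>real n * \<rho> / pi\<rfloor>"
    have F: "real F \<le> real n * \<rho> / pi" "real n * \<rho> / pi - 1 \<le> real F" "4 \<le> F"
      using big unfolding F_def by (linarith | simp add: le_nat_floor)+
    have "real m = real F - 2" using F(3) by (simp add: m_def F_def[symmetric] of_nat_diff)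
    thus "real m \<le> real n * \<rho> / pi - 2" "real n * \<rho> / pi - 3 \<le> real m" using F by linarith+
  qed
  have "real n * \<rho> / pi \<le> real n / 6"
  proof -
    have "\<rho> \<le> 1 / 2" using hL L by (simp add: \<rho>_def)
    moreover have "1 / 2 \<le> pi / 6" using pi_gt3 by simp
    ultimately have "\<rho> \<le> pi / 6" by linarith
    hence "real n * \<rho> \<le> real n * (pi / 6)" by (intro mult_left_mono) auto
    thus ?thesis by (simp add: divide_le_eq)
  qed
  hence mn: "real m \<le> real n / 6 - 2" using mr by linarith
  define c where "c = min (n - 1) (nat \<lfloor>real n * xs / pi\<rfloor>)"
  have cn: "c < n" using npos by (auto simp: c_def)
  have c_close: "\<bar>pi * real c / real n - xs\<bar> \<le> pi / real n"
  proof -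
    define y where "y = real n * xs / pi"
    have y: "0 \<le> y" "y \<le> real n" using xs npos by (auto simp: y_def divide_le_eq)
    have "\<bar>real c - y\<bar> \<le> 1"
    proof (cases "nat \<lfloor>y\<rfloor> \<le> n - 1")
      case True
      hence "c = nat \<lfloor>y\<rfloor>" by (simp add: c_def y_def[symmetric])
      thus ?thesis using y by linarith
    next
      case False
      hence "c = n - 1" by (simp add: c_def y_def[symmetric])
      moreover have "real n \<le> real (nat \<lfloor>y\<rfloor>)" using False by simp
      ultimately show ?thesis using y npos by linarith
    qed
    hence "pi / real n * \<bar>real c - y\<bar> \<le> pi / real n * 1" by (intro mult_left_mono) auto
    moreover have "pi * real c / real n - xs = pi / real n * (real c - y)" using npos by (simp add: y_def field_simps)
    ultimately show ?thesis using npos by (simp add: abs_mult)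
  qed
  \<comment> \<open>A one-sided block next to \<open>c\<close>, on a side that stays within the
    index range; since \<open>m\<close> is below \<open>n / 6\<close>, there is room on at least one
    side.\<close>
  define I where "I = (if c + m < n then {c..c + m} else {c - m..c})"
  have I: "I \<subseteq> {..<n}" "card I = m + 1" and I_close: "\<And>i. i \<in> I \<Longrightarrow> \<bar>real i - real c\<bar> \<le> real m"
    using cn mn npos unfolding I_def by (auto split: if_splits)
  have val: "h\<^sup>2 / 4 \<le> (g (freq n i))\<^sup>2" if i: "i \<in> I" for i
  proof -
    have fi: "freq n i \<in> {0..pi}" using i I by (intro freq_range) auto
    have "pi / real n * \<bar>real i - real c\<bar> \<le> pi / real n * real m" using I_close[OF i] by (intro mult_left_mono) auto
    hence "\<bar>pi * real i / real n - pi * real c / real n\<bar> \<le> pi / real n * real m"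
      by (simp add: abs_mult flip: right_diff_distrib diff_divide_distrib)
    hence "\<bar>freq n i - xs\<bar> \<le> pi / real n * real m + (pi / real n + pi / real n)"
      using freq_close[of n i] c_close by linarith
    also have "\<dots> = pi / real n * (real m + 2)" by (simp add: distrib_left)
    also have "\<dots> \<le> pi / real n * (real n * \<rho> / pi)" using mr by (intro mult_left_mono) auto
    also have "\<dots> = \<rho>" using npos by simp
    finally have "L * \<bar>freq n i - xs\<bar> \<le> L * \<rho>" using L by (intro mult_left_mono) auto
    also have "L * \<rho> = h / 2" using L by (simp add: \<rho>_def)
    finally have "\<bar>g (freq n i) - g xs\<bar> \<le> h / 2" using lip[OF fi xs] by linarith
    hence "h / 2 \<le> \<bar>g (freq n i)\<bar>" using h by linarith
    hence "(h / 2)\<^sup>2 \<le> \<bar>g (freq n i)\<bar>\<^sup>2" using h by (intro power_mono) auto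
    thus ?thesis by (simp add: power_divide)
  qed
  have "Z / 2 \<le> real m + 1" if "Z - 3 \<le> real m" "4 \<le> Z" for Z using that by linarith
  from this[OF mr(2) big] have "real n * \<rho> / pi / 2 \<le> real m + 1" .
  hence "real n * \<rho> / pi / 2 \<le> real (m + 1)" by (simp only: of_nat_add of_nat_1)
  hence "real n * \<rho> / pi / 2 * (h\<^sup>2 / 4) \<le> real (m + 1) * (h\<^sup>2 / 4)" by (intro mult_right_mono) auto
  also have "\<dots> = (\<Sum>i\<in>I. h\<^sup>2 / 4)" using I(2) by simp
  also have "\<dots> \<le> (\<Sum>i\<in>I. (g (freq n i))\<^sup>2)" by (intro sum_mono val)
  also have "\<dots> \<le> (\<Sum>i<n. (g (freq n i))\<^sup>2)" using I by (intro sum_mono2) auto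
  finally show ?thesis by (simp add: \<rho>_def power3_eq_cube power2_eq_square mult_ac)
qed

section \<open>Quadratic forms of the design\<close>

lemma weighted_gram_form:
  fixes y :: "nat \<Rightarrow> real^'r"
  shows "v \<bullet> ((\<chi> a b. \<Sum>i\<in>I. y i $ a * c i * y i $ b) *v v) = (\<Sum>i\<in>I. c i * (y i \<bullet> v)\<^sup>2)"
proof -
  have "v \<bullet> ((\<chi> a b. \<Sum>i\<in>I. y i $ a * c i * y i $ b) *v v)
      = (\<Sum>a\<in>UNIV. \<Sum>b\<in>UNIV. \<Sum>i\<in>I. v $ a * (y i $ a * c i * y i $ b * v $ b))"
    by (simp add: inner_vec_def matrix_vector_mult_def sum_distrib_left sum_distrib_right)
  also have "\<dots> = (\<Sum>a\<in>UNIV. \<Sum>i\<in>I. \<Sum>b\<in>UNIV. v $ a * (y i $ a * c i * y i $ b * v $ b))"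
    by (intro sum.cong refl sum.swap)
  also have "\<dots> = (\<Sum>i\<in>I. \<Sum>a\<in>UNIV. \<Sum>b\<in>UNIV. v $ a * (y i $ a * c i * y i $ b * v $ b))"
    by (rule sum.swap)
  also have "\<dots> = (\<Sum>i\<in>I. c i * ((\<Sum>a\<in>UNIV. y i $ a * v $ a) * (\<Sum>b\<in>UNIV. y i $ b * v $ b)))"
    by (simp add: sum_product sum_distrib_left mult_ac)
  finally show ?thesis by (simp add: inner_vec_def power2_eq_square)
qed

lemma gram_form: "v \<bullet> (gram X n *v v) = (\<Sum>t=1..n. (X n t \<bullet> v)\<^sup>2)"
  using weighted_gram_form[of v "\<lambda>t. X n t" "\<lambda>_. 1" "{1..n}"] by (simp add: gram_def)

lemma S_mat_form: "v \<bullet> (S_mat X f n *v v) = info X n f v"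
  using weighted_gram_form[of v "tilde_vec n (X n)" "\<lambda>i. 1 / D_diag n f i" "{..<n}"]
  by (simp add: S_mat_def info_def)

lemma transpose_gram: "transpose (gram X n) = gram X n"
  by (simp add: gram_def transpose_def vec_eq_iff mult.commute)

lemma transpose_S_mat: "transpose (S_mat X f n) = S_mat X f n"
  by (simp add: S_mat_def transpose_def vec_eq_iff mult_ac)

text \<open>Parseval: the orthogonal transform leaves the Gram matrix of the design
  unchanged.\<close>

lemma tilde_gram:
  fixes X :: "('r::finite) design" and v :: "real^'r"
  shows "(\<Sum>i<n. (tilde_vec n (X n) i \<bullet> v)\<^sup>2) = v \<bullet> (gram X n *v v)"
  unfolding tilde_vec_inner gram_form
  using tilde_vec_parseval[of n "\<lambda>t. X n t \<bullet> v" "\<lambda>t. X n t \<bullet> v"] by (simp add: power2_eq_square)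

text \<open>A constant strictly below the lower limit and one strictly above the upper limit bound
  the eigenvalues for all large \<open>n\<close>, and the extreme eigenvalues bound the form. The
  upper constant is raised to at least 1 to make it positive.\<close>

lemma assumption_D_gram_bounds:
  fixes X :: "('r::finite) design"
  assumes "assumption_D X"
  obtains c C where "0 < c" "0 < C"
    "\<forall>\<^sub>F n in sequentially. \<forall>v :: real^'r. c * real n * (v \<bullet> v) \<le> v \<bullet> (gram X n *v v) \<and> v \<bullet> (gram X n *v v) \<le> C * real n * (v \<bullet> v)"
proof -
  have lo: "0 < liminf (\<lambda>n. ereal (lambda_min (gram X n) / real n))"
    and hi: "limsup (\<lambda>n. ereal (lambda_max (gram X n) / real n)) < \<infinity>"
    using assms unfolding assumption_D_def by auto
  obtain c where c: "0 < c" "ereal c < liminf (\<lambda>n. ereal (lambda_min (gram X n) / real n))"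
    using ereal_dense2[OF lo] by (auto simp: zero_ereal_def)
  obtain C where C: "limsup (\<lambda>n. ereal (lambda_max (gram X n) / real n)) < ereal C"
    using ereal_dense2[OF hi] by auto
  have "\<forall>\<^sub>F n in sequentially. \<forall>v :: real^'r. c * real n * (v \<bullet> v) \<le> v \<bullet> (gram X n *v v) \<and> v \<bullet> (gram X n *v v) \<le> max 1 C * real n * (v \<bullet> v)"
    using less_LiminfD[OF c(2)] Limsup_lessD[OF C] eventually_gt_at_top[of 0]
  proof eventually_elim
    case (elim n)
    show ?case
    proof (intro allI conjI)
      fix v :: "real^'r"
      have "c * real n \<le> lambda_min (gram X n)" using elim by (simp add: pos_less_divide_eq)
      hence "c * real n * (v \<bullet> v) \<le> lambda_min (gram X n) * (v \<bullet> v)" by (intro mult_right_mono) auto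
      also have "\<dots> \<le> v \<bullet> (gram X n *v v)" by (rule lambda_min_form(2)[OF transpose_gram])
      finally show "c * real n * (v \<bullet> v) \<le> v \<bullet> (gram X n *v v)" .
      have "lambda_max (gram X n) \<le> C * real n" using elim by (simp add: pos_divide_less_eq)
      also have "\<dots> \<le> max 1 C * real n" by (intro mult_right_mono) auto
      finally have "lambda_max (gram X n) * (v \<bullet> v) \<le> max 1 C * real n * (v \<bullet> v)" by (intro mult_right_mono) auto
      thus "v \<bullet> (gram X n *v v) \<le> max 1 C * real n * (v \<bullet> v)"
        using lambda_max_form[OF transpose_gram, of v X n] by linarith
    qed
  qed
  thus thesis using c(1) by (intro that[of c "max 1 C"]) auto
qed

lemma info_bounds:
  fixes X :: "('r::finite) design" and v :: "real^'r"
  assumes "\<And>i. i < n \<Longrightarrow> lo \<le> f (freq n i)" "\<And>i. i < n \<Longrightarrow> f (freq n i) \<le> hi" "0 < lo"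
  shows "(v \<bullet> (gram X n *v v)) / (2 * pi * hi) \<le> info X n f v" "info X n f v \<le> (v \<bullet> (gram X n *v v)) / (2 * pi * lo)"
  unfolding tilde_gram[symmetric] info_def sum_divide_distrib
proof -
  have "0 < f (freq n i)" "lo \<le> f (freq n i)" "f (freq n i) \<le> hi" "0 < hi" if "i < n" for i
    using assms(1,2)[OF that] assms(3) by linarith+
  thus "(\<Sum>i<n. (tilde_vec n (X n) i \<bullet> v)\<^sup>2 / (2 * pi * hi)) \<le> (\<Sum>i<n. (tilde_vec n (X n) i \<bullet> v)\<^sup>2 / D_diag n f i)"
    "(\<Sum>i<n. (tilde_vec n (X n) i \<bullet> v)\<^sup>2 / D_diag n f i) \<le> (\<Sum>i<n. (tilde_vec n (X n) i \<bullet> v)\<^sup>2 / (2 * pi * lo))"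
    using assms(3) by (auto intro!: sum_mono divide_left_mono mult_pos_pos simp: D_diag_def)
qed

text \<open>The exceptional event. It involves the design and \<open>f\<^sub>0\<close> but neither
  \<theta> nor \<open>f\<close>, so that outside it the bounds hold for all parameters and all
  \<open>f\<close> in the support simultaneously. There is one linear sum for each coordinate
  \<open>a\<close> of the parameter.\<close>

definition noisy :: "('r::finite) design \<Rightarrow> (real \<Rightarrow> real) \<Rightarrow> nat \<Rightarrow> real \<Rightarrow> (nat \<Rightarrow> real) set" where
  "noisy X f\<^sub>0 n s = (\<Union>a. {\<epsilon> \<in> space (white_noise n). s \<le> partial_sum_size n (\<lambda>i. (tilde_vec n (X n) i $ a * sqrt (D_diag n f\<^sub>0 i)) * \<epsilon> i)})
    \<union> {\<epsilon> \<in> space (white_noise n). s \<le> partial_sum_size n (\<lambda>i. (\<epsilon> i)\<^sup>2 - 1)}"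

lemma partial_sum_size_measurable:
  assumes "\<And>i. i < n \<Longrightarrow> (\<lambda>\<epsilon>. y \<epsilon> i) \<in> borel_measurable M"
  shows "(\<lambda>\<epsilon>. partial_sum_size n (y \<epsilon>)) \<in> borel_measurable M"
  unfolding partial_sum_size_def using assms
  by (intro borel_measurable_add borel_measurable_abs borel_measurable_divide borel_measurable_sum borel_measurable_const) auto

lemma white_noise_coordinate: "i < n \<Longrightarrow> (\<lambda>\<epsilon>. \<epsilon> i) \<in> borel_measurable (white_noise n)"
  by measurable

lemma noisy_pieces_measurable:
  "{\<epsilon> \<in> space (white_noise n). s \<le> partial_sum_size n (\<lambda>i. c i * \<epsilon> i)} \<in> sets (white_noise n)"
  "{\<epsilon> \<in> space (white_noise n). s \<le> partial_sum_size n (\<lambda>i. (\<epsilon> i)\<^sup>2 - 1)} \<in> sets (white_noise n)"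
proof -
  have [measurable]: "(\<lambda>\<epsilon>. partial_sum_size n (\<lambda>i. c i * \<epsilon> i)) \<in> borel_measurable (white_noise n)"
    "(\<lambda>\<epsilon>. partial_sum_size n (\<lambda>i. (\<epsilon> i)\<^sup>2 - 1)) \<in> borel_measurable (white_noise n)"
    by (intro partial_sum_size_measurable borel_measurable_times borel_measurable_const borel_measurable_diff
        borel_measurable_power white_noise_coordinate; assumption)+
  show "{\<epsilon> \<in> space (white_noise n). s \<le> partial_sum_size n (\<lambda>i. c i * \<epsilon> i)} \<in> sets (white_noise n)"
    "{\<epsilon> \<in> space (white_noise n). s \<le> partial_sum_size n (\<lambda>i. (\<epsilon> i)\<^sup>2 - 1)} \<in> sets (white_noise n)"
    by measurable
qed

lemma noisy_measurable: "noisy X f\<^sub>0 n s \<in> sets (white_noise n)"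
  unfolding noisy_def by (intro sets.Un sets.finite_UN noisy_pieces_measurable) auto

text \<open>The variances of a linear sum add up to at most \<open>2 * pi * \<tau>\<^sub>1\<close>
  times a diagonal entry of the Gram matrix, which is of order \<open>n\<close>; those of the
  centred squares add up to \<open>2 * n\<close>. A union bound over the coordinates
  remains.\<close>

lemma prob_noisy:
  fixes X :: "('r::finite) design"
  assumes s: "0 < s" and C: "\<And>v. v \<bullet> (gram X n *v v) \<le> C * real n * (v \<bullet> v)" "0 \<le> C"
    and f0: "\<And>i. i < n \<Longrightarrow> 0 < f\<^sub>0 (freq n i)" "\<And>i. i < n \<Longrightarrow> f\<^sub>0 (freq n i) \<le> \<tau>\<^sub>1" "0 < \<tau>\<^sub>1"
  shows "measure (white_noise n) (noisy X f\<^sub>0 n s)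
    \<le> (real CARD('r) * (2 * sqrt (2 * pi * \<tau>\<^sub>1 * C)) + 2 * sqrt 2) * sqrt (real n) / s"
proof -
  interpret W: prob_space "white_noise n" by (rule prob_space_white_noise)
  have lin: "measure (white_noise n) {\<epsilon> \<in> space (white_noise n). s \<le> partial_sum_size n (\<lambda>i. (tilde_vec n (X n) i $ a * sqrt (D_diag n f\<^sub>0 i)) * \<epsilon> i)}
      \<le> 2 * sqrt (2 * pi * \<tau>\<^sub>1 * C * real n) / s" for a
  proof (rule white_noise_partial_sum_size)
    have "(\<Sum>i<n. (tilde_vec n (X n) i $ a * sqrt (D_diag n f\<^sub>0 i))\<^sup>2) \<le> (\<Sum>i<n. 2 * pi * \<tau>\<^sub>1 * (tilde_vec n (X n) i \<bullet> axis a 1)\<^sup>2)"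
    proof (intro sum_mono)
      fix i assume "i \<in> {..<n}"
      hence i: "i < n" by simp
      have "(tilde_vec n (X n) i $ a * sqrt (D_diag n f\<^sub>0 i))\<^sup>2 = D_diag n f\<^sub>0 i * (tilde_vec n (X n) i \<bullet> axis a 1)\<^sup>2"
        using f0(1)[OF i] by (simp add: power_mult_distrib D_diag_def inner_axis mult.commute)
      also have "\<dots> \<le> 2 * pi * \<tau>\<^sub>1 * (tilde_vec n (X n) i \<bullet> axis a 1)\<^sup>2"
        using f0(2)[OF i] by (intro mult_right_mono) (auto simp: D_diag_def)
      finally show "(tilde_vec n (X n) i $ a * sqrt (D_diag n f\<^sub>0 i))\<^sup>2 \<le> 2 * pi * \<tau>\<^sub>1 * (tilde_vec n (X n) i \<bullet> axis a 1)\<^sup>2" .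
    qed
    also have "\<dots> = 2 * pi * \<tau>\<^sub>1 * (axis a 1 \<bullet> (gram X n *v axis a 1))" by (simp add: tilde_gram[symmetric] sum_distrib_left)
    also have "\<dots> \<le> 2 * pi * \<tau>\<^sub>1 * (C * real n * (axis a 1 \<bullet> (axis a 1 :: real^'r)))"
      using f0(3) by (intro mult_left_mono C) auto
    finally show "(\<Sum>i<n. \<integral>x. (tilde_vec n (X n) i $ a * sqrt (D_diag n f\<^sub>0 i) * x)\<^sup>2 \<partial>density lborel std_normal_density) \<le> 2 * pi * \<tau>\<^sub>1 * C * real n"
      unfolding std_normal_linear_moments(4) by (simp add: inner_axis mult.assoc)
  qed (use s std_normal_linear_moments in auto)
  have sq: "measure (white_noise n) {\<epsilon> \<in> space (white_noise n). s \<le> partial_sum_size n (\<lambda>i. (\<epsilon> i)\<^sup>2 - 1)} \<le> 2 * sqrt (2 * real n) / s"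
    by (rule white_noise_partial_sum_size) (use s std_normal_square_moments in auto)
  have "measure (white_noise n) (noisy X f\<^sub>0 n s) \<le>
      measure (white_noise n) (\<Union>a. {\<epsilon> \<in> space (white_noise n). s \<le> partial_sum_size n (\<lambda>i. (tilde_vec n (X n) i $ a * sqrt (D_diag n f\<^sub>0 i)) * \<epsilon> i)})
      + measure (white_noise n) {\<epsilon> \<in> space (white_noise n). s \<le> partial_sum_size n (\<lambda>i. (\<epsilon> i)\<^sup>2 - 1)}"
    unfolding noisy_def by (intro measure_Un_le sets.finite_UN noisy_pieces_measurable) auto
  also have "\<dots> \<le> (\<Sum>a\<in>(UNIV :: 'r set). 2 * sqrt (2 * pi * \<tau>\<^sub>1 * C * real n) / s) + 2 * sqrt (2 * real n) / s"
    by (intro add_mono sq order_trans[OF measure_UNION_le sum_mono[OF lin]] noisy_pieces_measurable) auto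
  also have "\<dots> = (real CARD('r) * (2 * sqrt (2 * pi * \<tau>\<^sub>1 * C)) + 2 * sqrt 2) * sqrt (real n) / s"
    by (simp add: real_sqrt_mult add_divide_distrib distrib_left distrib_right mult_ac)
  finally show ?thesis .
qed

text \<open>In each coordinate the score is a sum of noise terms free of \<open>f\<close> with
  weights \<open>1 / D_diag n f i\<close>. These are bounded and change by order
  \<open>1 / n\<close> from row to row, so summation by parts applies with constants that depend on
  \<open>f\<close> only through \<open>\<tau>\<^sub>0\<close> and
  \<open>\<tau>\<^sub>1\<close>.\<close>

lemma score_bound:
  fixes X :: "('r::finite) design"
  assumes \<tau>: "0 < \<tau>\<^sub>0" "0 < \<tau>\<^sub>1" and f: "\<And>x. x \<in> {0..pi} \<Longrightarrow> \<tau>\<^sub>0 \<le> f x"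
    and lip: "\<And>x y. x \<in> {0..pi} \<Longrightarrow> y \<in> {0..pi} \<Longrightarrow> \<bar>f x - f y\<bar> \<le> \<tau>\<^sub>1 * \<bar>x - y\<bar>"
    and \<epsilon>: "\<epsilon> \<in> space (white_noise n)" "\<epsilon> \<notin> noisy X f\<^sub>0 n s" and s: "0 < s"
  shows "\<bar>score X n f (\<lambda>i. sqrt (D_diag n f\<^sub>0 i) * \<epsilon> i) \<delta>\<bar>
    \<le> real CARD('r) * (1 / (2 * pi * \<tau>\<^sub>0) + \<tau>\<^sub>1 / \<tau>\<^sub>0\<^sup>2) * s * norm \<delta>"
proof -
  define y where "y a i = (tilde_vec n (X n) i $ a * sqrt (D_diag n f\<^sub>0 i)) * \<epsilon> i" for a i
  define h where "h i = 1 / D_diag n f i" for i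
  define B where "B = 1 / (2 * pi * \<tau>\<^sub>0)"
  define \<Lambda> where "\<Lambda> = \<tau>\<^sub>1 / \<tau>\<^sub>0\<^sup>2"
  have fpos: "\<tau>\<^sub>0 \<le> f (freq n i)" "0 < f (freq n i)" if "i < n" for i
    using f[OF freq_range[OF that]] \<tau> by auto
  have hB: "\<bar>h i\<bar> \<le> B" if "i < n" for i
    unfolding h_def B_def D_diag_def using fpos[OF that] \<tau> by (auto simp: abs_of_pos intro!: divide_left_mono)
  have h\<Lambda>: "\<bar>h (Suc i) - h i\<bar> \<le> \<Lambda> / real n" if i: "Suc i < n" for i
  proof -
    define p q where "p = f (freq n i)" and "q = f (freq n (Suc i))"
    have pq: "\<tau>\<^sub>0 \<le> p" "\<tau>\<^sub>0 \<le> q" "0 < p" "0 < q" using fpos[of i] fpos[OF i] i by (auto simp: p_def q_def)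
    have "\<bar>p - q\<bar> \<le> \<tau>\<^sub>1 * \<bar>freq n i - freq n (Suc i)\<bar>"
      unfolding p_def q_def using i by (intro lip freq_range) auto
    also have "\<dots> \<le> \<tau>\<^sub>1 * (2 * pi / real n)"
      using freq_step[of n i] \<tau> by (intro mult_left_mono) (auto simp: abs_minus_commute)
    finally have pq2: "\<bar>p - q\<bar> \<le> \<tau>\<^sub>1 * (2 * pi / real n)" .
    have "h (Suc i) - h i = (p - q) / (2 * pi * (p * q))"
      unfolding h_def D_diag_def p_def[symmetric] q_def[symmetric] using pq by (simp add: field_simps)
    hence "\<bar>h (Suc i) - h i\<bar> = \<bar>p - q\<bar> / (2 * pi * (p * q))" using pq by (simp add: abs_mult)
    also have "\<dots> \<le> (\<tau>\<^sub>1 * (2 * pi / real n)) / (2 * pi * (\<tau>\<^sub>0 * \<tau>\<^sub>0))"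
      using pq2 pq \<tau> by (intro frac_le mult_left_mono mult_mono) auto
    also have "\<dots> = \<Lambda> / real n" by (simp add: \<Lambda>_def power2_eq_square)
    finally show ?thesis .
  qed
  have nn: "0 \<le> B" "0 \<le> \<Lambda>" using \<tau> by (auto simp: B_def \<Lambda>_def)
  have comp: "\<bar>\<Sum>i<n. h i * y a i\<bar> \<le> (B + \<Lambda>) * s" for a
  proof -
    have "partial_sum_size n (y a) < s"
      using \<epsilon> unfolding noisy_def y_def by (auto simp: not_le)
    hence "(B + \<Lambda>) * partial_sum_size n (y a) \<le> (B + \<Lambda>) * s" using nn by (intro mult_left_mono) auto
    thus ?thesis using abs_sum_le_partial_sum_size[of n h B \<Lambda> "y a", OF hB h\<Lambda> nn] by linarith
  qed
  have "score X n f (\<lambda>i. sqrt (D_diag n f\<^sub>0 i) * \<epsilon> i) \<delta> = (\<Sum>i<n. \<Sum>a\<in>UNIV. \<delta> $ a * (h i * y a i))"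
    unfolding score_def inner_vec_def sum_distrib_right sum_divide_distrib
    by (intro sum.cong refl) (simp add: h_def y_def mult_ac)
  also have "\<dots> = (\<Sum>a\<in>UNIV. \<delta> $ a * (\<Sum>i<n. h i * y a i))"
    unfolding sum_distrib_left by (rule sum.swap)
  also have "\<bar>\<dots>\<bar> \<le> (\<Sum>a\<in>(UNIV :: 'r set). norm \<delta> * ((B + \<Lambda>) * s))"
    by (rule order_trans[OF sum_abs], unfold abs_mult, intro sum_mono mult_mono comp component_le_norm_cart) auto
  finally show ?thesis by (simp add: B_def \<Lambda>_def mult_ac)
qed

text \<open>Summation by parts with the weights \<open>f\<^sub>0 / f - 1\<close>, which are
  Lipschitz because \<open>f\<close> is bounded away from zero; the factor \<open>2 * pi\<close> is
  \<open>n\<close> times the largest step between frequencies.\<close>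

lemma ratio_sum_bound:
  assumes \<tau>: "0 < \<tau>\<^sub>0" "0 < \<tau>\<^sub>1"
    and f: "\<And>x. x \<in> {0..pi} \<Longrightarrow> \<tau>\<^sub>0 \<le> f x" "\<And>x y. x \<in> {0..pi} \<Longrightarrow> y \<in> {0..pi} \<Longrightarrow> \<bar>f x - f y\<bar> \<le> \<tau>\<^sub>1 * \<bar>x - y\<bar>"
    and f0: "\<And>x. x \<in> {0..pi} \<Longrightarrow> \<tau>\<^sub>0 \<le> f\<^sub>0 x" "\<And>x. x \<in> {0..pi} \<Longrightarrow> f\<^sub>0 x \<le> \<tau>\<^sub>1"
      "\<And>x y. x \<in> {0..pi} \<Longrightarrow> y \<in> {0..pi} \<Longrightarrow> \<bar>f\<^sub>0 x - f\<^sub>0 y\<bar> \<le> \<tau>\<^sub>1 * \<bar>x - y\<bar>"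
    and \<epsilon>: "\<epsilon> \<in> space (white_noise n)" "\<epsilon> \<notin> noisy X f\<^sub>0 n s" and s: "0 < s"
  shows "\<bar>\<Sum>i<n. (spec_ratio n f\<^sub>0 f i - 1) * ((\<epsilon> i)\<^sup>2 - 1)\<bar>
    \<le> (\<tau>\<^sub>1 / \<tau>\<^sub>0 + 1 + 2 * pi * (\<tau>\<^sub>1 / \<tau>\<^sub>0 + \<tau>\<^sub>1\<^sup>2 / \<tau>\<^sub>0\<^sup>2)) * s"
proof -
  define B where "B = \<tau>\<^sub>1 / \<tau>\<^sub>0 + 1"
  define K where "K = \<tau>\<^sub>1 / \<tau>\<^sub>0 + \<tau>\<^sub>1\<^sup>2 / \<tau>\<^sub>0\<^sup>2"
  have nn: "0 \<le> B" "0 \<le> 2 * pi * K" "0 \<le> K" using \<tau> by (auto simp: B_def K_def)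
  have hB: "\<bar>spec_ratio n f\<^sub>0 f i - 1\<bar> \<le> B" if "i < n" for i
  proof -
    note x = freq_range[OF that]
    have "0 \<le> f\<^sub>0 (freq n i) / f (freq n i)" using f(1)[OF x] f0(1)[OF x] \<tau> by simp
    moreover have "f\<^sub>0 (freq n i) / f (freq n i) \<le> \<tau>\<^sub>1 / \<tau>\<^sub>0"
      using f(1)[OF x] f0(1,2)[OF x] \<tau> by (intro frac_le) auto
    ultimately show ?thesis unfolding spec_ratio_def B_def by linarith
  qed
  have h\<Lambda>: "\<bar>(spec_ratio n f\<^sub>0 f (Suc i) - 1) - (spec_ratio n f\<^sub>0 f i - 1)\<bar> \<le> 2 * pi * K / real n" if i: "Suc i < n" for i
  proof -
    define x y where "x = freq n (Suc i)" and "y = freq n i"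
    have xy: "x \<in> {0..pi}" "y \<in> {0..pi}"
      unfolding x_def y_def by (rule freq_range[OF i], rule freq_range[OF Suc_lessD[OF i]])
    have pos: "0 < f x" "0 < f y" "0 < f\<^sub>0 y" using f(1) f0(1) xy \<tau> by force+
    have "f\<^sub>0 x / f x - f\<^sub>0 y / f y = (f\<^sub>0 x - f\<^sub>0 y) / f x + f\<^sub>0 y * (f y - f x) / (f x * f y)"
      using pos by (simp add: field_simps)
    also have "\<bar>\<dots>\<bar> \<le> \<bar>f\<^sub>0 x - f\<^sub>0 y\<bar> / f x + f\<^sub>0 y * \<bar>f y - f x\<bar> / (f x * f y)"
      using pos by (intro order_trans[OF abs_triangle_ineq]) (simp add: abs_mult)
    also have "\<dots> \<le> (\<tau>\<^sub>1 * \<bar>x - y\<bar>) / \<tau>\<^sub>0 + \<tau>\<^sub>1 * (\<tau>\<^sub>1 * \<bar>x - y\<bar>) / (\<tau>\<^sub>0 * \<tau>\<^sub>0)"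
      using f(1)[OF xy(1)] f(1)[OF xy(2)] f(2)[OF xy(2,1)] f0(2)[OF xy(2)] f0(3)[OF xy] pos \<tau>
      by (intro add_mono frac_le mult_mono) (auto simp: abs_minus_commute)
    also have "\<dots> = K * \<bar>x - y\<bar>" by (simp add: K_def power2_eq_square distrib_right)
    also have "\<dots> \<le> K * (2 * pi / real n)" unfolding x_def y_def by (intro mult_left_mono freq_step nn)
    finally show ?thesis unfolding spec_ratio_def x_def[symmetric] y_def[symmetric] by (simp add: mult_ac)
  qed
  have "partial_sum_size n (\<lambda>i. (\<epsilon> i)\<^sup>2 - 1) < s" using \<epsilon> unfolding noisy_def by (auto simp: not_le)
  hence "(B + 2 * pi * K) * partial_sum_size n (\<lambda>i. (\<epsilon> i)\<^sup>2 - 1) \<le> (B + 2 * pi * K) * s"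
    using nn by (intro mult_left_mono) auto
  thus ?thesis
    using abs_sum_le_partial_sum_size[of n "\<lambda>i. spec_ratio n f\<^sub>0 f i - 1" B "2 * pi * K" "\<lambda>i. (\<epsilon> i)\<^sup>2 - 1", OF hB h\<Lambda> nn(1,2)]
    unfolding B_def K_def by linarith
qed

section \<open>Joint measurability of the likelihood and of the parameter sets\<close>

lemma whittle_density_joint_measurable:
  assumes Q: "sets Q = sets borel" and P: "sets P = sets C1_space"
  shows "(\<lambda>p. whittle_density X n (fst (snd p)) (snd (snd p)) (fst p))
    \<in> borel_measurable (Pi\<^sub>M {1..n} (\<lambda>_. lborel) \<Otimes>\<^sub>M (Q \<Otimes>\<^sub>M P))"
proof -
  let ?M = "Pi\<^sub>M {1..n} (\<lambda>_. lborel :: real measure) \<Otimes>\<^sub>M (Q \<Otimes>\<^sub>M P)"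
  have D: "(\<lambda>p. D_diag n (snd (snd p)) i) \<in> borel_measurable ?M" if "i < n" for i
  proof -
    have "(\<lambda>f. f (freq n i)) \<in> borel_measurable P"
      using evaluation_measurable[OF freq_range[OF that]] by (simp cong: measurable_cong_sets add: P)
    hence "(\<lambda>p. (snd (snd p)) (freq n i)) \<in> borel_measurable ?M"
      by (rule measurable_compose[rotated]) measurable
    thus ?thesis unfolding D_diag_def by (intro borel_measurable_times borel_measurable_const)
  qed
  have z: "(\<lambda>p. tilde_vec n (fst p) i) \<in> borel_measurable ?M" if "i < n" for i
    by (rule measurable_compose[OF measurable_fst borel_measurable_tilde_vec[OF that]])
  have "(\<lambda>\<theta>. \<theta>) \<in> measurable Q borel" by (simp cong: measurable_cong_sets add: Q)
  hence "(\<lambda>p. fst (snd p)) \<in> measurable ?M borel"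
    by (rule measurable_compose[rotated]) measurable
  hence \<theta>: "(\<lambda>p. tilde_vec n (X n) i \<bullet> fst (snd p)) \<in> borel_measurable ?M" for i
    by (intro borel_measurable_inner borel_measurable_const)
  show ?thesis
    unfolding whittle_density_def
    by (intro borel_measurable_times borel_measurable_divide borel_measurable_const
        borel_measurable_sqrt borel_measurable_prod borel_measurable_exp borel_measurable_sum borel_measurable_power
        borel_measurable_diff z \<theta> D measurable_compose[OF _ borel_measurable_exp] measurable_compose[OF _ borel_measurable_sqrt]) auto
qed

lemma Theta_set_measurable: "Theta_set X \<theta>\<^sub>0 f\<^sub>0 n \<in> sets borel"
proof -
  have "(\<lambda>\<theta>. info X n f\<^sub>0 (\<theta> - \<theta>\<^sub>0)) \<in> borel_measurable borel" unfolding info_def by measurable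
  hence "{\<theta> \<in> space borel. info X n f\<^sub>0 (\<theta> - \<theta>\<^sub>0) \<le> sqrt (lambda_min (S_mat X f\<^sub>0 n))} \<in> sets borel" by measurable
  thus ?thesis unfolding Theta_set_def S_mat_form by simp
qed

text \<open>Outside the exceptional event everything is deterministic. The first exponential bounds
  the mass outside \<open>Theta_set\<close>, divided by the prior mass \<open>q\<close> of a ball of
  radius \<open>1 / sqrt n\<close>. The second bounds the mass outside \<open>H_set\<close> and is
  divided by the prior mass \<open>v\<close> of a sup norm ball as well.\<close>

lemma posterior_lower_bound:
  fixes X :: "('r::finite) design" and \<theta>\<^sub>0 :: "real^'r"
  assumes \<tau>: "0 < \<tau>\<^sub>0" "0 < \<tau>\<^sub>1" and cont0: "continuous_on {0..pi} f\<^sub>0"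
    and f0: "\<And>x. x \<in> {0..pi} \<Longrightarrow> \<tau>\<^sub>0 \<le> f\<^sub>0 x" "\<And>x. x \<in> {0..pi} \<Longrightarrow> f\<^sub>0 x \<le> \<tau>\<^sub>1"
      "\<And>x y. x \<in> {0..pi} \<Longrightarrow> y \<in> {0..pi} \<Longrightarrow> \<bar>f\<^sub>0 x - f\<^sub>0 y\<bar> \<le> \<tau>\<^sub>1 * \<bar>x - y\<bar>"
    and gram: "\<And>v. c * real n * (v \<bullet> v) \<le> v \<bullet> (gram X n *v v)" "\<And>v. v \<bullet> (gram X n *v v) \<le> C * real n * (v \<bullet> v)" "0 < c" "0 < C"
    and n: "1 < ln (real n)" "16 * pi * \<tau>\<^sub>1 * ln (real n) \<le> real n" "1 / ln (real n) \<le> 2 * \<tau>\<^sub>1"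
    and \<epsilon>: "\<epsilon> \<in> space (white_noise n)" "\<epsilon> \<notin> noisy X f\<^sub>0 n s" and s: "0 < s"
    and Q: "prob_space Q" "sets Q = sets borel" and q: "0 < q" "q \<le> measure Q (cball \<theta>\<^sub>0 (1 / sqrt (real n)))"
    and P: "prob_space P" "sets P = sets C1_space" and AE_P: "AE f in P. f \<in> C_set \<tau>\<^sub>0 \<tau>\<^sub>1 \<and> 0 < f 0"
    and v: "0 < v" "v \<le> measure P {f \<in> C_set \<tau>\<^sub>0 \<tau>\<^sub>1. sup_norm (\<lambda>\<omega>. f \<omega> - f\<^sub>0 \<omega>) \<le> \<eta>}"
    and c12: "c\<^sub>1 = c / (2 * pi * \<tau>\<^sub>1)" "c\<^sub>2 = C / (2 * pi * \<tau>\<^sub>0)"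
    and K12: "K\<^sub>1 = real CARD('r) * (1 / (2 * pi * \<tau>\<^sub>0) + \<tau>\<^sub>1 / \<tau>\<^sub>0\<^sup>2)"
      "K\<^sub>2 = \<tau>\<^sub>1 / \<tau>\<^sub>0 + 1 + 2 * pi * (\<tau>\<^sub>1 / \<tau>\<^sub>0 + \<tau>\<^sub>1\<^sup>2 / \<tau>\<^sub>0\<^sup>2)"
  shows "1 - (exp (- (c\<^sub>1 / (4 * c\<^sub>2)) * sqrt (c\<^sub>1 * real n) + (K\<^sub>1 * s)\<^sup>2 / (c\<^sub>1 * real n) + (K\<^sub>1 * s / sqrt (real n) + c\<^sub>2 / 2)) / q
      + exp (- (real n * (1 / ln (real n)) ^ 3 / (256 * pi * \<tau>\<^sub>1 ^ 3)) + K\<^sub>2 * s + real n * \<eta>\<^sup>2 / (2 * \<tau>\<^sub>0\<^sup>2)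
          + (K\<^sub>1 * s)\<^sup>2 / (2 * c\<^sub>1 * real n) + (K\<^sub>1 * s / sqrt (real n) + c\<^sub>2 / 2)) / (v * q))
    \<le> measure (pseudo_posterior Q P X n (synthesis X n \<theta>\<^sub>0 f\<^sub>0 \<epsilon>)) (Theta_set X \<theta>\<^sub>0 f\<^sub>0 n \<times> H_set \<tau>\<^sub>0 \<tau>\<^sub>1 f\<^sub>0 n)" (is "1 - ?R \<le> _")
    and "measure (pseudo_posterior Q P X n (synthesis X n \<theta>\<^sub>0 f\<^sub>0 \<epsilon>)) (Theta_set X \<theta>\<^sub>0 f\<^sub>0 n \<times> H_set \<tau>\<^sub>0 \<tau>\<^sub>1 f\<^sub>0 n) \<le> 1"
proof -
  interpret Q: prob_space Q by fact
  interpret P: prob_space P by fact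
  define z where "z = synthesis X n \<theta>\<^sub>0 f\<^sub>0 \<epsilon>"
  define u where "u i = sqrt (D_diag n f\<^sub>0 i) * \<epsilon> i" for i
  define a where "a f = whittle_density X n \<theta>\<^sub>0 f z" for f
  define b where "b \<theta> f = exp (score X n f u (\<theta> - \<theta>\<^sub>0) - info X n f (\<theta> - \<theta>\<^sub>0) / 2)" for \<theta> f
  define G where "G f \<longleftrightarrow> f \<in> C_set \<tau>\<^sub>0 \<tau>\<^sub>1 \<and> 0 < f 0" for f
  have npos: "0 < real n" using n by (cases "n = 0") auto
  have u: "tilde_vec n z i - tilde_vec n (X n) i \<bullet> \<theta>\<^sub>0 = u i" if "i < n" for i
    unfolding z_def u_def by (rule tilde_vec_synthesis[OF that])
  have Gf: "\<tau>\<^sub>0 \<le> f x" "f x \<le> \<tau>\<^sub>1" "y \<in> {0..pi} \<Longrightarrow> \<bar>f x - f y\<bar> \<le> \<tau>\<^sub>1 * \<bar>x - y\<bar>"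
    if "G f" "x \<in> {0..pi}" for f x y
    using C_set_bounds[OF \<tau>(1)] that unfolding G_def by blast+
  have Gfreq: "\<tau>\<^sub>0 \<le> f (freq n i)" "f (freq n i) \<le> \<tau>\<^sub>1" "0 < f (freq n i)" "0 < D_diag n f i" if "G f" "i < n" for f i
    using Gf(1,2)[OF that(1) freq_range[OF that(2)]] \<tau> by (auto simp: D_diag_def)
  have f0freq: "\<tau>\<^sub>0 \<le> f\<^sub>0 (freq n i)" "f\<^sub>0 (freq n i) \<le> \<tau>\<^sub>1" "0 < f\<^sub>0 (freq n i)" "0 < D_diag n f\<^sub>0 i" if "i < n" for i
    using f0(1,2)[OF freq_range[OF that]] \<tau> by (auto simp: D_diag_def)
  have c12pos: "0 < c\<^sub>1" "0 < c\<^sub>2" using gram \<tau> by (auto simp: c12)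
  have K1: "0 \<le> K\<^sub>1" using \<tau> by (auto simp: K12)
  have vv: "0 \<le> norm \<delta>" "\<delta> \<bullet> \<delta> = (norm \<delta>)\<^sup>2" for \<delta> :: "real^'r" by (auto simp: power2_norm_eq_inner)
  have info_lo: "c\<^sub>1 * real n * (norm \<delta>)\<^sup>2 \<le> info X n f \<delta>" and info_hi: "info X n f \<delta> \<le> c\<^sub>2 * real n * (norm \<delta>)\<^sup>2"
    if "\<And>i. i < n \<Longrightarrow> \<tau>\<^sub>0 \<le> f (freq n i)" "\<And>i. i < n \<Longrightarrow> f (freq n i) \<le> \<tau>\<^sub>1" for f \<delta>
  proof -
    note ib = info_bounds[where n = n and lo = \<tau>\<^sub>0 and f = f and hi = \<tau>\<^sub>1 and v = \<delta> and X = X, OF that \<tau>(1)]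
    have "c\<^sub>1 * real n * (norm \<delta>)\<^sup>2 = c * real n * (\<delta> \<bullet> \<delta>) / (2 * pi * \<tau>\<^sub>1)" by (simp add: c12 vv(2))
    also have "\<dots> \<le> (\<delta> \<bullet> (gram X n *v \<delta>)) / (2 * pi * \<tau>\<^sub>1)" using \<tau> by (intro divide_right_mono gram) auto
    finally show "c\<^sub>1 * real n * (norm \<delta>)\<^sup>2 \<le> info X n f \<delta>" using ib(1) by linarith
    have "(\<delta> \<bullet> (gram X n *v \<delta>)) / (2 * pi * \<tau>\<^sub>0) \<le> C * real n * (\<delta> \<bullet> \<delta>) / (2 * pi * \<tau>\<^sub>0)" using \<tau> by (intro divide_right_mono gram) auto
    also have "\<dots> = c\<^sub>2 * real n * (norm \<delta>)\<^sup>2" by (simp add: c12 vv(2))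
    finally show "info X n f \<delta> \<le> c\<^sub>2 * real n * (norm \<delta>)\<^sup>2" using ib(2) by linarith
  qed
  have score: "\<bar>score X n f u \<delta>\<bar> \<le> K\<^sub>1 * s * norm \<delta>" if "G f" for f \<delta>
    unfolding u_def K12(1) by (rule score_bound[OF \<tau> Gf(1)[OF that] Gf(3)[OF that] \<epsilon> s])
  define T where "T = Theta_set X \<theta>\<^sub>0 f\<^sub>0 n"
  define H where "H = H_set \<tau>\<^sub>0 \<tau>\<^sub>1 f\<^sub>0 n"
  define V where "V = {f \<in> C_set \<tau>\<^sub>0 \<tau>\<^sub>1. sup_norm (\<lambda>\<omega>. f \<omega> - f\<^sub>0 \<omega>) \<le> \<eta>}"
  define m where "m = c\<^sub>1 * real n"
  have m: "0 < m" using c12pos npos by (simp add: m_def)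
  \<comment> \<open>Completing the square in the distance \<open>t\<close>. With
    \<open>k = 1/2\<close> all the curvature goes into a uniform bound; with \<open>k = 1/4\<close>
    half of it remains for the decay outside \<open>T\<close>.\<close>
  have quad: "K\<^sub>1 * s * t - k * m * t\<^sup>2 \<le> (K\<^sub>1 * s)\<^sup>2 / (4 * k * m)" if "0 < k" for t k
  proof -
    have "0 \<le> (2 * k * m * t - K\<^sub>1 * s)\<^sup>2 / (4 * k * m)" using m that by simp
    also have "\<dots> = k * m * t\<^sup>2 - K\<^sub>1 * s * t + (K\<^sub>1 * s)\<^sup>2 / (4 * k * m)"
      using m that by (simp add: power2_eq_square field_simps)
    finally show ?thesis by linarith
  qed
  have b_exp: "b \<theta> f \<le> exp (K\<^sub>1 * s * norm (\<theta> - \<theta>\<^sub>0) - m * (norm (\<theta> - \<theta>\<^sub>0))\<^sup>2 / 2)" if "G f" for \<theta> f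
    unfolding b_def m_def using score[OF that, of "\<theta> - \<theta>\<^sub>0"] info_lo[of f "\<theta> - \<theta>\<^sub>0"] Gfreq(1,2)[OF that] by simp
  have b1: "b \<theta> f \<le> exp ((K\<^sub>1 * s)\<^sup>2 / (2 * m))" if "G f" for \<theta> f
    using quad[of "1/2" "norm (\<theta> - \<theta>\<^sub>0)"] by (intro order_trans[OF b_exp[OF that]]) (simp add: mult_ac)
  have b2: "b \<theta> f \<le> exp (- (c\<^sub>1 / (4 * c\<^sub>2)) * sqrt m + (K\<^sub>1 * s)\<^sup>2 / m)" if G: "G f" and "\<theta> \<notin> T" for \<theta> f
  proof -
    define t where "t = norm (\<theta> - \<theta>\<^sub>0)"
    \<comment> \<open>Outside \<open>T\<close> the information at \<open>f\<^sub>0\<close> exceeds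
      \<open>sqrt m\<close>; since it is at most \<open>c\<^sub>2 * n * t\<^sup>2\<close>, this
      forces \<open>t\<^sup>2\<close> to exceed \<open>sqrt m / (c\<^sub>2 * n)\<close>.\<close>
    have "m \<le> lambda_min (S_mat X f\<^sub>0 n)"
    proof (rule le_lambda_minI[OF transpose_S_mat])
      show "m * (v \<bullet> v) \<le> v \<bullet> (S_mat X f\<^sub>0 n *v v)" for v
        unfolding S_mat_form vv(2) m_def by (rule info_lo) (use f0freq in auto)
    qed
    hence "sqrt m \<le> sqrt (lambda_min (S_mat X f\<^sub>0 n))" by simp
    also have "\<dots> < info X n f\<^sub>0 (\<theta> - \<theta>\<^sub>0)" using \<open>\<theta> \<notin> T\<close> by (simp add: T_def Theta_set_def S_mat_form)
    also have "\<dots> \<le> c\<^sub>2 * real n * t\<^sup>2" unfolding t_def by (rule info_hi) (use f0freq in auto)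
    finally have "c\<^sub>1 / (4 * c\<^sub>2) * sqrt m \<le> c\<^sub>1 / (4 * c\<^sub>2) * (c\<^sub>2 * real n * t\<^sup>2)"
      using c12pos by (intro mult_left_mono) auto
    also have "\<dots> = m * t\<^sup>2 / 4" using c12pos by (simp add: m_def)
    finally have "c\<^sub>1 / (4 * c\<^sub>2) * sqrt m \<le> m * t\<^sup>2 / 4" .
    moreover have "K\<^sub>1 * s * t - m * t\<^sup>2 / 4 \<le> (K\<^sub>1 * s)\<^sup>2 / m" using quad[of "1/4" t] by simp
    ultimately have "K\<^sub>1 * s * t - m * t\<^sup>2 / 2 \<le> - (c\<^sub>1 / (4 * c\<^sub>2)) * sqrt m + (K\<^sub>1 * s)\<^sup>2 / m" by linarith
    thus ?thesis using b_exp[OF G, of \<theta>] unfolding t_def by (meson exp_le_cancel_iff order_trans)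
  qed
  have b3: "exp (- (K\<^sub>1 * s / sqrt (real n) + c\<^sub>2 / 2)) \<le> b \<theta> f" if G: "G f" and "\<theta> \<in> cball \<theta>\<^sub>0 (1 / sqrt (real n))" for \<theta> f
  proof -
    define t where "t = norm (\<theta> - \<theta>\<^sub>0)"
    have t: "0 \<le> t" "t \<le> 1 / sqrt (real n)" using that(2) by (auto simp: t_def dist_norm norm_minus_commute)
    have "t\<^sup>2 \<le> (1 / sqrt (real n))\<^sup>2" using t by (intro power_mono) auto
    hence "real n * t\<^sup>2 \<le> 1" using npos by (simp add: power_divide field_simps)
    hence "c\<^sub>2 * (real n * t\<^sup>2) \<le> c\<^sub>2 * 1" using c12pos by (intro mult_left_mono) auto
    hence "info X n f (\<theta> - \<theta>\<^sub>0) \<le> c\<^sub>2" using info_hi[of f "\<theta> - \<theta>\<^sub>0"] Gfreq(1,2)[OF G] unfolding t_def by (simp add: mult.assoc)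
    moreover have "K\<^sub>1 * s * t \<le> K\<^sub>1 * s * (1 / sqrt (real n))" using K1 s t by (intro mult_left_mono) auto
    ultimately show ?thesis unfolding b_def using score[OF G, of "\<theta> - \<theta>\<^sub>0"] unfolding t_def by simp
  qed
  \<comment> \<open>The likelihood at the true pair, a common factor of numerator and
    denominator.\<close>
  define w0 where "w0 = a f\<^sub>0"
  have w0: "0 < w0" unfolding w0_def a_def
    by (subst whittle_density_shifted[where n = n and X = X and f = f\<^sub>0, OF f0freq(4) u])
       (auto intro!: prod_pos normal_density_pos f0freq)
  have a_eq: "a f = w0 * exp (- (\<Sum>i<n. defect (spec_ratio n f\<^sub>0 f i)) / 2 - (\<Sum>i<n. (spec_ratio n f\<^sub>0 f i - 1) * ((\<epsilon> i)\<^sup>2 - 1)) / 2)"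
    if "G f" for f
    unfolding a_def w0_def
    by (rule whittle_density_f_ratio[where n = n and X = X and f = f and f\<^sub>0 = f\<^sub>0 and \<epsilon> = \<epsilon>, OF Gfreq(3)[OF that] f0freq(3) u[unfolded u_def]])
  have fluct: "\<bar>\<Sum>i<n. (spec_ratio n f\<^sub>0 f i - 1) * ((\<epsilon> i)\<^sup>2 - 1)\<bar> \<le> K\<^sub>2 * s" if "G f" for f
    unfolding K12(2) by (rule ratio_sum_bound[OF \<tau> Gf(1)[OF that] Gf(3)[OF that] f0 \<epsilon> s])
  have defect: "(f\<^sub>0 (freq n i) - f (freq n i))\<^sup>2 / (4 * \<tau>\<^sub>1\<^sup>2) \<le> defect (spec_ratio n f\<^sub>0 f i)"
    "defect (spec_ratio n f\<^sub>0 f i) \<le> (f\<^sub>0 (freq n i) - f (freq n i))\<^sup>2 / \<tau>\<^sub>0\<^sup>2" if "G f" "i < n" for f i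
  proof -
    note d = defect_bounds[OF f0freq(3)[OF that(2)] Gfreq(3)[OF that] f0freq(2)[OF that(2)] Gfreq(2)[OF that]]
    show "(f\<^sub>0 (freq n i) - f (freq n i))\<^sup>2 / (4 * \<tau>\<^sub>1\<^sup>2) \<le> defect (spec_ratio n f\<^sub>0 f i)"
      using d(1) unfolding spec_ratio_def .
    have "\<tau>\<^sub>0\<^sup>2 \<le> f\<^sub>0 (freq n i) * f (freq n i)"
      unfolding power2_eq_square using f0freq[OF that(2)] Gfreq[OF that] \<tau> by (intro mult_mono) auto
    hence "(f\<^sub>0 (freq n i) - f (freq n i))\<^sup>2 / (f\<^sub>0 (freq n i) * f (freq n i)) \<le> (f\<^sub>0 (freq n i) - f (freq n i))\<^sup>2 / \<tau>\<^sub>0\<^sup>2"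
      using \<tau> f0freq(3)[OF that(2)] Gfreq(3)[OF that] by (intro divide_left_mono mult_pos_pos) auto
    thus "defect (spec_ratio n f\<^sub>0 f i) \<le> (f\<^sub>0 (freq n i) - f (freq n i))\<^sup>2 / \<tau>\<^sub>0\<^sup>2"
      using d(2) unfolding spec_ratio_def by linarith
  qed
  \<comment> \<open>A crude bound that makes the denominator finite.\<close>
  have a0: "a f \<le> w0 * exp (K\<^sub>2 * s / 2)" if "G f" for f
  proof -
    have "0 \<le> (\<Sum>i<n. defect (spec_ratio n f\<^sub>0 f i))"
      using defect(1)[OF that] by (intro sum_nonneg) (meson lessThan_iff order_trans zero_le_divide_iff zero_le_mult_iff zero_le_numeral zero_le_power2)
    thus ?thesis unfolding a_eq[OF that] using fluct[OF that] w0 by (intro mult_left_mono) auto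
  qed
  \<comment> \<open>\<open>f - f\<^sub>0\<close> is Lipschitz with constant
    \<open>2 * \<tau>\<^sub>1\<close> and exceeds \<open>h = 1 / ln n\<close> somewhere. The
    constant is \<open>256 = 16 * 2 * 4 * 2\<close>: from the sum over frequencies, this Lipschitz
    constant, the lower bound on \<open>defect\<close> and the halving in the exponent.\<close>
  have a1: "a f \<le> w0 * exp (- (real n * (1 / ln (real n)) ^ 3 / (256 * pi * \<tau>\<^sub>1 ^ 3)) + K\<^sub>2 * s / 2)" if G: "G f" and "f \<notin> H" for f
  proof -
    have fC: "f \<in> C_set \<tau>\<^sub>0 \<tau>\<^sub>1" "f \<in> C1_functions" using G by (auto simp: G_def C_set_iff[OF \<tau>(1)])
    obtain xs where xs: "xs \<in> {0..pi}" "1 / ln (real n) < \<bar>f xs - f\<^sub>0 xs\<bar>"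
      using \<open>f \<notin> H\<close> fC sup_norm_diff_le_iff[OF fC(2) cont0] unfolding H_def H_set_def by (auto simp: not_le)
    have "real n * (1 / ln (real n)) ^ 3 / (16 * pi * (2 * \<tau>\<^sub>1)) \<le> (\<Sum>i<n. (f (freq n i) - f\<^sub>0 (freq n i))\<^sup>2)"
    proof (rule sum_squares_at_freqs[OF _ _ xs(1)])
      fix x y assume xy: "x \<in> {0..pi}" "y \<in> {0..pi}"
      show "\<bar>(f x - f\<^sub>0 x) - (f y - f\<^sub>0 y)\<bar> \<le> 2 * \<tau>\<^sub>1 * \<bar>x - y\<bar>"
        using Gf(3)[OF G xy] f0(3)[OF xy] by linarith
    qed (use \<tau> n xs in \<open>auto simp: field_simps\<close>)
    hence "real n * (1 / ln (real n)) ^ 3 / (16 * pi * (2 * \<tau>\<^sub>1)) / (4 * \<tau>\<^sub>1\<^sup>2) \<le> (\<Sum>i<n. (f\<^sub>0 (freq n i) - f (freq n i))\<^sup>2) / (4 * \<tau>\<^sub>1\<^sup>2)"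
      by (intro divide_right_mono) (auto simp: power2_commute)
    also have "\<dots> \<le> (\<Sum>i<n. defect (spec_ratio n f\<^sub>0 f i))"
      unfolding sum_divide_distrib by (intro sum_mono defect(1)[OF G]) auto
    finally have "real n * (1 / ln (real n)) ^ 3 / (256 * pi * \<tau>\<^sub>1 ^ 3) \<le> (\<Sum>i<n. defect (spec_ratio n f\<^sub>0 f i)) / 2"
      by (simp add: power3_eq_cube power2_eq_square mult_ac)
    thus ?thesis unfolding a_eq[OF G] using fluct[OF G] w0 by (intro mult_left_mono) auto
  qed
  have a2: "w0 * exp (- (real n * \<eta>\<^sup>2 / (2 * \<tau>\<^sub>0\<^sup>2)) - K\<^sub>2 * s / 2) \<le> a f" if G: "G f" and "f \<in> V" for f
  proof -
    have fC: "f \<in> C1_functions" using G by (auto simp: G_def C_set_iff[OF \<tau>(1)])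
    have close: "\<bar>f x - f\<^sub>0 x\<bar> \<le> \<eta>" if "x \<in> {0..pi}" for x
      using \<open>f \<in> V\<close> sup_norm_diff_le_iff[OF fC cont0] that unfolding V_def by auto
    have "(\<Sum>i<n. defect (spec_ratio n f\<^sub>0 f i)) \<le> (\<Sum>i<n. \<eta>\<^sup>2 / \<tau>\<^sub>0\<^sup>2)"
    proof (intro sum_mono)
      fix i assume "i \<in> {..<n}"
      hence i: "i < n" by simp
      have "\<bar>f\<^sub>0 (freq n i) - f (freq n i)\<bar>\<^sup>2 \<le> \<eta>\<^sup>2"
        using close[OF freq_range[OF i]] by (intro power_mono) (auto simp: abs_minus_commute)
      hence "(f\<^sub>0 (freq n i) - f (freq n i))\<^sup>2 / \<tau>\<^sub>0\<^sup>2 \<le> \<eta>\<^sup>2 / \<tau>\<^sub>0\<^sup>2" by (intro divide_right_mono) auto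
      thus "defect (spec_ratio n f\<^sub>0 f i) \<le> \<eta>\<^sup>2 / \<tau>\<^sub>0\<^sup>2" using defect(2)[OF G i] by linarith
    qed
    hence "(\<Sum>i<n. defect (spec_ratio n f\<^sub>0 f i)) / 2 \<le> real n * \<eta>\<^sup>2 / (2 * \<tau>\<^sub>0\<^sup>2)" by simp
    hence "- (real n * \<eta>\<^sup>2 / (2 * \<tau>\<^sub>0\<^sup>2)) - K\<^sub>2 * s / 2
        \<le> - (\<Sum>i<n. defect (spec_ratio n f\<^sub>0 f i)) / 2 - (\<Sum>i<n. (spec_ratio n f\<^sub>0 f i - 1) * ((\<epsilon> i)\<^sup>2 - 1)) / 2"
      using fluct[OF G] by linarith
    thus ?thesis unfolding a_eq[OF G] using w0 by (intro mult_left_mono) (simp_all only: exp_le_cancel_iff less_imp_le)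
  qed
  have joint: "(\<lambda>p. whittle_density X n (fst p) (snd p) z) \<in> borel_measurable (Q \<Otimes>\<^sub>M P)"
  proof -
    have "z \<in> space (Pi\<^sub>M {1..n} (\<lambda>_. lborel))" unfolding z_def synthesis_def by (auto simp: space_PiM)
    from measurable_compose[OF measurable_Pair1'[OF this] whittle_density_joint_measurable[OF Q(2) P(2)]]
    show ?thesis by simp
  qed
  have a_meas: "a \<in> borel_measurable P"
  proof -
    have "\<theta>\<^sub>0 \<in> space Q" using sets_eq_imp_space_eq[OF Q(2)] by simp
    from measurable_compose[OF measurable_Pair1'[OF this] joint] show ?thesis unfolding a_def by simp
  qed
  have fact_ab: "whittle_density X n \<theta> f z = a f * b \<theta> f" if "G f" for \<theta> f
    unfolding a_def b_def by (rule whittle_density_theta_ratio[where n = n and X = X and f = f and u = u, OF Gfreq(4)[OF that] u])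
  have sets: "T \<in> sets Q" "H \<in> sets P" "V \<in> sets P" "cball \<theta>\<^sub>0 (1 / sqrt (real n)) \<in> sets Q"
    unfolding T_def H_def V_def H_set_def Q(2) P(2)
    by (rule Theta_set_measurable, (rule sup_ball_measurable[OF \<tau>(1) cont0])+) simp
  \<comment> \<open>The fluctuation \<open>K\<^sub>2 * s / 2\<close> is paid once in the numerator
    and once in the denominator, hence \<open>K\<^sub>2 * s\<close> in the final exponent.\<close>
  define R' where "R' = exp (- (c\<^sub>1 / (4 * c\<^sub>2)) * sqrt m + (K\<^sub>1 * s)\<^sup>2 / m) / (exp (- (K\<^sub>1 * s / sqrt (real n) + c\<^sub>2 / 2)) * q)
      + (w0 * exp (- (real n * (1 / ln (real n)) ^ 3 / (256 * pi * \<tau>\<^sub>1 ^ 3)) + K\<^sub>2 * s / 2)) * exp ((K\<^sub>1 * s)\<^sup>2 / (2 * m))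
        / ((w0 * exp (- (real n * \<eta>\<^sup>2 / (2 * \<tau>\<^sub>0\<^sup>2)) - K\<^sub>2 * s / 2)) * v * (exp (- (K\<^sub>1 * s / sqrt (real n) + c\<^sub>2 / 2)) * q))"
  have a_pos: "0 < a f" if "G f" for f using a_eq[OF that] w0 by simp
  have res: "1 - R' \<le> measure (density (Q \<Otimes>\<^sub>M P) (\<lambda>(\<theta>, f). ennreal (whittle_density X n \<theta> f z) / (\<integral>\<^sup>+(\<theta>', f'). ennreal (whittle_density X n \<theta>' f' z) \<partial>(Q \<Otimes>\<^sub>M P)))) (T \<times> H)"
    "measure (density (Q \<Otimes>\<^sub>M P) (\<lambda>(\<theta>, f). ennreal (whittle_density X n \<theta> f z) / (\<integral>\<^sup>+(\<theta>', f'). ennreal (whittle_density X n \<theta>' f' z) \<partial>(Q \<Otimes>\<^sub>M P)))) (T \<times> H) \<le> 1"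
    unfolding R'_def
    by (rule posterior_mass_lower[OF Q(1) P(1) _ a_meas sets(1,2,3,4) AE_P[folded G_def] fact_ab a_pos a0 _ b1 b2 b3 a1 a2 _ _ _ _ q(1) v(1) q(2) v(2)[folded V_def]];
        use joint w0 in \<open>simp add: b_def case_prod_beta'\<close>)+
  have "R' = ?R"
  proof -
    have e1: "exp x / (exp (- y) * q) = exp (x + y) / q" for x y :: real by (simp add: exp_add exp_minus field_simps)
    have e2: "(w0 * exp x1) * exp x2 / ((w0 * exp (- x3 - x4)) * v * (exp (- y) * q)) = exp (x1 + x2 + x3 + x4 + y) / (v * q)" for x1 x2 x3 x4 y :: real
      using w0 by (simp add: exp_add exp_minus exp_diff field_simps)
    show ?thesis unfolding R'_def e1 e2 m_def by (simp add: algebra_simps)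
  qed
  thus "1 - ?R \<le> measure (pseudo_posterior Q P X n (synthesis X n \<theta>\<^sub>0 f\<^sub>0 \<epsilon>)) (Theta_set X \<theta>\<^sub>0 f\<^sub>0 n \<times> H_set \<tau>\<^sub>0 \<tau>\<^sub>1 f\<^sub>0 n)"
    "measure (pseudo_posterior Q P X n (synthesis X n \<theta>\<^sub>0 f\<^sub>0 \<epsilon>)) (Theta_set X \<theta>\<^sub>0 f\<^sub>0 n \<times> H_set \<tau>\<^sub>0 \<tau>\<^sub>1 f\<^sub>0 n) \<le> 1"
    using res unfolding pseudo_posterior_def z_def T_def H_def by simp_all
qed

text \<open>The decay \<open>sqrt n\<close> beats \<open>n powr (1/4)\<close>, and the power of
  \<open>n\<close> coming from the prior mass of the parameter ball is negligible.\<close>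

lemma theta_rate_tendsto_0:
  fixes a b c d e :: real
  assumes "0 < a" "0 < b" "0 < c" "0 < d" "0 < e"
  shows "(\<lambda>n::nat. exp (- a * sqrt (real n) + b * real n powr (1/4) + c * real n powr (1/8) + d) * real n powr e) \<longlonglongrightarrow> 0"
  using assms by real_asymp

text \<open>The tight comparison is \<open>n / (ln n) ^ 3\<close> against
  \<open>n / (ln n) ^ 4\<close>, won by one logarithm. The term of order \<open>(ln n) ^ 8\<close>
  from the prior mass and the powers of \<open>n\<close> with exponent below 1 are of lower
  order.\<close>

lemma f_rate_tendsto_0:
  fixes a b c d e g h k :: real
  assumes "0 < a" "0 < b" "0 < c" "0 < d" "0 < e" "0 < g" "0 < h" "0 < k"
  shows "(\<lambda>n::nat. exp (- a * (real n * (1 / ln (real n)) ^ 3) + b * real n powr (5/8) + c * (real n / ln (real n) ^ 4)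
     + d * (ln (real n) ^ 4 + 3)\<^sup>2 + e * real n powr (1/4) + g * real n powr (1/8) + h) * real n powr k) \<longlonglongrightarrow> 0"
  using assms by real_asymp

lemma eventually_ln_conditions:
  fixes t :: real assumes "0 < t"
  shows "\<forall>\<^sub>F n in sequentially. 1 < ln (real n)"
  "\<forall>\<^sub>F n in sequentially. 16 * pi * t * ln (real n) \<le> real n"
  "\<forall>\<^sub>F n in sequentially. 1 / ln (real n) \<le> 2 * t"
  using assms by real_asymp+

text \<open>Numerator and denominator are integrals over the prior of a function that is jointly
  measurable in data, parameter and spectral density.\<close>

lemma pseudo_posterior_measurable:
  assumes Q: "prob_space Q" "sets Q = sets borel" and P: "prob_space P" "sets P = sets C1_space"
    and A: "A \<in> sets (Q \<Otimes>\<^sub>M P)"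
  shows "(\<lambda>z. measure (pseudo_posterior Q P X n z) A) \<in> borel_measurable (Pi\<^sub>M {1..n} (\<lambda>_. lborel))"
proof -
  interpret Q: prob_space Q by fact
  interpret P: prob_space P by fact
  interpret QP: pair_prob_space Q P ..
  let ?J = "Pi\<^sub>M {1..n} (\<lambda>_. lborel :: real measure)" and ?QP = "Q \<Otimes>\<^sub>M P"
  define w where "w z p = ennreal (whittle_density X n (fst p) (snd p) z)" for z p
  have wm[measurable]: "(\<lambda>x. w (fst x) (snd x)) \<in> borel_measurable (?J \<Otimes>\<^sub>M ?QP)"
    unfolding w_def using whittle_density_joint_measurable[OF Q(2) P(2), of X n] by (intro measurable_compose[OF _ measurable_ennreal])
  define Den where "Den z = (\<integral>\<^sup>+p. w z p \<partial>?QP)" for z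
  have Dm[measurable]: "Den \<in> borel_measurable ?J"
    unfolding Den_def by (rule QP.borel_measurable_nn_integral) (use wm in \<open>simp add: case_prod_beta'\<close>)
  have em: "emeasure (pseudo_posterior Q P X n z) A = (\<integral>\<^sup>+p. w z p / Den z * indicator A p \<partial>?QP)" if z: "z \<in> space ?J" for z
  proof -
    have [measurable]: "w z \<in> borel_measurable ?QP"
      using measurable_compose[OF measurable_Pair1'[OF z] wm] by simp
    have "pseudo_posterior Q P X n z = density ?QP (\<lambda>p. w z p / Den z)"
      unfolding pseudo_posterior_def Den_def w_def by (simp add: case_prod_beta')
    thus ?thesis using A by (simp add: emeasure_density)
  qed
  have [measurable]: "A \<in> sets ?QP" by fact
  have "(\<lambda>x. w (fst x) (snd x) / Den (fst x) * indicator A (snd x)) \<in> borel_measurable (?J \<Otimes>\<^sub>M ?QP)"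
    by measurable
  hence "(\<lambda>z. \<integral>\<^sup>+p. w z p / Den z * indicator A p \<partial>?QP) \<in> borel_measurable ?J"
    by (intro QP.borel_measurable_nn_integral) (simp add: case_prod_beta')
  hence "(\<lambda>z. enn2real (\<integral>\<^sup>+p. w z p / Den z * indicator A p \<partial>?QP)) \<in> borel_measurable ?J" by measurable
  thus ?thesis by (rule measurable_cong[THEN iffD1, rotated]) (simp add: measure_def em)
qed

text \<open>Conditioning divides by a probability, so masses inside the conditioning set can only
  grow.\<close>

lemma truncated_prior_mass:
  assumes "prob_space M" "C_set \<tau>\<^sub>0 \<tau>\<^sub>1 \<in> sets M" "0 < measure M (C_set \<tau>\<^sub>0 \<tau>\<^sub>1)"
    and V: "V \<in> sets M" "V \<subseteq> C_set \<tau>\<^sub>0 \<tau>\<^sub>1"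
  shows "prob_space (truncated_prior M \<tau>\<^sub>0 \<tau>\<^sub>1)" "measure M V \<le> measure (truncated_prior M \<tau>\<^sub>0 \<tau>\<^sub>1) V"
proof -
  interpret prob_space M by fact
  show "prob_space (truncated_prior M \<tau>\<^sub>0 \<tau>\<^sub>1)"
    unfolding truncated_prior_def using assms by (intro prob_space_uniform_measure) (auto simp: emeasure_eq_measure)
  have "measure (truncated_prior M \<tau>\<^sub>0 \<tau>\<^sub>1) V = measure M V / measure M (C_set \<tau>\<^sub>0 \<tau>\<^sub>1)"
    unfolding truncated_prior_def using assms by (subst measure_uniform_measure) (auto simp: emeasure_eq_measure Int_absorb1)
  moreover have "measure M V / 1 \<le> measure M V / measure M (C_set \<tau>\<^sub>0 \<tau>\<^sub>1)"
    using assms by (intro divide_left_mono) auto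
  ultimately show "measure M V \<le> measure (truncated_prior M \<tau>\<^sub>0 \<tau>\<^sub>1) V" by simp
qed

theorem theorem9:
  fixes X :: "('r::finite) design" and \<theta>\<^sub>0 :: "real^'r"
    and M :: "'w measure" and e :: "nat \<Rightarrow> 'w \<Rightarrow> real" and Z :: "nat \<Rightarrow> 'w \<Rightarrow> nat \<Rightarrow> real"
    and f\<^sub>0 :: "real \<Rightarrow> real" and \<tau>\<^sub>0 \<tau>\<^sub>1 :: real
    and Q :: "(real^'r) measure"
    and p :: "nat pmf" and N :: "'v measure" and \<Phi> :: "'v \<Rightarrow> real measure"
    and \<alpha> \<beta> :: "real \<Rightarrow> real"
  assumes design: "assumption_D X"
    and "prob_space M" and "stationary M e" and "mean_zero M e" and "gaussian_process M e"
    and "has_spectral_density M e f\<^sub>0"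
    and model: "\<And>n w. w \<in> space M \<Longrightarrow> Z n w = (\<lambda>t\<in>{1..n}. X n t \<bullet> \<theta>\<^sub>0 + e t w)"
    and spectral: "assumption_F f\<^sub>0"
    and "0 < \<tau>\<^sub>0" and "\<tau>\<^sub>0 < (INF \<omega>\<in>{0..2*pi}. f\<^sub>0 \<omega>)"
    and "(SUP \<omega>\<in>{0..2*pi}. f\<^sub>0 \<omega>) < \<tau>\<^sub>1"
    and well_specified: "lip_norm f\<^sub>0 \<le> \<tau>\<^sub>1"
    and prior_theta: "assumption_P Q \<theta>\<^sub>0"
    and "pmf p 0 = 0" and prior_k: "assumption_K p"
    and "\<alpha> \<in> borel_measurable (restrict_space borel {0..pi})"
    and "\<beta> \<in> borel_measurable (restrict_space borel {0..pi})"
    and "\<And>x. x \<in> {0..pi} \<Longrightarrow> 0 < \<alpha> x \<and> 0 < \<beta> x"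
    and "assumption_G \<alpha> \<beta>" and "gamma_process N \<Phi> \<alpha> \<beta>"
  shows "converges_in_prob
           (\<lambda>n. whittle_measure X n \<theta>\<^sub>0 f\<^sub>0)
           (\<lambda>n z. measure
              (pseudo_posterior Q
                 (truncated_prior (bernstein_gamma_prior p N \<Phi>) \<tau>\<^sub>0 \<tau>\<^sub>1) X n z)
              (Theta_set X \<theta>\<^sub>0 f\<^sub>0 n \<times> H_set \<tau>\<^sub>0 \<tau>\<^sub>1 f\<^sub>0 n))
           1"
proof -
  have \<tau>0: "0 < \<tau>\<^sub>0" by fact
  have cont2: "continuous_on {0..2*pi} f\<^sub>0" using spectral unfolding assumption_F_def by blast
  have pi_sub: "{0..pi} \<subseteq> {0..2*pi}" by auto
  have cont: "continuous_on {0..pi} f\<^sub>0" by (rule continuous_on_subset[OF cont2 pi_sub])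
  obtain cl cu where clu: "\<And>\<omega>. \<omega> \<in> {0..2*pi} \<Longrightarrow> cl \<le> f\<^sub>0 \<omega> \<and> f\<^sub>0 \<omega> \<le> cu"
    using spectral unfolding assumption_F_def by blast
  have ge: "\<tau>\<^sub>0 \<le> f\<^sub>0 x" if "x \<in> {0..pi}" for x
  proof -
    have "(INF \<omega>\<in>{0..2*pi}. f\<^sub>0 \<omega>) \<le> f\<^sub>0 x"
      using that clu by (intro cINF_lower bdd_belowI2[of _ cl]) auto
    thus ?thesis using \<open>\<tau>\<^sub>0 < (INF \<omega>\<in>{0..2*pi}. f\<^sub>0 \<omega>)\<close> by linarith
  qed
  have le: "f\<^sub>0 x < \<tau>\<^sub>1" if "x \<in> {0..pi}" for x
  proof -
    have "f\<^sub>0 x \<le> (SUP \<omega>\<in>{0..2*pi}. f\<^sub>0 \<omega>)"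
      using that clu by (intro cSUP_upper bdd_aboveI2[of _ _ cu]) auto
    thus ?thesis using \<open>(SUP \<omega>\<in>{0..2*pi}. f\<^sub>0 \<omega>) < \<tau>\<^sub>1\<close> by linarith
  qed
  have \<tau>: "0 < \<tau>\<^sub>0" "\<tau>\<^sub>0 < \<tau>\<^sub>1" "0 < \<tau>\<^sub>1" using \<tau>0 ge[of 0] le[of 0] by auto
  obtain a where a: "1 < a" "summable (\<lambda>h. norm (autocov f\<^sub>0 h) * real h powr a)"
    using spectral unfolding assumption_F_def by blast
  \<comment> \<open>An exponent above 1 dominates the linear weight at all lags
    \<open>h \<ge> 1\<close>.\<close>
  have sm: "summable (\<lambda>h. real h * norm (autocov f\<^sub>0 h))"
  proof (rule summable_comparison_test'[OF a(2), of 1])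
    fix h :: nat assume "1 \<le> h"
    hence "real h powr 1 \<le> real h powr a" using a by (intro powr_mono) auto
    hence "real h \<le> real h powr a" using \<open>1 \<le> h\<close> by simp
    thus "norm (real h * norm (autocov f\<^sub>0 h)) \<le> norm (autocov f\<^sub>0 h) * real h powr a"
      by (simp add: mult.commute[of "real h"] mult_left_mono)
  qed
  obtain L where L: "\<And>x y. x \<in> {0..2*pi} \<Longrightarrow> y \<in> {0..2*pi} \<Longrightarrow> \<bar>f\<^sub>0 x - f\<^sub>0 y\<bar> \<le> L * \<bar>x - y\<bar>"
    using lipschitz_of_summable_autocov[OF cont2 sm] by blast
  have "\<bar>f\<^sub>0 x - f\<^sub>0 y\<bar> \<le> L * \<bar>x - y\<bar>" if "x \<in> {0..pi}" "y \<in> {0..pi}" for x y using L that pi_sub by blast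
  \<comment> \<open>Only with bounded difference quotients does
    \<open>lip_norm f\<^sub>0 \<le> \<tau>\<^sub>1\<close> turn into inequalities for
    \<open>f\<^sub>0\<close>.\<close>
  from lip_norm_le_iff[OF this] well_specified
  have lip3: "\<bar>f\<^sub>0 x\<bar> * \<bar>y - z\<bar> + \<bar>f\<^sub>0 y - f\<^sub>0 z\<bar> \<le> \<tau>\<^sub>1 * \<bar>y - z\<bar>"
    if "x \<in> {0..pi}" "y \<in> {0..pi}" "z \<in> {0..pi}" for x y z using that by blast
  have lip: "\<bar>f\<^sub>0 x - f\<^sub>0 y\<bar> \<le> \<tau>\<^sub>1 * \<bar>x - y\<bar>" if "x \<in> {0..pi}" "y \<in> {0..pi}" for x y
  proof -
    have "0 \<le> \<bar>f\<^sub>0 x\<bar> * \<bar>x - y\<bar>" by simp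
    thus ?thesis using lip3[OF that(1) that] by linarith
  qed
  define PB where "PB = bernstein_gamma_prior p N \<Phi>"
  define P where "P = truncated_prior PB \<tau>\<^sub>0 \<tau>\<^sub>1"
  obtain R B where RB: "0 < R" "0 < B" and mass: "\<And>k V. 2 \<le> k \<Longrightarrow> V \<in> sets C1_space \<Longrightarrow>
      {f \<in> C_set \<tau>\<^sub>0 \<tau>\<^sub>1. 0 < f 0 \<and> (\<forall>x\<in>{0..pi}. \<bar>f x - f\<^sub>0 x\<bar> \<le> R / sqrt (real k))} \<subseteq> V \<Longrightarrow>
      exp (- B * (real k)\<^sup>2) \<le> measure PB V"
    unfolding PB_def
    by (rule bernstein_gamma_prior_mass[OF assms(20,16,17,18,19) prior_k \<tau>(1,2) cont ge lip3]) blast+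
  have sets_PB: "sets PB = sets C1_space" by (simp add: PB_def bernstein_gamma_prior_def)
  have PB: "prob_space PB"
  proof -
    interpret N: prob_space N
      using assms(20) unfolding gamma_process_def completely_random_measure_def by blast
    interpret pair_prob_space "measure_pmf p" N ..
    show ?thesis unfolding PB_def bernstein_gamma_prior_def
      by (rule prob_space_distr[OF bernstein_poly_measurable[OF assms(20)]])
  qed
  have C_meas: "C_set \<tau>\<^sub>0 \<tau>\<^sub>1 \<in> sets PB" unfolding sets_PB by (rule C_set_measurable[OF \<tau>(1)])
  \<comment> \<open>Any admissible \<open>k\<close> shows that the truncation conditions on an event
    of positive probability; 2 is the least one.\<close>
  have "exp (- B * (real 2)\<^sup>2) \<le> measure PB (C_set \<tau>\<^sub>0 \<tau>\<^sub>1)"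
    using C_meas unfolding sets_PB by (intro mass) auto
  hence C_pos: "0 < measure PB (C_set \<tau>\<^sub>0 \<tau>\<^sub>1)" by (rule less_le_trans[OF exp_gt_zero])
  have P: "prob_space P" unfolding P_def by (rule truncated_prior_mass(1)[OF PB C_meas C_pos sets.empty_sets]) simp
  have sets_P: "sets P = sets C1_space" by (simp add: P_def truncated_prior_def sets_PB)
  \<comment> \<open>The ball keeps \<open>f 0\<close> away from zero and the prior makes it
    nonnegative, so it is positive.\<close>
  have AE_P: "AE f in P. f \<in> C_set \<tau>\<^sub>0 \<tau>\<^sub>1 \<and> 0 < f 0"
    unfolding P_def truncated_prior_def
  proof (rule AE_uniform_measureI[OF C_meas])
    have "\<tau>\<^sub>0 \<le> \<bar>f 0\<bar>" if "f \<in> C_set \<tau>\<^sub>0 \<tau>\<^sub>1" for f using that unfolding C_set_iff[OF \<tau>(1)] by simp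
    thus "AE f in PB. f \<in> C_set \<tau>\<^sub>0 \<tau>\<^sub>1 \<longrightarrow> f \<in> C_set \<tau>\<^sub>0 \<tau>\<^sub>1 \<and> 0 < f 0"
      using bernstein_gamma_prior_nonneg[OF assms(20), of p] \<tau>(1) unfolding PB_def[symmetric]
      by (elim AE_mp) (intro AE_I2, force)
  qed
  have Q: "prob_space Q" "sets Q = sets borel"
    using prior_theta unfolding assumption_P_def by auto
  obtain q \<rho>\<^sub>0 where q: "0 < q" "0 < \<rho>\<^sub>0" and ball: "\<And>\<rho>. 0 < \<rho> \<Longrightarrow> \<rho> \<le> \<rho>\<^sub>0 \<Longrightarrow> q * \<rho> ^ CARD('r) \<le> measure Q (cball \<theta>\<^sub>0 \<rho>)"
    using prior_ball_mass[OF prior_theta] by blast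
  obtain c C where cC: "0 < c" "0 < C" and gram: "\<forall>\<^sub>F n in sequentially. \<forall>v :: real^'r. c * real n * (v \<bullet> v) \<le> v \<bullet> (gram X n *v v) \<and> v \<bullet> (gram X n *v v) \<le> C * real n * (v \<bullet> v)"
    using assumption_D_gram_bounds[OF design] by blast
  have D0: "0 < D_diag n f\<^sub>0 i" if "i < n" for n i
    using ge[OF freq_range[OF that]] \<tau>(1) by (simp add: D_diag_def)
  define T where "T n z = measure (pseudo_posterior Q P X n z) (Theta_set X \<theta>\<^sub>0 f\<^sub>0 n \<times> H_set \<tau>\<^sub>0 \<tau>\<^sub>1 f\<^sub>0 n)" for n z
  have W: "whittle_measure X n \<theta>\<^sub>0 f\<^sub>0 = distr (white_noise n) (Pi\<^sub>M {1..n} (\<lambda>_. lborel)) (synthesis X n \<theta>\<^sub>0 f\<^sub>0)" for n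
    by (rule whittle_measure_eq_distr[OF D0])
  have T_meas: "T n \<in> borel_measurable (Pi\<^sub>M {1..n} (\<lambda>_. lborel))" for n
    unfolding T_def
  proof (rule pseudo_posterior_measurable[OF Q P sets_P])
    have "Theta_set X \<theta>\<^sub>0 f\<^sub>0 n \<in> sets Q" "H_set \<tau>\<^sub>0 \<tau>\<^sub>1 f\<^sub>0 n \<in> sets P"
      unfolding Q(2) sets_P H_set_def by (rule Theta_set_measurable, rule sup_ball_measurable[OF \<tau>(1) cont])
    thus "Theta_set X \<theta>\<^sub>0 f\<^sub>0 n \<times> H_set \<tau>\<^sub>0 \<tau>\<^sub>1 f\<^sub>0 n \<in> sets (Q \<Otimes>\<^sub>M P)" by simp
  qed
  define c\<^sub>1 c\<^sub>2 where "c\<^sub>1 = c / (2 * pi * \<tau>\<^sub>1)" and "c\<^sub>2 = C / (2 * pi * \<tau>\<^sub>0)"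
  define K\<^sub>1 K\<^sub>2 where "K\<^sub>1 = real CARD('r) * (1 / (2 * pi * \<tau>\<^sub>0) + \<tau>\<^sub>1 / \<tau>\<^sub>0\<^sup>2)"
    and "K\<^sub>2 = \<tau>\<^sub>1 / \<tau>\<^sub>0 + 1 + 2 * pi * (\<tau>\<^sub>1 / \<tau>\<^sub>0 + \<tau>\<^sub>1\<^sup>2 / \<tau>\<^sub>0\<^sup>2)"
  have card_r: "0 < real CARD('r)" by simp
  have const_pos: "0 < c\<^sub>1" "0 < c\<^sub>2" "0 < K\<^sub>1" "0 < K\<^sub>2"
    using cC \<tau> card_r unfolding c\<^sub>1_def c\<^sub>2_def K\<^sub>1_def K\<^sub>2_def by (auto intro!: mult_pos_pos add_pos_pos)
  define K\<^sub>3 where "K\<^sub>3 = real CARD('r) * (2 * sqrt (2 * pi * \<tau>\<^sub>1 * C)) + 2 * sqrt 2"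
  \<comment> \<open>Half the dimension: a ball of radius \<open>1 / sqrt n\<close> has prior mass of
    order \<open>n powr (- r2)\<close>.\<close>
  define r2 where "r2 = real CARD('r) / 2"
  define S1 where "S1 n = exp (- (c\<^sub>1 / (4 * c\<^sub>2) * sqrt c\<^sub>1) * sqrt (real n) + K\<^sub>1\<^sup>2 / c\<^sub>1 * real n powr (1/4) + K\<^sub>1 * real n powr (1/8) + c\<^sub>2 / 2) * real n powr r2" for n
  define S2 where "S2 n = exp (- (1 / (256 * pi * \<tau>\<^sub>1 ^ 3)) * (real n * (1 / ln (real n)) ^ 3) + K\<^sub>2 * real n powr (5/8)
      + R\<^sup>2 / (2 * \<tau>\<^sub>0\<^sup>2) * (real n / ln (real n) ^ 4) + B * (ln (real n) ^ 4 + 3)\<^sup>2 + K\<^sub>1\<^sup>2 / (2 * c\<^sub>1) * real n powr (1/4)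
      + K\<^sub>1 * real n powr (1/8) + c\<^sub>2 / 2) * real n powr r2" for n
  have S: "S1 \<longlonglongrightarrow> 0" "S2 \<longlonglongrightarrow> 0"
    unfolding S1_def[abs_def] S2_def[abs_def]
    using const_pos \<tau> RB by (intro theta_rate_tendsto_0 f_rate_tendsto_0; simp add: r2_def)+
  hence "(\<lambda>n. (S1 n + S2 n) / q) \<longlonglongrightarrow> (0 + 0) / q" by (intro tendsto_intros) (use q in auto)
  hence S_lim: "(\<lambda>n. (S1 n + S2 n) / q) \<longlonglongrightarrow> 0" by simp
  have key: "\<forall>\<^sub>F n in sequentially. \<forall>\<epsilon> \<in> space (white_noise n) - noisy X f\<^sub>0 n (real n powr (5/8)).
      1 - (S1 n + S2 n) / q \<le> T n (synthesis X n \<theta>\<^sub>0 f\<^sub>0 \<epsilon>) \<and> T n (synthesis X n \<theta>\<^sub>0 f\<^sub>0 \<epsilon>) \<le> 1"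
  proof -
    have "(\<lambda>n. 1 / sqrt (real n)) \<longlonglongrightarrow> 0" by real_asymp
    hence ev_ball: "\<forall>\<^sub>F n in sequentially. 1 / sqrt (real n) < \<rho>\<^sub>0" by (rule order_tendstoD) (rule q)
    show ?thesis
      using gram eventually_ln_conditions[OF \<tau>(3)] ev_ball eventually_gt_at_top[of 0]
    proof eventually_elim
      case (elim n)
      have n0: "0 < real n" using elim by simp
      have ln0: "0 < ln (real n)" using elim(2) by linarith
      define s where "s = real n powr (5/8)"
      \<comment> \<open>With \<open>(ln n) ^ 4\<close> the squared radius
        \<open>\<eta>\<^sup>2 = R\<^sup>2 / k\<close> is at most
        \<open>R\<^sup>2 / (ln n) ^ 4\<close>; the added 2 guarantees
        \<open>2 \<le> k\<close>.\<close>
      define k where "k = nat \<lceil>ln (real n) ^ 4\<rceil> + 2"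
      define \<eta> where "\<eta> = R / sqrt (real k)"
      define v where "v = exp (- B * (real k)\<^sup>2)"
      define qn where "qn = q * (1 / sqrt (real n)) ^ CARD('r)"
      define V where "V = {f \<in> C_set \<tau>\<^sub>0 \<tau>\<^sub>1. sup_norm (\<lambda>\<omega>. f \<omega> - f\<^sub>0 \<omega>) \<le> \<eta>}"
      have k: "ln (real n) ^ 4 \<le> real k" "real k \<le> ln (real n) ^ 4 + 3" "2 \<le> k"
      proof -
        have "0 \<le> ln (real n) ^ 4" using ln0 by simp
        thus "ln (real n) ^ 4 \<le> real k" "real k \<le> ln (real n) ^ 4 + 3" "2 \<le> k"
          unfolding k_def by linarith+
      qed
      have V_meas: "V \<in> sets C1_space" unfolding V_def by (rule sup_ball_measurable[OF \<tau>(1) cont])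
      have "v \<le> measure PB V"
        unfolding v_def
      proof (rule mass[OF k(3) V_meas])
        show "{f \<in> C_set \<tau>\<^sub>0 \<tau>\<^sub>1. 0 < f 0 \<and> (\<forall>x\<in>{0..pi}. \<bar>f x - f\<^sub>0 x\<bar> \<le> R / sqrt (real k))} \<subseteq> V"
          unfolding V_def \<eta>_def using sup_norm_diff_le_iff[OF _ cont] by (auto simp: C_set_iff[OF \<tau>(1)])
      qed
      also have "\<dots> \<le> measure P V"
        unfolding P_def by (rule truncated_prior_mass(2)[OF PB C_meas C_pos]) (use V_meas sets_PB in \<open>auto simp: V_def\<close>)
      finally have vV: "v \<le> measure P V" .
      have rad: "0 < 1 / sqrt (real n)" "1 / sqrt (real n) \<le> \<rho>\<^sub>0" using n0 elim by auto
      have qn: "0 < qn" "qn \<le> measure Q (cball \<theta>\<^sub>0 (1 / sqrt (real n)))"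
        unfolding qn_def by (intro mult_pos_pos zero_less_power q(1) rad(1), rule ball[OF rad])
      have s: "0 < s" using n0 by (simp add: s_def)
      have s_sq: "(K\<^sub>1 * s)\<^sup>2 = K\<^sub>1\<^sup>2 * (real n * real n powr (1/4))"
      proof -
        have "s\<^sup>2 = real n powr (5/4)" unfolding s_def power2_eq_square powr_add[symmetric] by simp
        also have "\<dots> = real n powr 1 * real n powr (1/4)" unfolding powr_add[symmetric] by simp
        finally show ?thesis using n0 by (simp add: power_mult_distrib)
      qed
      have s_rt: "K\<^sub>1 * s / sqrt (real n) = K\<^sub>1 * real n powr (1/8)"
      proof -
        have "s = real n powr (1/8) * real n powr (1/2)" unfolding s_def powr_add[symmetric] by simp
        thus ?thesis using n0 by (simp add: powr_half_sqrt)
      qed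
      have qn_eq: "x / qn = x * real n powr r2 / q" for x
      proof -
        have "sqrt (real n) ^ CARD('r) = real n powr r2"
          unfolding r2_def using n0 by (simp add: powr_half_sqrt[symmetric] powr_realpow[symmetric] powr_powr)
        thus ?thesis unfolding qn_def using n0 by (simp add: power_one_over)
      qed
      have t1: "exp (- (c\<^sub>1 / (4 * c\<^sub>2)) * sqrt (c\<^sub>1 * real n) + (K\<^sub>1 * s)\<^sup>2 / (c\<^sub>1 * real n) + (K\<^sub>1 * s / sqrt (real n) + c\<^sub>2 / 2)) / qn = S1 n / q"
      proof -
        have "- (c\<^sub>1 / (4 * c\<^sub>2)) * sqrt (c\<^sub>1 * real n) + (K\<^sub>1 * s)\<^sup>2 / (c\<^sub>1 * real n) + (K\<^sub>1 * s / sqrt (real n) + c\<^sub>2 / 2)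
            = - (c\<^sub>1 / (4 * c\<^sub>2) * sqrt c\<^sub>1) * sqrt (real n) + K\<^sub>1\<^sup>2 / c\<^sub>1 * real n powr (1/4) + K\<^sub>1 * real n powr (1/8) + c\<^sub>2 / 2"
          unfolding s_sq s_rt using n0 by (simp add: real_sqrt_mult)
        thus ?thesis unfolding qn_eq S1_def by simp
      qed
      have t2: "exp (- (real n * (1 / ln (real n)) ^ 3 / (256 * pi * \<tau>\<^sub>1 ^ 3)) + K\<^sub>2 * s + real n * \<eta>\<^sup>2 / (2 * \<tau>\<^sub>0\<^sup>2)
          + (K\<^sub>1 * s)\<^sup>2 / (2 * c\<^sub>1 * real n) + (K\<^sub>1 * s / sqrt (real n) + c\<^sub>2 / 2)) / (v * qn) \<le> S2 n / q" (is "exp ?E / _ \<le> _")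
      proof -
        have "real n * \<eta>\<^sup>2 / (2 * \<tau>\<^sub>0\<^sup>2) \<le> R\<^sup>2 / (2 * \<tau>\<^sub>0\<^sup>2) * (real n / ln (real n) ^ 4)"
        proof -
          have "real n * \<eta>\<^sup>2 / (2 * \<tau>\<^sub>0\<^sup>2) = R\<^sup>2 / (2 * \<tau>\<^sub>0\<^sup>2) * (real n / real k)"
            by (simp add: \<eta>_def power_divide ac_simps)
          also have "\<dots> \<le> R\<^sup>2 / (2 * \<tau>\<^sub>0\<^sup>2) * (real n / ln (real n) ^ 4)"
            using k ln0 n0 by (intro mult_left_mono divide_left_mono mult_pos_pos) auto
          finally show ?thesis .
        qed
        moreover have "B * (real k)\<^sup>2 \<le> B * (ln (real n) ^ 4 + 3)\<^sup>2"
          using k RB by (intro mult_left_mono power_mono) auto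
        moreover have "(K\<^sub>1 * s)\<^sup>2 / (2 * c\<^sub>1 * real n) = K\<^sub>1\<^sup>2 / (2 * c\<^sub>1) * real n powr (1/4)"
          unfolding s_sq using n0 by simp
        moreover have "real n * (1 / ln (real n)) ^ 3 / (256 * pi * \<tau>\<^sub>1 ^ 3) = 1 / (256 * pi * \<tau>\<^sub>1 ^ 3) * (real n * (1 / ln (real n)) ^ 3)"
          by simp
        ultimately have "?E + B * (real k)\<^sup>2 \<le> - (1 / (256 * pi * \<tau>\<^sub>1 ^ 3)) * (real n * (1 / ln (real n)) ^ 3) + K\<^sub>2 * real n powr (5/8)
            + R\<^sup>2 / (2 * \<tau>\<^sub>0\<^sup>2) * (real n / ln (real n) ^ 4) + B * (ln (real n) ^ 4 + 3)\<^sup>2 + K\<^sub>1\<^sup>2 / (2 * c\<^sub>1) * real n powr (1/4)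
            + K\<^sub>1 * real n powr (1/8) + c\<^sub>2 / 2"
          using s_rt unfolding s_def by linarith
        hence "exp (?E + B * (real k)\<^sup>2) * real n powr r2 \<le> S2 n"
          unfolding S2_def by (intro mult_right_mono) simp_all
        hence "exp (?E + B * (real k)\<^sup>2) / qn \<le> S2 n / q"
          unfolding qn_eq using q by (intro divide_right_mono) auto
        moreover have "exp (?E + B * (real k)\<^sup>2) / qn = exp ?E / (v * qn)"
          unfolding v_def exp_add by (simp add: exp_minus field_simps)
        ultimately show ?thesis by simp
      qed
      show ?case
      proof (intro ballI)
        fix \<epsilon> assume "\<epsilon> \<in> space (white_noise n) - noisy X f\<^sub>0 n (real n powr (5/8))"
        hence \<epsilon>: "\<epsilon> \<in> space (white_noise n)" "\<epsilon> \<notin> noisy X f\<^sub>0 n s" by (auto simp: s_def)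
        have lo: "\<And>v. c * real n * (v \<bullet> v) \<le> v \<bullet> (gram X n *v v)" and hi: "\<And>v. v \<bullet> (gram X n *v v) \<le> C * real n * (v \<bullet> v)"
          using elim by blast+
        have v0: "0 < v" by (simp add: v_def)
        note bound = posterior_lower_bound[OF \<tau>(1,3) cont ge less_imp_le[OF le] lip lo hi cC elim(2,3,4) \<epsilon> s Q qn P sets_P AE_P v0 vV[unfolded V_def] c\<^sub>1_def c\<^sub>2_def K\<^sub>1_def K\<^sub>2_def]
        show "1 - (S1 n + S2 n) / q \<le> T n (synthesis X n \<theta>\<^sub>0 f\<^sub>0 \<epsilon>) \<and> T n (synthesis X n \<theta>\<^sub>0 f\<^sub>0 \<epsilon>) \<le> 1"
          unfolding T_def using bound t1 t2 by (auto simp: add_divide_distrib)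
      qed
    qed
  qed
  \<comment> \<open>Once the remainder has dropped below \<delta>, a deviation beyond \<delta> can
    only come from noise in the exceptional event, whose probability is of order
    \<open>n powr (- 1/8)\<close>.\<close>
  have conv: "(\<lambda>n. measure (whittle_measure X n \<theta>\<^sub>0 f\<^sub>0) {z \<in> space (whittle_measure X n \<theta>\<^sub>0 f\<^sub>0). \<delta> < \<bar>T n z - 1\<bar>}) \<longlonglongrightarrow> 0"
    if \<delta>: "0 < \<delta>" for \<delta>
  proof (rule tendsto_sandwich[of "\<lambda>_. 0" _ _ "\<lambda>n. K\<^sub>3 * sqrt (real n) / real n powr (5/8)"])
    show "(\<lambda>n. K\<^sub>3 * sqrt (real n) / real n powr (5/8)) \<longlonglongrightarrow> 0" by real_asymp
    have "\<forall>\<^sub>F n in sequentially. (S1 n + S2 n) / q < \<delta>" using S_lim \<delta> by (rule order_tendstoD)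
    thus "\<forall>\<^sub>F n in sequentially. measure (whittle_measure X n \<theta>\<^sub>0 f\<^sub>0) {z \<in> space (whittle_measure X n \<theta>\<^sub>0 f\<^sub>0). \<delta> < \<bar>T n z - 1\<bar>}
        \<le> K\<^sub>3 * sqrt (real n) / real n powr (5/8)"
      using key gram eventually_gt_at_top[of 0]
    proof eventually_elim
      case (elim n)
      interpret WN: prob_space "white_noise n" by (rule prob_space_white_noise)
      let ?E = "{z \<in> space (Pi\<^sub>M {1..n} (\<lambda>_. lborel)). \<delta> < \<bar>T n z - 1\<bar>}"
      have [measurable]: "T n \<in> borel_measurable (Pi\<^sub>M {1..n} (\<lambda>_. lborel))" by (rule T_meas)
      have E: "?E \<in> sets (Pi\<^sub>M {1..n} (\<lambda>_. lborel))" by measurable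
      have "measure (whittle_measure X n \<theta>\<^sub>0 f\<^sub>0) {z \<in> space (whittle_measure X n \<theta>\<^sub>0 f\<^sub>0). \<delta> < \<bar>T n z - 1\<bar>}
          = measure (white_noise n) (synthesis X n \<theta>\<^sub>0 f\<^sub>0 -` ?E \<inter> space (white_noise n))"
        unfolding W space_distr by (rule measure_distr[OF measurable_synthesis E])
      also have "\<dots> \<le> measure (white_noise n) (noisy X f\<^sub>0 n (real n powr (5/8)))"
      proof (rule WN.finite_measure_mono[OF _ noisy_measurable])
        show "synthesis X n \<theta>\<^sub>0 f\<^sub>0 -` ?E \<inter> space (white_noise n) \<subseteq> noisy X f\<^sub>0 n (real n powr (5/8))"
        proof
          fix \<epsilon> assume \<epsilon>: "\<epsilon> \<in> synthesis X n \<theta>\<^sub>0 f\<^sub>0 -` ?E \<inter> space (white_noise n)"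
          show "\<epsilon> \<in> noisy X f\<^sub>0 n (real n powr (5/8))"
          proof (rule ccontr)
            assume "\<epsilon> \<notin> noisy X f\<^sub>0 n (real n powr (5/8))"
            hence "1 - (S1 n + S2 n) / q \<le> T n (synthesis X n \<theta>\<^sub>0 f\<^sub>0 \<epsilon>) \<and> T n (synthesis X n \<theta>\<^sub>0 f\<^sub>0 \<epsilon>) \<le> 1"
              using elim(2) \<epsilon> by blast
            moreover have "\<delta> < \<bar>T n (synthesis X n \<theta>\<^sub>0 f\<^sub>0 \<epsilon>) - 1\<bar>" using \<epsilon> by simp
            ultimately show False using elim(1) by linarith
          qed
        qed
      qed
      also have "\<dots> \<le> K\<^sub>3 * sqrt (real n) / real n powr (5/8)"
        unfolding K\<^sub>3_def
      proof (rule prob_noisy)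
        show "0 < f\<^sub>0 (freq n i)" "f\<^sub>0 (freq n i) \<le> \<tau>\<^sub>1" if "i < n" for i
          using ge[OF freq_range[OF that]] le[OF freq_range[OF that]] \<tau> by linarith+
        show "v \<bullet> (gram X n *v v) \<le> C * real n * (v \<bullet> v)" for v using elim(3) by blast
      qed (use elim(4) cC \<tau> in auto)
      finally show ?case .
    qed
  qed (auto intro!: always_eventually)
  have "prob_space (whittle_measure X n \<theta>\<^sub>0 f\<^sub>0)" for n
    unfolding W by (rule prob_space.prob_space_distr[OF prob_space_white_noise measurable_synthesis])
  moreover have "T n \<in> borel_measurable (whittle_measure X n \<theta>\<^sub>0 f\<^sub>0)" for n
    using T_meas[of n] unfolding whittle_measure_def by simp
  ultimately have "converges_in_prob (\<lambda>n. whittle_measure X n \<theta>\<^sub>0 f\<^sub>0) T 1"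
    unfolding converges_in_prob_def using conv by blast
  thus ?thesis unfolding T_def[abs_def] P_def PB_def .
qed

end
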